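(* Let $V:\mathbb{R}^n\to\mathbb{R}$ be a smooth function possessing an $(n-1)$-dimensional compact manifold $M\subset\mathbb{R}^n$ of critical points. Suppose $x_0:S^1\to M$ is a non-degenerate closed geodesic, and suppose $V$ is repulsive with respect to $M$, i.e. $$V''(x)[n_x,n_x]<0\qquad\text{for all }x\in M .$$ Then there exists $T_0>0$ such that for every $T\ge T_0$ there exists a function $u_T:\mathbb{R}\to\mathbb{R}^n$ with the following properties: (i) $u_T$ is a $T$-periodic solution of $\ddot u+V'(u)=0$; (ii) as $T\to+\infty$, $u_T(T\,\cdot)\to x_0(\cdot)$ in $C^1(S^1;\mathbb{R}^n)$.
   Context: $S^1=\mathbb{R}/\mathbb{Z}$. $V'$ and $V''$ are the gradient and Hessian of $V$. $M$ is a smooth compact orientable embedded hypersurface of $\mathbb{R}^n$ (without boundary) with the induced Riemannian metric; $n_x$ is a unit normal vector to $M$ at $x$. $H^1(S^1;M)$ is the Hilbert manifold of closed $H^1$ loops in $M$; $T_hH^1(S^1;M)$ is the space of $H^1$ vector fields $\xi$ along $h$ with $\xi(t)\in T_{h(t)}M$. Closed geodesics are the critical points of $L_0(u)=\frac12\int_0^1|\dot u|^2\,dt$ on $H^1(S^1;M)$. A closed geodesic $h\in H^1(S^1;M)$ is called non-degenerate if the kernel of the Hessian $D^2L_0(h)$ on $T_hH^1(S^1;M)$ is one-dimensional, and hence coincides with the span of $\dot h$. *)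

theory Defs
  imports "HOL-Analysis.Analysis"
begin

section \<open>Smooth maps, gradient and Hessian\<close>

text \<open>\<open>Ck_on\<close> is meant for open sets.  In finite dimension \<open>f\<close> is \<open>C\<^sup>k\<^sup>+\<^sup>1\<close> on an open set iff it is
  differentiable there and all its directional derivatives are \<open>C\<^sup>k\<close>.\<close>

fun Ck_on :: "nat \<Rightarrow> 'a::euclidean_space set \<Rightarrow> ('a \<Rightarrow> 'b::real_normed_vector) \<Rightarrow> bool" where
  "Ck_on 0 S f \<longleftrightarrow> continuous_on S f"
| "Ck_on (Suc k) S f \<longleftrightarrow>
     (\<forall>x\<in>S. f differentiable (at x)) \<and> (\<forall>v. Ck_on k S (\<lambda>x. frechet_derivative f (at x) v))"

definition smooth_map_on :: "'a::euclidean_space set \<Rightarrow> ('a \<Rightarrow> 'b::real_normed_vector) \<Rightarrow> bool" where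
  "smooth_map_on S f \<longleftrightarrow> open S \<and> (\<forall>k. Ck_on k S f)"

definition grad :: "('a::euclidean_space \<Rightarrow> real) \<Rightarrow> 'a \<Rightarrow> 'a" where
  "grad V x = (THE D. GDERIV V x :> D)"

definition hess :: "('a::euclidean_space \<Rightarrow> real) \<Rightarrow> 'a \<Rightarrow> 'a \<Rightarrow> 'a \<Rightarrow> real" where
  "hess V x v w = inner (frechet_derivative (grad V) (at x) v) w"

section \<open>Compact orientable embedded hypersurfaces\<close>

text \<open>Smooth slice charts: near each of its points \<open>M\<close> is carried to a coordinate hyperplane by a
  diffeomorphism between open sets of the ambient space; in particular \<open>M\<close> has no boundary.\<close>

definition embedded_hypersurface :: "(real^'n) set \<Rightarrow> bool" where
  "embedded_hypersurface M \<longleftrightarrow>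
     (\<forall>p\<in>M. \<exists>U W (\<phi> :: real^'n \<Rightarrow> real^'n) \<psi> k. p \<in> U \<and> smooth_map_on U \<phi> \<and> smooth_map_on W \<psi> \<and>
        homeomorphism U W \<phi> \<psi> \<and> \<phi> ` (M \<inter> U) = {y \<in> W. y $ k = 0})"

definition tangent_space :: "'a::euclidean_space set \<Rightarrow> 'a \<Rightarrow> 'a set" where
  "tangent_space M p =
     {v. \<exists>\<gamma> \<epsilon>. 0 < (\<epsilon>::real) \<and> smooth_map_on {-\<epsilon><..<\<epsilon>} \<gamma> \<and> \<gamma> ` {-\<epsilon><..<\<epsilon>} \<subseteq> M \<and>
            \<gamma> 0 = p \<and> (\<gamma> has_vector_derivative v) (at 0)}"

definition unit_normal :: "'a::euclidean_space set \<Rightarrow> 'a \<Rightarrow> 'a \<Rightarrow> bool" where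
  "unit_normal M p \<nu> \<longleftrightarrow> norm \<nu> = 1 \<and> (\<forall>v\<in>tangent_space M p. inner \<nu> v = 0)"

text \<open>For a hypersurface of Euclidean space, orientability is expressed by a continuous (hence
  smooth) unit normal field.\<close>

definition orientable_hypersurface :: "(real^'n) set \<Rightarrow> bool" where
  "orientable_hypersurface M \<longleftrightarrow>
     embedded_hypersurface M \<and> (\<exists>N. continuous_on M N \<and> (\<forall>p\<in>M. unit_normal M p (N p)))"

section \<open>The Hilbert manifold of closed loops\<close>

text \<open>Functions on the circle \<open>\<real>/\<int>\<close> are 1-periodic functions on \<open>\<real>\<close>.  An \<open>H\<^sup>1\<close> function is represented
  by its continuous representative, so equality of \<open>H\<^sup>1\<close> functions is equality of functions; its weak
  derivative is determined on \<open>[0,1]\<close> up to null sets.\<close>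

definition is_weak_deriv :: "(real \<Rightarrow> 'a::euclidean_space) \<Rightarrow> (real \<Rightarrow> 'a) \<Rightarrow> bool" where
  "is_weak_deriv u g \<longleftrightarrow>
     g \<in> borel_measurable lborel \<and>
     set_integrable lborel {0..1} (\<lambda>t. (norm (g t))\<^sup>2) \<and>
     (\<forall>t\<in>{0..1}. u t = u 0 + (LINT s:{0..t}|lborel. g s))"

definition weak_deriv :: "(real \<Rightarrow> 'a::euclidean_space) \<Rightarrow> real \<Rightarrow> 'a" where
  "weak_deriv u = (SOME g. is_weak_deriv u g)"

definition H1_circle :: "(real \<Rightarrow> 'a::euclidean_space) set" where
  "H1_circle = {u. (\<forall>t. u (t + 1) = u t) \<and> (\<exists>g. is_weak_deriv u g)}"

definition H1_loops :: "'a::euclidean_space set \<Rightarrow> (real \<Rightarrow> 'a) set" where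
  "H1_loops M = {h \<in> H1_circle. \<forall>t. h t \<in> M}"

definition H1_tangent :: "'a::euclidean_space set \<Rightarrow> (real \<Rightarrow> 'a) \<Rightarrow> (real \<Rightarrow> 'a) set" where
  "H1_tangent M h = {\<xi> \<in> H1_circle. \<forall>t. \<xi> t \<in> tangent_space M (h t)}"

definition L0 :: "(real \<Rightarrow> 'a::euclidean_space) \<Rightarrow> real" where
  "L0 u = (1/2) * (LINT t:{0..1}|lborel. (norm (weak_deriv u t))\<^sup>2)"

text \<open>For \<open>M\<close> compact, the nearest-point projection is smooth on a tubular neighbourhood of \<open>M\<close>.
  Hence, for \<open>\<xi>\<close> near 0 in \<open>H1_tangent M h\<close>, the map \<open>\<xi> \<mapsto> loop_chart M h \<xi>\<close> is a local
  parametrization of the Hilbert manifold \<open>H1_loops M\<close> at \<open>h\<close>, whose differential at 0 is the identity.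
  The first and second differentials of \<open>L0\<close> at \<open>h\<close> are those at 0 of \<open>L0\<close> read in this chart; at a
  critical point the second differential does not depend on the chart.\<close>

definition loop_chart :: "'a::euclidean_space set \<Rightarrow> (real \<Rightarrow> 'a) \<Rightarrow> (real \<Rightarrow> 'a) \<Rightarrow> real \<Rightarrow> 'a" where
  "loop_chart M h \<xi> = (\<lambda>t. closest_point M (h t + \<xi> t))"

definition closed_geodesic :: "'a::euclidean_space set \<Rightarrow> (real \<Rightarrow> 'a) \<Rightarrow> bool" where
  "closed_geodesic M h \<longleftrightarrow>
     h \<in> H1_loops M \<and>
     (\<forall>\<xi>\<in>H1_tangent M h.
        ((\<lambda>s. L0 (loop_chart M h (\<lambda>t. s *\<^sub>R \<xi> t))) has_real_derivative 0) (at 0))"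

definition D2L0 ::
  "'a::euclidean_space set \<Rightarrow> (real \<Rightarrow> 'a) \<Rightarrow> (real \<Rightarrow> 'a) \<Rightarrow> (real \<Rightarrow> 'a) \<Rightarrow> real" where
  "D2L0 M h \<xi> \<eta> =
     deriv (\<lambda>s. deriv (\<lambda>r. L0 (loop_chart M h (\<lambda>t. s *\<^sub>R \<xi> t + r *\<^sub>R \<eta> t))) 0) 0"

definition ker_D2L0 :: "'a::euclidean_space set \<Rightarrow> (real \<Rightarrow> 'a) \<Rightarrow> (real \<Rightarrow> 'a) set" where
  "ker_D2L0 M h = {\<xi> \<in> H1_tangent M h. \<forall>\<eta>\<in>H1_tangent M h. D2L0 M h \<xi> \<eta> = 0}"

text \<open>One-dimensionality is written out, as function spaces are not instances of the library's
  class of real vector spaces.\<close>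

definition nondegenerate_closed_geodesic :: "'a::euclidean_space set \<Rightarrow> (real \<Rightarrow> 'a) \<Rightarrow> bool" where
  "nondegenerate_closed_geodesic M h \<longleftrightarrow>
     closed_geodesic M h \<and>
     (\<exists>\<xi>. \<xi> \<noteq> (\<lambda>t. 0) \<and> ker_D2L0 M h = {(\<lambda>t. c *\<^sub>R \<xi> t) | c. True})"

section \<open>Periodic solutions and convergence\<close>

definition solves_newton :: "('a::euclidean_space \<Rightarrow> real) \<Rightarrow> (real \<Rightarrow> 'a) \<Rightarrow> bool" where
  "solves_newton V u \<longleftrightarrow>
     (\<exists>v a. \<forall>t. (u has_vector_derivative v t) (at t) \<and> (v has_vector_derivative a t) (at t) \<and>
        a t + grad V (u t) = 0)"

definition C1_circle :: "(real \<Rightarrow> 'a::euclidean_space) set" where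
  "C1_circle = {f. (\<forall>t. f (t + 1) = f t) \<and> f C1_differentiable_on UNIV}"

definition tendsto_C1_circle ::
  "('i \<Rightarrow> real \<Rightarrow> 'a::euclidean_space) \<Rightarrow> (real \<Rightarrow> 'a) \<Rightarrow> 'i filter \<Rightarrow> bool" where
  "tendsto_C1_circle f g F \<longleftrightarrow>
     g \<in> C1_circle \<and> (\<forall>\<^sub>F i in F. f i \<in> C1_circle) \<and>
     uniform_limit UNIV f g F \<and>
     uniform_limit UNIV (\<lambda>i t. vector_derivative (f i) (at t)) (\<lambda>t. vector_derivative g (at t)) F"

end

theory Submission
  imports Defs
begin

text \<open>With \<open>\<delta> = T powr (- 1/4)\<close>, look for \<open>w = u\<^sub>T(T \<cdot>)\<close> in the form
  \<open>w = x0 + \<delta>\<^sup>8 v + \<xi> + a n\<close>, where \<open>n\<close> is the unit normal along \<open>x0\<close>, \<open>\<xi>\<close> is tangential and the normal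
  displacement \<open>\<delta>\<^sup>8 v\<close> makes the force balance the acceleration of the geodesic.  The equation
  \<open>w'' = - V'(w) / \<delta>\<^sup>8\<close> splits at first order into \<open>a'' = (b / \<delta>\<^sup>8) a + g\<close>, where \<open>b > 0\<close> because
  \<open>V\<close> is repulsive, so that the maximum principle bounds \<open>a\<close>, and into the Jacobi equation for \<open>\<xi>\<close>, whose
  curvature term is the second derivative of \<open>V'\<close> at the displacement \<open>v\<close>.  By nondegeneracy the latter is
  solvable up to a multiple \<open>l x0'\<close>.  A contraction in the forcing then gives a solution of
  \<open>w'' = - V'(w) / \<delta>\<^sup>8 - l x0'\<close>, and since the energy is periodic while its derivative is
  \<open>- l x0' \<bullet> w'\<close> with \<open>x0' \<bullet> w' > 0\<close>, the multiplier \<open>l\<close> vanishes.\<close>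

section \<open>Calculus of \<open>C\<^sup>k\<close> maps\<close>

text \<open>The obstacle is the singular factor 1/\<delta>^8 in front of a remainder that is only
  quadratic: at displacements of size \<delta>^6 it leaves a Lipschitz constant of order
  \<delta>^(-2). In the normal direction, inverting a'' - (b/\<delta>^8) a gains \<delta>^8 for a
  and \<delta>^4 for a', so a weight \<delta>^3 on the normal forcing can be afforded. In tangential
  directions nothing is gained, but the second derivative of V' at two tangent vectors of
  \<open>M\<close> is normal, and its pairing with \<delta>^8 v is of order one and belongs to the
  Jacobi equation. The scale T = \<delta>^(-4) makes all these powers integral. The normal field is
  given only as continuous and the geodesic only as H^1. Smoothness comes from the Hessian of V: it
  has rank one on \<open>M\<close> and supplies smooth normal vectors and a smooth tangential
  projector near \<open>M\<close>, from which the nearest-point projection, the geodesic and the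
  normal along it inherit their regularity. Nondegeneracy also admits a constant loop when
  \<open>M\<close> is a plane curve; that case is treated apart.\<close>

lemma Ck_on_cong:
  assumes "open S" "\<And>x. x \<in> S \<Longrightarrow> f x = g x"
  shows "Ck_on k S f \<longleftrightarrow> Ck_on k S g"
  using assms(2)
proof (induction k arbitrary: f g)
  case 0
  then show ?case by (auto intro: continuous_on_cong)
next
  case (Suc k)
  have 1: "(f differentiable at x) \<longleftrightarrow> (g differentiable at x)" if "x \<in> S" for x
    using Suc.prems that assms(1) unfolding differentiable_def
    by (metis has_derivative_transform_within_open)
  have 2: "frechet_derivative f (at x) = frechet_derivative g (at x)"
    if "x \<in> S" "f differentiable at x" for x
    using frechet_derivative_transform_within_open[OF that(2) assms(1) that(1)] Suc.prems by auto
  have "(\<forall>x\<in>S. f differentiable at x) \<Longrightarrow>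
      Ck_on k S (\<lambda>x. frechet_derivative f (at x) v) = Ck_on k S (\<lambda>x. frechet_derivative g (at x) v)" for v
    using 2 by (intro Suc.IH) auto
  then show ?case using 1 by auto
qed

lemma Ck_on_eqI:
  "open S \<Longrightarrow> Ck_on k S g \<Longrightarrow> (\<And>x. x \<in> S \<Longrightarrow> f x = g x) \<Longrightarrow> Ck_on k S f"
  using Ck_on_cong[of S f g k] by simp

text \<open>The rule behind the closure proofs below: it accepts any formula \<open>f'\<close> for
  the derivative, so the induction hypothesis meets an explicit expression instead of
  \<open>frechet_derivative f\<close>.\<close>

lemma Ck_on_SucI:
  assumes "open S" "\<And>x. x \<in> S \<Longrightarrow> (f has_derivative f' x) (at x)"
    and "\<And>v. Ck_on k S (\<lambda>x. f' x v)"
  shows "Ck_on (Suc k) S f"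
proof -
  have "frechet_derivative f (at x) = f' x" if "x \<in> S" for x
    using frechet_derivative_at[OF assms(2)[OF that]] by simp
  then have "Ck_on k S (\<lambda>x. frechet_derivative f (at x) v)" for v
    using assms(3)[of v] Ck_on_cong[OF assms(1), of "\<lambda>x. frechet_derivative f (at x) v" "\<lambda>x. f' x v"] by simp
  then show ?thesis using assms(2) by (auto simp: differentiable_def)
qed

lemma Ck_on_has_derivative:
  "Ck_on (Suc k) S f \<Longrightarrow> x \<in> S \<Longrightarrow> (f has_derivative frechet_derivative f (at x)) (at x)"
  by (auto simp: frechet_derivative_works[symmetric])

lemma Ck_on_SucD: "Ck_on (Suc k) S f \<Longrightarrow> Ck_on k S f"
proof (induction k arbitrary: f)
  case 0
  then show ?case
    by (auto intro!: differentiable_imp_continuous_on simp: differentiable_on_def differentiable_at_withinI)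
next
  case (Suc k)
  then show ?case by simp
qed

lemma Ck_on_mono: "Ck_on k S f \<Longrightarrow> j \<le> k \<Longrightarrow> Ck_on j S f"
  by (induction k) (auto simp del: Ck_on.simps(2) simp: le_Suc_eq dest: Ck_on_SucD)

lemma Ck_on_imp_continuous_on: "Ck_on k S f \<Longrightarrow> continuous_on S f"
  using Ck_on_mono[of k S f 0] by simp

lemma Ck_on_subset: "Ck_on k S f \<Longrightarrow> T \<subseteq> S \<Longrightarrow> Ck_on k T f"
  by (induction k arbitrary: f) (auto intro: continuous_on_subset)

text \<open>Differentiability at a point and the value of the derivative depend only on a
  neighbourhood. This glues the local smoothness of the nearest-point projection.\<close>

lemma Ck_on_local:
  assumes "\<And>x. x \<in> S \<Longrightarrow> \<exists>W. open W \<and> x \<in> W \<and> Ck_on k W f"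
  shows "Ck_on k S f"
  using assms
proof (induction k arbitrary: f)
  case 0
  show ?case unfolding Ck_on.simps
  proof (rule continuous_at_imp_continuous_on, rule ballI)
    fix x assume "x \<in> S"
    with 0 obtain W where "open W" "x \<in> W" "continuous_on W f" by auto
    then show "isCont f x" by (auto simp: continuous_on_eq_continuous_at)
  qed
next
  case (Suc k)
  show ?case unfolding Ck_on.simps
  proof (intro conjI ballI allI)
    fix x assume "x \<in> S"
    then show "f differentiable at x" using Suc.prems[of x] by auto
  next
    fix v
    show "Ck_on k S (\<lambda>x. frechet_derivative f (at x) v)"
    proof (rule Suc.IH)
      fix x assume "x \<in> S"
      from Suc.prems[OF this] obtain W where "open W" "x \<in> W" "Ck_on (Suc k) W f" by blast
      then show "\<exists>W. open W \<and> x \<in> W \<and> Ck_on k W (\<lambda>x. frechet_derivative f (at x) v)"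
        by (intro exI[of _ W]) simp
    qed
  qed
qed

lemma Ck_on_const [simp]: "Ck_on k S (\<lambda>x. c)"
  by (induction k arbitrary: c) auto

lemma Ck_on_bounded_linear:
  assumes h: "bounded_linear h" and "open S" "Ck_on k S f"
  shows "Ck_on k S (\<lambda>x. h (f x))"
  using assms(3)
proof (induction k arbitrary: f)
  case 0
  then show ?case using bounded_linear.continuous_on[OF h] by simp
next
  case (Suc k)
  show ?case
  proof (rule Ck_on_SucI[OF assms(2), where f' = "\<lambda>x v. h (frechet_derivative f (at x) v)"])
    show "((\<lambda>x. h (f x)) has_derivative (\<lambda>v. h (frechet_derivative f (at x) v))) (at x)" if "x \<in> S" for x
      using bounded_linear.has_derivative[OF h Ck_on_has_derivative[OF Suc.prems that]] .
    show "Ck_on k S (\<lambda>x. h (frechet_derivative f (at x) v))" for v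
      using Suc.IH Suc.prems by simp
  qed
qed

lemma Ck_on_add:
  assumes "open S" "Ck_on k S f" "Ck_on k S g"
  shows "Ck_on k S (\<lambda>x. f x + g x)"
  using assms(2,3)
proof (induction k arbitrary: f g)
  case 0
  then show ?case by (simp add: continuous_on_add)
next
  case (Suc k)
  show ?case
  proof (rule Ck_on_SucI[OF assms(1), where f' = "\<lambda>x v. frechet_derivative f (at x) v + frechet_derivative g (at x) v"])
    show "((\<lambda>x. f x + g x) has_derivative (\<lambda>v. frechet_derivative f (at x) v + frechet_derivative g (at x) v)) (at x)" if "x \<in> S" for x
      using has_derivative_add[OF Ck_on_has_derivative[OF Suc.prems(1) that] Ck_on_has_derivative[OF Suc.prems(2) that]] .
    show "Ck_on k S (\<lambda>x. frechet_derivative f (at x) v + frechet_derivative g (at x) v)" for v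
      using Suc.IH Suc.prems by simp
  qed
qed

lemma Ck_on_bilinear:
  assumes h: "bounded_bilinear h" and "open S" "Ck_on k S f" "Ck_on k S g"
  shows "Ck_on k S (\<lambda>x. h (f x) (g x))"
  using assms(3,4)
proof (induction k arbitrary: f g)
  case 0
  then show ?case using bounded_bilinear.continuous_on[OF h] by simp
next
  case (Suc k)
  show ?case
  proof (rule Ck_on_SucI[OF assms(2), where f' = "\<lambda>x v. h (f x) (frechet_derivative g (at x) v) + h (frechet_derivative f (at x) v) (g x)"])
    show "((\<lambda>x. h (f x) (g x)) has_derivative (\<lambda>v. h (f x) (frechet_derivative g (at x) v) + h (frechet_derivative f (at x) v) (g x))) (at x)" if "x \<in> S" for x
      using bounded_bilinear.FDERIV[OF h Ck_on_has_derivative[OF Suc.prems(1) that] Ck_on_has_derivative[OF Suc.prems(2) that]] .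
    show "Ck_on k S (\<lambda>x. h (f x) (frechet_derivative g (at x) v) + h (frechet_derivative f (at x) v) (g x))" for v
      using Suc.IH Suc.prems Ck_on_SucD[OF Suc.prems(1)] Ck_on_SucD[OF Suc.prems(2)]
      by (intro Ck_on_add[OF assms(2)]) simp_all
  qed
qed

lemmas Ck_on_scaleR = Ck_on_bilinear[OF bounded_bilinear_scaleR]
lemmas Ck_on_mult = Ck_on_bilinear[OF bounded_bilinear_mult]
lemmas Ck_on_inner = Ck_on_bilinear[OF bounded_bilinear_inner]

lemma Ck_on_minus: "open S \<Longrightarrow> Ck_on k S f \<Longrightarrow> Ck_on k S (\<lambda>x. - f x)"
  by (rule Ck_on_bounded_linear[OF bounded_linear_minus[OF bounded_linear_ident]])

lemma Ck_on_sum: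
  assumes "open S" "\<And>i. i \<in> I \<Longrightarrow> Ck_on k S (f i)"
  shows "Ck_on k S (\<lambda>x. \<Sum>i\<in>I. f i x)"
  using assms(2) by (induction I rule: infinite_finite_induct) (auto intro: Ck_on_add[OF assms(1)])

lemma Ck_on_ident: "open S \<Longrightarrow> Ck_on k S (\<lambda>x. x)"
proof (cases k)
  case (Suc j)
  show "open S \<Longrightarrow> ?thesis" unfolding Suc
    by (rule Ck_on_SucI[where f' = "\<lambda>x v. v"]) auto
qed auto

lemma Ck_on_linear: "bounded_linear h \<Longrightarrow> open S \<Longrightarrow> Ck_on k S h"
  using Ck_on_bounded_linear[OF _ _ Ck_on_ident] by blast

text \<open>\<open>Ck_on\<close> speaks of derivatives in one fixed direction. Expanding a moving
  direction in the basis reduces derivatives along it to finitely many fixed ones.\<close>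

lemma linear_expand:
  fixes L :: "'a::euclidean_space \<Rightarrow> 'b::real_normed_vector"
  assumes "linear L"
  shows "L v = (\<Sum>i\<in>Basis. (v \<bullet> i) *\<^sub>R L i)"
proof -
  have "L v = L (\<Sum>i\<in>Basis. (v \<bullet> i) *\<^sub>R i)" by (simp add: euclidean_representation)
  also have "\<dots> = (\<Sum>i\<in>Basis. (v \<bullet> i) *\<^sub>R L i)"
    using assms by (simp add: linear_sum linear_scale)
  finally show ?thesis .
qed

lemma Ck_on_linear_frechet: "Ck_on (Suc k) S f \<Longrightarrow> x \<in> S \<Longrightarrow> linear (frechet_derivative f (at x))"
  by (intro linear_frechet_derivative) simp

lemma Ck_on_compose:
  fixes g :: "'a::euclidean_space \<Rightarrow> 'b::euclidean_space" and f :: "'b \<Rightarrow> 'c::real_normed_vector"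
  assumes "open S" "open T" "Ck_on k S g" "Ck_on k T f" "g ` S \<subseteq> T"
  shows "Ck_on k S (\<lambda>x. f (g x))"
  using assms(3,4)
proof (induction k arbitrary: f)
  case 0
  then show ?case using assms(5) by (auto intro: continuous_on_compose2)
next
  case (Suc k)
  have g: "Ck_on k S g" using Suc.prems(1) by (rule Ck_on_SucD)
  show ?case
  proof (rule Ck_on_SucI[OF assms(1), where f' = "\<lambda>x v. frechet_derivative f (at (g x)) (frechet_derivative g (at x) v)"])
    show "((\<lambda>x. f (g x)) has_derivative (\<lambda>v. frechet_derivative f (at (g x)) (frechet_derivative g (at x) v))) (at x)" if "x \<in> S" for x
      using diff_chain_at[OF Ck_on_has_derivative[OF Suc.prems(1) that] Ck_on_has_derivative[OF Suc.prems(2), of "g x"]]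
        assms(5) that by (auto simp: o_def)
    fix v
    have "Ck_on k S (\<lambda>x. \<Sum>i\<in>Basis. (frechet_derivative g (at x) v \<bullet> i) *\<^sub>R frechet_derivative f (at (g x)) i)"
    proof (intro Ck_on_sum[OF assms(1)] Ck_on_scaleR[OF assms(1)])
      fix i :: 'b
      show "Ck_on k S (\<lambda>x. frechet_derivative g (at x) v \<bullet> i)"
        using Suc.prems(1) by (intro Ck_on_inner[OF assms(1)]) simp_all
      show "Ck_on k S (\<lambda>x. frechet_derivative f (at (g x)) i)"
        using Suc.prems(2) by (intro Suc.IH g) simp
    qed
    moreover have "frechet_derivative f (at (g x)) (frechet_derivative g (at x) v) =
        (\<Sum>i\<in>Basis. (frechet_derivative g (at x) v \<bullet> i) *\<^sub>R frechet_derivative f (at (g x)) i)" if "x \<in> S" for x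
      by (rule linear_expand) (use Ck_on_linear_frechet[OF Suc.prems(2)] assms(5) that in auto)
    ultimately show "Ck_on k S (\<lambda>x. frechet_derivative f (at (g x)) (frechet_derivative g (at x) v))"
      by (rule Ck_on_eqI[OF assms(1)])
  qed
qed

lemma Ck_on_inverse_real: "Ck_on k (- {0::real}) inverse"
proof (induction k)
  case 0
  show ?case unfolding Ck_on.simps by (rule continuous_on_inverse) (auto intro: continuous_on_id)
next
  case (Suc k)
  show ?case
  proof (rule Ck_on_SucI[where f' = "\<lambda>x v. - (inverse x * v * inverse x)"])
    show o: "open (- {0::real})" by (simp add: open_Compl)
    show "(inverse has_derivative (\<lambda>v. - (inverse x * v * inverse x))) (at x)" if "x \<in> - {0}" for x :: real
      using has_derivative_inverse'[of x UNIV] that by simp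
    show "Ck_on k (- {0}) (\<lambda>x. - (inverse x * v * inverse x))" for v :: real
      by (intro Ck_on_minus Ck_on_mult Suc.IH o Ck_on_const)
  qed
qed

lemma Ck_on_inverse:
  fixes f :: "'a::euclidean_space \<Rightarrow> real"
  assumes "open S" "Ck_on k S f" "\<And>x. x \<in> S \<Longrightarrow> f x \<noteq> 0"
  shows "Ck_on k S (\<lambda>x. inverse (f x))"
  by (rule Ck_on_compose[OF assms(1) _ assms(2) Ck_on_inverse_real]) (use assms(3) in \<open>auto simp: open_Compl\<close>)

lemma Ck_on_componentwise:
  fixes f :: "'a::euclidean_space \<Rightarrow> 'b::euclidean_space"
  assumes "open S" "\<And>i. i \<in> Basis \<Longrightarrow> Ck_on k S (\<lambda>x. f x \<bullet> i)"
  shows "Ck_on k S f"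
proof -
  have "Ck_on k S (\<lambda>x. \<Sum>i\<in>Basis. (f x \<bullet> i) *\<^sub>R i)"
    by (intro Ck_on_sum Ck_on_scaleR assms) auto
  then show ?thesis by (simp add: euclidean_representation)
qed

lemma Ck_on_frechet_apply:
  fixes f :: "'b::euclidean_space \<Rightarrow> 'c::real_normed_vector" and g h :: "'a::euclidean_space \<Rightarrow> 'b"
  assumes "open S" "open T" "Ck_on (Suc k) T f" "Ck_on k S g" "Ck_on k S h" "g ` S \<subseteq> T"
  shows "Ck_on k S (\<lambda>x. frechet_derivative f (at (g x)) (h x))"
proof -
  have "Ck_on k S (\<lambda>x. \<Sum>i\<in>Basis. (h x \<bullet> i) *\<^sub>R frechet_derivative f (at (g x)) i)"
  proof (intro Ck_on_sum[OF assms(1)] Ck_on_scaleR[OF assms(1)])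
    fix i :: 'b
    show "Ck_on k S (\<lambda>x. h x \<bullet> i)" by (intro Ck_on_inner assms) simp
    show "Ck_on k S (\<lambda>x. frechet_derivative f (at (g x)) i)"
      using assms(3) by (intro Ck_on_compose[OF assms(1,2,4) _ assms(6)]) simp
  qed
  moreover have "frechet_derivative f (at (g x)) (h x) =
      (\<Sum>i\<in>Basis. (h x \<bullet> i) *\<^sub>R frechet_derivative f (at (g x)) i)" if "x \<in> S" for x
    by (rule linear_expand) (use Ck_on_linear_frechet[OF assms(3)] assms(6) that in auto)
  ultimately show ?thesis by (rule Ck_on_eqI[OF assms(1)])
qed

section \<open>Symmetry of second derivatives\<close>

lemma isCont_distD:
  "isCont f x \<Longrightarrow> e > 0 \<Longrightarrow> \<exists>d>0. \<forall>y. dist y x < d \<longrightarrow> dist (f y) (f x) < e"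
  unfolding continuous_at_eps_delta by blast

text \<open>Two mean value theorems: along \<open>u\<close> for the increment of \<open>f\<close> in
  the direction of \<open>v\<close>, then along \<open>v\<close> for the resulting
  derivative.\<close>

lemma mixed_difference:
  fixes f :: "'a::euclidean_space \<Rightarrow> real"
  assumes "open S" "Ck_on 2 S f" "h > 0"
    and in_S: "\<And>s t. 0 \<le> s \<Longrightarrow> s \<le> h \<Longrightarrow> 0 \<le> t \<Longrightarrow> t \<le> h \<Longrightarrow> x + s *\<^sub>R u + t *\<^sub>R v \<in> S"
  shows "\<exists>s t. 0 < s \<and> s < h \<and> 0 < t \<and> t < h \<and>
    f (x + h *\<^sub>R u + h *\<^sub>R v) - f (x + h *\<^sub>R u) - f (x + h *\<^sub>R v) + f x =
    h\<^sup>2 * frechet_derivative (\<lambda>x. frechet_derivative f (at x) u) (at (x + s *\<^sub>R u + t *\<^sub>R v)) v"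
proof -
  have C: "Ck_on (Suc (Suc 0)) S f" using assms(2) by (simp only: numeral_2_eq_2)
  let ?Df = "\<lambda>x. frechet_derivative f (at x)"
  let ?D2 = "\<lambda>x. frechet_derivative (\<lambda>x. ?Df x u) (at x)"
  have d1: "((\<lambda>s. f (x + s *\<^sub>R u + t *\<^sub>R v)) has_real_derivative ?Df (x + s *\<^sub>R u + t *\<^sub>R v) u) (at s)"
    if "0 \<le> s" "s \<le> h" "0 \<le> t" "t \<le> h" for s t
  proof -
    have g: "((\<lambda>s. x + s *\<^sub>R u + t *\<^sub>R v) has_derivative (\<lambda>d. d *\<^sub>R u)) (at s)"
      by (auto intro!: derivative_eq_intros)
    have "((\<lambda>s. f (x + s *\<^sub>R u + t *\<^sub>R v)) has_derivative (\<lambda>d. ?Df (x + s *\<^sub>R u + t *\<^sub>R v) (d *\<^sub>R u))) (at s)"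
      using diff_chain_at[OF g Ck_on_has_derivative[OF C in_S[OF that]]] by (simp add: o_def)
    moreover have "?Df (x + s *\<^sub>R u + t *\<^sub>R v) (d *\<^sub>R u) = d * ?Df (x + s *\<^sub>R u + t *\<^sub>R v) u" for d
      using linear_scale[OF Ck_on_linear_frechet[OF C in_S[OF that]]] by simp
    ultimately show ?thesis unfolding has_field_derivative_def by (simp add: mult_commute_abs)
  qed
  have d2: "((\<lambda>t. ?Df (x + s *\<^sub>R u + t *\<^sub>R v) u) has_real_derivative ?D2 (x + s *\<^sub>R u + t *\<^sub>R v) v) (at t)"
    if "0 \<le> s" "s \<le> h" "0 \<le> t" "t \<le> h" for s t
  proof -
    have C1: "Ck_on (Suc 0) S (\<lambda>x. ?Df x u)" using C by simp
    have g: "((\<lambda>t. x + s *\<^sub>R u + t *\<^sub>R v) has_derivative (\<lambda>d. d *\<^sub>R v)) (at t)"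
      by (auto intro!: derivative_eq_intros)
    have "((\<lambda>t. ?Df (x + s *\<^sub>R u + t *\<^sub>R v) u) has_derivative (\<lambda>d. ?D2 (x + s *\<^sub>R u + t *\<^sub>R v) (d *\<^sub>R v))) (at t)"
      using diff_chain_at[OF g Ck_on_has_derivative[OF C1 in_S[OF that]]] by (simp add: o_def)
    moreover have "?D2 (x + s *\<^sub>R u + t *\<^sub>R v) (d *\<^sub>R v) = d * ?D2 (x + s *\<^sub>R u + t *\<^sub>R v) v" for d
      using linear_scale[OF Ck_on_linear_frechet[OF C1 in_S[OF that]]] by simp
    ultimately show ?thesis unfolding has_field_derivative_def by (simp add: mult_commute_abs)
  qed
  have "\<exists>z>0. z < h \<and> (f (x + h *\<^sub>R u + h *\<^sub>R v) - f (x + h *\<^sub>R u + 0 *\<^sub>R v)) - (f (x + 0 *\<^sub>R u + h *\<^sub>R v) - f (x + 0 *\<^sub>R u + 0 *\<^sub>R v))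
     = (h - 0) * (?Df (x + z *\<^sub>R u + h *\<^sub>R v) u - ?Df (x + z *\<^sub>R u + 0 *\<^sub>R v) u)"
    using assms(3) by (intro MVT2[of 0 h "\<lambda>s. f (x + s *\<^sub>R u + h *\<^sub>R v) - f (x + s *\<^sub>R u + 0 *\<^sub>R v)"
      "\<lambda>s. ?Df (x + s *\<^sub>R u + h *\<^sub>R v) u - ?Df (x + s *\<^sub>R u + 0 *\<^sub>R v) u"] DERIV_diff d1) simp_all
  then obtain s where s: "0 < s" "s < h" and
    e1: "f (x + h *\<^sub>R u + h *\<^sub>R v) - f (x + h *\<^sub>R u) - f (x + h *\<^sub>R v) + f x
     = h * (?Df (x + s *\<^sub>R u + h *\<^sub>R v) u - ?Df (x + s *\<^sub>R u + 0 *\<^sub>R v) u)" by auto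
  have "\<exists>z>0. z < h \<and> ?Df (x + s *\<^sub>R u + h *\<^sub>R v) u - ?Df (x + s *\<^sub>R u + 0 *\<^sub>R v) u
     = (h - 0) * ?D2 (x + s *\<^sub>R u + z *\<^sub>R v) v"
    using assms(3) s by (intro MVT2[of 0 h "\<lambda>t. ?Df (x + s *\<^sub>R u + t *\<^sub>R v) u"] d2) simp_all
  then obtain t where t: "0 < t" "t < h" "?Df (x + s *\<^sub>R u + h *\<^sub>R v) u - ?Df (x + s *\<^sub>R u + 0 *\<^sub>R v) u
     = h * ?D2 (x + s *\<^sub>R u + t *\<^sub>R v) v" by auto
  show ?thesis using s t e1 by (intro exI[of _ s] exI[of _ t]) (simp add: power2_eq_square)
qed

text \<open>The second difference over a small parallelogram is symmetric in \<open>u\<close> and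
  \<open>v\<close>, and \<open>mixed_difference\<close> turns it into either mixed derivative at
  some point of the parallelogram. Continuity brings both close to their values at
  \<open>x\<close>.\<close>

lemma frechet_second_commute_real:
  fixes f :: "'a::euclidean_space \<Rightarrow> real"
  assumes "open S" "Ck_on 2 S f" "x \<in> S"
  shows "frechet_derivative (\<lambda>x. frechet_derivative f (at x) u) (at x) v =
         frechet_derivative (\<lambda>x. frechet_derivative f (at x) v) (at x) u" (is "?A x = ?B x")
proof (rule ccontr)
  assume ne: "?A x \<noteq> ?B x"
  \<comment> \<open>Two errors below half the gap contradict the equality \<open>eq\<close> of the
    displaced values.\<close>
  define e where "e = \<bar>?A x - ?B x\<bar> / 2"
  have "e > 0" using ne by (simp add: e_def)
  have "Ck_on (Suc (Suc 0)) S f" using assms(2) by (simp only: numeral_2_eq_2)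
  then have "continuous_on S ?A" "continuous_on S ?B" by simp_all
  then have "isCont ?A x" "isCont ?B x" using assms by (simp_all add: continuous_on_eq_continuous_at)
  note cont = isCont_distD[OF this(1) \<open>e > 0\<close>] isCont_distD[OF this(2) \<open>e > 0\<close>]
  from cont(1) obtain d1 where d1: "d1 > 0" "\<And>y. dist y x < d1 \<Longrightarrow> dist (?A y) (?A x) < e" by blast
  from cont(2) obtain d2 where d2: "d2 > 0" "\<And>y. dist y x < d2 \<Longrightarrow> dist (?B y) (?B x) < e" by blast
  note d = d1(1) d2(1) d1(2) d2(2)
  obtain d3 where d3: "d3 > 0" "ball x d3 \<subseteq> S" using assms by (meson open_contains_ball)
  define d where "d = min d1 (min d2 d3)"
  have "d > 0" using d d3 by (simp add: d_def)
  define h where "h = d / (2 * (norm u + norm v + 1))"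
  have n0: "norm u + norm v + 1 > 0" by (simp add: add_nonneg_pos)
  have h: "h > 0" using \<open>d > 0\<close> n0 by (simp add: h_def)
  have near: "dist (x + s *\<^sub>R u + t *\<^sub>R v) x < d" if "0 \<le> s" "s \<le> h" "0 \<le> t" "t \<le> h" for s t
  proof -
    have "dist (x + s *\<^sub>R u + t *\<^sub>R v) x = norm (s *\<^sub>R u + t *\<^sub>R v)" by (simp add: dist_norm algebra_simps)
    also have "\<dots> \<le> s * norm u + t * norm v" using that norm_triangle_ineq[of "s *\<^sub>R u" "t *\<^sub>R v"] by simp
    also have "\<dots> \<le> h * norm u + h * norm v" using that by (intro add_mono mult_right_mono) auto
    also have "\<dots> \<le> h * (norm u + norm v + 1)" using h by (simp add: algebra_simps)
    also have "\<dots> = d / 2" using n0 by (simp add: h_def field_simps)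
    also have "\<dots> < d" using \<open>d > 0\<close> by simp
    finally show ?thesis .
  qed
  have inS: "x + s *\<^sub>R u + t *\<^sub>R v \<in> S" if "0 \<le> s" "s \<le> h" "0 \<le> t" "t \<le> h" for s t
    using near[OF that] d3(2) by (auto simp: d_def dist_commute subset_iff)
  have inS': "x + s *\<^sub>R v + t *\<^sub>R u \<in> S" if "0 \<le> s" "s \<le> h" "0 \<le> t" "t \<le> h" for s t
    using inS[of t s] that by (simp add: algebra_simps)
  obtain s t where 1: "0 < s" "s < h" "0 < t" "t < h"
    "f (x + h *\<^sub>R u + h *\<^sub>R v) - f (x + h *\<^sub>R u) - f (x + h *\<^sub>R v) + f x = h\<^sup>2 * ?A (x + s *\<^sub>R u + t *\<^sub>R v)"
    using mixed_difference[OF assms(1,2) h inS] by auto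
  obtain s' t' where 2: "0 < s'" "s' < h" "0 < t'" "t' < h"
    "f (x + h *\<^sub>R v + h *\<^sub>R u) - f (x + h *\<^sub>R v) - f (x + h *\<^sub>R u) + f x = h\<^sup>2 * ?B (x + s' *\<^sub>R v + t' *\<^sub>R u)"
    using mixed_difference[OF assms(1,2) h inS'] by auto
  have "f (x + h *\<^sub>R v + h *\<^sub>R u) = f (x + h *\<^sub>R u + h *\<^sub>R v)" by (simp add: algebra_simps)
  with 1(5) 2(5) have "h\<^sup>2 * ?A (x + s *\<^sub>R u + t *\<^sub>R v) = h\<^sup>2 * ?B (x + s' *\<^sub>R v + t' *\<^sub>R u)" by linarith
  then have eq: "?A (x + s *\<^sub>R u + t *\<^sub>R v) = ?B (x + t' *\<^sub>R u + s' *\<^sub>R v)" using h by (simp add: algebra_simps)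
  have "dist (?A (x + s *\<^sub>R u + t *\<^sub>R v)) (?A x) < e"
    using near[of s t] 1 by (intro d(3)) (simp add: d_def)
  moreover have "dist (?B (x + t' *\<^sub>R u + s' *\<^sub>R v)) (?B x) < e"
    using near[of t' s'] 2 by (intro d(4)) (simp add: d_def)
  ultimately have "\<bar>?A x - ?B x\<bar> < 2 * e" using eq by (simp add: dist_real_def)
  then show False by (simp add: e_def)
qed

lemma frechet_derivative_inner_left:
  assumes "f differentiable (at x)"
  shows "frechet_derivative (\<lambda>x. f x \<bullet> i) (at x) v = frechet_derivative f (at x) v \<bullet> i"
proof -
  have "((\<lambda>x. f x \<bullet> i) has_derivative (\<lambda>v. frechet_derivative f (at x) v \<bullet> i)) (at x)"
    using assms by (auto simp: frechet_derivative_works intro: has_derivative_inner_left)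
  from fun_cong[OF frechet_derivative_at[OF this], of v] show ?thesis by simp
qed

lemma frechet_second_commute:
  fixes f :: "'a::euclidean_space \<Rightarrow> 'b::euclidean_space"
  assumes "open S" "Ck_on 2 S f" "x \<in> S"
  shows "frechet_derivative (\<lambda>x. frechet_derivative f (at x) u) (at x) v =
         frechet_derivative (\<lambda>x. frechet_derivative f (at x) v) (at x) u"
proof (rule euclidean_eqI)
  fix i :: 'b assume "i \<in> Basis"
  have C: "Ck_on (Suc (Suc 0)) S f" using assms(2) by (simp only: numeral_2_eq_2)
  let ?f = "\<lambda>x. f x \<bullet> i"
  have Cf: "Ck_on 2 S ?f" using assms by (intro Ck_on_inner) auto
  have key: "frechet_derivative (\<lambda>x. frechet_derivative f (at x) u) (at x) v \<bullet> i =
     frechet_derivative (\<lambda>x. frechet_derivative ?f (at x) u) (at x) v" for u v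
  proof -
    have d: "((\<lambda>x. frechet_derivative f (at x) u)) differentiable (at x)" using C assms(3) by simp
    have "((\<lambda>x. frechet_derivative f (at x) u \<bullet> i) has_derivative (\<lambda>v. frechet_derivative (\<lambda>x. frechet_derivative f (at x) u) (at x) v \<bullet> i)) (at x)"
      using d by (auto simp: frechet_derivative_works intro: has_derivative_inner_left)
    then have "((\<lambda>x. frechet_derivative ?f (at x) u) has_derivative (\<lambda>v. frechet_derivative (\<lambda>x. frechet_derivative f (at x) u) (at x) v \<bullet> i)) (at x)"
      by (rule has_derivative_transform_within_open[OF _ assms(1,3)])
        (use C in \<open>simp add: frechet_derivative_inner_left\<close>)
    from fun_cong[OF frechet_derivative_at[OF this], of v] show ?thesis by simp
  qed
  show "frechet_derivative (\<lambda>x. frechet_derivative f (at x) u) (at x) v \<bullet> i =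
        frechet_derivative (\<lambda>x. frechet_derivative f (at x) v) (at x) u \<bullet> i"
    by (rule trans[OF key[of u v] trans[OF frechet_second_commute_real[OF assms(1) Cf assms(3), of u v] key[of v u, symmetric]]])
qed

text \<open>Continuity and bounds of derivatives are known one direction at a time. The crude factor
  \<open>DIM('a)\<close> makes them uniform over all directions.\<close>

lemma norm_linear_le_basis:
  fixes L :: "'a::euclidean_space \<Rightarrow> 'b::real_normed_vector"
  assumes "linear L" "\<And>i. i \<in> Basis \<Longrightarrow> norm (L i) \<le> c"
  shows "norm (L v) \<le> (real DIM('a) * c) * norm v"
proof -
  have "norm (L v) \<le> (\<Sum>i\<in>Basis. norm ((v \<bullet> i) *\<^sub>R L i))"
    unfolding linear_expand[OF assms(1), of v] by (rule norm_sum)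
  also have "\<dots> \<le> (\<Sum>i\<in>(Basis::'a set). norm v * c)"
    by (intro sum_mono) (auto intro!: mult_mono assms(2) simp: Basis_le_norm)
  finally show ?thesis by (simp add: algebra_simps)
qed

lemma frechet_near:
  fixes f :: "'a::euclidean_space \<Rightarrow> 'b::real_normed_vector"
  assumes "open S" "Ck_on (Suc 0) S f" "x \<in> S" "e > 0"
  shows "\<exists>d>0. ball x d \<subseteq> S \<and>
    (\<forall>y\<in>ball x d. \<forall>v. norm (frechet_derivative f (at y) v - frechet_derivative f (at x) v) \<le> e * norm v)"
proof -
  let ?D = "\<lambda>y. frechet_derivative f (at y)"
  define c where "c = e / real DIM('a)"
  have c: "c > 0" using assms by (simp add: c_def)
  have "\<exists>d>0. \<forall>y. dist y x < d \<longrightarrow> dist (?D y i) (?D x i) < c" for i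
  proof -
    have "continuous_on S (\<lambda>y. ?D y i)" using assms(2) by simp
    then have "isCont (\<lambda>y. ?D y i) x" using assms by (simp add: continuous_on_eq_continuous_at)
    then show ?thesis using c by (rule isCont_distD)
  qed
  then obtain r where r: "\<And>i. r i > 0" "\<And>i y. dist y x < r i \<Longrightarrow> dist (?D y i) (?D x i) < c" by metis
  obtain d0 where d0: "d0 > 0" "ball x d0 \<subseteq> S" using assms by (meson open_contains_ball)
  define d where "d = Min (insert d0 (r ` Basis))"
  have "d > 0" unfolding d_def using d0 r by (subst Min_gr_iff) auto
  have dle: "d \<le> d0" "\<And>i. i \<in> Basis \<Longrightarrow> d \<le> r i" unfolding d_def by (rule Min_le; simp)+
  have "norm (?D y v - ?D x v) \<le> e * norm v" if "y \<in> ball x d" for y v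
  proof -
    have yS: "y \<in> S" using that dle d0 by auto
    have "linear (\<lambda>v. ?D y v - ?D x v)"
      by (intro linear_compose_sub Ck_on_linear_frechet[OF assms(2)] yS assms(3))
    then have "norm (?D y v - ?D x v) \<le> (real DIM('a) * c) * norm v"
    proof (rule norm_linear_le_basis)
      fix i :: 'a assume "i \<in> Basis"
      then show "norm (?D y i - ?D x i) \<le> c"
        using r(2)[of y i] dle(2)[of i] that by (auto simp: dist_norm norm_minus_commute)
    qed
    then show ?thesis by (simp add: c_def)
  qed
  then show ?thesis using \<open>d > 0\<close> d0 dle by (intro exI[of _ d]) auto
qed

lemma frechet_bounded_on_compact:
  fixes f :: "'a::euclidean_space \<Rightarrow> 'b::real_normed_vector"
  assumes "Ck_on (Suc 0) S f" "compact K" "K \<subseteq> S"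
  shows "\<exists>C\<ge>0. \<forall>y\<in>K. \<forall>v. norm (frechet_derivative f (at y) v) \<le> C * norm v"
proof -
  have "\<exists>c. \<forall>y\<in>K. norm (frechet_derivative f (at y) i) \<le> c" for i
  proof -
    have "continuous_on K (\<lambda>y. frechet_derivative f (at y) i)"
      using assms by (auto intro: continuous_on_subset)
    then have "bounded ((\<lambda>y. frechet_derivative f (at y) i) ` K)"
      using assms compact_continuous_image compact_imp_bounded by blast
    then show ?thesis by (auto simp: bounded_iff)
  qed
  then obtain c where c: "\<And>i y. y \<in> K \<Longrightarrow> norm (frechet_derivative f (at y) i) \<le> c i" by metis
  define m where "m = (\<Sum>i\<in>Basis. \<bar>c i\<bar>)"
  have "norm (frechet_derivative f (at y) v) \<le> (real DIM('a) * m) * norm v" if "y \<in> K" for y v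
  proof (rule norm_linear_le_basis)
    show "linear (frechet_derivative f (at y))" using Ck_on_linear_frechet[OF assms(1)] assms(3) that by auto
    fix i :: 'a assume "i \<in> Basis"
    then have "\<bar>c i\<bar> \<le> m" unfolding m_def by (intro member_le_sum) auto
    then show "norm (frechet_derivative f (at y) i) \<le> m" using c[OF that, of i] by linarith
  qed
  moreover have "0 \<le> real DIM('a) * m" by (simp add: m_def sum_nonneg)
  ultimately show ?thesis by blast
qed

text \<open>Bounded second derivatives make the first derivative Lipschitz, and the linearization
  estimate along the segment from \<open>x\<close> to \<open>x + z\<close> does the rest.\<close>

lemma Ck_taylor1:
  fixes f :: "'a::euclidean_space \<Rightarrow> 'b::real_normed_vector"
  assumes "Ck_on 2 UNIV f"
  shows "\<exists>C\<ge>0. \<forall>x\<in>cball 0 r. \<forall>z. norm z \<le> 1 \<longrightarrow>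
    norm (f (x + z) - f x - frechet_derivative f (at x) z) \<le> C * (norm z)\<^sup>2"
proof -
  let ?D = "\<lambda>y. frechet_derivative f (at y)"
  have C: "Ck_on (Suc (Suc 0)) UNIV f" using assms by (simp only: numeral_2_eq_2)
  \<comment> \<open>The radius \<open>r + 1\<close> covers every segment from \<open>x\<close> to
    \<open>x + z\<close> with \<open>norm z \<le> 1\<close>.\<close>
  have "\<exists>c\<ge>0. \<forall>y\<in>cball 0 (r+1). \<forall>v. norm (frechet_derivative (\<lambda>y. ?D y i) (at y) v) \<le> c * norm v" for i
    using C by (intro frechet_bounded_on_compact[where S=UNIV]) auto
  then obtain c where c: "\<And>i. c i \<ge> 0"
    "\<And>i y v. y \<in> cball 0 (r+1) \<Longrightarrow> norm (frechet_derivative (\<lambda>y. ?D y i) (at y) v) \<le> c i * norm v" by metis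
  define m where "m = (\<Sum>i\<in>Basis. c i)"
  have lip: "norm (?D y i - ?D x i) \<le> m * norm (y - x)"
    if "x \<in> cball 0 (r+1)" "y \<in> cball 0 (r+1)" "i \<in> Basis" for x y i
  proof -
    have "norm (?D y i - ?D x i) \<le> c i * norm (y - x)"
    proof (rule differentiable_bound[OF convex_cball[of 0 "r+1"] _ _ that(2,1)])
      fix z :: 'a assume z: "z \<in> cball 0 (r+1)"
      have "Ck_on (Suc 0) UNIV (\<lambda>y. ?D y i)" using C by simp
      then show "((\<lambda>y. ?D y i) has_derivative frechet_derivative (\<lambda>y. ?D y i) (at z)) (at z within cball 0 (r+1))"
        using Ck_on_has_derivative has_derivative_at_withinI by blast
      show "onorm (frechet_derivative (\<lambda>y. ?D y i) (at z)) \<le> c i"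
        using c z by (intro onorm_le) auto
    qed
    also have "\<dots> \<le> m * norm (y - x)"
      unfolding m_def using that(3) c(1) by (intro mult_right_mono member_le_sum) auto
    finally show ?thesis .
  qed
  let ?C = "real DIM('a) * m"
  have m0: "m \<ge> 0" unfolding m_def using c(1) by (intro sum_nonneg) auto
  have "norm (f (x + z) - f x - ?D x z) \<le> ?C * (norm z)\<^sup>2" if x: "x \<in> cball 0 r" and z: "norm z \<le> 1" for x z
  proof -
    have xc: "x \<in> cball 0 (r+1)" using x by auto
    have seg: "x + t *\<^sub>R z \<in> cball 0 (r+1)" if "t \<in> {0..1}" for t
    proof -
      have "norm (x + t *\<^sub>R z) \<le> norm x + \<bar>t\<bar> * norm z" using norm_triangle_ineq[of x "t *\<^sub>R z"] by simp
      also have "\<dots> \<le> r + 1 * 1" using x z that by (intro add_mono mult_mono) auto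
      finally show ?thesis by simp
    qed
    have "norm (f (x + z) - f x - ?D x ((x + z) - x)) \<le> norm ((x + z) - x) * (?C * norm z)"
    proof (rule differentiable_bound_linearization[where S = "closed_segment x (x+z)" and f' = "?D"])
      show "x + t *\<^sub>R (x + z - x) \<in> closed_segment x (x + z)" if "t \<in> {0..1}" for t
        using that by (auto simp: closed_segment_def algebra_simps intro!: exI[of _ t])
      show "(f has_derivative ?D y) (at y within closed_segment x (x + z))" for y
        using Ck_on_has_derivative[OF C] has_derivative_at_withinI by blast
      show "x \<in> closed_segment x (x + z)" by simp
      fix y assume "y \<in> closed_segment x (x + z)"
      then obtain t where t: "t \<in> {0..1}" "y = x + t *\<^sub>R z" by (auto simp: closed_segment_def algebra_simps)
      show "onorm (?D y - ?D x) \<le> ?C * norm z"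
      proof (rule onorm_le)
        fix v
        have lin: "linear (\<lambda>v. ?D y v - ?D x v)"
          by (intro linear_compose_sub Ck_on_linear_frechet[OF C]) auto
        have "norm (?D y v - ?D x v) \<le> (real DIM('a) * (m * norm (y - x))) * norm v"
        proof (rule norm_linear_le_basis[OF lin])
          show "norm (?D y i - ?D x i) \<le> m * norm (y - x)" if "i \<in> Basis" for i
            using lip[OF xc seg[OF t(1)] that] t(2) by simp
        qed
        also have "\<dots> \<le> (real DIM('a) * (m * norm z)) * norm v"
          using t m0 by (intro mult_right_mono mult_left_mono) (auto intro!: mult_left_le_one_le)
        finally show "norm ((?D y - ?D x) v) \<le> ?C * norm z * norm v" by (simp add: algebra_simps)
      qed
    qed
    then show ?thesis by (simp add: power2_eq_square algebra_simps)
  qed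
  then show ?thesis using m0 by (intro exI[of _ ?C]) auto
qed

section \<open>Inverses of smooth families and of smooth maps\<close>

lemma has_derivative_scaleR_vanishing:
  fixes \<rho> :: "'a::euclidean_space \<Rightarrow> real" and c :: "'a \<Rightarrow> 'b::real_normed_vector"
  assumes "(\<rho> has_derivative \<rho>') (at x)" "\<rho> x = 0" "isCont c x"
  shows "((\<lambda>y. \<rho> y *\<^sub>R c y) has_derivative (\<lambda>d. \<rho>' d *\<^sub>R c x)) (at x)"
proof -
  have bl: "bounded_linear \<rho>'" using assms(1) by (rule has_derivative_bounded_linear)
  obtain K where K: "K > 0" "\<And>d. norm (\<rho>' d) \<le> norm d * K"
    using bounded_linear.pos_bounded[OF bl] by blast
  have "((\<lambda>y. \<rho> y *\<^sub>R (c y - c x)) has_derivative (\<lambda>d. 0)) (at x)"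
    unfolding has_derivative_at_alt
  proof (intro conjI allI impI)
    show "bounded_linear (\<lambda>d::'a. 0::'b)" by simp
    fix e :: real assume e: "e > 0"
    obtain d1 where d1: "d1 > 0" "\<And>y. norm (y - x) < d1 \<Longrightarrow> norm (\<rho> y - \<rho> x - \<rho>' (y - x)) \<le> 1 * norm (y - x)"
      using assms(1) unfolding has_derivative_at_alt by (metis zero_less_one)
    have "e / (K + 1) > 0" using e K by simp
    from isCont_distD[OF assms(3) this] obtain d2 where
      d2: "d2 > 0" "\<And>y. dist y x < d2 \<Longrightarrow> dist (c y) (c x) < e / (K + 1)" by blast
    have "norm (\<rho> y *\<^sub>R (c y - c x) - \<rho> x *\<^sub>R (c x - c x) - 0) \<le> e * norm (y - x)"
      if "norm (y - x) < min d1 d2" for y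
    proof -
      have "\<bar>\<rho> y\<bar> \<le> \<bar>\<rho> y - \<rho>' (y - x)\<bar> + \<bar>\<rho>' (y - x)\<bar>" by simp
      also have "\<dots> \<le> norm (y - x) + norm (y - x) * K"
        using d1(2)[of y] K(2)[of "y - x"] that assms(2) by simp
      finally have r: "\<bar>\<rho> y\<bar> \<le> (K + 1) * norm (y - x)" by (simp add: algebra_simps)
      have "norm (c y - c x) \<le> e / (K + 1)" using d2(2)[of y] that by (simp add: dist_norm)
      then have "\<bar>\<rho> y\<bar> * norm (c y - c x) \<le> ((K + 1) * norm (y - x)) * (e / (K + 1))"
        using r K by (intro mult_mono) auto
      also have "\<dots> = e * norm (y - x)" using K by simp
      finally show ?thesis by simp
    qed
    then show "\<exists>d>0. \<forall>y. norm (y - x) < d \<longrightarrow> norm (\<rho> y *\<^sub>R (c y - c x) - \<rho> x *\<^sub>R (c x - c x) - 0) \<le> e * norm (y - x)"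
      using d1(1) d2(1) by (intro exI[of _ "min d1 d2"]) auto
  qed
  from has_derivative_add[OF this has_derivative_scaleR_left[OF assms(1), of "c x"]]
  show ?thesis by (simp add: algebra_simps)
qed

lemma linear_bij_inv:
  assumes "linear A" "bij A"
  shows "linear (inv A)"
proof (rule linearI)
  have A: "A (inv A y) = y" "inv A (A z) = z" for y z
    using assms(2) by (simp_all add: bij_is_surj surj_f_inv_f bij_is_inj)
  show "inv A (x + y) = inv A x + inv A y" for x y
    by (metis A linear_add[OF assms(1)])
  show "inv A (c *\<^sub>R x) = c *\<^sub>R inv A x" for c x
    by (metis A linear_scale[OF assms(1)])
qed

text \<open>Based on A(q)^-1 v - A(p)^-1 v = - A(q)^-1 (A(q) - A(p)) A(p)^-1 v. The outer inverse is
  at first known only to be continuous, but A(q) - A(p) vanishes at \<open>p\<close>, which is the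
  situation of \<open>has_derivative_scaleR_vanishing\<close>. The derivative formula involves only
  inverses and derivatives of \<open>A\<close>, so induction applies.\<close>

lemma Ck_on_linear_inv:
  fixes A :: "'a::euclidean_space \<Rightarrow> 'b::euclidean_space \<Rightarrow> 'b"
  assumes S: "open S" and lin: "\<And>q. q \<in> S \<Longrightarrow> linear (A q)" and bij: "\<And>q. q \<in> S \<Longrightarrow> bij (A q)"
    and A: "\<And>v. Ck_on k S (\<lambda>q. A q v)"
  shows "Ck_on k S (\<lambda>q. inv (A q) v)"
proof -
  let ?I = "\<lambda>q. inv (A q)"
  have linI: "linear (?I q)" if "q \<in> S" for q
    using lin[OF that] bij[OF that] by (rule linear_bij_inv)
  have AI: "A q (?I q v) = v" "?I q (A q v) = v" if "q \<in> S" for q v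
    using bij[OF that] by (simp_all add: bij_is_surj surj_f_inv_f bij_is_inj)
  have diff: "?I q v - ?I p v = - ?I q (A q (?I p v) - A p (?I p v))" if "q \<in> S" "p \<in> S" for q p v
    using that AI linear_diff[OF linI[OF that(1)]] by simp
  have cont: "continuous_on S (\<lambda>q. ?I q v)" if A: "\<And>v. continuous_on S (\<lambda>q. A q v)" for v
  proof (rule continuous_at_imp_continuous_on, rule ballI)
    fix p assume p: "p \<in> S"
    have "inj (A p)" using bij[OF p] by (rule bij_is_inj)
    then obtain c where c: "c > 0" "\<And>z. c * norm z \<le> norm (A p z)"
      using linear_inj_bounded_below_pos[OF lin[OF p]] by (metis mult.commute)
    have cA: "isCont (\<lambda>q. A q z) p" for z using A[of z] p S by (simp add: continuous_on_eq_continuous_at)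
    \<comment> \<open>Half of the lower bound \<open>c\<close> survives for \<open>q\<close> near
      \<open>p\<close>, which bounds the inverses there by \<open>2 / c\<close>.\<close>
    define c' where "c' = c / (2 * real DIM('b))"
    have c': "c' > 0" using c by (simp add: c'_def)
    from isCont_distD[OF cA this] obtain r where
      r: "\<And>i. r i > 0" "\<And>i q. dist q p < r i \<Longrightarrow> dist (A q i) (A p i) < c'" by metis
    obtain d0 where d0: "d0 > 0" "ball p d0 \<subseteq> S" using S p by (meson open_contains_ball)
    define d where "d = Min (insert d0 (r ` Basis))"
    have "d > 0" unfolding d_def using d0 r by (subst Min_gr_iff) auto
    have dle: "d \<le> d0" "\<And>i. i \<in> Basis \<Longrightarrow> d \<le> r i" unfolding d_def by (rule Min_le; simp)+
    have near: "q \<in> S" "norm (?I q z) \<le> (2 / c) * norm z" if "dist q p < d" for q z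
    proof -
      show q: "q \<in> S" using that dle d0 by (auto simp: dist_commute)
      have l: "linear (\<lambda>v. A q v - A p v)" by (intro linear_compose_sub lin p q)
      let ?w = "?I q z"
      have "norm (A q ?w - A p ?w) \<le> (real DIM('b) * c') * norm ?w"
      proof (rule norm_linear_le_basis[OF l])
        fix i :: 'b assume "i \<in> Basis"
        then show "norm (A q i - A p i) \<le> c'" using r(2)[of q i] dle(2)[of i] that by (simp add: dist_norm)
      qed
      then have "norm (A q ?w - A p ?w) \<le> (c / 2) * norm ?w" by (simp add: c'_def)
      moreover have "norm (A p ?w) \<le> norm (A q ?w) + norm (A q ?w - A p ?w)"
        by (metis norm_minus_commute norm_triangle_sub)
      ultimately have "c / 2 * norm ?w \<le> norm z" using c(2)[of ?w] AI(1)[OF q] by simp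
      then show "norm ?w \<le> (2 / c) * norm z" using c(1) by (simp add: field_simps)
    qed
    show "isCont (\<lambda>q. ?I q v) p"
    proof -
      have "((\<lambda>q. (2 / c) * norm (A q (?I p v) - A p (?I p v))) \<longlongrightarrow> (2 / c) * norm (A p (?I p v) - A p (?I p v))) (at p)"
        using cA[of "?I p v"] unfolding isCont_def by (intro tendsto_intros)
      then have "((\<lambda>q. (2 / c) * norm (A q (?I p v) - A p (?I p v))) \<longlongrightarrow> 0) (at p)" by simp
      moreover have "\<forall>\<^sub>F q in at p. norm (?I q v - ?I p v) \<le> (2 / c) * norm (A q (?I p v) - A p (?I p v))"
      proof -
        have "norm (?I q v - ?I p v) \<le> (2 / c) * norm (A q (?I p v) - A p (?I p v))" if "dist q p < d" for q
          using near(2)[OF that] diff[OF near(1)[OF that] p, of v] by (simp only: norm_minus_cancel)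
        then show ?thesis using \<open>d > 0\<close> unfolding eventually_at by blast
      qed
      ultimately have "((\<lambda>q. ?I q v - ?I p v) \<longlongrightarrow> 0) (at p)" by (rule Lim_null_comparison[rotated])
      then show ?thesis unfolding isCont_def by (simp add: LIM_zero_iff)
    qed
  qed
  show ?thesis using A
  proof (induction k arbitrary: v)
    case 0
    then show ?case using cont by simp
  next
    case (Suc k)
    have contI: "isCont (\<lambda>q. ?I q v) p" if "p \<in> S" for p v
      using cont[of v] Ck_on_imp_continuous_on[OF Suc.prems] that S by (simp add: continuous_on_eq_continuous_at)
    let ?D = "\<lambda>z q. frechet_derivative (\<lambda>q. A q z) (at q)"
    have IH: "Ck_on k S (\<lambda>q. ?I q v)" for v
      using Suc.IH Ck_on_SucD[OF Suc.prems] by blast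
    show ?case
    proof (rule Ck_on_SucI[OF S, where f' = "\<lambda>q d. - (\<Sum>i\<in>Basis. (\<Sum>j\<in>Basis. (?I q v \<bullet> j) * (?D j q d \<bullet> i)) *\<^sub>R ?I q i)"])
      fix p assume p: "p \<in> S"
      let ?w = "?I p v"
      have dA: "((\<lambda>q. A q z) has_derivative ?D z p) (at p)" for z
        using Ck_on_has_derivative[OF Suc.prems p] .
      have dr: "((\<lambda>q. (\<Sum>j\<in>Basis. (?w \<bullet> j) *\<^sub>R (A q j - A p j)) \<bullet> i) has_derivative
          (\<lambda>d. (\<Sum>j\<in>Basis. (?w \<bullet> j) *\<^sub>R (?D j p d - 0)) \<bullet> i)) (at p)" for i
        by (intro has_derivative_inner_left has_derivative_sum has_derivative_scaleR_right has_derivative_diff dA has_derivative_const)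
      have dsum: "((\<lambda>q. \<Sum>i\<in>Basis. ((\<Sum>j\<in>Basis. (?w \<bullet> j) *\<^sub>R (A q j - A p j)) \<bullet> i) *\<^sub>R ?I q i) has_derivative
          (\<lambda>d. \<Sum>i\<in>Basis. ((\<Sum>j\<in>Basis. (?w \<bullet> j) *\<^sub>R (?D j p d - 0)) \<bullet> i) *\<^sub>R ?I p i)) (at p)"
        by (intro has_derivative_sum has_derivative_scaleR_vanishing dr contI p) simp
      have "((\<lambda>q. ?I p v - (\<Sum>i\<in>Basis. ((\<Sum>j\<in>Basis. (?w \<bullet> j) *\<^sub>R (A q j - A p j)) \<bullet> i) *\<^sub>R ?I q i)) has_derivative
          (\<lambda>d. 0 - (\<Sum>i\<in>Basis. ((\<Sum>j\<in>Basis. (?w \<bullet> j) *\<^sub>R (?D j p d - 0)) \<bullet> i) *\<^sub>R ?I p i))) (at p)"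
        by (intro has_derivative_diff dsum has_derivative_const)
      moreover have "?I p v - (\<Sum>i\<in>Basis. ((\<Sum>j\<in>Basis. (?w \<bullet> j) *\<^sub>R (A q j - A p j)) \<bullet> i) *\<^sub>R ?I q i) = ?I q v"
        if q: "q \<in> S" for q
      proof -
        have "(\<Sum>j\<in>Basis. (?w \<bullet> j) *\<^sub>R (A q j - A p j)) = A q ?w - A p ?w"
          unfolding linear_expand[OF lin[OF q], of ?w] linear_expand[OF lin[OF p], of ?w]
          by (simp add: sum_subtractf scaleR_diff_right)
        then have "(\<Sum>i\<in>Basis. ((\<Sum>j\<in>Basis. (?w \<bullet> j) *\<^sub>R (A q j - A p j)) \<bullet> i) *\<^sub>R ?I q i) = ?I q (A q ?w - A p ?w)"
          using linear_expand[OF linI[OF q], of "A q ?w - A p ?w"] by simp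
        then show ?thesis using diff[OF q p, of v] by (simp add: algebra_simps)
      qed
      ultimately have "((\<lambda>q. ?I q v) has_derivative
          (\<lambda>d. 0 - (\<Sum>i\<in>Basis. ((\<Sum>j\<in>Basis. (?w \<bullet> j) *\<^sub>R (?D j p d - 0)) \<bullet> i) *\<^sub>R ?I p i))) (at p)"
        by (rule has_derivative_transform_within_open[OF _ S p])
      then show "((\<lambda>q. ?I q v) has_derivative (\<lambda>d. - (\<Sum>i\<in>Basis. (\<Sum>j\<in>Basis. (?I p v \<bullet> j) * (?D j p d \<bullet> i)) *\<^sub>R ?I p i))) (at p)"
        by (simp add: inner_sum_left)
    next
      fix d
      have "Ck_on k S (\<lambda>q. ?D j q d)" for j using Suc.prems[of j] by simp
      then show "Ck_on k S (\<lambda>q. - (\<Sum>i\<in>Basis. (\<Sum>j\<in>Basis. (?I q v \<bullet> j) * (?D j q d \<bullet> i)) *\<^sub>R ?I q i))"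
        by (intro Ck_on_minus Ck_on_sum Ck_on_scaleR Ck_on_mult Ck_on_inner IH S Ck_on_const)
    qed
  qed
qed

text \<open>The C^1 theorem gives an inverse \<open>g\<close> whose derivative at \<open>y\<close>
  is the inverse of the derivative of \<open>F\<close> at \<open>g y\<close>. That expression is C^k
  as soon as \<open>g\<close> is, which raises the order step by step.\<close>

theorem Ck_inverse_function:
  fixes F :: "'a::euclidean_space \<Rightarrow> 'a"
  assumes U: "open U" and F: "\<And>k. Ck_on k U F" and p: "p \<in> U"
    and inj: "\<And>v. frechet_derivative F (at p) v = 0 \<Longrightarrow> v = 0"
  obtains U' V g where "open U'" "U' \<subseteq> U" "p \<in> U'" "open V" "F p \<in> V" "homeomorphism U' V F g"
    "\<And>k. Ck_on k V g"
proof -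
  have F1: "Ck_on (Suc 0) U F" by (rule F)
  define f' where "f' x = Blinfun (frechet_derivative F (at x))" for x
  have f': "blinfun_apply (f' x) = frechet_derivative F (at x)" if "x \<in> U" for x
    unfolding f'_def using Ck_on_has_derivative[OF F1 that]
    by (intro bounded_linear_Blinfun_apply has_derivative_bounded_linear)
  have der: "(F has_derivative blinfun_apply (f' x)) (at x)" if "x \<in> U" for x
    using Ck_on_has_derivative[OF F1 that] f'[OF that] by simp
  have "continuous_on U (\<lambda>x. blinfun_apply (f' x) i)" for i
    using F1 by (simp add: f' cong: continuous_on_cong)
  then have cont: "continuous_on U f'" by (intro continuous_on_blinfun_componentwise) auto
  let ?L = "frechet_derivative F (at p)"
  have lin: "linear ?L" using Ck_on_linear_frechet[OF F1 p] .
  have injL: "inj ?L" using inj linear_injective_0[OF lin] by blast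
  have bl: "bounded_linear (inv ?L)"
    using linear_bij_inv[OF lin] injL linear_inj_imp_surj[OF lin injL]
    by (simp add: bij_def linear_conv_bounded_linear)
  have "Blinfun (inv ?L) o\<^sub>L f' p = id_blinfun"
    by (rule blinfun_eqI) (simp add: f'[OF p] bounded_linear_Blinfun_apply[OF bl] injL)
  from inverse_function_theorem[OF U der cont p this]
  obtain U' V g g' where *: "open U'" "U' \<subseteq> U" "p \<in> U'" "open V" "F p \<in> V" "homeomorphism U' V F g"
    "\<And>y. y \<in> V \<Longrightarrow> (g has_derivative (g' y)) (at y)"
    "\<And>y. y \<in> V \<Longrightarrow> g' y = inv (blinfun_apply (f'(g y)))"
    "\<And>y. y \<in> V \<Longrightarrow> bij (blinfun_apply (f'(g y)))" by blast
  have im: "g ` V = U'" "F ` U' = V" using *(6) by (auto simp: homeomorphism_def)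
  have bij: "bij (frechet_derivative F (at q))" if "q \<in> U'" for q
  proof -
    have "g (F q) = q" "F q \<in> V" using *(6) that by (auto simp: homeomorphism_def)
    then show ?thesis using *(9)[of "F q"] f'[of q] *(2) that by auto
  qed
  have "Ck_on k V g" for k
  proof (induction k)
    case 0
    then show ?case using *(6) by (simp add: homeomorphism_def)
  next
    case (Suc k)
    show ?case
    proof (rule Ck_on_SucI[OF *(4), where f' = "\<lambda>y v. inv (frechet_derivative F (at (g y))) v"])
      fix y assume y: "y \<in> V"
      then have "g y \<in> U" using im *(2) by auto
      then show "(g has_derivative inv (frechet_derivative F (at (g y)))) (at y)"
        using *(7)[OF y] *(8)[OF y] f'[of "g y"] by simp
    next
      fix v
      have C: "Ck_on k U' (\<lambda>q. frechet_derivative F (at q) w)" for w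
        using F[of "Suc k"] *(2) by (auto intro: Ck_on_subset)
      have "Ck_on k U' (\<lambda>q. inv (frechet_derivative F (at q)) v)"
        using Ck_on_linear_frechet[OF F1] *(2) by (intro Ck_on_linear_inv *(1) bij C) auto
      then show "Ck_on k V (\<lambda>y. inv (frechet_derivative F (at (g y))) v)"
        by (rule Ck_on_compose[OF *(4,1) Suc.IH]) (simp add: im)
    qed
  qed
  with * show ?thesis using that by blast
qed

lemma Ck_on_Pair:
  assumes "open S" "Ck_on k S f" "Ck_on k S g"
  shows "Ck_on k S (\<lambda>x. (f x, g x))"
proof -
  have "Ck_on k S (\<lambda>x. (f x, 0) + (0, g x))"
    by (intro Ck_on_add Ck_on_bounded_linear[OF bounded_linear_Pair[OF bounded_linear_ident bounded_linear_zero]]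
        Ck_on_bounded_linear[OF bounded_linear_Pair[OF bounded_linear_zero bounded_linear_ident]] assms)
  then show ?thesis by simp
qed

lemma frechet_derivative_eq: "(f has_derivative f') (at x) \<Longrightarrow> frechet_derivative f (at x) = f'"
  using frechet_derivative_at by metis

section \<open>Critical hypersurfaces and the nearest-point projection\<close>

lemma GDERIV_grad:
  fixes V :: "'a::euclidean_space \<Rightarrow> real"
  assumes "V differentiable (at x)"
  shows "GDERIV V x :> grad V x" "grad V x = (\<Sum>i\<in>Basis. frechet_derivative V (at x) i *\<^sub>R i)"
proof -
  let ?g = "\<Sum>i\<in>Basis. frechet_derivative V (at x) i *\<^sub>R i"
  have d: "(V has_derivative frechet_derivative V (at x)) (at x)"
    using assms by (simp add: frechet_derivative_works[symmetric])
  have "frechet_derivative V (at x) h = h \<bullet> ?g" for h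
    using linear_expand[OF linear_frechet_derivative[OF assms], of h]
    by (simp add: inner_sum_right mult.commute)
  then have "frechet_derivative V (at x) = (\<lambda>h. h \<bullet> ?g)" by blast
  then have 1: "GDERIV V x :> ?g" unfolding gderiv_def using d by simp
  have "D = ?g" if "GDERIV V x :> D" for D
  proof -
    have "(\<lambda>h. h \<bullet> D) = (\<lambda>h. h \<bullet> ?g)"
      using has_derivative_unique[of V "\<lambda>h. h \<bullet> D" x "\<lambda>h. h \<bullet> ?g"] that 1 unfolding gderiv_def by blast
    then have "h \<bullet> D = h \<bullet> ?g" for h by meson
    then show ?thesis by (metis vector_eq_ldot)
  qed
  then show 2: "grad V x = ?g" unfolding grad_def by (intro the_equality 1)
  show "GDERIV V x :> grad V x" unfolding 2 by (rule 1)
qed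

lemma Ck_on_grad:
  fixes V :: "'a::euclidean_space \<Rightarrow> real"
  assumes "\<And>k. Ck_on k UNIV V"
  shows "Ck_on k UNIV (grad V)"
proof -
  have S: "Ck_on (Suc k) UNIV V" by (rule assms)
  have "grad V x = (\<Sum>i\<in>Basis. frechet_derivative V (at x) i *\<^sub>R i)" for x
    using S by (intro GDERIV_grad) simp
  then have "grad V = (\<lambda>x. \<Sum>i\<in>Basis. frechet_derivative V (at x) i *\<^sub>R i)" by blast
  then show ?thesis using S by (auto intro!: Ck_on_sum Ck_on_scaleR)
qed

lemma grad_inner:
  fixes V :: "'a::euclidean_space \<Rightarrow> real"
  assumes "\<And>k. Ck_on k UNIV V"
  shows "frechet_derivative V (at x) v = grad V x \<bullet> v"
  using frechet_derivative_eq[of V "\<lambda>h. h \<bullet> grad V x" x] GDERIV_grad(1)[of V x] assms[of "Suc 0"]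
  by (simp add: gderiv_def inner_commute)

lemma hessian_symmetric:
  fixes V :: "'a::euclidean_space \<Rightarrow> real"
  assumes V: "\<And>k. Ck_on k UNIV V"
  shows "frechet_derivative (grad V) (at x) u \<bullet> v = frechet_derivative (grad V) (at x) v \<bullet> u"
proof -
  have "grad V differentiable (at x)" using Ck_on_grad[OF V, of "Suc 0"] by simp
  then have *: "frechet_derivative (\<lambda>x. frechet_derivative V (at x) v) (at x) u = frechet_derivative (grad V) (at x) u \<bullet> v" for u v
    unfolding grad_inner[OF V] by (rule frechet_derivative_inner_left)
  show ?thesis using frechet_second_commute_real[OF open_UNIV V UNIV_I, of u x v] by (simp only: *)
qed

text \<open>Velocities of curves in \<open>M\<close> do not form a linear space by definition. The
  derivative of the inverse chart maps the coordinate hyperplane injectively into them, and its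
  image fills the complement of \<open>\<nu>\<close> because both have dimension one less than the
  space.\<close>

lemma orthogonal_to_normal_is_tangent:
  fixes M :: "(real^'n) set"
  assumes M: "embedded_hypersurface M" and p: "p \<in> M" and \<nu>: "unit_normal M p \<nu>" and v: "v \<bullet> \<nu> = 0"
  shows "v \<in> tangent_space M p"
proof -
  obtain U W k and \<phi> \<psi> :: "real^'n \<Rightarrow> real^'n" where
    pU: "p \<in> U" and \<phi>: "smooth_map_on U \<phi>" and \<psi>: "smooth_map_on W \<psi>" and
    hom: "homeomorphism U W \<phi> \<psi>" and im: "\<phi> ` (M \<inter> U) = {y \<in> W. y $ k = 0}"
    using M p unfolding embedded_hypersurface_def by meson
  have UW: "open U" "open W" using \<phi> \<psi> by (auto simp: smooth_map_on_def)
  define y where "y = \<phi> p"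
  have y: "y \<in> W" "y $ k = 0" using im p pU unfolding y_def by blast+
  have \<psi>y: "\<psi> y = p" unfolding y_def using hom pU by (simp add: homeomorphism_def)
  have C\<psi>: "Ck_on j W \<psi>" and C\<phi>: "Ck_on j U \<phi>" for j using \<phi> \<psi> by (auto simp: smooth_map_on_def)
  let ?L = "frechet_derivative \<psi> (at y)"
  have d\<psi>: "(\<psi> has_derivative ?L) (at y)" using Ck_on_has_derivative[OF C\<psi> y(1)] .
  have lin: "linear ?L" using Ck_on_linear_frechet[OF C\<psi> y(1)] .
  have "((\<phi> \<circ> \<psi>) has_derivative (frechet_derivative \<phi> (at p) \<circ> ?L)) (at y)"
    using diff_chain_at[OF d\<psi>] Ck_on_has_derivative[OF C\<phi> pU] \<psi>y by simp
  moreover have "((\<phi> \<circ> \<psi>) has_derivative (\<lambda>h. h)) (at y)"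
    by (rule has_derivative_transform_within_open[OF has_derivative_ident UW(2) y(1)])
      (use hom in \<open>simp add: homeomorphism_def\<close>)
  ultimately have "frechet_derivative \<phi> (at p) \<circ> ?L = (\<lambda>h. h)" by (rule has_derivative_unique)
  then have injL: "inj ?L" by (metis inj_on_id2 inj_on_imageI2)
  have mem: "?L z \<in> tangent_space M p" if z: "z $ k = 0" for z
  proof -
    have "continuous (at 0) (\<lambda>t::real. y + t *\<^sub>R z)" by (intro continuous_intros)
    moreover have "y + 0 *\<^sub>R z \<in> W" using y by simp
    ultimately have "\<forall>\<^sub>F t in at (0::real). y + t *\<^sub>R z \<in> W"
      using topological_tendstoD[OF _ UW(2)] unfolding continuous_at by blast
    then obtain e where e: "e > 0" "\<And>t. t \<noteq> 0 \<Longrightarrow> dist t 0 < e \<Longrightarrow> y + t *\<^sub>R z \<in> W"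
      unfolding eventually_at by blast
    have W: "y + t *\<^sub>R z \<in> W" if "t \<in> {-e<..<e}" for t
      using e(2)[of t] that y by (cases "t = 0") auto
    let ?\<gamma> = "\<lambda>t. \<psi> (y + t *\<^sub>R z)"
    have "Ck_on j {-e<..<e} ?\<gamma>" for j
    proof (rule Ck_on_compose[OF _ UW(2) _ C\<psi>])
      show "Ck_on j {-e<..<e} (\<lambda>t. y + t *\<^sub>R z)"
        by (intro Ck_on_add Ck_on_scaleR Ck_on_ident) auto
    qed (use W in auto)
    then have "smooth_map_on {-e<..<e} ?\<gamma>" by (simp add: smooth_map_on_def)
    moreover have "?\<gamma> ` {-e<..<e} \<subseteq> M"
    proof clarify
      fix t assume "t \<in> {-e<..<e}"
      then have "y + t *\<^sub>R z \<in> {y \<in> W. y $ k = 0}" using W y z by simp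
      then obtain m where "m \<in> M \<inter> U" "\<phi> m = y + t *\<^sub>R z" using im by (metis imageE)
      then show "?\<gamma> t \<in> M" using hom by (metis IntE homeomorphism_apply1)
    qed
    moreover have "(?\<gamma> has_vector_derivative ?L z) (at 0)"
    proof -
      have "((\<lambda>t. y + t *\<^sub>R z) has_derivative (\<lambda>t. t *\<^sub>R z)) (at 0)"
        by (auto intro!: derivative_eq_intros)
      from diff_chain_at[OF this, of \<psi> ?L] d\<psi>
      have "(?\<gamma> has_derivative (\<lambda>t. ?L (t *\<^sub>R z))) (at 0)" by (simp add: o_def)
      then show ?thesis unfolding has_vector_derivative_def by (simp add: linear_scale[OF lin])
    qed
    ultimately show ?thesis unfolding tangent_space_def using e(1) \<psi>y
      by (intro CollectI exI[of _ ?\<gamma>] exI[of _ e]) simp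
  qed
  let ?H = "{z::real^'n. axis k 1 \<bullet> z = 0}"
  have H: "?H = {z. z $ k = 0}" by (simp add: inner_axis')
  have \<nu>0: "\<nu> \<noteq> 0" using \<nu> by (auto simp: unit_normal_def)
  have "dim (?L ` ?H) = DIM(real^'n) - 1"
    using dim_image_eq[OF lin, of ?H] injL dim_hyperplane[of "axis k 1 :: real^'n"]
    by (simp add: inj_on_subset axis_eq_0_iff)
  moreover have "dim {z. \<nu> \<bullet> z = 0} = DIM(real^'n) - 1" using dim_hyperplane[OF \<nu>0] .
  moreover have "?L ` ?H \<subseteq> {z. \<nu> \<bullet> z = 0}" using mem \<nu> H by (auto simp: unit_normal_def)
  ultimately have "?L ` ?H = {z. \<nu> \<bullet> z = 0}"
    by (intro subspace_dim_equal linear_subspace_image[OF lin] subspace_hyperplane) auto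
  then have "v \<in> ?L ` ?H" using v by (simp add: inner_commute)
  then show ?thesis using mem H by auto
qed

text \<open>The squared distance from \<open>y\<close> to a curve in \<open>M\<close> through the
  nearest point has a minimum there.\<close>

lemma closest_point_orthogonal:
  assumes "closed M" "M \<noteq> {}" "w \<in> tangent_space M (closest_point M y)"
  shows "(y - closest_point M y) \<bullet> w = 0"
proof -
  let ?q = "closest_point M y"
  obtain \<gamma> e where g: "0 < (e::real)" "\<gamma> ` {-e<..<e} \<subseteq> M" "\<gamma> 0 = ?q" "(\<gamma> has_vector_derivative w) (at 0)"
    using assms(3) unfolding tangent_space_def by auto
  have "((\<lambda>s. (y - \<gamma> s) \<bullet> (y - \<gamma> s)) has_real_derivative (-2 * ((y - ?q) \<bullet> w))) (at 0)"
    using g(4) unfolding has_field_derivative_def has_vector_derivative_def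
    by (auto intro!: derivative_eq_intros simp: g(3) inner_commute algebra_simps)
  moreover have "(y - \<gamma> 0) \<bullet> (y - \<gamma> 0) \<le> (y - \<gamma> s) \<bullet> (y - \<gamma> s)" if "\<bar>0 - s\<bar> < e" for s
  proof -
    have "s \<in> {-e<..<e}" using that by auto
    then have "\<gamma> s \<in> M" using g(2) by blast
    then have "dist y ?q \<le> dist y (\<gamma> s)" using closest_point_le[OF assms(1)] by blast
    then have "(dist y ?q)\<^sup>2 \<le> (dist y (\<gamma> s))\<^sup>2" by (intro power_mono) auto
    then show ?thesis by (simp add: g(3) dist_norm power2_norm_eq_inner)
  qed
  ultimately have "-2 * ((y - ?q) \<bullet> w) = 0" using DERIV_local_min[OF _ g(1)] by blast
  then show ?thesis by simp
qed

locale repulsive_hypersurface =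
  fixes V :: "real^'n \<Rightarrow> real" and M :: "(real^'n) set"
  assumes smooth_V: "smooth_map_on UNIV V" and compact_M: "compact M"
    and orientable_M: "orientable_hypersurface M"
    and critical_M: "\<forall>x\<in>M. grad V x = 0"
    and repulsive_M: "\<forall>x\<in>M. \<forall>\<nu>. unit_normal M x \<nu> \<longrightarrow> hess V x \<nu> \<nu> < 0"
begin

abbreviation G where "G \<equiv> grad V"
abbreviation DG where "DG x \<equiv> frechet_derivative (grad V) (at x)"
abbreviation \<pi> where "\<pi> \<equiv> closest_point M"

text \<open>Any global choice of sign serves. The field is only continuous here; its smoothness
  along the geodesic is recovered in \<open>n1\<close> and \<open>Ck_n\<close>.\<close>

definition normal_field :: "real^'n \<Rightarrow> real^'n" where
  "normal_field = (SOME N. continuous_on M N \<and> (\<forall>p\<in>M. unit_normal M p (N p)))"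

lemma normal_field: "continuous_on M normal_field" "p \<in> M \<Longrightarrow> unit_normal M p (normal_field p)"
proof -
  have "\<exists>N. continuous_on M N \<and> (\<forall>p\<in>M. unit_normal M p (N p))"
    using orientable_M by (simp add: orientable_hypersurface_def)
  from someI_ex[OF this]
  have "continuous_on M normal_field \<and> (\<forall>p\<in>M. unit_normal M p (normal_field p))"
    unfolding normal_field_def .
  then show "continuous_on M normal_field" "p \<in> M \<Longrightarrow> unit_normal M p (normal_field p)" by blast+
qed

lemma Ck_V: "Ck_on k UNIV V" using smooth_V by (simp add: smooth_map_on_def)
lemma Ck_G: "Ck_on k UNIV G" by (rule Ck_on_grad[OF Ck_V])
lemma Ck_DG: "Ck_on k UNIV (\<lambda>x. DG x v)" using Ck_G[of "Suc k"] by simp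
lemma linear_DG: "linear (DG x)" using Ck_on_linear_frechet[OF Ck_G] by blast
lemma DG_symmetric: "DG x u \<bullet> v = DG x v \<bullet> u" by (rule hessian_symmetric[OF Ck_V])
lemma G_has_derivative: "(G has_derivative DG x) (at x)" using Ck_on_has_derivative[OF Ck_G] by blast

lemma norm_normal: "p \<in> M \<Longrightarrow> normal_field p \<bullet> normal_field p = 1"
  using normal_field(2) unfolding unit_normal_def by (metis norm_eq_1)

lemma tangent_iff: "p \<in> M \<Longrightarrow> v \<in> tangent_space M p \<longleftrightarrow> v \<bullet> normal_field p = 0"
  using orthogonal_to_normal_is_tangent[OF _ _ normal_field(2)] normal_field(2) orientable_M
  unfolding orientable_hypersurface_def unit_normal_def by (metis inner_commute)

text \<open>\<open>G\<close> vanishes identically along a curve in \<open>M\<close>, so its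
  derivative kills the velocity.\<close>

lemma DG_tangent:
  assumes "p \<in> M" "v \<bullet> normal_field p = 0"
  shows "DG p v = 0"
proof -
  have "v \<in> tangent_space M p" using assms tangent_iff by blast
  then obtain \<gamma> e where g: "0 < (e::real)" "\<gamma> ` {-e<..<e} \<subseteq> M" "\<gamma> 0 = p" "(\<gamma> has_vector_derivative v) (at 0)"
    unfolding tangent_space_def by auto
  have "((G \<circ> \<gamma>) has_derivative (DG p \<circ> (\<lambda>t. t *\<^sub>R v))) (at 0)"
    using diff_chain_at[OF g(4)[unfolded has_vector_derivative_def], of G "DG p"] G_has_derivative[of p] g(3) by simp
  moreover have "((G \<circ> \<gamma>) has_derivative (\<lambda>t. 0)) (at 0)"
  proof (rule has_derivative_transform_within_open[OF has_derivative_const[of 0], of "{-e<..<e}"])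
    show "0 = (G \<circ> \<gamma>) t" if "t \<in> {-e<..<e}" for t
      using g(2) critical_M that by (simp add: image_subset_iff)
  qed (use g in auto)
  ultimately have "DG p \<circ> (\<lambda>t. t *\<^sub>R v) = (\<lambda>t. 0)" by (rule has_derivative_unique)
  then have "DG p (1 *\<^sub>R v) = 0" unfolding o_def by meson
  then show ?thesis by simp
qed

text \<open>On \<open>M\<close> the Hessian of \<open>V\<close> has rank one, so its trace is its only nonzero eigenvalue.\<close>

definition strength :: "real^'n \<Rightarrow> real" where
  "strength x = - (\<Sum>i\<in>Basis. DG x i \<bullet> i)"

lemma Ck_strength: "Ck_on k UNIV strength"
  unfolding strength_def[abs_def] by (intro Ck_on_minus Ck_on_sum Ck_on_inner Ck_DG) auto

text \<open>The Hessian kills tangent vectors by \<open>DG_tangent\<close>; being symmetric, it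
  therefore maps into the normal line. Repulsiveness gives the sign of the one remaining eigenvalue,
  \<open>- strength p\<close>.\<close>

lemma DG_on_M:
  assumes p: "p \<in> M"
  shows "DG p v = - (strength p * (normal_field p \<bullet> v)) *\<^sub>R normal_field p" and "strength p > 0"
proof -
  let ?n = "normal_field p"
  have nn: "?n \<bullet> ?n = 1" by (rule norm_normal[OF p])
  have *: "DG p v = (v \<bullet> ?n) *\<^sub>R DG p ?n" for v
  proof -
    have "(v - (v \<bullet> ?n) *\<^sub>R ?n) \<bullet> ?n = 0" by (simp add: inner_diff_left nn)
    then have "DG p (v - (v \<bullet> ?n) *\<^sub>R ?n) = 0" by (rule DG_tangent[OF p])
    then show ?thesis by (simp add: linear_diff[OF linear_DG] linear_scale[OF linear_DG])
  qed
  define c where "c = DG p ?n \<bullet> ?n"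
  have "DG p ?n \<bullet> w = c * (w \<bullet> ?n)" for w
    using DG_symmetric[of p ?n w] *[of w] by (simp add: c_def)
  then have "DG p ?n \<bullet> w = (c *\<^sub>R ?n) \<bullet> w" for w by (simp add: inner_commute)
  then have n: "DG p ?n = c *\<^sub>R ?n" using vector_eq_rdot by blast
  have "strength p = - (\<Sum>i\<in>Basis. (i \<bullet> ?n) * (c * (?n \<bullet> i)))"
    unfolding strength_def by (subst *) (simp add: n mult.assoc)
  also have "(\<Sum>i\<in>Basis. (i \<bullet> ?n) * (c * (?n \<bullet> i))) = c * (\<Sum>i\<in>Basis. (?n \<bullet> i) * (?n \<bullet> i))"
    by (simp add: sum_distrib_left inner_commute mult_ac)
  also have "(\<Sum>i\<in>Basis. (?n \<bullet> i) * (?n \<bullet> i)) = 1" using euclidean_inner[of ?n ?n] nn by simp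
  finally have s: "strength p = - c" by simp
  show "DG p v = - (strength p * (?n \<bullet> v)) *\<^sub>R ?n"
    using *[of v] n s by (simp add: inner_commute)
  have "hess V p ?n ?n < 0" using repulsive_M p normal_field(2)[OF p] by blast
  then show "strength p > 0" using s by (simp add: hess_def c_def)
qed

lemma normal_component:
  assumes "p \<in> M" "\<And>w. w \<bullet> normal_field p = 0 \<Longrightarrow> u \<bullet> w = 0"
  shows "u = (u \<bullet> normal_field p) *\<^sub>R normal_field p"
proof -
  let ?n = "normal_field p" and ?w = "u - (u \<bullet> normal_field p) *\<^sub>R normal_field p"
  have w: "?w \<bullet> ?n = 0" by (simp add: inner_diff_left norm_normal[OF assms(1)])
  have "?w \<bullet> ?w = u \<bullet> ?w - (u \<bullet> ?n) * (?w \<bullet> ?n)" by (simp add: inner_diff_left inner_commute)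
  also have "\<dots> = 0" using w assms(2)[OF w] by simp
  finally show ?thesis by simp
qed

text \<open>The unit normal is not yet known to be smooth, so \<open>m q = DG q \<nu>\<close>
  replaces it: a smooth field that is normal at points of \<open>M\<close> and nonzero near
  \<open>p\<close>. If \<open>q\<close> is the nearest point to \<open>y\<close>, then
  \<open>y = q + l *\<^sub>R m q\<close> and \<open>G q = 0\<close>, that is,
  \<open>F (q, l) = (y, 0)\<close>. Hence the projection is the first component of the smooth local
  inverse of \<open>F\<close>.\<close>

lemma closest_point_smooth_near:
  assumes p: "p \<in> M"
  shows "\<exists>W. open W \<and> p \<in> W \<and> (\<forall>k. Ck_on k W \<pi>)"
proof -
  have clM: "closed M" "M \<noteq> {}" using compact_M p compact_imp_closed by auto
  define \<nu> where "\<nu> = normal_field p"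
  have nn: "\<nu> \<bullet> \<nu> = 1" unfolding \<nu>_def by (rule norm_normal[OF p])
  define m where "m q = DG q \<nu>" for q
  have Cm: "Ck_on k UNIV m" for k unfolding m_def[abs_def] by (rule Ck_DG)
  define b where "b = strength p"
  have b: "b > 0" unfolding b_def by (rule DG_on_M(2)[OF p])
  have mp: "m p = - b *\<^sub>R \<nu>" unfolding m_def DG_on_M(1)[OF p] b_def using nn by (simp add: \<nu>_def)
  define F where "F z = (fst z + snd z *\<^sub>R m (fst z), \<nu> \<bullet> G (fst z))" for z :: "(real^'n) \<times> real"
  have CF: "Ck_on k UNIV F" for k unfolding F_def[abs_def]
    by (intro Ck_on_Pair Ck_on_add Ck_on_scaleR Ck_on_inner Ck_on_const
        Ck_on_linear[OF bounded_linear_fst] Ck_on_linear[OF bounded_linear_snd]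
        Ck_on_compose[OF open_UNIV open_UNIV _ Cm] Ck_on_compose[OF open_UNIV open_UNIV _ Ck_G]) auto
  have Fp: "F (p, 0) = (p, 0)" using critical_M p by (simp add: F_def)
  have dF: "(F has_derivative (\<lambda>z. (fst z + snd z *\<^sub>R m p, \<nu> \<bullet> DG p (fst z)))) (at (p, 0))"
  proof -
    have dG: "((\<lambda>z. G (fst z)) has_derivative (\<lambda>z. DG p (fst z))) (at (p, 0))"
      by (rule has_derivative_compose[OF has_derivative_fst[OF has_derivative_ident]]) (simp add: G_has_derivative)
    have dm: "((\<lambda>z. m (fst z)) has_derivative (\<lambda>z. frechet_derivative m (at p) (fst z))) (at (p, 0))"
      by (rule has_derivative_compose[OF has_derivative_fst[OF has_derivative_ident]])
        (simp add: Ck_on_has_derivative[OF Cm])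
    have "((\<lambda>z. snd z *\<^sub>R m (fst z)) has_derivative (\<lambda>z. snd z *\<^sub>R m p)) (at (p, 0))"
      using has_derivative_scaleR[OF has_derivative_snd[OF has_derivative_ident] dm] by simp
    from has_derivative_Pair[OF has_derivative_add[OF has_derivative_fst[OF has_derivative_ident] this]
        has_derivative_inner_right[OF dG, of \<nu>]]
    show ?thesis unfolding F_def[abs_def] .
  qed
  have inj: "z = 0" if z: "frechet_derivative F (at (p, 0)) z = 0" for z
  proof -
    have e: "fst z + snd z *\<^sub>R m p = 0" "\<nu> \<bullet> DG p (fst z) = 0"
      using z unfolding frechet_derivative_eq[OF dF] by (simp_all add: prod_eq_iff)
    from e(2) have "\<nu> \<bullet> fst z = 0" unfolding DG_on_M(1)[OF p] using b nn by (auto simp: \<nu>_def b_def)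
    moreover have "fst z = (snd z * b) *\<^sub>R \<nu>" using e(1) mp by (simp add: algebra_simps)
    ultimately have "snd z = 0" using b nn by simp
    then show ?thesis using e(1) by (simp add: prod_eq_iff)
  qed
  obtain U' V' g where *: "open U'" "(p, 0) \<in> U'" "open V'" "(p, 0) \<in> V'" "homeomorphism U' V' F g"
    "\<And>k. Ck_on k V' g"
    using Ck_inverse_function[OF open_UNIV CF UNIV_I inj] Fp by metis
  obtain d where d: "d > 0" "ball (p, 0) d \<subseteq> U'" using * by (meson open_contains_ball)
  have "isCont m p" using Ck_on_imp_continuous_on[OF Cm] by (simp add: continuous_on_eq_continuous_at)
  from isCont_distD[OF this, of "b / 2"] b obtain d2 where
    d2: "d2 > 0" "\<And>q. dist q p < d2 \<Longrightarrow> dist (m q) (m p) < b / 2" by auto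
  \<comment> \<open>The nearest point lies within \<open>2 * r\<close> of \<open>p\<close>, and
    \<open>l\<close> is below \<open>r * (2 / b)\<close>. The first entry keeps \<open>m\<close>
    away from zero at the nearest point; the second places \<open>(q, l)\<close> where
    \<open>g\<close> inverts \<open>F\<close>.\<close>
  define r where "r = min (d2 / 2) (d / (2 + 2 / b))"
  have pb: "2 + 2 / b > 0" using b by (simp add: add_pos_pos)
  have r: "r > 0" using d d2 pb by (simp add: r_def)
  define W where "W = ball p r \<inter> {y. (y, 0::real) \<in> V'}"
  have "open {y. (y, 0::real) \<in> V'}"
    using open_vimage[OF *(3), of "\<lambda>y. (y, 0)"] by (simp add: vimage_def continuous_on_Pair)
  then have W: "open W" "p \<in> W" using r *(4) by (auto simp: W_def)
  have eq: "\<pi> y = fst (g (y, 0))" if y: "y \<in> W" for y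
  proof -
    let ?q = "\<pi> y"
    have q: "?q \<in> M" using closest_point_in_set[OF clM] .
    have yr: "dist y p < r" using y by (simp add: W_def dist_commute)
    have qy: "dist y ?q \<le> dist y p" using closest_point_le[OF clM(1) p] .
    have qp: "dist ?q p < 2 * r" using dist_triangle[of ?q p y] qy yr by (simp add: dist_commute)
    then have "dist (m ?q) (m p) < b / 2" by (intro d2) (auto simp: r_def)
    moreover have "norm (m p) = b" using b nn by (simp add: mp norm_eq_1)
    ultimately have mq: "norm (m ?q) > b / 2"
      using norm_triangle_ineq2[of "m p" "m ?q"] by (simp add: dist_norm norm_minus_commute)
    define n where "n = normal_field ?q"
    define c where "c = strength ?q * (n \<bullet> \<nu>)"
    have mqn: "m ?q = - c *\<^sub>R n" unfolding m_def DG_on_M(1)[OF q] by (simp add: n_def c_def)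
    have "c \<noteq> 0" using mq b mqn by auto
    have "y - ?q = ((y - ?q) \<bullet> n) *\<^sub>R n" unfolding n_def
    proof (rule normal_component[OF q])
      fix w assume "w \<bullet> normal_field ?q = 0"
      then have "w \<in> tangent_space M ?q" by (simp add: tangent_iff[OF q])
      then show "(y - ?q) \<bullet> w = 0" by (rule closest_point_orthogonal[OF clM])
    qed
    also have "\<dots> = (- ((y - ?q) \<bullet> n) / c) *\<^sub>R m ?q" unfolding mqn using \<open>c \<noteq> 0\<close> by simp
    finally obtain l where l: "y - ?q = l *\<^sub>R m ?q" by blast
    have "\<bar>l\<bar> * (b / 2) \<le> \<bar>l\<bar> * norm (m ?q)" using mq by (intro mult_left_mono) auto
    also have "\<dots> = dist y ?q" using l by (simp add: dist_norm)
    also have "\<dots> < r" using qy yr by simp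
    finally have "\<bar>l\<bar> < r * (2 / b)" using b by (simp add: field_simps)
    have "dist (?q, l) (p, 0) \<le> dist ?q p + \<bar>l\<bar>"
      unfolding dist_Pair_Pair using sqrt_sum_squares_le_sum_abs[of "dist ?q p" "dist l 0"] by simp
    also have "\<dots> < r * (2 + 2 / b)" using qp \<open>\<bar>l\<bar> < r * (2 / b)\<close> by (simp add: algebra_simps)
    also have "\<dots> \<le> d" using pos_le_divide_eq[OF pb, of r d] by (simp add: r_def)
    finally have "(?q, l) \<in> U'" using d(2) by (auto simp: dist_commute)
    then have "g (F (?q, l)) = (?q, l)" using *(5) by (simp add: homeomorphism_def)
    moreover have "F (?q, l) = (y, 0)" using l critical_M q by (simp add: F_def algebra_simps)
    ultimately show ?thesis by simp
  qed
  have "Ck_on k W \<pi>" for k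
  proof (rule Ck_on_eqI[OF W(1) _ eq])
    have "Ck_on k W (\<lambda>y. g (y, 0))"
      by (rule Ck_on_compose[OF W(1) *(3) _ *(6)]) (auto simp: W_def intro!: Ck_on_Pair Ck_on_ident W(1)[unfolded W_def])
    then show "Ck_on k W (\<lambda>y. fst (g (y, 0)))" by (rule Ck_on_bounded_linear[OF bounded_linear_fst W(1)])
  qed
  with W show ?thesis by blast
qed

lemma closest_point_smooth:
  obtains U where "open U" "M \<subseteq> U" "\<And>k. Ck_on k U \<pi>"
proof -
  obtain W where W: "\<And>p. p \<in> M \<Longrightarrow> open (W p) \<and> p \<in> W p \<and> (\<forall>k. Ck_on k (W p) \<pi>)"
    using closest_point_smooth_near by metis
  have "Ck_on k (\<Union>p\<in>M. W p) \<pi>" for k using W by (intro Ck_on_local) blast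
  then show ?thesis using W by (intro that[of "\<Union>p\<in>M. W p"]) auto
qed

end

section \<open>Second and third derivatives along curves\<close>

abbreviation D1 :: "('a::euclidean_space \<Rightarrow> 'b::real_normed_vector) \<Rightarrow> 'a \<Rightarrow> 'a \<Rightarrow> 'b" where
  "D1 f x \<equiv> frechet_derivative f (at x)"

definition D2 :: "('a::euclidean_space \<Rightarrow> 'b::real_normed_vector) \<Rightarrow> 'a \<Rightarrow> 'a \<Rightarrow> 'a \<Rightarrow> 'b" where
  "D2 f x a b = D1 (\<lambda>y. D1 f y b) x a"

definition D3 :: "('a::euclidean_space \<Rightarrow> 'b::real_normed_vector) \<Rightarrow> 'a \<Rightarrow> 'a \<Rightarrow> 'a \<Rightarrow> 'a \<Rightarrow> 'b" where
  "D3 f x a b c = D1 (\<lambda>y. D2 f y b c) x a"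

lemma has_real_derivative_inner_const:
  "(y has_vector_derivative y1) (at t within T) \<Longrightarrow> ((\<lambda>t. y t \<bullet> i) has_real_derivative (y1 \<bullet> i)) (at t within T)"
  unfolding has_real_derivative_iff_has_vector_derivative
  by (rule bounded_linear.has_vector_derivative[OF bounded_linear_inner_left])

lemma Ck_on_D1: "Ck_on (Suc k) S f \<Longrightarrow> Ck_on k S (\<lambda>x. D1 f x b)"
  by simp

lemma Ck_on_D2: "Ck_on (Suc (Suc k)) S f \<Longrightarrow> Ck_on k S (\<lambda>x. D2 f x a b)"
  by (simp add: D2_def)

context
  fixes f :: "'a::euclidean_space \<Rightarrow> 'b::euclidean_space" and S :: "'a set"
  assumes S: "open S" and f: "Ck_on 3 S f"
begin

lemma Ck_on_Suc3: "Ck_on (Suc (Suc (Suc 0))) S f" using f by (simp only: numeral_3_eq_3)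
lemma Ck_on_Suc2: "Ck_on (Suc (Suc 0)) S f" using Ck_on_Suc3 by (rule Ck_on_SucD)
lemma Ck_on_two: "Ck_on 2 S f" using Ck_on_Suc2 by (simp only: numeral_2_eq_2)
lemma Ck_on_Suc1: "Ck_on (Suc 0) S f" using Ck_on_Suc2 by (rule Ck_on_SucD)

lemma D2_commute: "x \<in> S \<Longrightarrow> D2 f x a b = D2 f x b a"
  unfolding D2_def by (rule frechet_second_commute[OF S Ck_on_two])

lemma linear_D1: "x \<in> S \<Longrightarrow> linear (D1 f x)"
  by (rule Ck_on_linear_frechet[OF Ck_on_Suc1])

lemma linear_D2_left: "x \<in> S \<Longrightarrow> linear (\<lambda>a. D2 f x a b)"
  unfolding D2_def by (rule Ck_on_linear_frechet[OF Ck_on_D1[OF Ck_on_Suc2]])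

lemma linear_D2_right: "x \<in> S \<Longrightarrow> linear (D2 f x a)"
  using linear_D2_left[of x a] D2_commute[of x a] by presburger

lemma D3_commute_left: "x \<in> S \<Longrightarrow> D3 f x a b c = D3 f x b a c"
  unfolding D3_def D2_def
  using frechet_second_commute[OF S, of "\<lambda>x. D1 f x c" x b a] Ck_on_D1[OF Ck_on_Suc3] by (simp only: numeral_2_eq_2)

lemma D3_commute_right: "x \<in> S \<Longrightarrow> D3 f x a b c = D3 f x a c b"
proof -
  assume x: "x \<in> S"
  have "(\<lambda>y. D2 f y b c) differentiable (at x)"
    using Ck_on_D2[OF Ck_on_Suc3] x by simp
  from frechet_derivative_transform_within_open[OF this S x]
  show ?thesis unfolding D3_def using D2_commute by metis
qed

lemma D1_curve:
  assumes "(y has_vector_derivative y1) (at t within T)" "(z has_vector_derivative z1) (at t within T)" "y t \<in> S" "t \<in> T"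
  shows "((\<lambda>t. D1 f (y t) (z t)) has_vector_derivative (D2 f (y t) y1 (z t) + D1 f (y t) z1)) (at t within T)"
proof -
  have dy: "((\<lambda>t. D1 f (y t) i) has_vector_derivative D2 f (y t) y1 i) (at t within T)" for i
  proof -
    have "((\<lambda>x. D1 f x i) has_derivative D1 (\<lambda>x. D1 f x i) (y t)) (at (y t))"
      by (rule Ck_on_has_derivative[OF Ck_on_D1[OF Ck_on_Suc2] assms(3)])
    from has_derivative_compose[OF assms(1)[unfolded has_vector_derivative_def] this]
    show ?thesis
      unfolding has_vector_derivative_def D2_def[symmetric]
      by (simp add: linear_scale[OF linear_D2_left[OF assms(3)]])
  qed
  have "((\<lambda>t. \<Sum>i\<in>Basis. (z t \<bullet> i) *\<^sub>R D1 f (y t) i) has_vector_derivative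
     (\<Sum>i\<in>Basis. (z t \<bullet> i) *\<^sub>R D2 f (y t) y1 i + (z1 \<bullet> i) *\<^sub>R D1 f (y t) i)) (at t within T)"
    by (intro has_vector_derivative_sum has_vector_derivative_scaleR dy
        has_real_derivative_inner_const assms(2))
  moreover have "(\<Sum>i\<in>Basis. (z t \<bullet> i) *\<^sub>R D2 f (y t) y1 i + (z1 \<bullet> i) *\<^sub>R D1 f (y t) i) =
      D2 f (y t) y1 (z t) + D1 f (y t) z1"
    using linear_expand[OF linear_D2_right[OF assms(3)], of y1 "z t"] linear_expand[OF linear_D1[OF assms(3)], of z1]
    by (simp add: sum.distrib)
  ultimately have *: "((\<lambda>t. \<Sum>i\<in>Basis. (z t \<bullet> i) *\<^sub>R D1 f (y t) i) has_vector_derivative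
      (D2 f (y t) y1 (z t) + D1 f (y t) z1)) (at t within T)" by simp
  have "continuous (at t within T) y" using assms(1) by (rule has_vector_derivative_continuous)
  then have "\<forall>\<^sub>F s in at t within T. y s \<in> S"
    unfolding continuous_within using topological_tendstoD[OF _ S assms(3)] by blast
  then have ev: "\<forall>\<^sub>F s in at t within T. (\<Sum>i\<in>Basis. (z s \<bullet> i) *\<^sub>R D1 f (y s) i) = D1 f (y s) (z s)"
    by (rule eventually_mono) (rule linear_expand[OF linear_D1, symmetric])
  show ?thesis
    unfolding has_vector_derivative_def
    by (rule has_derivative_transform_eventually[OF *[unfolded has_vector_derivative_def] ev
          linear_expand[OF linear_D1[OF assms(3)], of "z t", symmetric] assms(4)])
qed

lemma D2_curve:
  assumes "(y has_vector_derivative y1) (at t)" "(a has_vector_derivative a1) (at t)"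
    "(b has_vector_derivative b1) (at t)" "y t \<in> S"
  shows "((\<lambda>t. D2 f (y t) (a t) (b t)) has_vector_derivative
    (D3 f (y t) y1 (a t) (b t) + D2 f (y t) a1 (b t) + D2 f (y t) (a t) b1)) (at t)"
proof -
  have da: "((\<lambda>t. D2 f (y t) (a t) j) has_vector_derivative D3 f (y t) y1 (a t) j + D2 f (y t) a1 j) (at t)" for j
  proof -
    have g: "Ck_on (Suc (Suc 0)) S (\<lambda>x. D1 f x j)" using Ck_on_Suc3 by simp
    let ?g = "\<lambda>x. D1 f x j"
    have dy: "((\<lambda>t. D1 ?g (y t) i) has_vector_derivative D2 ?g (y t) y1 i) (at t)" for i
    proof -
      have "((\<lambda>x. D1 ?g x i) has_derivative D1 (\<lambda>x. D1 ?g x i) (y t)) (at (y t))"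
        by (rule Ck_on_has_derivative[OF Ck_on_D1[OF g] assms(4)])
      from has_derivative_compose[OF assms(1)[unfolded has_vector_derivative_def] this]
      have "((\<lambda>t. D1 ?g (y t) i) has_derivative (\<lambda>h. D2 ?g (y t) (h *\<^sub>R y1) i)) (at t)"
        unfolding D2_def .
      moreover have "linear (\<lambda>v. D2 ?g (y t) v i)" unfolding D2_def
        by (rule Ck_on_linear_frechet[OF Ck_on_D1[OF g] assms(4)])
      ultimately show ?thesis unfolding has_vector_derivative_def
        using linear_scale[of "\<lambda>v. D2 ?g (y t) v i"] by simp
    qed
    have lin: "linear (D1 ?g x)" if "x \<in> S" for x
      by (rule Ck_on_linear_frechet[OF Ck_on_SucD[OF g] that])
    have lin2: "linear (D2 ?g (y t) y1)"
    proof -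
      have g2: "Ck_on 2 S ?g" using g by (simp only: numeral_2_eq_2)
      have "linear (\<lambda>v. D2 ?g (y t) v y1)" unfolding D2_def
        by (rule Ck_on_linear_frechet[OF Ck_on_D1[OF g] assms(4)])
      moreover have "D2 ?g (y t) v y1 = D2 ?g (y t) y1 v" for v
        unfolding D2_def by (rule frechet_second_commute[OF S g2 assms(4)])
      ultimately show ?thesis by simp
    qed
    have "((\<lambda>t. \<Sum>i\<in>Basis. (a t \<bullet> i) *\<^sub>R D1 ?g (y t) i) has_vector_derivative
       (\<Sum>i\<in>Basis. (a t \<bullet> i) *\<^sub>R D2 ?g (y t) y1 i + (a1 \<bullet> i) *\<^sub>R D1 ?g (y t) i)) (at t)"
      by (intro has_vector_derivative_sum has_vector_derivative_scaleR dy
          has_real_derivative_inner_const assms(2))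
    moreover have "(\<Sum>i\<in>Basis. (a t \<bullet> i) *\<^sub>R D2 ?g (y t) y1 i + (a1 \<bullet> i) *\<^sub>R D1 ?g (y t) i) =
        D2 ?g (y t) y1 (a t) + D1 ?g (y t) a1"
      using linear_expand[OF lin2, of "a t"] linear_expand[OF lin[OF assms(4)], of a1]
      by (simp add: sum.distrib)
    moreover have "D2 ?g (y t) y1 (a t) = D3 f (y t) y1 (a t) j" by (simp add: D2_def D3_def)
    moreover have "D1 ?g (y t) a1 = D2 f (y t) a1 j" by (simp add: D2_def)
    ultimately have *: "((\<lambda>t. \<Sum>i\<in>Basis. (a t \<bullet> i) *\<^sub>R D1 ?g (y t) i) has_vector_derivative
        (D3 f (y t) y1 (a t) j + D2 f (y t) a1 j)) (at t)" by simp
    have "isCont y t" using assms(1) by (rule has_vector_derivative_continuous)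
    then have "\<forall>\<^sub>F s in at t. y s \<in> S"
      unfolding isCont_def using topological_tendstoD[OF _ S assms(4)] by blast
    then have ev: "\<forall>\<^sub>F s in at t. (\<Sum>i\<in>Basis. (a s \<bullet> i) *\<^sub>R D1 ?g (y s) i) = D2 f (y s) (a s) j"
      unfolding D2_def by (rule eventually_mono) (rule linear_expand[OF lin, symmetric])
    have "(\<Sum>i\<in>Basis. (a t \<bullet> i) *\<^sub>R D1 ?g (y t) i) = D2 f (y t) (a t) j"
      unfolding D2_def by (rule linear_expand[OF lin[OF assms(4)], symmetric])
    then show ?thesis
      unfolding has_vector_derivative_def
      by (intro has_derivative_transform_eventually[OF *[unfolded has_vector_derivative_def] ev _ UNIV_I])
  qed
  have "((\<lambda>t. \<Sum>j\<in>Basis. (b t \<bullet> j) *\<^sub>R D2 f (y t) (a t) j) has_vector_derivative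
     (\<Sum>j\<in>Basis. (b t \<bullet> j) *\<^sub>R (D3 f (y t) y1 (a t) j + D2 f (y t) a1 j) + (b1 \<bullet> j) *\<^sub>R D2 f (y t) (a t) j)) (at t)"
    by (intro has_vector_derivative_sum has_vector_derivative_scaleR da
        has_real_derivative_inner_const assms(3))
  moreover have "(\<Sum>j\<in>Basis. (b t \<bullet> j) *\<^sub>R (D3 f (y t) y1 (a t) j + D2 f (y t) a1 j) + (b1 \<bullet> j) *\<^sub>R D2 f (y t) (a t) j) =
      D3 f (y t) y1 (a t) (b t) + D2 f (y t) a1 (b t) + D2 f (y t) (a t) b1"
  proof -
    \<comment> \<open>Basis expansion of \<open>D3\<close> in its last argument, by differentiating
      that of \<open>D2\<close>.\<close>
    have "((\<lambda>x. \<Sum>j\<in>Basis. (b t \<bullet> j) *\<^sub>R D2 f x (a t) j) has_derivative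
        (\<lambda>v. \<Sum>j\<in>Basis. (b t \<bullet> j) *\<^sub>R D3 f (y t) v (a t) j)) (at (y t))"
      unfolding D3_def
      by (intro has_derivative_sum has_derivative_scaleR_right Ck_on_has_derivative[OF Ck_on_D2[OF Ck_on_Suc3] assms(4)])
    then have "((\<lambda>x. D2 f x (a t) (b t)) has_derivative (\<lambda>v. \<Sum>j\<in>Basis. (b t \<bullet> j) *\<^sub>R D3 f (y t) v (a t) j)) (at (y t))"
      by (rule has_derivative_transform_within_open[OF _ S assms(4)]) (rule linear_expand[OF linear_D2_right, symmetric])
    from fun_cong[OF frechet_derivative_eq[OF this], of y1]
    have "D3 f (y t) y1 (a t) (b t) = (\<Sum>j\<in>Basis. (b t \<bullet> j) *\<^sub>R D3 f (y t) y1 (a t) j)" unfolding D3_def .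
    then show ?thesis
      using linear_expand[OF linear_D2_right[OF assms(4)], of a1 "b t"]
        linear_expand[OF linear_D2_right[OF assms(4)], of "a t" b1]
      by (simp add: sum.distrib scaleR_add_right)
  qed
  ultimately have *: "((\<lambda>t. \<Sum>j\<in>Basis. (b t \<bullet> j) *\<^sub>R D2 f (y t) (a t) j) has_vector_derivative
      (D3 f (y t) y1 (a t) (b t) + D2 f (y t) a1 (b t) + D2 f (y t) (a t) b1)) (at t)" by simp
  have "isCont y t" using assms(1) by (rule has_vector_derivative_continuous)
  then have "\<forall>\<^sub>F s in at t. y s \<in> S"
    unfolding isCont_def using topological_tendstoD[OF _ S assms(4)] by blast
  then have ev: "\<forall>\<^sub>F s in at t. (\<Sum>j\<in>Basis. (b s \<bullet> j) *\<^sub>R D2 f (y s) (a s) j) = D2 f (y s) (a s) (b s)"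
    by (rule eventually_mono) (rule linear_expand[OF linear_D2_right, symmetric])
  have "(\<Sum>j\<in>Basis. (b t \<bullet> j) *\<^sub>R D2 f (y t) (a t) j) = D2 f (y t) (a t) (b t)"
    by (rule linear_expand[OF linear_D2_right[OF assms(4)], symmetric])
  then show ?thesis
    unfolding has_vector_derivative_def
    by (intro has_derivative_transform_eventually[OF *[unfolded has_vector_derivative_def] ev _ UNIV_I])
qed

lemma D2_double_expand:
  "x \<in> S \<Longrightarrow> D2 f x a b = (\<Sum>i\<in>Basis. \<Sum>j\<in>Basis. ((b \<bullet> i) * (a \<bullet> j)) *\<^sub>R D2 f x j i)"
  by (subst linear_expand[OF linear_D2_right], assumption, subst linear_expand[OF linear_D2_left], assumption)
    (simp add: scaleR_sum_right)

lemma Ck_on_D1_apply: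
  fixes g h :: "'c::euclidean_space \<Rightarrow> 'a"
  assumes "open T" "Ck_on (Suc 0) T g" "Ck_on (Suc 0) T h" "g ` T \<subseteq> S"
  shows "Ck_on (Suc 0) T (\<lambda>x. D1 f (g x) (h x))"
  by (rule Ck_on_frechet_apply[OF assms(1) S Ck_on_Suc2 assms(2-4)])

lemma Ck_on_D2_apply:
  fixes g a b :: "'c::euclidean_space \<Rightarrow> 'a"
  assumes "open T" "Ck_on (Suc 0) T g" "Ck_on (Suc 0) T a" "Ck_on (Suc 0) T b" "g ` T \<subseteq> S"
  shows "Ck_on (Suc 0) T (\<lambda>x. D2 f (g x) (a x) (b x))"
proof (rule Ck_on_eqI[OF assms(1)])
  show "Ck_on (Suc 0) T (\<lambda>x. \<Sum>i\<in>Basis. \<Sum>j\<in>Basis. ((b x \<bullet> i) * (a x \<bullet> j)) *\<^sub>R D2 f (g x) j i)"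
    by (intro Ck_on_sum Ck_on_scaleR Ck_on_mult Ck_on_inner assms Ck_on_const
        Ck_on_compose[OF assms(1) S assms(2) Ck_on_D2[OF Ck_on_Suc3] assms(5)])
  show "D2 f (g x) (a x) (b x) = (\<Sum>i\<in>Basis. \<Sum>j\<in>Basis. ((b x \<bullet> i) * (a x \<bullet> j)) *\<^sub>R D2 f (g x) j i)"
    if "x \<in> T" for x using that assms(5) by (intro D2_double_expand) auto
qed

lemma continuous_on_D1_apply:
  assumes "continuous_on T y" "continuous_on T a" "y ` T \<subseteq> S"
  shows "continuous_on T (\<lambda>t. D1 f (y t) (a t))"
proof -
  have "continuous_on T (\<lambda>t. \<Sum>i\<in>Basis. (a t \<bullet> i) *\<^sub>R D1 f (y t) i)"
    by (intro continuous_on_sum continuous_on_scaleR continuous_on_inner continuous_on_const assms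
        continuous_on_compose2[OF Ck_on_imp_continuous_on[OF Ck_on_D1[OF Ck_on_Suc1]] assms(1) assms(3)])
  moreover have "D1 f (y t) (a t) = (\<Sum>i\<in>Basis. (a t \<bullet> i) *\<^sub>R D1 f (y t) i)" if "t \<in> T" for t
    by (rule linear_expand[OF linear_D1]) (use that assms(3) in auto)
  ultimately show ?thesis by (simp cong: continuous_on_cong)
qed

lemma continuous_on_D2_apply:
  assumes "continuous_on T y" "continuous_on T a" "continuous_on T b" "y ` T \<subseteq> S"
  shows "continuous_on T (\<lambda>t. D2 f (y t) (a t) (b t))"
proof -
  have "continuous_on T (\<lambda>t. \<Sum>i\<in>Basis. \<Sum>j\<in>Basis. ((b t \<bullet> i) * (a t \<bullet> j)) *\<^sub>R D2 f (y t) j i)"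
    by (intro continuous_on_sum continuous_on_scaleR continuous_on_mult continuous_on_inner continuous_on_const assms
        continuous_on_compose2[OF Ck_on_imp_continuous_on[OF Ck_on_D2[OF Ck_on_Suc2]] assms(1) assms(4)])
  moreover have "D2 f (y t) (a t) (b t) = (\<Sum>i\<in>Basis. \<Sum>j\<in>Basis. ((b t \<bullet> i) * (a t \<bullet> j)) *\<^sub>R D2 f (y t) j i)" if "t \<in> T" for t
    by (rule D2_double_expand) (use that assms(4) in auto)
  ultimately show ?thesis by (simp cong: continuous_on_cong)
qed

lemma D2_bounded_on_compact:
  assumes "compact K" "K \<subseteq> S"
  shows "\<exists>C\<ge>0. \<forall>x\<in>K. \<forall>a b. norm (D2 f x a b) \<le> C * (norm a * norm b)"
proof -
  have "\<exists>c\<ge>0. \<forall>x\<in>K. \<forall>a. norm (D2 f x a i) \<le> c * norm a" for i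
    using frechet_bounded_on_compact[OF Ck_on_D1[OF Ck_on_Suc2] assms] unfolding D2_def .
  then obtain c where c: "\<And>i. c i \<ge> 0" "\<And>i x a. x \<in> K \<Longrightarrow> norm (D2 f x a i) \<le> c i * norm a" by metis
  define m where "m = (\<Sum>i\<in>Basis. c i)"
  have m: "m \<ge> 0" unfolding m_def using c by (intro sum_nonneg) auto
  have "norm (D2 f x a b) \<le> (real DIM('a) * m) * (norm a * norm b)" if x: "x \<in> K" for x a b
  proof -
    have "norm (D2 f x a b) \<le> (real DIM('a) * (m * norm a)) * norm b"
    proof (rule norm_linear_le_basis)
      show "linear (D2 f x a)" using linear_D2_right x assms(2) by auto
      fix i :: 'a assume "i \<in> Basis"
      then have "c i \<le> m" unfolding m_def using c by (intro member_le_sum) auto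
      then show "norm (D2 f x a i) \<le> m * norm a" using c(2)[OF x, of a i] mult_right_mono[of "c i" m "norm a"] by simp
    qed
    then show ?thesis by (simp add: mult_ac)
  qed
  then show ?thesis using m by (intro exI[of _ "real DIM('a) * m"]) auto
qed

end

section \<open>Weak derivatives and the energy\<close>

text \<open>Absolute continuity with density \<open>g\<close>. In contrast to
  \<open>is_weak_deriv\<close> it asks only for integrability of \<open>g\<close>, because densities
  that are products of two velocities, such as \<open>flux\<close>, need not be square
  integrable.\<close>

definition ac_deriv :: "(real \<Rightarrow> 'a::euclidean_space) \<Rightarrow> (real \<Rightarrow> 'a) \<Rightarrow> bool" where
  "ac_deriv u g \<longleftrightarrow> g \<in> borel_measurable lborel \<and> set_integrable lborel {0..1} g \<and>
     (\<forall>t\<in>{0..1}. u t = u 0 + (LINT s:{0..t}|lborel. g s))"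

lemma ac_deriv_integral:
  assumes "ac_deriv u g" "0 \<le> s" "s \<le> t" "t \<le> 1"
  shows "g integrable_on {s..t}" "(\<lambda>x. norm (g x)) integrable_on {s..t}" "u t - u s = integral {s..t} g"
proof -
  have i: "set_integrable lborel {a..b} g" if "0 \<le> a" "b \<le> 1" for a b
  proof -
    have "set_integrable lborel {0..1} g" using assms(1) by (simp add: ac_deriv_def)
    then show ?thesis by (rule set_integrable_subset) (use that in auto)
  qed
  show "g integrable_on {s..t}" by (rule set_borel_integral_eq_integral(1)[OF i]) (use assms in auto)
  have "set_integrable lborel {s..t} (\<lambda>x. norm (g x))"
    using i[of s t] assms by (intro set_integrable_norm) auto
  then show "(\<lambda>x. norm (g x)) integrable_on {s..t}" by (rule set_borel_integral_eq_integral(1))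
  have eq: "u a = u 0 + integral {0..a} g" if "0 \<le> a" "a \<le> 1" for a
  proof -
    have "a \<in> {0..1}" using that by simp
    then have "u a = u 0 + (LINT s:{0..a}|lborel. g s)" using assms(1) unfolding ac_deriv_def by blast
    also have "(LINT s:{0..a}|lborel. g s) = integral {0..a} g"
      by (rule set_borel_integral_eq_integral(2)[OF i]) (use that in auto)
    finally show ?thesis .
  qed
  have "integral {0..s} g + integral {s..t} g = integral {0..t} g"
  proof (rule Henstock_Kurzweil_Integration.integral_combine)
    show "g integrable_on {0..t}" by (rule set_borel_integral_eq_integral(1)[OF i]) (use assms in auto)
  qed (use assms in auto)
  then show "u t - u s = integral {s..t} g" using eq[of s] eq[of t] assms by (simp add: algebra_simps)
qed

lemma ac_deriv_norm_le:
  assumes "ac_deriv u g" "0 \<le> s" "s \<le> t" "t \<le> 1"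
  shows "norm (u t - u s) \<le> integral {s..t} (\<lambda>x. norm (g x))"
  unfolding ac_deriv_integral(3)[OF assms]
  by (rule integral_norm_bound_integral) (use ac_deriv_integral[OF assms] in auto)

lemma ac_deriv_continuous: "ac_deriv u g \<Longrightarrow> continuous_on {0..1} u"
proof -
  assume a: "ac_deriv u g"
  have "continuous_on {0..1} (\<lambda>t. u 0 + integral {0..t} g)"
    by (intro continuous_intros indefinite_integral_continuous_1 ac_deriv_integral(1)[OF a]) auto
  then show ?thesis
  proof (rule continuous_on_eq)
    show "u 0 + integral {0..t} g = u t" if "t \<in> {0..1}" for t
      using ac_deriv_integral(3)[OF a, of 0 t] that by (simp add: algebra_simps)
  qed
qed

lemma borel_measurable_D1_along:
  fixes f :: "'a::euclidean_space \<Rightarrow> 'b::euclidean_space"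
  assumes "open U" "Ck_on (Suc 0) U f" "continuous_on {0..1} u" "u ` {0..1::real} \<subseteq> U" "g \<in> borel_measurable lborel"
  shows "(\<lambda>t. indicator {0..1} t *\<^sub>R D1 f (u t) (g t)) \<in> borel_measurable lborel"
proof -
  have m: "(\<lambda>t. indicator {0..1} t *\<^sub>R D1 f (u t) i) \<in> borel_measurable borel" for i
    by (intro borel_measurable_continuous_on_indicator
        continuous_on_compose2[OF Ck_on_imp_continuous_on[OF Ck_on_D1[OF assms(2)]] assms(3,4)]) simp
  have "(\<lambda>t. \<Sum>i\<in>Basis. (g t \<bullet> i) *\<^sub>R (indicator {0..1} t *\<^sub>R D1 f (u t) i)) \<in> borel_measurable lborel"
    by (rule borel_measurable_sum, rule borel_measurable_scaleR) (use m assms(5) in simp_all)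
  also have "(\<lambda>t. \<Sum>i\<in>Basis. (g t \<bullet> i) *\<^sub>R (indicator {0..1} t *\<^sub>R D1 f (u t) i)) =
     (\<lambda>t. indicator {0..1} t *\<^sub>R D1 f (u t) (g t))"
  proof
    fix t :: real
    show "(\<Sum>i\<in>Basis. (g t \<bullet> i) *\<^sub>R (indicator {0..1} t *\<^sub>R D1 f (u t) i)) = indicator {0..1} t *\<^sub>R D1 f (u t) (g t)"
    proof (cases "t \<in> {0..1}")
      case True
      then have "u t \<in> U" using assms(4) by auto
      then show ?thesis using True linear_expand[OF Ck_on_linear_frechet[OF assms(2)], of "u t" "g t"] by simp
    qed simp
  qed
  finally show ?thesis .
qed

text \<open>With \<open>g\<close> merely integrable there is no pointwise derivative of
  \<open>u\<close> to work with. Instead the defect \<open>E\<close> is shown to have increments at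
  most \<open>e\<close> times the integral of \<open>norm g\<close>, for every \<open>e > 0\<close>:
  on short intervals \<open>f\<close> is replaced by its linearization at one point, and bisection
  adds up the short intervals.\<close>

lemma ac_deriv_compose:
  fixes f :: "'a::euclidean_space \<Rightarrow> 'b::euclidean_space"
  assumes u: "ac_deriv u g" and U: "open U" and f: "Ck_on (Suc 0) U f" and uU: "u ` {0..1} \<subseteq> U"
  shows "ac_deriv (\<lambda>t. f (u t)) (\<lambda>t. indicator {0..1} t *\<^sub>R D1 f (u t) (g t))" (is "ac_deriv _ ?W")
proof -
  have cu: "continuous_on {0..1} u" by (rule ac_deriv_continuous[OF u])
  have gm: "g \<in> borel_measurable lborel" and gi: "set_integrable lborel {0..1} g" using u unfolding ac_deriv_def by blast+
  have Wm: "?W \<in> borel_measurable lborel" by (rule borel_measurable_D1_along[OF U f cu uU gm])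
  have "compact (u ` {0..1})" using cu by (rule compact_continuous_image) simp
  from frechet_bounded_on_compact[OF f this uU] obtain C where
    C: "C \<ge> 0" "\<And>t v. t \<in> {0..1} \<Longrightarrow> norm (D1 f (u t) v) \<le> C * norm v" by blast
  have Wi: "set_integrable lborel {0..1} ?W"
  proof (rule set_integrable_bound)
    show "set_integrable lborel {0..1} (\<lambda>t. C * norm (g t))" using set_integrable_norm[OF gi] by simp
    have "(\<lambda>x. indicator {0..1} x *\<^sub>R ?W x) = ?W" by (auto simp: indicator_def fun_eq_iff)
    then show "set_borel_measurable lborel {0..1} ?W" unfolding set_borel_measurable_def using Wm by simp
    show "AE t in lborel. t \<in> {0..1} \<longrightarrow> norm (?W t) \<le> norm (C * norm (g t))"
      using C by (intro AE_I2) auto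
  qed
  have Wint: "?W integrable_on {s..t}" if "0 \<le> s" "t \<le> 1" for s t
    by (rule set_borel_integral_eq_integral(1)[OF set_integrable_subset[OF Wi]]) (use that in auto)
  define E where "E t = f (u t) - integral {0..t} ?W" for t
  have key: "norm (E t - E 0) \<le> e * integral {0..t} (\<lambda>x. norm (g x))" if e: "e > 0" and t: "0 \<le> t" "t \<le> 1" for e t
  proof -
    define P where "P a b \<longleftrightarrow> (0 \<le> a \<longrightarrow> a \<le> b \<longrightarrow> b \<le> 1 \<longrightarrow> norm (E b - E a) \<le> e * integral {a..b} (\<lambda>x. norm (g x)))" for a b
    have "P 0 t" using t(1)
    proof (induction rule: Bolzano)
      case (trans a b c)
      show ?case unfolding P_def
      proof (intro impI)
        assume *: "0 \<le> a" "c \<le> 1"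
        have "norm (E c - E a) \<le> norm (E c - E b) + norm (E b - E a)"
          using norm_triangle_ineq[of "E c - E b" "E b - E a"] by simp
        also have "\<dots> \<le> e * integral {b..c} (\<lambda>x. norm (g x)) + e * integral {a..b} (\<lambda>x. norm (g x))"
          using trans * unfolding P_def by (intro add_mono) auto
        also have "\<dots> = e * integral {a..c} (\<lambda>x. norm (g x))"
          using Henstock_Kurzweil_Integration.integral_combine[OF trans(3,4) ac_deriv_integral(2)[OF u]] * trans(3,4)
          by (simp add: algebra_simps flip: distrib_left)
        finally show "norm (E c - E a) \<le> e * integral {a..c} (\<lambda>x. norm (g x))" .
      qed
    next
      case (local x)
      then have x: "x \<in> {0..1}" using t by auto
      let ?p = "u x"
      have pU: "?p \<in> U" using uU x by auto
      from frechet_near[OF U f pU, of "e / 2"] e obtain d where d: "d > 0" "ball ?p d \<subseteq> U"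
        "\<And>y v. y \<in> ball ?p d \<Longrightarrow> norm (D1 f y v - D1 f ?p v) \<le> e / 2 * norm v" by auto
      have "\<exists>d'>0. \<forall>s\<in>{0..1}. dist s x < d' \<longrightarrow> dist (u s) (u x) < d"
        using cu x d(1) unfolding continuous_on_iff by blast
      then obtain d' where d': "d' > 0" "\<And>s. s \<in> {0..1} \<Longrightarrow> dist s x < d' \<Longrightarrow> u s \<in> ball ?p d"
        by (auto simp: dist_commute)
      have "P a b" if ab: "a \<le> x" "x \<le> b" "b - a < d'" for a b
        unfolding P_def
      proof (intro impI)
        assume *: "0 \<le> a" "a \<le> b" "b \<le> 1"
        have in_ball: "u s \<in> ball ?p d" if "s \<in> {a..b}" for s
          using that ab * by (intro d'(2)) (auto simp: dist_real_def)
        have lin: "bounded_linear (D1 f ?p)"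
          using Ck_on_linear_frechet[OF f pU] by (simp add: linear_conv_bounded_linear)
        have "norm ((f (u b) - D1 f ?p (u b)) - (f (u a) - D1 f ?p (u a))) \<le> (e / 2) * norm (u b - u a)"
        proof (rule differentiable_bound[OF convex_ball[of ?p d]])
          fix y assume y: "y \<in> ball ?p d"
          show "((\<lambda>y. f y - D1 f ?p y) has_derivative (\<lambda>v. D1 f y v - D1 f ?p v)) (at y within ball ?p d)"
            using d(2) y
            by (intro has_derivative_diff bounded_linear_imp_has_derivative[OF lin]
                has_derivative_at_withinI[OF Ck_on_has_derivative[OF f]]) auto
          show "onorm (\<lambda>v. D1 f y v - D1 f ?p v) \<le> e / 2" using d(3)[OF y] by (intro onorm_le) auto
        qed (use in_ball * in auto)
        then have 1: "norm (f (u b) - f (u a) - D1 f ?p (u b - u a)) \<le> (e / 2) * norm (u b - u a)"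
          by (simp add: bounded_linear.linear[OF lin] linear_diff algebra_simps)
        have ig: "g integrable_on {a..b}" by (rule ac_deriv_integral(1)[OF u *])
        have in_: "(\<lambda>x. norm (g x)) integrable_on {a..b}" by (rule ac_deriv_integral(2)[OF u *])
        have 2: "D1 f ?p (u b - u a) = integral {a..b} (\<lambda>x. D1 f ?p (g x))"
          unfolding ac_deriv_integral(3)[OF u *] using integral_linear[OF ig lin] by (simp add: o_def)
        have 3: "(\<lambda>x. D1 f ?p (g x)) integrable_on {a..b}" using integrable_linear[OF ig lin] by (simp add: o_def)
        have "norm (integral {a..b} (\<lambda>x. ?W x - D1 f ?p (g x))) \<le> integral {a..b} (\<lambda>x. e / 2 * norm (g x))"
        proof (rule integral_norm_bound_integral)
          show "(\<lambda>x. ?W x - D1 f ?p (g x)) integrable_on {a..b}" using * by (intro integrable_diff Wint 3) auto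
          show "(\<lambda>x. e / 2 * norm (g x)) integrable_on {a..b}" using integrable_cmul[OF in_, of "e / 2"] by simp
          show "norm (?W x - D1 f ?p (g x)) \<le> e / 2 * norm (g x)" if "x \<in> {a..b}" for x
            using d(3)[OF in_ball[OF that], of "g x"] that * by simp
        qed
        then have 4: "norm (integral {a..b} ?W - D1 f ?p (u b - u a)) \<le> e / 2 * integral {a..b} (\<lambda>x. norm (g x))"
          unfolding 2 using * by (simp add: integral_diff Wint 3)
        have "integral {0..a} ?W + integral {a..b} ?W = integral {0..b} ?W"
          using * Wint by (intro Henstock_Kurzweil_Integration.integral_combine) auto
        then have "E b - E a = (f (u b) - f (u a) - D1 f ?p (u b - u a)) - (integral {a..b} ?W - D1 f ?p (u b - u a))"
          by (simp add: E_def algebra_simps)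
        then have "norm (E b - E a) \<le> norm (f (u b) - f (u a) - D1 f ?p (u b - u a)) + norm (integral {a..b} ?W - D1 f ?p (u b - u a))"
          by (simp only: norm_triangle_ineq4)
        also have "\<dots> \<le> (e / 2) * norm (u b - u a) + e / 2 * integral {a..b} (\<lambda>x. norm (g x))"
          by (rule add_mono[OF 1 4])
        also have "\<dots> \<le> (e / 2) * integral {a..b} (\<lambda>x. norm (g x)) + e / 2 * integral {a..b} (\<lambda>x. norm (g x))"
          using ac_deriv_norm_le[OF u *] e by (intro add_mono mult_left_mono) auto
        finally show "norm (E b - E a) \<le> e * integral {a..b} (\<lambda>x. norm (g x))" by simp
      qed
      then show ?case using d'(1) by blast
    qed
    then show ?thesis using t by (simp add: P_def)
  qed
  have "E t = E 0" if t: "t \<in> {0..1}" for t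
  proof (rule ccontr)
    assume "E t \<noteq> E 0"
    then have pos: "norm (E t - E 0) > 0" by simp
    let ?I = "integral {0..t} (\<lambda>x. norm (g x))"
    have I: "?I \<ge> 0" using ac_deriv_integral(2)[OF u, of 0 t] t by (intro integral_nonneg) auto
    \<comment> \<open>An \<open>e\<close> so small that the bound falls below the left side; the
      \<open>+ 1\<close> guards against a zero integral.\<close>
    have "norm (E t - E 0) \<le> (norm (E t - E 0) / (2 * (?I + 1))) * ?I"
      using t I pos by (intro key) auto
    also have "\<dots> = norm (E t - E 0) * (?I / (2 * (?I + 1)))" by simp
    also have "\<dots> < norm (E t - E 0) * 1" using I by (intro mult_strict_left_mono pos) (simp add: divide_simps)
    finally show False by simp
  qed
  note E = this
  have "f (u t) = f (u 0) + (LINT s:{0..t}|lborel. ?W s)" if t: "t \<in> {0..1}" for t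
  proof -
    have "(LINT s:{0..t}|lborel. ?W s) = integral {0..t} ?W"
      by (rule set_borel_integral_eq_integral(2)[OF set_integrable_subset[OF Wi]]) (use t in auto)
    moreover have "f (u t) - integral {0..t} ?W = f (u 0) - integral {0..0} ?W"
      using E[OF t] unfolding E_def .
    moreover have "integral {0..0::real} ?W = 0" by simp
    ultimately show ?thesis by (simp only: diff_zero diff_eq_eq)
  qed
  then show ?thesis unfolding ac_deriv_def using Wm Wi by blast
qed

text \<open>The integrals vanish over all half-lines, which are stable under intersection and
  generate the Borel sets, so they vanish over every Borel set.\<close>

lemma AE_zero_if_initial_integrals_zero:
  fixes f :: "real \<Rightarrow> 'a::euclidean_space"
  assumes f: "set_integrable lborel {0..1} f" and z: "\<And>t. t \<in> {0..1} \<Longrightarrow> (LINT s:{0..t}|lborel. f s) = 0"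
  shows "AE t in lborel. t \<in> {0..1} \<longrightarrow> f t = 0"
proof -
  define F where "F t = indicator {0..1} t *\<^sub>R f t" for t
  have Fi: "integrable lborel F" using f unfolding set_integrable_def F_def .
  have FiA: "set_integrable lborel A F" if "A \<in> sets lborel" for A
    using Fi that unfolding set_integrable_def by (rule integrable_mult_indicator[rotated])
  have tot: "(LINT s:UNIV|lborel. F s) = 0"
    using z[of 1] unfolding set_lebesgue_integral_def F_def by simp
  have "set_lebesgue_integral lborel A F = 0" if "A \<in> sets lborel" for A
  proof -
    let ?G = "range (\<lambda>a::real. {..a})"
    have st: "Int_stable ?G" by (auto simp: Int_stable_def)
    have sb: "sets lborel = sigma_sets UNIV ?G" using arg_cong[OF borel_eq_atMost[where 'a=real], of sets] by simp
    have "A \<in> sigma_sets UNIV ?G" using that sb by simp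
    with st have "Int_stable ?G" "?G \<subseteq> Pow UNIV" "A \<in> sigma_sets UNIV ?G" by simp_all
    then show ?thesis
    proof (induction rule: sigma_sets_induct_disjoint)
      case (basic A)
      then obtain a where A: "A = {..a}" by auto
      consider "a < 0" | "0 \<le> a" "a \<le> 1" | "1 < a" by linarith
      then show ?case
      proof cases
        case 1
        then have "(\<lambda>x. indicator A x *\<^sub>R F x) = (\<lambda>x. 0)" by (auto simp: fun_eq_iff A F_def indicator_def)
        then show ?thesis by (simp add: set_lebesgue_integral_def)
      next
        case 2
        then have "(\<lambda>x. indicator A x *\<^sub>R F x) = (\<lambda>x. indicator {0..a} x *\<^sub>R f x)" by (auto simp: fun_eq_iff A F_def indicator_def)
        then show ?thesis using z[of a] 2 by (simp add: set_lebesgue_integral_def)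
      next
        case 3
        then have "(\<lambda>x. indicator A x *\<^sub>R F x) = (\<lambda>x. indicator {0..1} x *\<^sub>R f x)" by (auto simp: fun_eq_iff A F_def indicator_def)
        then show ?thesis using z[of 1] by (simp add: set_lebesgue_integral_def)
      qed
    next
      case (compl A)
      have AA: "A \<in> sets lborel" using compl sb by simp
      have "(LINT s:A \<union> (UNIV - A)|lborel. F s) = (LINT s:A|lborel. F s) + (LINT s:(UNIV - A)|lborel. F s)"
        using AA by (intro set_integral_Un FiA) auto
      then show ?case using tot compl by simp
    next
      case (union B)
      have B: "B i \<in> sets lborel" for i using union(2) sb by auto
      have "(LINT x:(\<Union>i. B i)|lborel. F x) = (\<Sum>i. (LINT x:(B i)|lborel. F x))"
        using union(1) B by (intro lebesgue_integral_countable_add FiA) (auto simp: disjoint_family_on_def)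
      then show ?case using union by simp
    qed (auto simp: set_lebesgue_integral_def)
  qed
  from sigma_finite_measure.density_zero[OF sigma_finite_lborel Fi this]
  have "AE t in lborel. F t = 0" .
  then show ?thesis
  proof eventually_elim
    case (elim t)
    then show ?case by (auto simp: F_def)
  qed
qed

lemma ac_deriv_unique:
  assumes "ac_deriv u g" "ac_deriv u h"
  shows "AE t in lborel. t \<in> {0..1} \<longrightarrow> g t = h t"
proof -
  have i: "set_integrable lborel {0..1} g" "set_integrable lborel {0..1} h" using assms unfolding ac_deriv_def by blast+
  have "AE t in lborel. t \<in> {0..1} \<longrightarrow> g t - h t = 0"
  proof (rule AE_zero_if_initial_integrals_zero)
    show "set_integrable lborel {0..1} (\<lambda>t. g t - h t)" using i by (rule set_integral_diff)
    fix t :: real assume t: "t \<in> {0..1}"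
    have it: "set_integrable lborel {0..t} g" "set_integrable lborel {0..t} h"
      using t by (auto intro: set_integrable_subset[OF i(1)] set_integrable_subset[OF i(2)])
    have "u t = u 0 + (LINT s:{0..t}|lborel. g s)" "u t = u 0 + (LINT s:{0..t}|lborel. h s)"
      using assms t unfolding ac_deriv_def by blast+
    then show "(LINT s:{0..t}|lborel. g s - h s) = 0" using set_integral_diff(2)[OF it] by simp
  qed
  then show ?thesis by eventually_elim simp
qed

text \<open>On an interval of finite length square integrability implies integrability, through
  \<open>norm (g t) \<le> 1 + (norm (g t))\<^sup>2\<close>.\<close>

lemma is_weak_deriv_iff:
  "is_weak_deriv u g \<longleftrightarrow> ac_deriv u g \<and> set_integrable lborel {0..1} (\<lambda>t. (norm (g t))\<^sup>2)"
proof -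
  have "set_integrable lborel {0..1} g" if g: "g \<in> borel_measurable lborel" "set_integrable lborel {0..1} (\<lambda>t. (norm (g t))\<^sup>2)"
  proof (rule set_integrable_bound)
    have "set_integrable lborel {0..1} (\<lambda>t::real. 1::real)"
      by (rule borel_integrable_atLeastAtMost') (rule continuous_on_const)
    then show "set_integrable lborel {0..1} (\<lambda>t. 1 + (norm (g t))\<^sup>2)" using g(2) by (rule set_integral_add)
    show "set_borel_measurable lborel {0..1} g" using g(1) by (simp add: set_borel_measurable_def)
    have "norm (g t) \<le> 1 + (norm (g t))\<^sup>2" for t
      using sum_power2_ge_zero[of "norm (g t) - 1" "norm (g t)"] by (simp add: power2_eq_square algebra_simps)
    then show "AE t in lborel. t \<in> {0..1} \<longrightarrow> norm (g t) \<le> norm (1 + (norm (g t))\<^sup>2)"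
      by (intro AE_I2) (simp add: order_trans[OF _ abs_ge_self])
  qed
  then show ?thesis unfolding is_weak_deriv_def ac_deriv_def by blast
qed

text \<open>\<open>weak_deriv\<close> is an arbitrary choice. Weak derivatives agree almost
  everywhere, so the energy can be computed with whichever one is at hand.\<close>

lemma L0_eq:
  assumes "is_weak_deriv u g"
  shows "L0 u = (1/2) * (LINT t:{0..1}|lborel. (norm (g t))\<^sup>2)"
proof -
  have w: "is_weak_deriv u (weak_deriv u)" unfolding weak_deriv_def by (rule someI[of "is_weak_deriv u", OF assms])
  have ae: "AE t in lborel. t \<in> {0..1} \<longrightarrow> weak_deriv u t = g t"
    by (rule ac_deriv_unique[of u]) (use w assms in \<open>simp_all add: is_weak_deriv_iff\<close>)
  have m: "weak_deriv u \<in> borel_measurable lborel" "g \<in> borel_measurable lborel"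
    using w assms unfolding is_weak_deriv_def by blast+
  have "(LINT t:{0..1}|lborel. (norm (weak_deriv u t))\<^sup>2) = (LINT t:{0..1}|lborel. (norm (g t))\<^sup>2)"
  proof (rule set_lebesgue_integral_cong_AE)
    show "(\<lambda>t. (norm (weak_deriv u t))\<^sup>2) \<in> borel_measurable lborel" "(\<lambda>t. (norm (g t))\<^sup>2) \<in> borel_measurable lborel"
      using m by (auto intro!: borel_measurable_power borel_measurable_norm)
    show "AE x\<in>{0..1} in lborel. (norm (weak_deriv u x))\<^sup>2 = (norm (g x))\<^sup>2" using ae by eventually_elim auto
  qed simp
  then show ?thesis by (simp add: L0_def)
qed

lemma is_weak_deriv_compose:
  fixes f :: "'a::euclidean_space \<Rightarrow> 'b::euclidean_space"
  assumes u: "is_weak_deriv u g" and U: "open U" and f: "Ck_on (Suc 0) U f" and uU: "u ` {0..1} \<subseteq> U"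
  shows "is_weak_deriv (\<lambda>t. f (u t)) (\<lambda>t. indicator {0..1} t *\<^sub>R D1 f (u t) (g t))"
proof -
  have ac: "ac_deriv u g" and g2: "set_integrable lborel {0..1} (\<lambda>t. (norm (g t))\<^sup>2)"
    using u unfolding is_weak_deriv_iff by blast+
  have acW: "ac_deriv (\<lambda>t. f (u t)) (\<lambda>t. indicator {0..1} t *\<^sub>R D1 f (u t) (g t))"
    by (rule ac_deriv_compose[OF ac U f uU])
  have "compact (u ` {0..1})" using ac_deriv_continuous[OF ac] by (rule compact_continuous_image) simp
  from frechet_bounded_on_compact[OF f this uU] obtain C where
    C: "C \<ge> 0" "\<And>t v. t \<in> {0..1} \<Longrightarrow> norm (D1 f (u t) v) \<le> C * norm v" by blast
  have Wm: "(\<lambda>t. indicator {0..1} t *\<^sub>R D1 f (u t) (g t)) \<in> borel_measurable lborel"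
    using acW unfolding ac_deriv_def by blast
  have "set_integrable lborel {0..1} (\<lambda>t. (norm (indicator {0..1} t *\<^sub>R D1 f (u t) (g t)))\<^sup>2)"
  proof (rule set_integrable_bound)
    show "set_integrable lborel {0..1} (\<lambda>t. C\<^sup>2 * (norm (g t))\<^sup>2)" using g2 by simp
    show "set_borel_measurable lborel {0..1} (\<lambda>t. (norm (indicator {0..1} t *\<^sub>R D1 f (u t) (g t)))\<^sup>2)"
      unfolding set_borel_measurable_def
      using Wm by measurable
    have "(norm (indicator {0..1} t *\<^sub>R D1 f (u t) (g t)))\<^sup>2 \<le> C\<^sup>2 * (norm (g t))\<^sup>2" if "t \<in> {0..1}" for t
      using power_mono[OF C(2)[OF that, of "g t"], of 2] that by (simp add: power_mult_distrib)
    then show "AE t in lborel. t \<in> {0..1} \<longrightarrow>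
        norm ((norm (indicator {0..1} t *\<^sub>R D1 f (u t) (g t)))\<^sup>2) \<le> norm (C\<^sup>2 * (norm (g t))\<^sup>2)"
      by (intro AE_I2) simp
  qed
  then show ?thesis using acW unfolding is_weak_deriv_iff by blast
qed

section \<open>The first variation of the energy\<close>

lemma set_integrable_sum_norms_squared:
  assumes "is_weak_deriv u g" "is_weak_deriv v h"
  shows "set_integrable lborel {0..1} (\<lambda>t. (norm (g t) + norm (h t))\<^sup>2)"
proof (rule set_integrable_bound)
  have gh: "set_integrable lborel {0..1} (\<lambda>t. (norm (g t))\<^sup>2)" "set_integrable lborel {0..1} (\<lambda>t. (norm (h t))\<^sup>2)"
    and m: "g \<in> borel_measurable lborel" "h \<in> borel_measurable lborel"
    using assms unfolding is_weak_deriv_def by blast+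
  show "set_integrable lborel {0..1} (\<lambda>t. 2 * (norm (g t))\<^sup>2 + 2 * (norm (h t))\<^sup>2)"
    using gh by (intro set_integral_add(1)) simp_all
  show "set_borel_measurable lborel {0..1} (\<lambda>t. (norm (g t) + norm (h t))\<^sup>2)"
    unfolding set_borel_measurable_def
    using m by measurable
  have "(norm (g t) + norm (h t))\<^sup>2 \<le> 2 * (norm (g t))\<^sup>2 + 2 * (norm (h t))\<^sup>2" for t
    using sum_squares_bound[of "norm (g t)" "norm (h t)"] by (simp add: power2_sum)
  then show "AE t in lborel. t \<in> {0..1} \<longrightarrow> norm ((norm (g t) + norm (h t))\<^sup>2) \<le> norm (2 * (norm (g t))\<^sup>2 + 2 * (norm (h t))\<^sup>2)"
    by (intro AE_I2) simp
qed

lemma is_weak_deriv_add_scaleR: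
  assumes "is_weak_deriv u g" "is_weak_deriv v h"
  shows "is_weak_deriv (\<lambda>t. u t + r *\<^sub>R v t) (\<lambda>t. g t + r *\<^sub>R h t)"
proof -
  have u: "ac_deriv u g" and v: "ac_deriv v h" using assms unfolding is_weak_deriv_iff by blast+
  have m: "g \<in> borel_measurable lborel" "h \<in> borel_measurable lborel"
    and i: "set_integrable lborel {0..1} g" "set_integrable lborel {0..1} h"
    using u v unfolding ac_deriv_def by blast+
  have m': "(\<lambda>t. g t + r *\<^sub>R h t) \<in> borel_measurable lborel" using m by simp
  have "u t + r *\<^sub>R v t = u 0 + r *\<^sub>R v 0 + (LINT s:{0..t}|lborel. g s + r *\<^sub>R h s)" if "t \<in> {0..1}" for t
  proof -
    have e: "u t = u 0 + (LINT s:{0..t}|lborel. g s)" "v t = v 0 + (LINT s:{0..t}|lborel. h s)"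
      using u v that unfolding ac_deriv_def by blast+
    have i': "set_integrable lborel {0..t} g" "set_integrable lborel {0..t} h"
      using that by (auto intro: set_integrable_subset[OF i(1)] set_integrable_subset[OF i(2)])
    have "(LINT s:{0..t}|lborel. g s + r *\<^sub>R h s) = (LINT s:{0..t}|lborel. g s) + r *\<^sub>R (LINT s:{0..t}|lborel. h s)"
      using i' by (subst set_integral_add(2)) simp_all
    then show ?thesis by (subst e(1), subst e(2)) (simp add: algebra_simps)
  qed
  moreover have "set_integrable lborel {0..1} (\<lambda>t. (norm (g t + r *\<^sub>R h t))\<^sup>2)"
  proof (rule set_integrable_bound)
    show "set_integrable lborel {0..1} (\<lambda>t. (1 + \<bar>r\<bar>)\<^sup>2 * (norm (g t) + norm (h t))\<^sup>2)"
      using set_integrable_sum_norms_squared[OF assms] by simp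
    show "set_borel_measurable lborel {0..1} (\<lambda>t. (norm (g t + r *\<^sub>R h t))\<^sup>2)"
      unfolding set_borel_measurable_def
      using m' by measurable
    have "(norm (g t + r *\<^sub>R h t))\<^sup>2 \<le> (1 + \<bar>r\<bar>)\<^sup>2 * (norm (g t) + norm (h t))\<^sup>2" for t
    proof -
      have "norm (g t + r *\<^sub>R h t) \<le> norm (g t) + \<bar>r\<bar> * norm (h t)" using norm_triangle_ineq[of "g t" "r *\<^sub>R h t"] by simp
      also have "\<dots> \<le> (1 + \<bar>r\<bar>) * (norm (g t) + norm (h t))" by (simp add: algebra_simps)
      finally show ?thesis unfolding power_mult_distrib[symmetric] by (rule power_mono) simp
    qed
    then show "AE t in lborel. t \<in> {0..1} \<longrightarrow>
        norm ((norm (g t + r *\<^sub>R h t))\<^sup>2) \<le> norm ((1 + \<bar>r\<bar>)\<^sup>2 * (norm (g t) + norm (h t))\<^sup>2)"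
      by (intro AE_I2) simp
  qed
  ultimately show ?thesis unfolding is_weak_deriv_def using m' by blast
qed

lemma weak_deriv_of_C1:
  assumes "\<And>t. (u has_vector_derivative g t) (at t)" "continuous_on UNIV g"
  shows "is_weak_deriv u g"
proof -
  have gc: "continuous_on A g" for A using assms(2) by (rule continuous_on_subset) simp
  have "u t = u 0 + (LINT s:{0..t}|lborel. g s)" if "t \<in> {0..1}" for t
  proof -
    have "(g has_integral (u t - u 0)) {0..t}"
      by (rule fundamental_theorem_of_calculus) (use that in \<open>auto intro: has_vector_derivative_at_within[OF assms(1)]\<close>)
    moreover have "(LINT s:{0..t}|lborel. g s) = integral {0..t} g"
      by (rule set_borel_integral_eq_integral(2)[OF borel_integrable_atLeastAtMost'[OF gc]])
    ultimately show ?thesis by (simp add: integral_unique)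
  qed
  moreover have "set_integrable lborel {0..1} (\<lambda>t. (norm (g t))\<^sup>2)"
    by (intro borel_integrable_atLeastAtMost' continuous_intros gc)
  moreover have "g \<in> borel_measurable lborel"
    using borel_measurable_continuous_onI[OF assms(2)] by simp
  ultimately show ?thesis unfolding is_weak_deriv_def by blast
qed

text \<open>Dominated convergence for the difference quotients, which the mean value theorem bounds
  by \<open>w\<close>.\<close>

lemma leibniz_dominated:
  fixes f f' :: "real \<Rightarrow> real \<Rightarrow> real"
  assumes \<delta>: "\<delta> > 0" and int: "\<And>s. \<bar>s\<bar> < \<delta> \<Longrightarrow> set_integrable lborel {0..1} (f s)"
    and der: "\<And>s t. \<bar>s\<bar> < \<delta> \<Longrightarrow> t \<in> {0..1} \<Longrightarrow> ((\<lambda>s. f s t) has_real_derivative f' s t) (at s)"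
    and bnd: "\<And>s t. \<bar>s\<bar> < \<delta> \<Longrightarrow> t \<in> {0..1} \<Longrightarrow> \<bar>f' s t\<bar> \<le> w t"
    and w: "set_integrable lborel {0..1} w"
  shows "((\<lambda>s. LINT t:{0..1}|lborel. f s t) has_real_derivative (LINT t:{0..1}|lborel. f' 0 t)) (at 0)"
proof -
  let ?S = "{-\<delta><..<\<delta>}"
  let ?q = "\<lambda>h t. (f h t - f 0 t) / h"
  have "((\<lambda>h. ((LINT t:{0..1}|lborel. f h t) - (LINT t:{0..1}|lborel. f 0 t)) / h) \<longlongrightarrow> (LINT t:{0..1}|lborel. f' 0 t)) (at 0 within ?S)"
    unfolding tendsto_at_iff_sequentially
  proof (intro allI impI)
    fix X :: "nat \<Rightarrow> real" assume X: "\<forall>i. X i \<in> ?S - {0}" "X \<longlonglongrightarrow> 0"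
    have Xb: "\<bar>X i\<bar> < \<delta>" "X i \<noteq> 0" for i using X(1)[rule_format, of i] by auto
    have qi: "set_integrable lborel {0..1} (?q (X i))" for i
      using int[OF Xb(1)[of i]] int[of 0] \<delta> by (intro set_integrable_divide set_integral_diff(1)) auto
    have lim: "(\<lambda>i. ?q (X i) t) \<longlonglongrightarrow> f' 0 t" if t: "t \<in> {0..1}" for t
    proof -
      have "((\<lambda>h. (f h t - f 0 t) / h) \<longlongrightarrow> f' 0 t) (at 0)"
        using der[of 0 t] t \<delta> unfolding DERIV_def by simp
      moreover have "filterlim X (at 0) sequentially" using X(2) Xb(2) by (intro filterlim_atI) auto
      ultimately show ?thesis by (rule filterlim_compose)
    qed
    have qb: "\<bar>?q (X i) t\<bar> \<le> w t" if t: "t \<in> {0..1}" for i t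
    proof -
      have "norm (f (X i) t - f 0 t) \<le> w t * norm (X i - 0)"
      proof (rule field_differentiable_bound[where S = ?S and f' = "\<lambda>s. f' s t"])
        show "((\<lambda>s. f s t) has_real_derivative f' z t) (at z within ?S)" if "z \<in> ?S" for z
          using that by (intro has_field_derivative_at_within[OF der] t) auto
        show "norm (f' z t) \<le> w t" if "z \<in> ?S" for z using bnd[of z t] t that by auto
      qed (use Xb[of i] \<delta> in auto)
      then show ?thesis using Xb(2)[of i] by (simp add: divide_le_eq)
    qed
    have "(\<lambda>i. LINT t|lborel. indicator {0..1} t *\<^sub>R ?q (X i) t) \<longlonglongrightarrow> (LINT t|lborel. indicator {0..1} t *\<^sub>R f' 0 t)"
    proof (rule integral_dominated_convergence[where w = "\<lambda>t. indicator {0..1} t *\<^sub>R w t"])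
      show m: "(\<lambda>t. indicator {0..1} t *\<^sub>R ?q (X i) t) \<in> borel_measurable lborel" for i
        using qi[of i] unfolding set_integrable_def by (rule borel_measurable_integrable)
      have l: "(\<lambda>i. indicator {0..1} t *\<^sub>R ?q (X i) t) \<longlonglongrightarrow> indicator {0..1} t *\<^sub>R f' 0 t" for t
        using lim[of t] by (cases "t \<in> {0..1}") simp_all
      show "(\<lambda>t. indicator {0..1} t *\<^sub>R f' 0 t) \<in> borel_measurable lborel"
        by (rule borel_measurable_LIMSEQ_metric[OF m l])
      show "integrable lborel (\<lambda>t. indicator {0..1} t *\<^sub>R w t)" using w unfolding set_integrable_def .
      show "AE t in lborel. (\<lambda>i. indicator {0..1} t *\<^sub>R ?q (X i) t) \<longlonglongrightarrow> indicator {0..1} t *\<^sub>R f' 0 t"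
        by (intro AE_I2 l)
      show "AE t in lborel. norm (indicator {0..1} t *\<^sub>R ?q (X i) t) \<le> indicator {0..1} t *\<^sub>R w t" for i
      proof (intro AE_I2)
        fix t show "norm (indicator {0..1} t *\<^sub>R ?q (X i) t) \<le> indicator {0..1} t *\<^sub>R w t"
          using qb[of t i] by (cases "t \<in> {0..1}") simp_all
      qed
    qed
    note L = this
    have e: "(LINT t|lborel. indicator {0..1} t *\<^sub>R ?q (X i) t) = ((LINT t:{0..1}|lborel. f (X i) t) - (LINT t:{0..1}|lborel. f 0 t)) / X i" for i
      using set_integral_diff(2)[OF int[OF Xb(1)[of i]] int[of 0]] \<delta>
      by (simp add: set_lebesgue_integral_def flip: set_integral_divide_zero)
    show "((\<lambda>h. ((LINT t:{0..1}|lborel. f h t) - (LINT t:{0..1}|lborel. f 0 t)) / h) \<circ> X) \<longlonglongrightarrow> (LINT t:{0..1}|lborel. f' 0 t)"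
      using L by (simp only: e o_def set_lebesgue_integral_def)
  qed
  then show ?thesis unfolding DERIV_def using at_within_open[of 0 ?S] \<delta> by simp
qed

text \<open>For \<open>f\<close> the nearest-point projection this is the derivative of the energy
  along \<open>loop_chart\<close>. The base loop \<open>u\<close> is general because the second
  variation needs the formula at all loops \<open>x0 + s \<xi>\<close> with small
  \<open>s\<close>.\<close>

lemma L0_first_variation:
  fixes f :: "'a::euclidean_space \<Rightarrow> 'b::euclidean_space"
  assumes U: "open U" and f: "Ck_on 3 U f" and u: "is_weak_deriv u u'" and z: "is_weak_deriv z z'"
    and uU: "u ` {0..1} \<subseteq> U"
  shows "((\<lambda>r. L0 (\<lambda>t. f (u t + r *\<^sub>R z t))) has_real_derivative
    (LINT t:{0..1}|lborel. D1 f (u t) (u' t) \<bullet> (D2 f (u t) (z t) (u' t) + D1 f (u t) (z' t)))) (at 0)"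
proof -
  have f1: "Ck_on (Suc 0) U f" by (rule Ck_on_Suc1[OF U f])
  have cu: "continuous_on {0..1} u" and cz: "continuous_on {0..1} z"
    using u z ac_deriv_continuous unfolding is_weak_deriv_iff by blast+
  have "compact (u ` {0..1})" using cu by (rule compact_continuous_image) simp
  from compact_subset_open_imp_ball_epsilon_subset[OF this U uU]
  obtain d where d: "d > 0" "(\<Union>x\<in>u ` {0..1}. ball x d) \<subseteq> U" .
  have "bounded (z ` {0..1})" using cz compact_continuous_image compact_imp_bounded by blast
  then obtain B where B: "B > 0" "\<And>t. t \<in> {0..1} \<Longrightarrow> norm (z t) \<le> B" by (auto simp: bounded_pos)
  \<comment> \<open>Displacements then stay within \<open>d / 2\<close>, so
    \<open>u t + r *\<^sub>R z t\<close> does not leave the open set.\<close>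
  define r0 where "r0 = d / (2 * B)"
  have r0: "r0 > 0" using d B by (simp add: r0_def)
  have inU: "u t + r *\<^sub>R z t \<in> U" if "t \<in> {0..1}" "\<bar>r\<bar> \<le> r0" for r t
  proof -
    have "norm (r *\<^sub>R z t) \<le> r0 * B" using that B by (simp add: mult_mono)
    also have "\<dots> < d" using d B by (simp add: r0_def)
    finally have "u t + r *\<^sub>R z t \<in> ball (u t) d" by (simp add: dist_norm)
    then show ?thesis using d(2) that by blast
  qed
  define K where "K = (\<lambda>(r, t). u t + r *\<^sub>R z t) ` ({-r0..r0} \<times> {0..1})"
  have "continuous_on ({-r0..r0} \<times> {0..1}) (\<lambda>(r, t). u t + r *\<^sub>R z t)"
    unfolding case_prod_unfold
    by (intro continuous_intros continuous_on_compose2[OF cu] continuous_on_compose2[OF cz]) auto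
  then have K: "compact K" unfolding K_def by (rule compact_continuous_image) (intro compact_Times compact_Icc)
  have KU: "K \<subseteq> U" unfolding K_def using inU by auto
  have inK: "u t + r *\<^sub>R z t \<in> K" if "t \<in> {0..1}" "\<bar>r\<bar> \<le> r0" for r t
    unfolding K_def using that by (intro image_eqI[of _ _ "(r, t)"]) auto
  obtain C1 where C1: "C1 \<ge> 0" "\<And>y v. y \<in> K \<Longrightarrow> norm (D1 f y v) \<le> C1 * norm v"
    using frechet_bounded_on_compact[OF f1 K KU] by blast
  obtain C2 where C2: "C2 \<ge> 0" "\<And>y a b. y \<in> K \<Longrightarrow> norm (D2 f y a b) \<le> C2 * (norm a * norm b)"
    using D2_bounded_on_compact[OF U f K KU] by blast
  define W where "W r t = D1 f (u t + r *\<^sub>R z t) (u' t + r *\<^sub>R z' t)" for r t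
  have weak: "is_weak_deriv (\<lambda>t. f (u t + r *\<^sub>R z t)) (\<lambda>t. indicator {0..1} t *\<^sub>R W r t)" if "\<bar>r\<bar> \<le> r0" for r
    unfolding W_def
    by (rule is_weak_deriv_compose[OF is_weak_deriv_add_scaleR[OF u z] U f1]) (use inU that in auto)
  have sq: "(LINT t:{0..1}|lborel. (norm (indicator {0..1} t *\<^sub>R W r t))\<^sup>2) = (LINT t:{0..1}|lborel. W r t \<bullet> W r t)" for r
    by (rule set_lebesgue_integral_cong) (auto simp: power2_norm_eq_inner)
  have L0W: "L0 (\<lambda>t. f (u t + r *\<^sub>R z t)) = (1/2) * (LINT t:{0..1}|lborel. W r t \<bullet> W r t)" if "\<bar>r\<bar> \<le> r0" for r
    unfolding L0_eq[OF weak[OF that]] sq ..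
  let ?F' = "\<lambda>r t. 2 * (W r t \<bullet> (D2 f (u t + r *\<^sub>R z t) (z t) (u' t + r *\<^sub>R z' t) + D1 f (u t + r *\<^sub>R z t) (z' t)))"
  let ?\<sigma> = "\<lambda>t. norm (u' t) + norm (z' t)"
  have "((\<lambda>r. LINT t:{0..1}|lborel. W r t \<bullet> W r t) has_real_derivative (LINT t:{0..1}|lborel. ?F' 0 t)) (at 0)"
  proof (rule leibniz_dominated[OF r0, where w = "\<lambda>t. (2 * (C1 * (1 + r0)) * (C2 * B * (1 + r0) + C1)) * (?\<sigma> t)\<^sup>2"])
    fix r :: real assume r: "\<bar>r\<bar> < r0"
    have "set_integrable lborel {0..1} (\<lambda>t. (norm (indicator {0..1} t *\<^sub>R W r t))\<^sup>2)"
      using weak[of r] r unfolding is_weak_deriv_iff by simp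
    then show "set_integrable lborel {0..1} (\<lambda>t. W r t \<bullet> W r t)"
      by (rule set_integrable_cong[THEN iffD1, rotated -1]) (auto simp: power2_norm_eq_inner)
    fix t :: real assume t: "t \<in> {0..1}"
    have yK: "u t + r *\<^sub>R z t \<in> K" and yU: "u t + r *\<^sub>R z t \<in> U" using inK inU t r by auto
    have dW: "((\<lambda>r. W r t) has_vector_derivative
        (D2 f (u t + r *\<^sub>R z t) (z t) (u' t + r *\<^sub>R z' t) + D1 f (u t + r *\<^sub>R z t) (z' t))) (at r)"
      unfolding W_def
      by (rule D1_curve[OF U f]) (auto intro!: derivative_eq_intros simp: yU)
    show "((\<lambda>r. W r t \<bullet> W r t) has_real_derivative ?F' r t) (at r)"
      using has_derivative_inner[OF dW[unfolded has_vector_derivative_def] dW[unfolded has_vector_derivative_def]]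
      unfolding has_field_derivative_def
      by (rule has_derivative_eq_rhs) (auto simp: fun_eq_iff inner_commute)
    have a: "norm (u' t + r *\<^sub>R z' t) \<le> (1 + r0) * ?\<sigma> t"
    proof -
      have "norm (u' t + r *\<^sub>R z' t) \<le> norm (u' t) + \<bar>r\<bar> * norm (z' t)" using norm_triangle_ineq[of "u' t" "r *\<^sub>R z' t"] by simp
      also have "\<dots> \<le> norm (u' t) + r0 * norm (z' t)" using r by (intro add_left_mono mult_right_mono) auto
      also have "\<dots> \<le> (1 + r0) * ?\<sigma> t" using r0 by (simp add: algebra_simps)
      finally show ?thesis .
    qed
    have "\<bar>?F' r t\<bar> \<le> 2 * (norm (W r t) * norm (D2 f (u t + r *\<^sub>R z t) (z t) (u' t + r *\<^sub>R z' t) + D1 f (u t + r *\<^sub>R z t) (z' t)))"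
      using Cauchy_Schwarz_ineq2 by (simp add: abs_mult)
    also have "\<dots> \<le> 2 * ((C1 * ((1 + r0) * ?\<sigma> t)) * (C2 * (B * ((1 + r0) * ?\<sigma> t)) + C1 * ?\<sigma> t))"
    proof (intro mult_left_mono mult_mono)
      have "norm (W r t) \<le> C1 * norm (u' t + r *\<^sub>R z' t)" unfolding W_def by (rule C1(2)[OF yK])
      also have "\<dots> \<le> C1 * ((1 + r0) * ?\<sigma> t)" using a C1(1) by (rule mult_left_mono)
      finally show "norm (W r t) \<le> C1 * ((1 + r0) * ?\<sigma> t)" .
      have "norm (D2 f (u t + r *\<^sub>R z t) (z t) (u' t + r *\<^sub>R z' t)) \<le> C2 * (norm (z t) * norm (u' t + r *\<^sub>R z' t))"
        by (rule C2(2)[OF yK])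
      also have "\<dots> \<le> C2 * (B * ((1 + r0) * ?\<sigma> t))"
        using a C2(1) B(2)[OF t] B(1) by (intro mult_left_mono mult_mono) auto
      finally have 1: "norm (D2 f (u t + r *\<^sub>R z t) (z t) (u' t + r *\<^sub>R z' t)) \<le> C2 * (B * ((1 + r0) * ?\<sigma> t))" .
      have "norm (D1 f (u t + r *\<^sub>R z t) (z' t)) \<le> C1 * norm (z' t)" by (rule C1(2)[OF yK])
      also have "\<dots> \<le> C1 * ?\<sigma> t" using C1(1) by (intro mult_left_mono) auto
      finally show "norm (D2 f (u t + r *\<^sub>R z t) (z t) (u' t + r *\<^sub>R z' t) + D1 f (u t + r *\<^sub>R z t) (z' t))
          \<le> C2 * (B * ((1 + r0) * ?\<sigma> t)) + C1 * ?\<sigma> t" using 1 by (intro norm_triangle_le add_mono)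
    qed (use C1(1) r0 in auto)
    also have "\<dots> = (2 * (C1 * (1 + r0)) * (C2 * B * (1 + r0) + C1)) * (?\<sigma> t)\<^sup>2"
      by (simp add: power2_eq_square algebra_simps)
    finally show "\<bar>?F' r t\<bar> \<le> (2 * (C1 * (1 + r0)) * (C2 * B * (1 + r0) + C1)) * (?\<sigma> t)\<^sup>2" .
  next
    show "set_integrable lborel {0..1} (\<lambda>t. (2 * (C1 * (1 + r0)) * (C2 * B * (1 + r0) + C1)) * (?\<sigma> t)\<^sup>2)"
      using set_integrable_sum_norms_squared[OF u z] by simp
  qed
  from DERIV_cmult[OF this, of "1/2"]
  have "((\<lambda>r. (1/2) * (LINT t:{0..1}|lborel. W r t \<bullet> W r t)) has_real_derivative
     (LINT t:{0..1}|lborel. D1 f (u t) (u' t) \<bullet> (D2 f (u t) (z t) (u' t) + D1 f (u t) (z' t)))) (at 0)"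
    by (simp add: W_def)
  then show ?thesis
    by (rule has_field_derivative_transform_within_open[of _ _ _ "{-r0<..<r0}"]) (use r0 L0W in auto)
qed

text \<open>Together with \<open>ac_deriv_compose\<close> this yields product rules: a product is a
  smooth function of the pair of its factors.\<close>

lemma ac_deriv_Pair:
  assumes "ac_deriv u g" "ac_deriv v h"
  shows "ac_deriv (\<lambda>t. (u t, v t)) (\<lambda>t. (g t, h t))"
proof -
  have m: "g \<in> borel_measurable lborel" "h \<in> borel_measurable lborel"
    and i: "set_integrable lborel {0..1} g" "set_integrable lborel {0..1} h"
    using assms unfolding ac_deriv_def by blast+
  have ipair: "set_integrable lborel A (\<lambda>t. (g t, h t))" if "set_integrable lborel A g" "set_integrable lborel A h" for A
  proof -
    have "integrable lborel (\<lambda>x. (indicator A x *\<^sub>R g x, 0) + (0, indicator A x *\<^sub>R h x))"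
      using that unfolding set_integrable_def
      by (intro Bochner_Integration.integrable_add
          integrable_bounded_linear[OF bounded_linear_Pair[OF bounded_linear_ident bounded_linear_zero]]
          integrable_bounded_linear[OF bounded_linear_Pair[OF bounded_linear_zero bounded_linear_ident]])
    then show ?thesis unfolding set_integrable_def by simp
  qed
  have "(u t, v t) = (u 0, v 0) + (LINT s:{0..t}|lborel. (g s, h s))" if "t \<in> {0..1}" for t
  proof -
    have i': "set_integrable lborel {0..t} g" "set_integrable lborel {0..t} h"
      using that by (auto intro: set_integrable_subset[OF i(1)] set_integrable_subset[OF i(2)])
    note ii = ipair[OF i', unfolded set_integrable_def]
    have "fst (LINT s:{0..t}|lborel. (g s, h s)) = (LINT s:{0..t}|lborel. g s)"
      "snd (LINT s:{0..t}|lborel. (g s, h s)) = (LINT s:{0..t}|lborel. h s)"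
      using integral_bounded_linear[OF bounded_linear_fst ii] integral_bounded_linear[OF bounded_linear_snd ii]
      by (simp_all add: set_lebesgue_integral_def)
    then have e: "(LINT s:{0..t}|lborel. (g s, h s)) = (LINT s:{0..t}|lborel. g s, LINT s:{0..t}|lborel. h s)"
      by (simp add: prod_eq_iff)
    have "u t = u 0 + (LINT s:{0..t}|lborel. g s)" "v t = v 0 + (LINT s:{0..t}|lborel. h s)"
      using assms that unfolding ac_deriv_def by blast+
    then show ?thesis unfolding e by (simp only: prod_eq_iff fst_add snd_add fst_conv snd_conv simp_thms)
  qed
  moreover have "(\<lambda>t. (g t, h t)) \<in> borel_measurable lborel" using m by simp
  ultimately show ?thesis unfolding ac_deriv_def using ipair[OF i] by blast
qed

lemma D1_eq_curve:
  assumes "Ck_on (Suc 0) S F" "p \<in> S" "((\<lambda>s. F (p + s *\<^sub>R q)) has_vector_derivative d) (at 0)"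
  shows "D1 F p q = d"
proof -
  have "((\<lambda>s. p + s *\<^sub>R q) has_derivative (\<lambda>s. s *\<^sub>R q)) (at 0)" by (auto intro!: derivative_eq_intros)
  moreover have "(F has_derivative D1 F p) (at (p + 0 *\<^sub>R q))" using Ck_on_has_derivative[OF assms(1,2)] by simp
  ultimately have "((\<lambda>s. F (p + s *\<^sub>R q)) has_derivative (\<lambda>s. D1 F p (s *\<^sub>R q))) (at 0)"
    by (rule has_derivative_compose)
  then have "((\<lambda>s. F (p + s *\<^sub>R q)) has_vector_derivative D1 F p q) (at 0)"
    unfolding has_vector_derivative_def by (simp add: linear_scale[OF Ck_on_linear_frechet[OF assms(1,2)]])
  from vector_derivative_unique_at[OF this assms(3)] show ?thesis .
qed

lemma ac_deriv_closed_integral: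
  assumes "ac_deriv F f" "F 1 = F 0"
  shows "(LINT t:{0..1}|lborel. f t) = 0"
proof -
  have "\<forall>t\<in>{0..1}. F t = F 0 + (LINT s:{0..t}|lborel. f s)" using assms(1) unfolding ac_deriv_def by blast
  from bspec[OF this, of 1] show ?thesis using assms(2) by simp
qed

lemma leibniz_C1:
  fixes \<kappa> :: "'a::euclidean_space \<Rightarrow> real" and p q :: "real \<Rightarrow> 'a"
  assumes U: "open U" and \<kappa>: "Ck_on (Suc 0) U \<kappa>" and cp: "continuous_on {0..1} p" and cq: "continuous_on {0..1} q"
    and pU: "p ` {0..1} \<subseteq> U"
  shows "((\<lambda>s. LINT t:{0..1}|lborel. \<kappa> (p t + s *\<^sub>R q t)) has_real_derivative (LINT t:{0..1}|lborel. D1 \<kappa> (p t) (q t))) (at 0)"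
proof -
  have "compact (p ` {0..1})" using cp by (rule compact_continuous_image) simp
  from compact_subset_open_imp_ball_epsilon_subset[OF this U pU]
  obtain d where d: "d > 0" "(\<Union>x\<in>p ` {0..1}. ball x d) \<subseteq> U" .
  have "bounded (q ` {0..1})" using cq compact_continuous_image compact_imp_bounded by blast
  then obtain B where B: "B > 0" "\<And>t. t \<in> {0..1} \<Longrightarrow> norm (q t) \<le> B" by (auto simp: bounded_pos)
  define r0 where "r0 = d / (2 * B)"
  have r0: "r0 > 0" using d B by (simp add: r0_def)
  have inU: "p t + r *\<^sub>R q t \<in> U" if "t \<in> {0..1}" "\<bar>r\<bar> \<le> r0" for r t
  proof -
    have "norm (r *\<^sub>R q t) \<le> r0 * B" using that B by (simp add: mult_mono)
    also have "\<dots> < d" using d B by (simp add: r0_def)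
    finally have "p t + r *\<^sub>R q t \<in> ball (p t) d" by (simp add: dist_norm)
    then show ?thesis using d(2) that by blast
  qed
  define K where "K = (\<lambda>(r, t). p t + r *\<^sub>R q t) ` ({-r0..r0} \<times> {0..1})"
  have "continuous_on ({-r0..r0} \<times> {0..1}) (\<lambda>(r, t). p t + r *\<^sub>R q t)"
    unfolding case_prod_unfold
    by (intro continuous_intros continuous_on_compose2[OF cp] continuous_on_compose2[OF cq]) auto
  then have K: "compact K" unfolding K_def by (rule compact_continuous_image) (intro compact_Times compact_Icc)
  have KU: "K \<subseteq> U" unfolding K_def using inU by auto
  have inK: "p t + r *\<^sub>R q t \<in> K" if "t \<in> {0..1}" "\<bar>r\<bar> \<le> r0" for r t
    unfolding K_def using that by (intro image_eqI[of _ _ "(r, t)"]) auto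
  obtain C1 where C1: "C1 \<ge> 0" "\<And>y v. y \<in> K \<Longrightarrow> norm (D1 \<kappa> y v) \<le> C1 * norm v"
    using frechet_bounded_on_compact[OF \<kappa> K KU] by blast
  have "((\<lambda>s. LINT t:{0..1}|lborel. \<kappa> (p t + s *\<^sub>R q t)) has_real_derivative
      (LINT t:{0..1}|lborel. D1 \<kappa> (p t + 0 *\<^sub>R q t) (q t))) (at 0)"
  proof (rule leibniz_dominated[OF r0, where w = "\<lambda>t. C1 * B" and f' = "\<lambda>s t. D1 \<kappa> (p t + s *\<^sub>R q t) (q t)"])
    show "set_integrable lborel {0..1} (\<lambda>t::real. C1 * B)" by (rule borel_integrable_atLeastAtMost'[OF continuous_on_const])
    fix s :: real assume s: "\<bar>s\<bar> < r0"
    show "set_integrable lborel {0..1} (\<lambda>t. \<kappa> (p t + s *\<^sub>R q t))"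
      by (intro borel_integrable_atLeastAtMost' continuous_on_compose2[OF Ck_on_imp_continuous_on[OF \<kappa>]]
          continuous_intros cp cq) (use inU s in auto)
    fix t :: real assume t: "t \<in> {0..1}"
    have y: "p t + s *\<^sub>R q t \<in> U" and yK: "p t + s *\<^sub>R q t \<in> K" using inU inK s t by auto
    have "((\<lambda>s. p t + s *\<^sub>R q t) has_derivative (\<lambda>h. h *\<^sub>R q t)) (at s)" by (auto intro!: derivative_eq_intros)
    from has_derivative_compose[OF this Ck_on_has_derivative[OF \<kappa> y]]
    show "((\<lambda>s. \<kappa> (p t + s *\<^sub>R q t)) has_real_derivative D1 \<kappa> (p t + s *\<^sub>R q t) (q t)) (at s)"
      unfolding has_field_derivative_def
      by (rule has_derivative_eq_rhs) (simp add: linear_scale[OF Ck_on_linear_frechet[OF \<kappa> y]] mult.commute fun_eq_iff)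
    have "norm (D1 \<kappa> (p t + s *\<^sub>R q t) (q t)) \<le> C1 * norm (q t)" by (rule C1(2)[OF yK])
    also have "\<dots> \<le> C1 * B" using B(2)[OF t] C1(1) by (rule mult_left_mono)
    finally show "\<bar>D1 \<kappa> (p t + s *\<^sub>R q t) (q t)\<bar> \<le> C1 * B" by simp
  qed
  then show ?thesis by simp
qed

section \<open>Periodic functions and antiderivatives\<close>

lemma continuous_on_frac_extension:
  fixes k :: "real \<Rightarrow> 'a::topological_space"
  assumes k: "continuous_on {0..1} k" and "k 0 = k 1"
  shows "continuous_on UNIV (\<lambda>t. k (frac t))"
proof (rule continuous_at_imp_continuous_on, rule ballI)
  fix t :: real
  \<comment> \<open>The integer nearest to \<open>t\<close>. The two unit intervals adjacent to it
    cover a neighbourhood of \<open>t\<close>; on each of them \<open>frac\<close> is a translation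
    up to one end point, where \<open>k 0 = k 1\<close> is used.\<close>
  define m where "m = \<lfloor>t + 1/2\<rfloor>"
  have t: "t \<in> {of_int m - 1<..<of_int m + 1}" unfolding m_def by (simp, linarith)
  have "continuous_on ({of_int m - 1..of_int m} \<union> {of_int m..of_int m + 1}) (\<lambda>t. k (frac t))"
  proof (rule continuous_on_closed_Un)
    have "continuous_on {of_int m - 1..of_int m} (\<lambda>t. k (t - of_int m + 1))"
      by (intro continuous_on_compose2[OF k] continuous_intros) auto
    then show "continuous_on {of_int m - 1..of_int m} (\<lambda>t. k (frac t))"
    proof (rule continuous_on_eq)
      fix s assume s: "s \<in> {real_of_int m - 1..of_int m}"
      show "k (s - of_int m + 1) = k (frac s)"
      proof (cases "s = of_int m")
        case False
        then have "frac s = s - of_int m + 1" using s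
          by (intro frac_unique_iff[THEN iffD2]) auto
        then show ?thesis by simp
      qed (use assms(2) in simp)
    qed
    have "continuous_on {of_int m..of_int m + 1} (\<lambda>t. k (t - of_int m))"
      by (intro continuous_on_compose2[OF k] continuous_intros) auto
    then show "continuous_on {of_int m..of_int m + 1} (\<lambda>t. k (frac t))"
    proof (rule continuous_on_eq)
      fix s assume s: "s \<in> {real_of_int m..of_int m + 1}"
      show "k (s - of_int m) = k (frac s)"
      proof (cases "s = of_int m + 1")
        case True
        then have "frac s = 0" by simp
        then show ?thesis using True assms(2) by simp
      next
        case False
        then have "frac s = s - of_int m" using s
          by (intro frac_unique_iff[THEN iffD2]) auto
        then show ?thesis by simp
      qed
    qed
  qed auto
  then have "continuous_on {of_int m - 1<..<of_int m + 1} (\<lambda>t. k (frac t))"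
    by (rule continuous_on_subset) auto
  then show "isCont (\<lambda>t. k (frac t)) t" using t by (simp add: continuous_on_eq_continuous_at)
qed

lemma periodic_add_int:
  fixes u :: "real \<Rightarrow> 'a"
  assumes "\<And>t. u (t + 1) = u t"
  shows "u (t + of_int m) = u t"
proof (induction m rule: int_induct[of _ 0])
  case (step1 i)
  then show ?case using assms[of "t + of_int i"] by (simp add: add.assoc)
next
  case (step2 i)
  then show ?case using assms[of "t + of_int i - 1"] by (simp add: algebra_simps)
qed simp

lemma periodic_frac:
  fixes u :: "real \<Rightarrow> 'a"
  assumes "\<And>t. u (t + 1) = u t"
  shows "u (frac t) = u t"
  using periodic_add_int[of u "frac t" "\<lfloor>t\<rfloor>", OF assms] by (simp add: frac_def)

lemma antiderivative_exists:
  fixes f :: "real \<Rightarrow> 'a::euclidean_space"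
  assumes "continuous_on UNIV f"
  obtains F where "\<And>t. (F has_vector_derivative f t) (at t)"
proof -
  have "\<exists>F. \<forall>x::real. -\<infinity> < ereal x \<longrightarrow> ereal x < \<infinity> \<longrightarrow> (F has_vector_derivative f x) (at x)"
    using assms by (intro einterval_antiderivative) (auto simp: continuous_on_eq_continuous_at)
  then show ?thesis using that by auto
qed

text \<open>An antiderivative \<open>W\<close> of the periodic extension of \<open>k\<close>
  satisfies \<open>W (t + 1) - W t = c\<close>. Periodicity of \<open>u\<close> gives
  \<open>c = 0\<close>, and then \<open>u - W\<close> is constant on the whole line and not only on
  one period.\<close>

lemma periodic_antiderivative:
  fixes u :: "real \<Rightarrow> 'a::euclidean_space"
  assumes per: "\<And>t. u (t + 1) = u t" and k: "continuous_on {0..1} k" "k 0 = k 1"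
    and u: "\<And>t. t \<in> {0..1} \<Longrightarrow> u t = u 0 + integral {0..t} k"
  shows "(u has_vector_derivative k (frac t)) (at t)"
proof -
  let ?k = "\<lambda>t. k (frac t)"
  obtain W where W: "\<And>t. (W has_vector_derivative ?k t) (at t)"
    using antiderivative_exists[OF continuous_on_frac_extension[OF k]] by blast
  have uW: "u t - u 0 = W t - W 0" if t: "t \<in> {0..1}" for t
  proof -
    have "(?k has_integral (W t - W 0)) {0..t}"
      by (rule fundamental_theorem_of_calculus) (use t in \<open>auto intro: has_vector_derivative_at_within[OF W]\<close>)
    moreover have "integral {0..t} ?k = integral {0..t} k"
    proof (rule integral_cong)
      fix s assume "s \<in> {0..t}"
      then have "s \<in> {0..<1} \<or> s = 1" using t by auto
      then show "?k s = k s" using k(2) frac_eq[of s] by auto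
    qed
    moreover have "u t - u 0 = integral {0..t} k" using u[OF t] by (metis add_diff_cancel_left')
    ultimately show ?thesis by (simp add: integral_unique)
  qed
  have "((\<lambda>t. W (t + 1) - W t) has_derivative (\<lambda>h. 0)) (at t)" for t
  proof -
    have "((\<lambda>t. W (t + 1)) has_vector_derivative ?k (t + 1)) (at t)"
    proof -
      have "((\<lambda>t. t + 1) has_vector_derivative 1) (at t)"
        unfolding has_real_derivative_iff_has_vector_derivative[symmetric] by (auto intro!: derivative_eq_intros)
      from vector_diff_chain_at[OF this W] show ?thesis by (simp add: o_def)
    qed
    then have "((\<lambda>t. W (t + 1) - W t) has_vector_derivative (?k (t + 1) - ?k t)) (at t)"
      using W by (intro has_vector_derivative_diff)
    then show ?thesis by (simp add: has_vector_derivative_def frac_1_eq)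
  qed
  then obtain c where c: "\<And>t. W (t + 1) - W t = c"
    using has_derivative_zero_constant[of UNIV "\<lambda>t. W (t + 1) - W t"] by auto
  have "W 1 - W 0 = u 1 - u 0" using uW[of 1] by simp
  then have "c = 0" using c[of 0] per[of 0] by simp
  then have Wper: "W (t + 1) = W t" for t using c[of t] by simp
  have "u t = W t + (u 0 - W 0)" for t
    using uW[of "frac t"] periodic_frac[of u, OF per] periodic_frac[of W, OF Wper] frac_lt_1[of t] frac_ge_0[of t]
    by (simp add: algebra_simps)
  then have "u = (\<lambda>t. W t + (u 0 - W 0))" by blast
  moreover have "((\<lambda>t. W t + (u 0 - W 0)) has_vector_derivative ?k t + 0) (at t)"
    by (intro has_vector_derivative_add W has_vector_derivative_const)
  ultimately show ?thesis by simp
qed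

text \<open>On one period \<open>min t \<tau> - \<tau> * t\<close> is the Green function of minus
  the second derivative with zero end values. As a test function it therefore recovers a value at
  \<open>\<tau>\<close>.\<close>

lemma hat_weak_deriv:
  fixes \<tau> :: real
  assumes \<tau>: "\<tau> \<in> {0..1}"
  shows "is_weak_deriv (\<lambda>t. min (frac t) \<tau> - \<tau> * frac t) (\<lambda>t. indicator {0..\<tau>} t - \<tau>)"
proof -
  let ?\<psi> = "\<lambda>t. indicator {0..\<tau>} t - \<tau> :: real"
  have I: "(LINT s:{0..t}|lborel. ?\<psi> s) = min t \<tau> - \<tau> * t" if t: "t \<in> {0..1}" for t
  proof -
    have i1: "set_integrable lborel {0..t} (\<lambda>s. indicator {0..\<tau>} s :: real)"
      by (rule set_integrable_bound[OF borel_integrable_atLeastAtMost'[OF continuous_on_const, of _ _ "1::real"]])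
        (auto simp: set_borel_measurable_def indicator_def)
    have i2: "set_integrable lborel {0..t} (\<lambda>s. \<tau>)" by (rule borel_integrable_atLeastAtMost'[OF continuous_on_const])
    have "(\<lambda>s. indicator {0..t} s *\<^sub>R (indicator {0..\<tau>} s :: real)) = (\<lambda>s. indicator {0..min t \<tau>} s)"
      by (auto simp: fun_eq_iff indicator_def)
    then have "(LINT s:{0..t}|lborel. (indicator {0..\<tau>} s :: real)) = measure lborel {0..min t \<tau>}"
      by (simp add: set_lebesgue_integral_def)
    also have "\<dots> = min t \<tau>" using t \<tau> by simp
    finally have 1: "(LINT s:{0..t}|lborel. (indicator {0..\<tau>} s :: real)) = min t \<tau>" .
    have 2: "(LINT s:{0..t}|lborel. \<tau>) = \<tau> * t"
      using t set_borel_integral_eq_integral(2)[OF i2] by simp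
    show ?thesis using set_integral_diff(2)[OF i1 i2] 1 2 by simp
  qed
  have "min (frac t) \<tau> - \<tau> * frac t = (min (frac 0) \<tau> - \<tau> * frac 0) + (LINT s:{0..t}|lborel. ?\<psi> s)" if t: "t \<in> {0..1}" for t
  proof (cases "t = 1")
    case True
    then show ?thesis unfolding I[OF t] using \<tau> by simp
  next
    case False
    then have "frac t = t" using t by (simp add: frac_eq)
    then show ?thesis unfolding I[OF t] using \<tau> by simp
  qed
  moreover have "set_integrable lborel {0..1} (\<lambda>t. (norm (?\<psi> t))\<^sup>2)"
  proof (rule set_integrable_bound[OF borel_integrable_atLeastAtMost'[OF continuous_on_const, of _ _ "1::real"]])
    show "set_borel_measurable lborel {0..1} (\<lambda>t. (norm (?\<psi> t))\<^sup>2)"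
      unfolding set_borel_measurable_def by measurable
    show "AE x in lborel. x \<in> {0..1} \<longrightarrow> norm ((norm (?\<psi> x))\<^sup>2) \<le> norm (1::real)"
      using \<tau> by (intro AE_I2) (auto simp: indicator_def power2_eq_square abs_mult mult_le_one)
  qed
  moreover have "?\<psi> \<in> borel_measurable lborel" by simp
  ultimately show ?thesis unfolding is_weak_deriv_def by blast
qed

lemma ac_deriv_indefinite:
  assumes "q \<in> borel_measurable lborel" "set_integrable lborel {0..1} q"
  shows "ac_deriv (\<lambda>t. LINT s:{0..t}|lborel. q s) q"
proof -
  have "(LINT s:{0..0}|lborel. q s) = 0"
    using set_borel_integral_eq_integral(2)[OF set_integrable_subset[OF assms(2), of "{0..0}"]] by simp
  then show ?thesis using assms unfolding ac_deriv_def by simp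
qed

text \<open>An antiderivative rather than an integral over an interval, so that negative times need
  no separate treatment.\<close>

definition indef :: "(real \<Rightarrow> 'a::euclidean_space) \<Rightarrow> real \<Rightarrow> 'a" where
  "indef h t = (let F = (SOME F. \<forall>t. (F has_vector_derivative h t) (at t)) in F t - F 0)"

lemma indef_has_vector_derivative:
  assumes "continuous_on UNIV h"
  shows "(indef h has_vector_derivative h t) (at t)"
proof -
  let ?F = "SOME F. \<forall>t. (F has_vector_derivative h t) (at t)"
  obtain F where "\<forall>t. (F has_vector_derivative h t) (at t)" using antiderivative_exists[OF assms] by blast
  then have "\<forall>t. (?F has_vector_derivative h t) (at t)"
    by (rule someI[of "\<lambda>F. \<forall>t. (F has_vector_derivative h t) (at t)"])
  then have "((\<lambda>t. ?F t - ?F 0) has_vector_derivative h t - 0) (at t)"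
    by (intro has_vector_derivative_diff has_vector_derivative_const) simp
  then show ?thesis by (simp add: indef_def[abs_def] Let_def)
qed

lemma indef_0 [simp]: "indef h 0 = 0"
  by (simp add: indef_def Let_def)

lemma vector_derivative_zero_imp_const:
  fixes f :: "real \<Rightarrow> 'a::real_normed_vector"
  assumes "\<And>t. (f has_vector_derivative 0) (at t)"
  shows "f t = f 0"
proof -
  have "(f has_derivative (\<lambda>h. 0)) (at x)" for x
    using assms[of x] by (simp add: has_vector_derivative_def)
  then obtain c where "\<And>t. f t = c" using has_derivative_zero_constant[of UNIV f] by auto
  then show ?thesis by simp
qed

lemma indef_diff:
  assumes "continuous_on UNIV g" "continuous_on UNIV h"
  shows "indef g t - indef h t = indef (\<lambda>s. g s - h s) t"
proof -
  have "((\<lambda>t. indef g t - indef h t - indef (\<lambda>s. g s - h s) t) has_vector_derivative (g t - h t - (g t - h t))) (at t)" for t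
    by (intro has_vector_derivative_diff indef_has_vector_derivative continuous_on_diff assms)
  then have "((\<lambda>t. indef g t - indef h t - indef (\<lambda>s. g s - h s) t) has_vector_derivative 0) (at t)" for t
    by simp
  from vector_derivative_zero_imp_const[OF this, of t] show ?thesis by simp
qed

section \<open>Linear differential equations\<close>

lemma norm_inverse_scaleR_le:
  fixes w :: "'a::real_normed_vector"
  shows "e > 0 \<Longrightarrow> norm w \<le> c * e \<Longrightarrow> norm (inverse e *\<^sub>R w) \<le> c"
  by (simp add: field_simps)

text \<open>Against the weight \<open>exp (L * \<bar>t\<bar>)\<close> one integration gains a factor
  \<open>1 / L\<close>. This makes the Picard map a contraction on the whole line at once. Negative
  times are reflected.\<close>

lemma exp_bound_integrated:
  fixes u :: "real \<Rightarrow> 'a::euclidean_space"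
  assumes L: "L > 0" and u: "\<And>t. (u has_vector_derivative h t) (at t)" "u 0 = 0"
    and h: "\<And>t. norm (h t) \<le> M * exp (L * \<bar>t\<bar>)"
  shows "norm (u t) \<le> M / L * (exp (L * \<bar>t\<bar>) - 1)"
proof -
  have pos: "norm (w t) \<le> M / L * (exp (L * t) - 1)"
    if t: "t > 0" and w: "\<And>t. (w has_vector_derivative k t) (at t)" "w 0 = 0"
      and k: "\<And>t. norm (k t) \<le> M * exp (L * \<bar>t\<bar>)" for w k and t :: real
  proof -
    have "norm (w t - w 0) \<le> M / L * exp (L * t) - M / L * exp (L * 0)"
    proof (rule differentiable_bound_general[OF t])
      show "continuous_on {0..t} w" using w(1)
        by (intro continuous_at_imp_continuous_on ballI) (auto intro: has_vector_derivative_continuous)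
      show "continuous_on {0..t} (\<lambda>t. M / L * exp (L * t))" by (intro continuous_intros)
      fix x assume x: "0 < x" "x < t"
      show "(w has_vector_derivative k x) (at x)" by (rule w(1))
      show "((\<lambda>t. M / L * exp (L * t)) has_vector_derivative (M * exp (L * x))) (at x)"
        unfolding has_real_derivative_iff_has_vector_derivative[symmetric]
        using L by (auto intro!: derivative_eq_intros)
      show "norm (k x) \<le> M * exp (L * x)" using k[of x] x by simp
    qed
    then show ?thesis using w(2) by (simp add: algebra_simps)
  qed
  consider "t > 0" | "t = 0" | "t < 0" by linarith
  then show ?thesis
  proof cases
    case 1
    then show ?thesis using pos[OF 1 u h] by simp
  next
    case 3
    have "((\<lambda>t. u (- t)) has_vector_derivative (- h (- t))) (at t)" for t
    proof -
      have "((\<lambda>t. - t) has_vector_derivative - 1) (at t)"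
        unfolding has_real_derivative_iff_has_vector_derivative[symmetric] by (auto intro!: derivative_eq_intros)
      from vector_diff_chain_at[OF this u(1)] show ?thesis by (simp add: o_def)
    qed
    moreover have "norm (- h (- t)) \<le> M * exp (L * \<bar>t\<bar>)" for t using h[of "- t"] by simp
    ultimately show ?thesis using pos[of "- t" "\<lambda>t. u (- t)" "\<lambda>t. - h (- t)"] 3 u(2) by simp
  qed (use u in simp)
qed

locale linear_ode =
  fixes A :: "real \<Rightarrow> 'x::euclidean_space \<Rightarrow> 'x" and K :: real
  assumes lin: "\<And>t. linear (A t)" and K: "K > 0" and bound: "\<And>t u. norm (A t u) \<le> K * norm u"
    and cont: "\<And>y. continuous_on UNIV y \<Longrightarrow> continuous_on UNIV (\<lambda>t. A t (y t))"
begin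

text \<open>Picard iteration for \<open>y\<close> divided by the weight
  \<open>exp (2 * K * \<bar>t\<bar>)\<close>, in the complete space of bounded continuous
  functions.\<close>

lemma exists:
  assumes f: "continuous_on UNIV f" and F: "\<And>t. norm (f t) \<le> F"
  shows "\<exists>y. y 0 = p \<and> (\<forall>t. (y has_vector_derivative (A t (y t) + f t)) (at t)) \<and>
    (\<forall>t. norm (y t) \<le> exp (2 * K * \<bar>t\<bar>) * (2 * norm p + F / K))"
proof -
  \<comment> \<open>Makes the contraction constant \<open>K / L\<close> equal to
    \<open>1/2\<close>.\<close>
  define L where "L = 2 * K"
  have L: "L > 0" using K by (simp add: L_def)
  have F0: "F \<ge> 0" using F[of 0] norm_ge_zero order_trans by blast
  let ?e = "\<lambda>t. exp (L * \<bar>t\<bar>)"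
  let ?r = "\<lambda>(z :: real \<Rightarrow>\<^sub>C 'x) s. A s (?e s *\<^sub>R apply_bcontfun z s) + f s"
  let ?T = "\<lambda>(z :: real \<Rightarrow>\<^sub>C 'x) t. exp (- (L * \<bar>t\<bar>)) *\<^sub>R (p + indef (?r z) t)"
  have cz: "continuous_on UNIV (apply_bcontfun z)" for z :: "real \<Rightarrow>\<^sub>C 'x" by (rule continuous_on_apply_bcontfun)
  have ce: "continuous_on UNIV ?e" by (intro continuous_intros)
  have cr: "continuous_on UNIV (?r z)" for z
    by (intro continuous_on_add cont f continuous_on_scaleR ce cz)
  have e1: "?e t \<ge> 1" for t using L by simp
  have rb: "norm (?r z t) \<le> (K * norm z + F) * ?e t" for z t
  proof -
    have "norm (?r z t) \<le> K * (?e t * norm (apply_bcontfun z t)) + F"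
      using norm_triangle_mono[OF bound F, of t "?e t *\<^sub>R apply_bcontfun z t" t] by simp
    also have "\<dots> \<le> K * (?e t * norm z) + F * ?e t"
      using K norm_bounded[of z t] F0 e1[of t] by (intro add_mono mult_left_mono) (auto simp: mult_le_cancel_left1)
    finally show ?thesis by (simp add: algebra_simps)
  qed
  have J: "norm (indef (?r z) t) \<le> (K * norm z + F) / L * (?e t - 1)" for z t
    by (rule exp_bound_integrated[OF L indef_has_vector_derivative[OF cr] indef_0 rb])
  have ei: "exp (- (L * \<bar>t\<bar>)) = inverse (?e t)" for t by (simp add: exp_minus)
  have Tb: "norm (?T z t) \<le> norm p + (K * norm z + F) / L" for z t
  proof -
    have c: "(K * norm z + F) / L \<ge> 0" using K L F0 by simp
    have "norm (p + indef (?r z) t) \<le> norm p + (K * norm z + F) / L * (?e t - 1)"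
      by (rule norm_triangle_le[OF add_left_mono[OF J]])
    also have "\<dots> \<le> norm p * ?e t + (K * norm z + F) / L * ?e t"
      using e1[of t] c by (intro add_mono mult_left_mono) (auto simp: mult_le_cancel_left1)
    finally have "norm (p + indef (?r z) t) \<le> (norm p + (K * norm z + F) / L) * ?e t" by (simp only: distrib_right)
    then show ?thesis unfolding ei by (rule norm_inverse_scaleR_le[rotated]) simp
  qed
  have Tc: "continuous_on UNIV (?T z)" for z
  proof -
    have "continuous_on UNIV (indef (?r z))"
      using indef_has_vector_derivative[OF cr]
      by (intro continuous_at_imp_continuous_on ballI) (auto intro: has_vector_derivative_continuous)
    then show ?thesis by (intro continuous_intros)
  qed
  define \<Phi> where "\<Phi> z = Bcontfun (?T z)" for z
  have \<Phi>: "apply_bcontfun (\<Phi> z) = ?T z" for z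
    unfolding \<Phi>_def using Tc[of z] Tb[where z = z]
    by (intro Bcontfun_inverse) (auto simp: bcontfun_def bounded_iff)
  have "dist (\<Phi> z1) (\<Phi> z2) \<le> (1/2) * dist z1 z2" for z1 z2
  proof (rule dist_bound)
    fix t
    let ?D = "dist z1 z2"
    have eq: "indef (?r z1) t - indef (?r z2) t = indef (\<lambda>s. ?r z1 s - ?r z2 s) t"
      by (rule indef_diff[OF cr cr])
    have "norm (?r z1 s - ?r z2 s) \<le> (K * ?D) * ?e s" for s
    proof -
      have "?r z1 s - ?r z2 s = A s (?e s *\<^sub>R (apply_bcontfun z1 s - apply_bcontfun z2 s))"
        by (simp add: linear_diff[OF lin] scaleR_diff_right)
      also have "norm \<dots> \<le> K * (?e s * norm (apply_bcontfun z1 s - apply_bcontfun z2 s))" using bound[of s] by (metis abs_exp_cancel norm_scaleR)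
      also have "\<dots> \<le> K * (?e s * ?D)"
        using K dist_bounded[of z1 s z2] by (intro mult_left_mono) (auto simp: dist_norm)
      finally show ?thesis by (simp add: mult_ac)
    qed
    from exp_bound_integrated[OF L indef_has_vector_derivative[OF continuous_on_diff[OF cr cr]] indef_0 this]
    have "norm (indef (?r z1) t - indef (?r z2) t) \<le> K * ?D / L * (?e t - 1)" unfolding eq .
    also have "\<dots> \<le> (?D / 2) * ?e t" using K by (simp add: L_def field_simps)
    finally have "norm (indef (?r z1) t - indef (?r z2) t) \<le> (?D / 2) * ?e t" .
    then have "norm (exp (- (L * \<bar>t\<bar>)) *\<^sub>R (indef (?r z1) t - indef (?r z2) t)) \<le> ?D / 2"
      unfolding ei by (rule norm_inverse_scaleR_le[rotated]) simp
    then show "dist (apply_bcontfun (\<Phi> z1) t) (apply_bcontfun (\<Phi> z2) t) \<le> 1/2 * ?D"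
      unfolding \<Phi> dist_norm by (simp add: scaleR_diff_right scaleR_add_right)
  qed
  then obtain z where z: "\<Phi> z = z" using banach_fix_type[of "1/2" \<Phi>] by auto
  define y where "y t = p + indef (?r z) t" for t
  have yz: "y t = ?e t *\<^sub>R apply_bcontfun z t" for t
    using fun_cong[OF \<Phi>[of z], of t] unfolding z ei y_def by simp
  have d: "(y has_vector_derivative (A t (y t) + f t)) (at t)" for t
  proof -
    have "y = (\<lambda>t. p + indef (?r z) t)" by (simp add: y_def fun_eq_iff)
    then have "(y has_vector_derivative ?r z t) (at t)"
      using has_vector_derivative_add[OF has_vector_derivative_const indef_has_vector_derivative[OF cr[of z]], of p t] by simp
    then show ?thesis by (simp add: yz)
  qed
  have "norm z \<le> norm p + (K * norm z + F) / L"
  proof (rule norm_bound)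
    fix t
    have "apply_bcontfun z t = ?T z t" using fun_cong[OF \<Phi>[of z], of t] unfolding z .
    then show "norm (apply_bcontfun z t) \<le> norm p + (K * norm z + F) / L"
      using Tb[where z = z and t = t] by metis
  qed
  then have zb: "norm z \<le> 2 * norm p + F / K" using K by (simp add: L_def field_simps)
  have "norm (y t) \<le> exp (2 * K * \<bar>t\<bar>) * (2 * norm p + F / K)" for t
  proof -
    have "norm (y t) = ?e t * norm (apply_bcontfun z t)" by (simp add: yz)
    also have "\<dots> \<le> ?e t * (2 * norm p + F / K)"
      using norm_bounded[of z t] zb by (intro mult_left_mono) auto
    finally show ?thesis by (simp add: L_def)
  qed
  then show ?thesis using d by (intro exI[of _ y]) (simp add: y_def)
qed

text \<open>A Gronwall argument: \<open>y t \<bullet> y t\<close> times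
  \<open>exp (- 2 * K * t)\<close> does not increase, which serves for positive times, and times
  \<open>exp (2 * K * t)\<close> does not decrease, which serves for negative ones.\<close>

lemma unique_zero:
  assumes d: "\<And>t. (y has_vector_derivative A t (y t)) (at t)" and "y 0 = 0"
  shows "y t = 0"
proof -
  have yy: "((\<lambda>t. y t \<bullet> y t) has_real_derivative 2 * (y t \<bullet> A t (y t))) (at t)" for t
    using has_derivative_inner[OF d[unfolded has_vector_derivative_def] d[unfolded has_vector_derivative_def]]
    unfolding has_field_derivative_def
    by (rule has_derivative_eq_rhs) (auto simp: fun_eq_iff inner_commute)
  have yA: "\<bar>y t \<bullet> A t (y t)\<bar> \<le> K * (y t \<bullet> y t)" for t
  proof -
    have "\<bar>y t \<bullet> A t (y t)\<bar> \<le> norm (y t) * (K * norm (y t))"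
      using Cauchy_Schwarz_ineq2[of "y t" "A t (y t)"] bound[of t "y t"] mult_left_mono[OF bound norm_ge_zero] order_trans by blast
    then show ?thesis by (simp add: power2_norm_eq_inner[symmetric] power2_eq_square mult_ac)
  qed
  have "(y t \<bullet> y t) * exp (c * t) \<le> 0" if "c = - (2 * K) \<and> t \<ge> 0 \<or> c = 2 * K \<and> t \<le> 0" for c
  proof -
    let ?g = "\<lambda>t. (y t \<bullet> y t) * exp (c * t)"
    have g: "(?g has_real_derivative (2 * (y t \<bullet> A t (y t)) + c * (y t \<bullet> y t)) * exp (c * t)) (at t)" for t
      by (auto intro!: derivative_eq_intros yy simp: algebra_simps)
    from that show ?thesis
    proof
      assume c: "c = - (2 * K) \<and> t \<ge> 0"
      have "\<exists>l. (?g has_real_derivative l) (at s) \<and> l \<le> 0" for s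
      proof -
        have "2 * (y s \<bullet> A s (y s)) + c * (y s \<bullet> y s) \<le> 0" using yA[of s] c by auto
        then show ?thesis using g[of s] by (intro exI[of _ "(2 * (y s \<bullet> A s (y s)) + c * (y s \<bullet> y s)) * exp (c * s)"] conjI) (auto simp: mult_nonpos_nonneg)
      qed
      then have "?g t \<le> ?g 0" using c by (intro DERIV_nonpos_imp_nonincreasing[of 0 t ?g]) blast+
      then show ?thesis using assms(2) by simp
    next
      assume c: "c = 2 * K \<and> t \<le> 0"
      have "\<exists>l. (?g has_real_derivative l) (at s) \<and> 0 \<le> l" for s
      proof -
        have "2 * (y s \<bullet> A s (y s)) + c * (y s \<bullet> y s) \<ge> 0" using yA[of s] c by auto
        then show ?thesis using g[of s] by (intro exI[of _ "(2 * (y s \<bullet> A s (y s)) + c * (y s \<bullet> y s)) * exp (c * s)"] conjI) auto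
      qed
      then have "?g t \<le> ?g 0" using c by (intro DERIV_nonneg_imp_nondecreasing[of t 0 ?g]) blast+
      then show ?thesis using assms(2) by simp
    qed
  qed
  then have "\<exists>c. (y t \<bullet> y t) * exp (c * t) \<le> 0" by (metis le_cases)
  then obtain c where "(y t \<bullet> y t) * exp (c * t) \<le> 0 * exp (c * t)" by auto
  then have "y t \<bullet> y t \<le> 0" by (rule mult_right_le_imp_le) simp
  then show ?thesis using inner_ge_zero[of "y t"] by (simp add: order_antisym)
qed

lemma unique:
  assumes "\<And>t. (y has_vector_derivative (A t (y t) + f t)) (at t)" "\<And>t. (z has_vector_derivative (A t (z t) + f t)) (at t)"
    and "y 0 = z 0"
  shows "y = z"
proof
  fix t
  have "((\<lambda>t. y t - z t) has_vector_derivative A t (y t - z t)) (at t)" for t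
    using has_vector_derivative_diff[OF assms(1,2), of t] by (simp add: linear_diff[OF lin])
  from unique_zero[OF this, of t] show "y t = z t" using assms(3) by simp
qed

text \<open>Shooting: a solution is a particular one starting at 0 plus a homogeneous one, and the
  boundary condition becomes the linear equation \<open>h p = - B 0 (z 1)\<close> for the initial
  value \<open>p\<close>. In finite dimension, uniqueness for the homogeneous problem makes
  \<open>h\<close> bijective with a bounded inverse.\<close>

lemma boundary_value_problem:
  assumes B: "linear (\<lambda>z. B (fst z) (snd z))"
    and hom: "\<And>y. (\<And>t. (y has_vector_derivative A t (y t)) (at t)) \<Longrightarrow> B (y 0) (y 1) = (0::'x) \<Longrightarrow> y 0 = 0"
  shows "\<exists>C>0. \<forall>f F. continuous_on UNIV f \<longrightarrow> (\<forall>t. norm (f t) \<le> F) \<longrightarrow>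
    (\<exists>y. (\<forall>t. (y has_vector_derivative (A t (y t) + f t)) (at t)) \<and> B (y 0) (y 1) = 0 \<and> (\<forall>t\<in>{0..1}. norm (y t) \<le> C * F))"
proof -
  have "\<exists>y. y 0 = p \<and> (\<forall>t. (y has_vector_derivative A t (y t)) (at t)) \<and> (\<forall>t. norm (y t) \<le> exp (2 * K * \<bar>t\<bar>) * (2 * norm p))" for p
    using exists[of "\<lambda>t. 0" 0 p] by auto
  then obtain Y where Y: "\<And>p. Y p 0 = p" "\<And>p t. (Y p has_vector_derivative A t (Y p t)) (at t)"
    "\<And>p t. norm (Y p t) \<le> exp (2 * K * \<bar>t\<bar>) * (2 * norm p)" by metis
  have Yadd: "Y (p + q) = (\<lambda>t. Y p t + Y q t)" for p q
  proof (rule unique[where f = "\<lambda>t. 0"])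
    show "((\<lambda>t. Y p t + Y q t) has_vector_derivative A t (Y p t + Y q t) + 0) (at t)" for t
      using has_vector_derivative_add[OF Y(2)[of p t] Y(2)[of q t]] by (simp add: linear_add[OF lin])
  qed (use Y in simp_all)
  have Ysc: "Y (c *\<^sub>R p) = (\<lambda>t. c *\<^sub>R Y p t)" for c p
  proof (rule unique[where f = "\<lambda>t. 0"])
    show "((\<lambda>t. c *\<^sub>R Y p t) has_vector_derivative A t (c *\<^sub>R Y p t) + 0) (at t)" for t
      using bounded_linear.has_vector_derivative[OF bounded_linear_scaleR_right Y(2)[of p t]] by (simp add: linear_scale[OF lin])
  qed (use Y in simp_all)
  define h where "h p = B p (Y p 1)" for p
  have hB: "h p = (\<lambda>z. B (fst z) (snd z)) (p, Y p 1)" for p by (simp add: h_def)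
  have hlin: "linear h"
  proof (rule linearI)
    show "h (p + q) = h p + h q" for p q
      unfolding hB linear_add[OF B, symmetric] by (simp add: Yadd)
    show "h (c *\<^sub>R p) = c *\<^sub>R h p" for c p
      unfolding hB linear_scale[OF B, symmetric] by (simp add: Ysc)
  qed
  have "h p = 0 \<Longrightarrow> p = 0" for p using hom[of "Y p"] Y by (simp add: h_def)
  then have inj: "inj h" using linear_injective_0[OF hlin] by blast
  then have surj: "surj h" using linear_inj_imp_surj[OF hlin] by blast
  obtain c where c: "c > 0" "\<And>p. c * norm p \<le> norm (h p)"
    using linear_inj_bounded_below_pos[OF hlin inj] by (metis mult.commute)
  obtain \<beta> where \<beta>: "\<beta> > 0" "\<And>z. norm (B (fst z) (snd z)) \<le> norm z * \<beta>"
    using bounded_linear.pos_bounded[OF linear_linear[THEN iffD2, OF B]] by blast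
  \<comment> \<open>The first summand bounds the particular solution on \<open>{0..1}\<close>; the
    second bounds the homogeneous one, whose initial value is at most
    \<open>exp (2 * K) / K * \<beta> / c * F\<close>.\<close>
  define C where "C = exp (2 * K) / K + exp (2 * K) * (2 * (exp (2 * K) / K * \<beta> / c))"
  have C: "C > 0" unfolding C_def using K \<beta> c by (intro add_pos_pos) auto
  have "\<exists>y. (\<forall>t. (y has_vector_derivative (A t (y t) + f t)) (at t)) \<and> B (y 0) (y 1) = 0 \<and> (\<forall>t\<in>{0..1}. norm (y t) \<le> C * F)"
    if f: "continuous_on UNIV f" "\<And>t. norm (f t) \<le> F" for f F
  proof -
    obtain z where z: "z 0 = 0" "\<And>t. (z has_vector_derivative (A t (z t) + f t)) (at t)"
      "\<And>t. norm (z t) \<le> exp (2 * K * \<bar>t\<bar>) * (F / K)"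
      using exists[OF f, of 0] by auto
    have F0: "F \<ge> 0" using f(2)[of 0] norm_ge_zero order_trans by blast
    have emono: "exp (2 * K * \<bar>t\<bar>) \<le> exp (2 * K)" if "t \<in> {0..1}" for t
      using that K by simp
    have z1: "norm (z t) \<le> exp (2 * K) * (F / K)" if "t \<in> {0..1}" for t
      using z(3)[of t] mult_right_mono[OF emono[OF that], of "F / K"] F0 K by auto
    obtain p where p: "h p = - B 0 (z 1)" using surj by (metis surjD)
    have "c * norm p \<le> norm (B 0 (z 1))" using c(2)[of p] p by simp
    also have "\<dots> \<le> norm (z 1) * \<beta>" using \<beta>(2)[of "(0, z 1)"] by simp
    also have "\<dots> \<le> exp (2 * K) * (F / K) * \<beta>" using z1[of 1] \<beta>(1) by (intro mult_right_mono) auto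
    finally have "norm p \<le> exp (2 * K) * (F / K) * \<beta> / c"
      by (subst pos_le_divide_eq[OF c(1)], subst mult.commute)
    then have pb: "norm p \<le> exp (2 * K) / K * \<beta> / c * F" by (simp add: mult_ac)
    let ?y = "\<lambda>t. Y p t + z t"
    have "(?y has_vector_derivative (A t (?y t) + f t)) (at t)" for t
      using has_vector_derivative_add[OF Y(2)[of p t] z(2)[of t]] by (simp add: linear_add[OF lin] add.assoc)
    moreover have "B (?y 0) (?y 1) = 0"
      using linear_add[OF B, of "(p, Y p 1)" "(0, z 1)"] p by (simp add: h_def Y z)
    moreover have "norm (?y t) \<le> C * F" if t: "t \<in> {0..1}" for t
    proof -
      have "norm (Y p t) \<le> exp (2 * K) * (2 * norm p)"
        using Y(3)[of p t] mult_right_mono[OF emono[OF t], of "2 * norm p"] by auto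
      also have "\<dots> \<le> exp (2 * K) * (2 * (exp (2 * K) / K * \<beta> / c * F))"
        using pb by (intro mult_left_mono) auto
      finally have "norm (?y t) \<le> exp (2 * K) * (2 * (exp (2 * K) / K * \<beta> / c * F)) + exp (2 * K) * (F / K)"
        using z1[OF t] by (intro norm_triangle_le add_mono)
      then show ?thesis by (simp add: C_def algebra_simps)
    qed
    ultimately show ?thesis by (intro exI[of _ ?y]) blast
  qed
  then show ?thesis using C by blast
qed

end

lemma is_weak_deriv_Pair:
  assumes "is_weak_deriv u g" "is_weak_deriv v h"
  shows "is_weak_deriv (\<lambda>t. (u t, v t)) (\<lambda>t. (g t, h t))"
proof -
  have "set_integrable lborel {0..1} (\<lambda>t. (norm (g t))\<^sup>2 + (norm (h t))\<^sup>2)"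
    using assms unfolding is_weak_deriv_iff by (intro set_integral_add(1)) blast+
  then have "set_integrable lborel {0..1} (\<lambda>t. (norm (g t, h t))\<^sup>2)" by (simp add: norm_Pair)
  then show ?thesis using assms ac_deriv_Pair unfolding is_weak_deriv_iff by blast
qed

lemma weak_deriv_product_integrable:
  assumes "is_weak_deriv u g" "is_weak_deriv v h"
  shows "set_integrable lborel {0..1} (\<lambda>t. g t \<bullet> h t)"
proof (rule set_integrable_bound[OF set_integrable_sum_norms_squared[OF assms]])
  have m: "g \<in> borel_measurable lborel" "h \<in> borel_measurable lborel"
    using assms unfolding is_weak_deriv_def by blast+
  then show "set_borel_measurable lborel {0..1} (\<lambda>t. g t \<bullet> h t)"
    unfolding set_borel_measurable_def by measurable
  have "\<bar>g t \<bullet> h t\<bar> \<le> (norm (g t) + norm (h t))\<^sup>2" for t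
  proof -
    have "\<bar>g t \<bullet> h t\<bar> \<le> norm (g t) * norm (h t)" by (rule Cauchy_Schwarz_ineq2)
    also have "\<dots> \<le> (norm (g t) + norm (h t)) * (norm (g t) + norm (h t))" by (intro mult_mono) auto
    finally show ?thesis by (simp add: power2_eq_square)
  qed
  then show "AE t in lborel. t \<in> {0..1} \<longrightarrow> norm (g t \<bullet> h t) \<le> norm ((norm (g t) + norm (h t))\<^sup>2)"
    by (intro AE_I2) simp
qed

lemma Ck_on_real_derivative:
  fixes u :: "real \<Rightarrow> 'a::real_normed_vector"
  assumes "Ck_on (Suc k) UNIV u"
  shows "(u has_vector_derivative D1 u t 1) (at t)" "Ck_on k UNIV (\<lambda>t. D1 u t 1)"
proof -
  have "D1 u t h = h *\<^sub>R D1 u t 1" for h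
    using linear_scale[OF Ck_on_linear_frechet[OF assms], of t h 1] by simp
  then show "(u has_vector_derivative D1 u t 1) (at t)"
    using Ck_on_has_derivative[OF assms, of t] unfolding has_vector_derivative_def by (metis UNIV_I ext)
  show "Ck_on k UNIV (\<lambda>t. D1 u t 1)" using assms by simp
qed

lemma Ck_on_real_SucI:
  fixes u :: "real \<Rightarrow> 'a::real_normed_vector"
  assumes "\<And>t. (u has_vector_derivative u' t) (at t)" "Ck_on k UNIV u'"
  shows "Ck_on (Suc k) UNIV u"
  by (rule Ck_on_SucI[OF open_UNIV, where f' = "\<lambda>t h. h *\<^sub>R u' t"])
    (use assms in \<open>auto simp: has_vector_derivative_def intro!: Ck_on_scaleR\<close>)

context repulsive_hypersurface
begin

definition tube :: "(real^'n) set" where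
  "tube = (SOME U. open U \<and> M \<subseteq> U \<and> (\<forall>k. Ck_on k U \<pi>))"

lemma tube: "open tube" "M \<subseteq> tube" "Ck_on k tube \<pi>"
proof -
  have "\<exists>U. open U \<and> M \<subseteq> U \<and> (\<forall>k. Ck_on k U \<pi>)" using closest_point_smooth by metis
  from someI_ex[OF this] show "open tube" "M \<subseteq> tube" "Ck_on k tube \<pi>" unfolding tube_def by blast+
qed

text \<open>The projection is the identity along curves in \<open>M\<close>.\<close>

lemma D1_closest_point_tangent:
  assumes "p \<in> M" "v \<bullet> normal_field p = 0"
  shows "D1 \<pi> p v = v"
proof -
  have "v \<in> tangent_space M p" using assms tangent_iff by blast
  then obtain \<gamma> e where g: "0 < (e::real)" "\<gamma> ` {-e<..<e} \<subseteq> M" "\<gamma> 0 = p" "(\<gamma> has_vector_derivative v) (at 0)"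
    unfolding tangent_space_def by auto
  have "p \<in> tube" using tube(2) assms(1) by blast
  then have "(\<pi> has_derivative D1 \<pi> p) (at (\<gamma> 0))"
    using Ck_on_has_derivative[OF tube(3)] g(3) by blast
  from has_derivative_compose[OF g(4)[unfolded has_vector_derivative_def] this]
  have 1: "((\<lambda>t. \<pi> (\<gamma> t)) has_derivative (\<lambda>t. D1 \<pi> p (t *\<^sub>R v))) (at 0)" .
  have "((\<lambda>t. \<pi> (\<gamma> t)) has_derivative (\<lambda>t. t *\<^sub>R v)) (at 0)"
  proof (rule has_derivative_transform_within_open[OF g(4)[unfolded has_vector_derivative_def], of "{-e<..<e}"])
    fix t assume "t \<in> {-e<..<e}"
    then have "\<gamma> t \<in> M" using g(2) by blast
    then show "\<gamma> t = \<pi> (\<gamma> t)" by (simp add: closest_point_self)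
  qed (use g in auto)
  from has_derivative_unique[OF 1 this] have "(\<lambda>t. D1 \<pi> p (t *\<^sub>R v)) = (\<lambda>t. t *\<^sub>R v)" .
  from fun_cong[OF this, of 1] show ?thesis by simp
qed

definition reg :: "(real^'n) set" where "reg = {x. strength x > 0}"

text \<open>On \<open>M\<close> this is the orthogonal projection onto the tangent space, by an expression that is smooth
  off \<open>M\<close> as well.\<close>

definition proj :: "real^'n \<Rightarrow> real^'n \<Rightarrow> real^'n" where
  "proj x e = e + inverse (strength x) *\<^sub>R DG x e"

lemma open_reg: "open reg"
  unfolding reg_def using Ck_on_imp_continuous_on[OF Ck_strength]
  by (intro open_Collect_less continuous_on_const)

lemma M_reg: "M \<subseteq> reg" using DG_on_M(2) by (auto simp: reg_def)

lemma Ck_proj: "Ck_on k reg (\<lambda>x. proj x e)"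
  unfolding proj_def
  by (intro Ck_on_add Ck_on_scaleR Ck_on_inverse open_reg Ck_on_const Ck_on_subset[OF Ck_strength] Ck_on_subset[OF Ck_DG])
    (auto simp: reg_def)

lemma proj_on_M: "p \<in> M \<Longrightarrow> proj p e = e - (normal_field p \<bullet> e) *\<^sub>R normal_field p"
  using DG_on_M[of p] by (simp add: proj_def)

end

section \<open>Regularity of closed geodesics\<close>

locale repulsive_geodesic = repulsive_hypersurface V M for V :: "real^'n \<Rightarrow> real" and M +
  fixes x0 :: "real \<Rightarrow> real^'n"
  assumes nondeg: "nondegenerate_closed_geodesic M x0"
begin

lemma geodesic: "closed_geodesic M x0" using nondeg by (simp add: nondegenerate_closed_geodesic_def)
lemma x0_periodic: "x0 (t + 1) = x0 t" and x0_in_M: "x0 t \<in> M"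
  using geodesic by (auto simp: closed_geodesic_def H1_loops_def H1_circle_def)
lemma x0_weak: obtains h where "is_weak_deriv x0 h"
  using geodesic unfolding closed_geodesic_def H1_loops_def H1_circle_def by blast
lemma x0_image: "x0 ` S \<subseteq> tube" "x0 ` S \<subseteq> reg" using x0_in_M tube(2) M_reg by auto

abbreviation n where "n t \<equiv> normal_field (x0 t)"

lemma nn: "n t \<bullet> n t = 1" by (rule norm_normal[OF x0_in_M])
lemma n_periodic: "n (t + 1) = n t" by (simp add: x0_periodic)

lemma H1_tangentI:
  assumes "\<And>t. \<xi> (t + 1) = \<xi> t" "is_weak_deriv \<xi> \<xi>'" "\<And>t. \<xi> t \<bullet> n t = 0"
  shows "\<xi> \<in> H1_tangent M x0"
  using assms tangent_iff[OF x0_in_M] unfolding H1_tangent_def H1_circle_def by blast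

text \<open>Weak differentiation of \<open>G (x0 t) = 0\<close> puts the velocity into the kernel of
  the Hessian, which on \<open>M\<close> is the tangent space.\<close>

lemma velocity_tangent_AE:
  assumes "is_weak_deriv x0 h"
  shows "AE t in lborel. t \<in> {0..1} \<longrightarrow> n t \<bullet> h t = 0"
proof -
  have "ac_deriv (\<lambda>t. G (x0 t)) (\<lambda>t. indicator {0..1} t *\<^sub>R D1 G (x0 t) (h t))"
    by (rule ac_deriv_compose[OF _ open_UNIV Ck_G]) (use assms in \<open>auto simp: is_weak_deriv_iff\<close>)
  moreover have "(\<lambda>t. G (x0 t)) = (\<lambda>t. 0)" using critical_M x0_in_M by (auto simp: fun_eq_iff)
  ultimately have 1: "ac_deriv (\<lambda>t. 0) (\<lambda>t. indicator {0..1} t *\<^sub>R D1 G (x0 t) (h t))" by simp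
  have 2: "ac_deriv (\<lambda>t. 0 :: real^'n) (\<lambda>t. 0)" by (simp add: ac_deriv_def set_integrable_def)
  from ac_deriv_unique[OF 1 2] show ?thesis
  proof eventually_elim
    case (elim t)
    show ?case
    proof
      assume t: "t \<in> {0..1}"
      then have "D1 G (x0 t) (h t) = 0" using elim by simp
      then have "strength (x0 t) * (n t \<bullet> h t) = 0 \<or> n t = 0" unfolding DG_on_M(1)[OF x0_in_M] by simp
      then show "n t \<bullet> h t = 0" using DG_on_M(2)[OF x0_in_M, of t] nn[of t] by auto
    qed
  qed
qed

text \<open>Weak derivative of the identity \<open>D1 \<pi> (x0 t) (\<xi> t) = \<xi> t\<close>,
  whose left side is what the first variation formula produces.\<close>

lemma D1_pi_apply_compose:
  assumes "ac_deriv x0 h" "ac_deriv \<xi> \<xi>'" "\<And>t. \<xi> t \<bullet> n t = 0"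
  shows "AE t in lborel. t \<in> {0..1} \<longrightarrow> D2 \<pi> (x0 t) (\<xi> t) (h t) + D1 \<pi> (x0 t) (\<xi>' t) = \<xi>' t"
    and "(\<lambda>t. indicator {0..1} t *\<^sub>R (D2 \<pi> (x0 t) (\<xi> t) (h t) + D1 \<pi> (x0 t) (\<xi>' t))) \<in> borel_measurable lborel"
proof -
  let ?\<Psi> = "\<lambda>p. D1 \<pi> (fst p) (snd p)" and ?S = "tube \<times> (UNIV :: (real^'n) set)"
  have S: "open ?S" by (intro open_Times tube(1) open_UNIV)
  have C\<Psi>: "Ck_on (Suc 0) ?S ?\<Psi>"
    by (rule Ck_on_D1_apply[OF tube(1,3) S Ck_on_linear[OF bounded_linear_fst S] Ck_on_linear[OF bounded_linear_snd S]]) auto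
  have D\<Psi>: "D1 ?\<Psi> (x, z) (a, b) = D2 \<pi> x z a + D1 \<pi> x b" if "x \<in> tube" for x z a b
  proof (rule D1_eq_curve[OF C\<Psi>])
    show "(x, z) \<in> ?S" using that by simp
    have "((\<lambda>s. D1 \<pi> (x + s *\<^sub>R a) (z + s *\<^sub>R b)) has_vector_derivative
        (D2 \<pi> (x + 0 *\<^sub>R a) a (z + 0 *\<^sub>R b) + D1 \<pi> (x + 0 *\<^sub>R a) b)) (at 0)"
      by (rule D1_curve[OF tube(1,3)]) (auto intro!: derivative_eq_intros simp: that)
    then show "((\<lambda>s. ?\<Psi> ((x, z) + s *\<^sub>R (a, b))) has_vector_derivative D2 \<pi> x z a + D1 \<pi> x b) (at 0)"
      using D2_commute[OF tube(1,3) that] by simp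
  qed
  have "ac_deriv (\<lambda>t. ?\<Psi> (x0 t, \<xi> t)) (\<lambda>t. indicator {0..1} t *\<^sub>R D1 ?\<Psi> (x0 t, \<xi> t) (h t, \<xi>' t))"
    by (rule ac_deriv_compose[OF ac_deriv_Pair[OF assms(1,2)] S C\<Psi>]) (use x0_image in auto)
  moreover have "D1 ?\<Psi> (x0 t, \<xi> t) (h t, \<xi>' t) = D2 \<pi> (x0 t) (\<xi> t) (h t) + D1 \<pi> (x0 t) (\<xi>' t)" for t
    by (rule D\<Psi>) (use x0_in_M tube(2) in blast)
  moreover have "?\<Psi> (x0 t, \<xi> t) = \<xi> t" for t
    using D1_closest_point_tangent[OF x0_in_M assms(3)] by simp
  ultimately have 1: "ac_deriv \<xi> (\<lambda>t. indicator {0..1} t *\<^sub>R (D2 \<pi> (x0 t) (\<xi> t) (h t) + D1 \<pi> (x0 t) (\<xi>' t)))"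
    by simp
  then show "(\<lambda>t. indicator {0..1} t *\<^sub>R (D2 \<pi> (x0 t) (\<xi> t) (h t) + D1 \<pi> (x0 t) (\<xi>' t))) \<in> borel_measurable lborel"
    unfolding ac_deriv_def by blast
  from ac_deriv_unique[OF 1 assms(2)]
  show "AE t in lborel. t \<in> {0..1} \<longrightarrow> D2 \<pi> (x0 t) (\<xi> t) (h t) + D1 \<pi> (x0 t) (\<xi>' t) = \<xi>' t"
    by eventually_elim simp
qed

lemma D1_pi_velocity:
  assumes "ac_deriv x0 h"
  shows "AE t in lborel. t \<in> {0..1} \<longrightarrow> D1 \<pi> (x0 t) (h t) = h t"
    and "(\<lambda>t. indicator {0..1} t *\<^sub>R D1 \<pi> (x0 t) (h t)) \<in> borel_measurable lborel"
proof -
  have "ac_deriv (\<lambda>t. \<pi> (x0 t)) (\<lambda>t. indicator {0..1} t *\<^sub>R D1 \<pi> (x0 t) (h t))"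
    by (rule ac_deriv_compose[OF assms tube(1,3) x0_image(1)])
  then have 1: "ac_deriv x0 (\<lambda>t. indicator {0..1} t *\<^sub>R D1 \<pi> (x0 t) (h t))"
    by (simp add: closest_point_self[OF x0_in_M])
  then show "(\<lambda>t. indicator {0..1} t *\<^sub>R D1 \<pi> (x0 t) (h t)) \<in> borel_measurable lborel"
    unfolding ac_deriv_def by blast
  from ac_deriv_unique[OF 1 assms] show "AE t in lborel. t \<in> {0..1} \<longrightarrow> D1 \<pi> (x0 t) (h t) = h t"
    by eventually_elim simp
qed

text \<open>In the first variation formula the derivatives of the projection act on tangential data,
  where the two preceding lemmas replace them by \<open>h\<close> and \<open>\<xi>'\<close>.\<close>

lemma weak_geodesic_equation:
  assumes h: "is_weak_deriv x0 h" and \<xi>: "is_weak_deriv \<xi> \<xi>'" "\<xi> \<in> H1_tangent M x0"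
  shows "(LINT t:{0..1}|lborel. h t \<bullet> \<xi>' t) = 0"
proof -
  have tan: "\<xi> t \<bullet> n t = 0" for t using \<xi>(2) tangent_iff[OF x0_in_M] by (auto simp: H1_tangent_def)
  have ac: "ac_deriv x0 h" "ac_deriv \<xi> \<xi>'" using h \<xi>(1) by (auto simp: is_weak_deriv_iff)
  let ?W = "\<lambda>t. D1 \<pi> (x0 t) (h t)" and ?Z = "\<lambda>t. D2 \<pi> (x0 t) (\<xi> t) (h t) + D1 \<pi> (x0 t) (\<xi>' t)"
  have "((\<lambda>s. L0 (loop_chart M x0 (\<lambda>t. s *\<^sub>R \<xi> t))) has_real_derivative 0) (at 0)"
    using geodesic \<xi>(2) by (auto simp: closed_geodesic_def)
  moreover have "((\<lambda>s. L0 (loop_chart M x0 (\<lambda>t. s *\<^sub>R \<xi> t))) has_real_derivative (LINT t:{0..1}|lborel. ?W t \<bullet> ?Z t)) (at 0)"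
    unfolding loop_chart_def by (rule L0_first_variation[OF tube(1,3) h \<xi>(1) x0_image(1)])
  ultimately have 0: "(LINT t:{0..1}|lborel. ?W t \<bullet> ?Z t) = 0" using DERIV_unique by blast
  have "(LINT t|lborel. indicator {0..1} t *\<^sub>R (?W t \<bullet> ?Z t)) = (LINT t|lborel. indicator {0..1} t *\<^sub>R (h t \<bullet> \<xi>' t))"
  proof (rule integral_cong_AE)
    have "(\<lambda>t. indicator {0..1} t *\<^sub>R (?W t \<bullet> ?Z t)) = (\<lambda>t. (indicator {0..1} t *\<^sub>R ?W t) \<bullet> (indicator {0..1} t *\<^sub>R ?Z t))"
      by (auto simp: indicator_def fun_eq_iff)
    then show "(\<lambda>t. indicator {0..1} t *\<^sub>R (?W t \<bullet> ?Z t)) \<in> borel_measurable lborel"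
      using borel_measurable_inner[OF D1_pi_velocity(2)[OF ac(1)] D1_pi_apply_compose(2)[OF ac tan]] by simp
    have "h \<in> borel_measurable lborel" "\<xi>' \<in> borel_measurable lborel" using ac unfolding ac_deriv_def by blast+
    then show "(\<lambda>t. indicator {0..1} t *\<^sub>R (h t \<bullet> \<xi>' t)) \<in> borel_measurable lborel" by measurable
    show "AE t in lborel. indicator {0..1} t *\<^sub>R (?W t \<bullet> ?Z t) = indicator {0..1} t *\<^sub>R (h t \<bullet> \<xi>' t)"
      using D1_pi_velocity(1)[OF ac(1)] D1_pi_apply_compose(1)[OF ac tan]
    proof eventually_elim
      case (elim t)
      then show ?case by (cases "t \<in> {0..1}") simp_all
    qed
  qed
  then show ?thesis using 0 by (simp add: set_lebesgue_integral_def)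
qed

text \<open>For a smooth geodesic with velocity \<open>h\<close> this is, on one period, the
  component of the acceleration along \<open>e\<close>; compare \<open>x2_inner\<close>.\<close>

definition flux :: "(real \<Rightarrow> real^'n) \<Rightarrow> real^'n \<Rightarrow> real \<Rightarrow> real" where
  "flux h e t = h t \<bullet> (indicator {0..1} t *\<^sub>R D1 (\<lambda>x. proj x e) (x0 t) (h t))"

text \<open>The geodesic equation tested with the tangential field
  \<open>\<phi> t *\<^sub>R proj (x0 t) e\<close>. Since \<open>h\<close> is tangential,
  \<open>h t \<bullet> proj (x0 t) e\<close> is \<open>h t \<bullet> e\<close>, and the result says
  that \<open>flux h e\<close> is the derivative of \<open>h \<bullet> e\<close> in the sense of
  distributions.\<close>

lemma weak_flux_equation:
  assumes h: "is_weak_deriv x0 h" and \<phi>: "is_weak_deriv \<phi> \<psi>" "\<And>t. \<phi> (t + 1) = \<phi> t"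
  shows "(LINT t:{0..1}|lborel. \<psi> t * (h t \<bullet> e) + \<phi> t * flux h e t) = 0"
    and "set_integrable lborel {0..1} (flux h e)" "flux h e \<in> borel_measurable lborel"
proof -
  let ?P = "\<lambda>x. proj x e" and ?S = "(UNIV :: real set) \<times> reg"
  let ?\<Theta> = "\<lambda>p. fst p *\<^sub>R ?P (snd p)"
  have S: "open ?S" by (intro open_Times open_reg open_UNIV)
  have C\<Theta>: "Ck_on (Suc 0) ?S ?\<Theta>"
    by (intro Ck_on_scaleR S Ck_on_linear[OF bounded_linear_fst S]
        Ck_on_compose[OF S open_reg Ck_on_linear[OF bounded_linear_snd S] Ck_proj]) auto
  have D\<Theta>: "D1 ?\<Theta> (c, x) (a, b) = a *\<^sub>R ?P x + c *\<^sub>R D1 ?P x b" if x: "x \<in> reg" for c x a b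
  proof -
    have dP: "((\<lambda>p. ?P (snd p)) has_derivative (\<lambda>p. D1 ?P x (snd p))) (at (c, x))"
      by (rule has_derivative_compose[OF has_derivative_snd[OF has_derivative_ident]])
        (simp add: Ck_on_has_derivative[OF Ck_proj x])
    from has_derivative_scaleR[OF has_derivative_fst[OF has_derivative_ident] dP]
    have "(?\<Theta> has_derivative (\<lambda>p. c *\<^sub>R D1 ?P x (snd p) + fst p *\<^sub>R ?P x)) (at (c, x))" by simp
    from frechet_derivative_eq[OF this] show ?thesis by (simp add: add.commute)
  qed
  let ?\<xi> = "\<lambda>t. \<phi> t *\<^sub>R ?P (x0 t)"
  let ?\<xi>' = "\<lambda>t. indicator {0..1} t *\<^sub>R (\<psi> t *\<^sub>R ?P (x0 t) + \<phi> t *\<^sub>R D1 ?P (x0 t) (h t))"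
  have xr: "x0 t \<in> reg" for t using x0_in_M M_reg by blast
  have "is_weak_deriv (\<lambda>t. ?\<Theta> (\<phi> t, x0 t)) (\<lambda>t. indicator {0..1} t *\<^sub>R D1 ?\<Theta> (\<phi> t, x0 t) (\<psi> t, h t))"
    by (rule is_weak_deriv_compose[OF is_weak_deriv_Pair[OF \<phi>(1) h] S C\<Theta>]) (use xr in auto)
  then have w: "is_weak_deriv ?\<xi> ?\<xi>'" by (simp add: D\<Theta>[OF xr])
  have "?\<xi> \<in> H1_tangent M x0"
  proof (rule H1_tangentI[OF _ w])
    show "\<phi> (t + 1) *\<^sub>R ?P (x0 (t + 1)) = \<phi> t *\<^sub>R ?P (x0 t)" for t by (simp add: \<phi>(2) x0_periodic)
    show "(\<phi> t *\<^sub>R ?P (x0 t)) \<bullet> n t = 0" for t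
      by (simp add: proj_on_M[OF x0_in_M] inner_diff_left nn inner_commute[of _ e])
  qed
  from weak_geodesic_equation[OF h w this] have 0: "(LINT t:{0..1}|lborel. h t \<bullet> ?\<xi>' t) = 0" .
  have wq: "is_weak_deriv (\<lambda>t. ?P (x0 t)) (\<lambda>t. indicator {0..1} t *\<^sub>R D1 ?P (x0 t) (h t))"
    by (rule is_weak_deriv_compose[OF h open_reg Ck_proj x0_image(2)])
  show q1: "set_integrable lborel {0..1} (flux h e)"
    unfolding flux_def[abs_def] by (rule weak_deriv_product_integrable[OF h wq])
  have m: "h \<in> borel_measurable lborel" "(\<lambda>t. indicator {0..1} t *\<^sub>R D1 ?P (x0 t) (h t)) \<in> borel_measurable lborel"
    "?\<xi>' \<in> borel_measurable lborel" "\<psi> \<in> borel_measurable lborel"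
    using h wq w \<phi>(1) unfolding is_weak_deriv_def by blast+
  then show q2: "flux h e \<in> borel_measurable lborel" unfolding flux_def[abs_def] by (intro borel_measurable_inner)
  have "continuous_on {0..1} \<phi>" using \<phi>(1) ac_deriv_continuous unfolding is_weak_deriv_iff by blast
  then have m\<phi>: "(\<lambda>t. indicator {0..1} t *\<^sub>R \<phi> t) \<in> borel_measurable lborel"
    using borel_measurable_continuous_on_indicator[of "{0..1}" \<phi>] by simp
  have "(LINT t|lborel. indicator {0..1} t *\<^sub>R (h t \<bullet> ?\<xi>' t)) =
      (LINT t|lborel. indicator {0..1} t *\<^sub>R (\<psi> t * (h t \<bullet> e) + \<phi> t * flux h e t))"
  proof (rule integral_cong_AE)
    show "(\<lambda>t. indicator {0..1} t *\<^sub>R (h t \<bullet> ?\<xi>' t)) \<in> borel_measurable lborel" using m(1,3) by measurable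
    have "(\<lambda>t. indicator {0..1} t *\<^sub>R (\<psi> t * (h t \<bullet> e) + \<phi> t * flux h e t)) =
      (\<lambda>t. indicator {0..1} t *\<^sub>R (\<psi> t * (h t \<bullet> e)) + (indicator {0..1} t *\<^sub>R \<phi> t) * flux h e t)"
      by (auto simp: fun_eq_iff algebra_simps)
    then show "(\<lambda>t. indicator {0..1} t *\<^sub>R (\<psi> t * (h t \<bullet> e) + \<phi> t * flux h e t)) \<in> borel_measurable lborel"
      using m(1,4) m\<phi> q2 by simp
    show "AE t in lborel. indicator {0..1} t *\<^sub>R (h t \<bullet> ?\<xi>' t) = indicator {0..1} t *\<^sub>R (\<psi> t * (h t \<bullet> e) + \<phi> t * flux h e t)"
      using velocity_tangent_AE[OF h]
    proof eventually_elim
      case (elim t)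
      show ?case
      proof (cases "t \<in> {0..1}")
        case True
        then have "h t \<bullet> ?P (x0 t) = h t \<bullet> e"
          using elim by (simp add: proj_on_M[OF x0_in_M] inner_diff_right inner_commute)
        then show ?thesis using True by (simp add: flux_def inner_add_right)
      qed simp
    qed
  qed
  then show "(LINT t:{0..1}|lborel. \<psi> t * (h t \<bullet> e) + \<phi> t * flux h e t) = 0"
    using 0 by (simp add: set_lebesgue_integral_def)
qed

definition fluxint :: "(real \<Rightarrow> real^'n) \<Rightarrow> real^'n \<Rightarrow> real \<Rightarrow> real" where
  "fluxint h e t = (LINT s:{0..t}|lborel. flux h e s)"

text \<open>Testing the weak geodesic equation with the tangential part of \<open>\<phi> e\<close>, where \<open>\<phi>\<close> is the
  hat function with peak at \<open>\<tau>\<close>, represents \<open>x0 \<tau> \<bullet> e\<close> explicitly and gains one derivative.\<close>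

lemma geodesic_representation:
  assumes h: "is_weak_deriv x0 h"
  shows "continuous_on {0..1} (fluxint h e)" "fluxint h e 0 = 0" "fluxint h e 1 = 0"
    and "\<exists>c. \<forall>\<tau>\<in>{0..1}. x0 \<tau> \<bullet> e = x0 0 \<bullet> e + integral {0..\<tau>} (\<lambda>s. fluxint h e s - c)"
proof -
  let ?K = "fluxint h e"
  have one: "is_weak_deriv (\<lambda>t. 1::real) (\<lambda>t. 0)"
    by (rule weak_deriv_of_C1) (auto intro!: derivative_eq_intros)
  note q = weak_flux_equation(2,3)[OF h one, of e]
  have acK: "ac_deriv ?K (flux h e)"
    unfolding fluxint_def[abs_def] using q by (intro ac_deriv_indefinite) auto
  show cK: "continuous_on {0..1} ?K" by (rule ac_deriv_continuous[OF acK])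
  show K0: "?K 0 = 0"
    unfolding fluxint_def using set_borel_integral_eq_integral(2)[OF set_integrable_subset[OF q(1), of "{0..0}"]] by simp
  \<comment> \<open>The constant test function shows that the total flux is zero, so
    \<open>fluxint\<close> extends continuously to a periodic function.\<close>
  show K1: "?K 1 = 0"
    unfolding fluxint_def using weak_flux_equation(1)[OF h one, of e] by simp
  have Kint: "?K integrable_on {0..t}" if "t \<le> 1" for t
    by (rule integrable_continuous_real[OF continuous_on_subset[OF cK]]) (use that in auto)
  \<comment> \<open>The mean of \<open>fluxint\<close>, whose subtraction reflects the periodicity
    of \<open>x0\<close>.\<close>
  define c where "c = integral {0..1} ?K"
  have "x0 \<tau> \<bullet> e = x0 0 \<bullet> e + integral {0..\<tau>} (\<lambda>s. ?K s - c)" if \<tau>: "\<tau> \<in> {0..1}" for \<tau>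
  proof -
    let ?\<phi> = "\<lambda>t. min (frac t) \<tau> - \<tau> * frac t" and ?\<psi> = "\<lambda>t. indicator {0..\<tau>} t - \<tau> :: real"
    have \<phi>: "is_weak_deriv ?\<phi> ?\<psi>" by (rule hat_weak_deriv[OF \<tau>])
    have \<phi>per: "?\<phi> (t + 1) = ?\<phi> t" for t by (simp add: frac_1_eq)
    have eq1: "(LINT t:{0..1}|lborel. ?\<psi> t * (h t \<bullet> e) + ?\<phi> t * flux h e t) = 0"
      by (rule weak_flux_equation(1)[OF h \<phi> \<phi>per])
    have split: "(LINT t:{0..1}|lborel. ?\<psi> t * g t) = integral {0..\<tau>} g - \<tau> * integral {0..1} g"
      "set_integrable lborel {0..1} (\<lambda>t. ?\<psi> t * g t)"
      if g: "set_integrable lborel {0..1} g" for g :: "real \<Rightarrow> real"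
    proof -
      have g\<tau>: "set_integrable lborel {0..\<tau>} g" by (rule set_integrable_subset[OF g]) (use \<tau> in auto)
      have f: "(\<lambda>t. indicator {0..1} t *\<^sub>R (?\<psi> t * g t)) = (\<lambda>t. indicator {0..\<tau>} t *\<^sub>R g t - \<tau> * (indicator {0..1} t *\<^sub>R g t))"
        using \<tau> by (auto simp: fun_eq_iff indicator_def algebra_simps)
      show "set_integrable lborel {0..1} (\<lambda>t. ?\<psi> t * g t)"
        unfolding set_integrable_def f using g g\<tau> unfolding set_integrable_def
        by (intro Bochner_Integration.integrable_diff integrable_mult_right)
      have "(LINT t:{0..1}|lborel. ?\<psi> t * g t) = (LINT t:{0..\<tau>}|lborel. g t) - \<tau> * (LINT t:{0..1}|lborel. g t)"
        unfolding set_lebesgue_integral_def f using g g\<tau> unfolding set_integrable_def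
        by (subst Bochner_Integration.integral_diff) (auto intro!: integrable_mult_right)
      then show "(LINT t:{0..1}|lborel. ?\<psi> t * g t) = integral {0..\<tau>} g - \<tau> * integral {0..1} g"
        by (simp only: set_borel_integral_eq_integral(2)[OF g] set_borel_integral_eq_integral(2)[OF g\<tau>])
    qed
    have ach: "ac_deriv x0 h" using h by (simp add: is_weak_deriv_iff)
    have he: "set_integrable lborel {0..1} (\<lambda>t. h t \<bullet> e)"
    proof -
      have "integrable lborel (\<lambda>t. (indicator {0..1} t *\<^sub>R h t) \<bullet> e)"
        using ach unfolding ac_deriv_def set_integrable_def by (intro integrable_inner_left) blast
      then show ?thesis unfolding set_integrable_def by simp
    qed
    have hint: "integral {0..t} (\<lambda>t. h t \<bullet> e) = (x0 t - x0 0) \<bullet> e" if "t \<in> {0..1}" for t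
    proof -
      have i: "h integrable_on {0..t}" and e: "x0 t - x0 0 = integral {0..t} h"
        using ac_deriv_integral(1,3)[OF ach, of 0 t] that by auto
      show ?thesis unfolding e using integral_linear[OF i bounded_linear_inner_left, of e] by (simp add: o_def)
    qed
    have x1: "x0 1 = x0 0" using x0_periodic[of 0] by simp
    have "(LINT t:{0..1}|lborel. ?\<psi> t * (h t \<bullet> e)) = (x0 \<tau> - x0 0) \<bullet> e"
      unfolding split(1)[OF he] using hint[OF \<tau>] hint[of 1] x1 by simp
    moreover have "(LINT t:{0..1}|lborel. ?\<psi> t * ?K t + ?\<phi> t * flux h e t) = 0"
      and \<phi>q: "set_integrable lborel {0..1} (\<lambda>t. ?\<phi> t * flux h e t)"
    proof -
      \<comment> \<open>Integration by parts, as the chain rule for the product of the hat function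
        and \<open>fluxint\<close>. No boundary term appears, since \<open>fluxint\<close> vanishes
        at both ends.\<close>
      let ?m = "\<lambda>p :: real \<times> real. fst p * snd p"
      have Cm: "Ck_on (Suc 0) UNIV ?m"
        by (intro Ck_on_mult Ck_on_linear[OF bounded_linear_fst] Ck_on_linear[OF bounded_linear_snd]) auto
      have Dm: "D1 ?m (a, b) (a', b') = a' * b + a * b'" for a b a' b'
      proof -
        have "(?m has_derivative (\<lambda>h. fst (a, b) * snd h + fst h * snd (a, b))) (at (a, b))"
          by (rule has_derivative_mult[OF has_derivative_fst[OF has_derivative_ident] has_derivative_snd[OF has_derivative_ident]])
        from frechet_derivative_eq[OF this] show ?thesis by simp
      qed
      have ac\<phi>: "ac_deriv ?\<phi> ?\<psi>" using \<phi> by (simp add: is_weak_deriv_iff)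
      have ac: "ac_deriv (\<lambda>t. ?m (?\<phi> t, ?K t)) (\<lambda>t. indicator {0..1} t *\<^sub>R D1 ?m (?\<phi> t, ?K t) (?\<psi> t, flux h e t))"
        by (rule ac_deriv_compose[OF ac_deriv_Pair[OF ac\<phi> acK] open_UNIV Cm]) simp
      have "(LINT t:{0..1}|lborel. indicator {0..1} t *\<^sub>R D1 ?m (?\<phi> t, ?K t) (?\<psi> t, flux h e t)) = 0"
        by (rule ac_deriv_closed_integral[OF ac]) (simp add: K0 K1)
      then show "(LINT t:{0..1}|lborel. ?\<psi> t * ?K t + ?\<phi> t * flux h e t) = 0"
        unfolding Dm set_lebesgue_integral_def by (simp add: mult.assoc[symmetric] flip: indicator_inter_arith)
      have "set_integrable lborel {0..1} (\<lambda>t. indicator {0..1} t *\<^sub>R D1 ?m (?\<phi> t, ?K t) (?\<psi> t, flux h e t))"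
        using ac unfolding ac_deriv_def by blast
      then have a: "set_integrable lborel {0..1} (\<lambda>t. ?\<psi> t * ?K t + ?\<phi> t * flux h e t)"
        unfolding Dm set_integrable_def by (simp add: mult.assoc[symmetric] flip: indicator_inter_arith)
      from set_integral_diff(1)[OF a split(2)[OF borel_integrable_atLeastAtMost'[OF cK]]]
      show "set_integrable lborel {0..1} (\<lambda>t. ?\<phi> t * flux h e t)" by simp
    qed
    moreover have "(LINT t:{0..1}|lborel. ?\<psi> t * (h t \<bullet> e) + ?\<phi> t * flux h e t) =
        (LINT t:{0..1}|lborel. ?\<psi> t * (h t \<bullet> e)) + (LINT t:{0..1}|lborel. ?\<phi> t * flux h e t)"
      by (rule set_integral_add(2)[OF split(2)[OF he] \<phi>q])
    moreover have "(LINT t:{0..1}|lborel. ?\<psi> t * ?K t + ?\<phi> t * flux h e t) =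
        (LINT t:{0..1}|lborel. ?\<psi> t * ?K t) + (LINT t:{0..1}|lborel. ?\<phi> t * flux h e t)"
      by (rule set_integral_add(2)[OF split(2)[OF borel_integrable_atLeastAtMost'[OF cK]] \<phi>q])
    ultimately have "(x0 \<tau> - x0 0) \<bullet> e = integral {0..\<tau>} ?K - \<tau> * c"
      using eq1 split(1)[OF borel_integrable_atLeastAtMost'[OF cK]] by (simp add: c_def)
    also have "\<dots> = integral {0..\<tau>} (\<lambda>s. ?K s - c)"
      using \<tau> Kint[of \<tau>] by (subst integral_diff) auto
    finally show ?thesis by (simp add: inner_diff_left)
  qed
  then show "\<exists>c. \<forall>\<tau>\<in>{0..1}. x0 \<tau> \<bullet> e = x0 0 \<bullet> e + integral {0..\<tau>} (\<lambda>s. ?K s - c)" by blast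
qed

lemma geodesic_component_derivative:
  assumes h: "is_weak_deriv x0 h"
  shows "\<exists>c. \<forall>t. ((\<lambda>t. x0 t \<bullet> e) has_vector_derivative (fluxint h e (frac t) - c)) (at t)"
proof -
  obtain c where c: "\<And>\<tau>. \<tau> \<in> {0..1} \<Longrightarrow> x0 \<tau> \<bullet> e = x0 0 \<bullet> e + integral {0..\<tau>} (\<lambda>s. fluxint h e s - c)"
    using geodesic_representation(4)[OF h, of e] by blast
  have "((\<lambda>t. x0 t \<bullet> e) has_vector_derivative (fluxint h e (frac t) - c)) (at t)" for t
    by (rule periodic_antiderivative[of "\<lambda>t. x0 t \<bullet> e" "\<lambda>s. fluxint h e s - c", OF _ _ _ c])
      (auto simp: x0_periodic geodesic_representation(2,3)[OF h] intro!: continuous_on_diff geodesic_representation(1)[OF h])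
  then show ?thesis by blast
qed

definition x1 where "x1 t = vector_derivative x0 (at t)"
definition x2 where "x2 t = vector_derivative x1 (at t)"

lemma vector_derivative_of_components:
  fixes u :: "real \<Rightarrow> 'a::euclidean_space"
  assumes "\<And>e. e \<in> Basis \<Longrightarrow> ((\<lambda>t. u t \<bullet> e) has_vector_derivative k e) (at t)"
  shows "(u has_vector_derivative (\<Sum>e\<in>Basis. k e *\<^sub>R e)) (at t)"
proof -
  have "((\<lambda>t. \<Sum>e\<in>Basis. (u t \<bullet> e) *\<^sub>R e) has_vector_derivative (\<Sum>e\<in>Basis. k e *\<^sub>R e)) (at t)"
    by (intro has_vector_derivative_sum bounded_linear.has_vector_derivative[OF bounded_linear_scaleR_left] assms)
  then show ?thesis by (simp add: euclidean_representation)
qed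

lemma x1: "(x0 has_vector_derivative x1 t) (at t)" "continuous_on UNIV x1"
  and x1_periodic: "x1 (t + 1) = x1 t"
proof -
  obtain h where h: "is_weak_deriv x0 h" using x0_weak .
  obtain c where c: "\<And>e t. ((\<lambda>t. x0 t \<bullet> e) has_vector_derivative (fluxint h e (frac t) - c e)) (at t)"
    using geodesic_component_derivative[OF h] by metis
  let ?k = "\<lambda>t. \<Sum>e\<in>Basis. (fluxint h e (frac t) - c e) *\<^sub>R e"
  have d: "(x0 has_vector_derivative ?k t) (at t)" for t
    by (rule vector_derivative_of_components[OF c])
  then have eq: "x1 = ?k" unfolding x1_def[abs_def] by (intro ext vector_derivative_at)
  show "(x0 has_vector_derivative x1 t) (at t)" using d eq by metis
  show "continuous_on UNIV x1" unfolding eq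
    by (intro continuous_intros continuous_on_frac_extension geodesic_representation(1)[OF h])
      (simp add: geodesic_representation(2,3)[OF h])
  show "x1 (t + 1) = x1 t" unfolding eq by (simp add: frac_1_eq)
qed

text \<open>With \<open>x1\<close> continuous the flux is continuous, so the same representation can
  be differentiated once more.\<close>

lemma x2_components: "((\<lambda>t. x1 t \<bullet> e) has_vector_derivative x1 t \<bullet> D1 (\<lambda>x. proj x e) (x0 t) (x1 t)) (at t)"
proof -
  have h: "is_weak_deriv x0 x1" by (rule weak_deriv_of_C1[OF x1])
  have c0: "continuous_on UNIV x0"
    using x1(1) by (intro continuous_at_imp_continuous_on ballI) (auto intro: has_vector_derivative_continuous)
  let ?q = "\<lambda>t. x1 t \<bullet> D1 (\<lambda>x. proj x e) (x0 t) (x1 t)"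
  have qc: "continuous_on UNIV ?q"
    by (intro continuous_intros continuous_on_D1_apply[OF open_reg Ck_proj] x1(2) c0 x0_image)
  obtain c where c: "\<And>t. ((\<lambda>t. x0 t \<bullet> e) has_vector_derivative (fluxint x1 e (frac t) - c)) (at t)"
    using geodesic_component_derivative[OF h] by blast
  have "((\<lambda>t. x0 t \<bullet> e) has_vector_derivative x1 t \<bullet> e) (at t)" for t
    by (rule bounded_linear.has_vector_derivative[OF bounded_linear_inner_left x1(1)])
  then have x1e: "x1 t \<bullet> e = fluxint x1 e (frac t) - c" for t using vector_derivative_unique_at c by blast
  have "x1 t \<bullet> e = x1 0 \<bullet> e + integral {0..t} ?q" if t: "t \<in> {0..1}" for t
  proof -
    have "fluxint x1 e (frac t) = fluxint x1 e t"
    proof (cases "t = 1")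
      case True
      then show ?thesis using geodesic_representation(2,3)[OF h] by simp
    next
      case False
      then show ?thesis using t by (simp add: frac_eq)
    qed
    also have "\<dots> = (LINT s:{0..t}|lborel. ?q s)"
      unfolding fluxint_def by (rule set_lebesgue_integral_cong) (use t in \<open>auto simp: flux_def\<close>)
    also have "\<dots> = integral {0..t} ?q"
      by (rule set_borel_integral_eq_integral(2)[OF borel_integrable_atLeastAtMost'[OF continuous_on_subset[OF qc]]]) simp
    finally show ?thesis using x1e[of t] x1e[of 0] geodesic_representation(2)[OF h] by simp
  qed
  note rep = this
  have "((\<lambda>t. x1 t \<bullet> e) has_vector_derivative ?q (frac t)) (at t)"
  proof (rule periodic_antiderivative[of "\<lambda>t. x1 t \<bullet> e" ?q, OF _ _ _ rep])
    show "x1 (t + 1) \<bullet> e = x1 t \<bullet> e" for t by (simp add: x1_periodic)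
    show "continuous_on {0..1} ?q" by (rule continuous_on_subset[OF qc]) simp
    show "?q 0 = ?q 1" using x0_periodic[of 0] x1_periodic[of 0] by simp
  qed
  moreover have "?q (frac t) = ?q t"
    by (rule periodic_frac[of ?q]) (simp add: x0_periodic x1_periodic)
  ultimately show ?thesis by simp
qed

lemma x2: "(x1 has_vector_derivative x2 t) (at t)"
  and x2_inner: "x2 t \<bullet> e = x1 t \<bullet> D1 (\<lambda>x. proj x e) (x0 t) (x1 t)"
proof -
  have "(x1 has_vector_derivative (\<Sum>e\<in>Basis. (x1 t \<bullet> D1 (\<lambda>x. proj x e) (x0 t) (x1 t)) *\<^sub>R e)) (at t)"
    by (rule vector_derivative_of_components[OF x2_components])
  then show d: "(x1 has_vector_derivative x2 t) (at t)" unfolding x2_def by (simp add: vector_derivative_at)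
  have "((\<lambda>t. x1 t \<bullet> e) has_vector_derivative x2 t \<bullet> e) (at t)"
    by (rule bounded_linear.has_vector_derivative[OF bounded_linear_inner_left d])
  then show "x2 t \<bullet> e = x1 t \<bullet> D1 (\<lambda>x. proj x e) (x0 t) (x1 t)"
    using x2_components vector_derivative_unique_at by blast
qed

text \<open>\<open>x2_inner\<close> expresses \<open>x2\<close> smoothly through \<open>x0\<close>
  and \<open>x1\<close>, so each order of smoothness gives the next.\<close>

lemma Ck_x0_x1: "Ck_on k UNIV x0 \<and> Ck_on k UNIV x1"
proof (induction k)
  case 0
  show ?case using x1 by (auto intro!: continuous_at_imp_continuous_on has_vector_derivative_continuous)
next
  case (Suc k)
  have "Ck_on k UNIV x2"
  proof (rule Ck_on_componentwise[OF open_UNIV])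
    fix e :: "real^'n"
    show "Ck_on k UNIV (\<lambda>t. x2 t \<bullet> e)"
      unfolding x2_inner
      by (intro Ck_on_inner Ck_on_frechet_apply[OF open_UNIV open_reg Ck_proj] x0_image) (use Suc in auto)
  qed
  then show ?case using Suc x1 x2 by (auto intro!: Ck_on_real_SucI simp del: Ck_on.simps)
qed

lemma x2_periodic: "x2 (t + 1) = x2 t"
proof (rule euclidean_eqI)
  show "x2 (t + 1) \<bullet> e = x2 t \<bullet> e" for e unfolding x2_inner by (simp add: x0_periodic x1_periodic)
qed

lemma Ck_x2: "Ck_on k UNIV x2"
proof -
  have "x2 = (\<lambda>t. D1 x1 t 1)"
    using Ck_on_real_derivative(1)[of 0 x1] Ck_x0_x1 x2 vector_derivative_unique_at by blast
  then show ?thesis using Ck_on_real_derivative(2)[of k x1] Ck_x0_x1 by simp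
qed

lemma n_x1: "n t \<bullet> x1 t = 0"
proof -
  have "((\<lambda>t. G (x0 t)) has_derivative (\<lambda>s. DG (x0 t) (s *\<^sub>R x1 t))) (at t)"
    by (rule has_derivative_compose[OF x1(1)[unfolded has_vector_derivative_def] G_has_derivative])
  moreover have "(\<lambda>t. G (x0 t)) = (\<lambda>t. 0)" using critical_M x0_in_M by (auto simp: fun_eq_iff)
  ultimately have "((\<lambda>t::real. 0 :: real^'n) has_derivative (\<lambda>s. DG (x0 t) (s *\<^sub>R x1 t))) (at t)" by simp
  from has_derivative_unique[OF this has_derivative_const]
  have "DG (x0 t) (1 *\<^sub>R x1 t) = 0" by meson
  then have "strength (x0 t) * (n t \<bullet> x1 t) = 0 \<or> n t = 0" unfolding DG_on_M(1)[OF x0_in_M] by simp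
  then show ?thesis using DG_on_M(2)[OF x0_in_M, of t] nn[of t] by auto
qed

text \<open>The derivative of \<open>x1 t \<bullet> proj (x0 t) e = x1 t \<bullet> e\<close>,
  compared with \<open>x2_components\<close>, leaves
  \<open>x2 t \<bullet> proj (x0 t) e = 0\<close>.\<close>

lemma x2_normal: "x2 t = (n t \<bullet> x2 t) *\<^sub>R n t"
proof -
  have "x2 t \<bullet> proj (x0 t) e = 0" for e
  proof -
    have "((\<lambda>t. proj (x0 t) e) has_vector_derivative D1 (\<lambda>x. proj x e) (x0 t) (x1 t)) (at t)"
    proof -
      have r: "x0 t \<in> reg" using x0_in_M M_reg by blast
      from has_derivative_compose[OF x1(1)[unfolded has_vector_derivative_def] Ck_on_has_derivative[OF Ck_proj r]]
      show ?thesis unfolding has_vector_derivative_def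
        by (simp add: linear_scale[OF Ck_on_linear_frechet[OF Ck_proj r]])
    qed
    then have "((\<lambda>t. x1 t \<bullet> proj (x0 t) e) has_derivative
        (\<lambda>s. x1 t \<bullet> (s *\<^sub>R D1 (\<lambda>x. proj x e) (x0 t) (x1 t)) + (s *\<^sub>R x2 t) \<bullet> proj (x0 t) e)) (at t)"
      using x2 unfolding has_vector_derivative_def by (intro has_derivative_inner)
    moreover have "x1 t \<bullet> proj (x0 t) e = x1 t \<bullet> e" for t
      using n_x1[of t] by (simp add: proj_on_M[OF x0_in_M] inner_diff_right inner_commute)
    ultimately have "((\<lambda>t. x1 t \<bullet> e) has_derivative
        (\<lambda>s. x1 t \<bullet> (s *\<^sub>R D1 (\<lambda>x. proj x e) (x0 t) (x1 t)) + (s *\<^sub>R x2 t) \<bullet> proj (x0 t) e)) (at t)" by simp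
    from has_derivative_unique[OF this x2_components[unfolded has_vector_derivative_def]]
    show ?thesis by (auto dest!: fun_cong[of _ _ 1])
  qed
  from this[of "x2 t - (n t \<bullet> x2 t) *\<^sub>R n t"]
  have "x2 t \<bullet> (x2 t - (n t \<bullet> x2 t) *\<^sub>R n t) = 0" by (simp add: proj_on_M[OF x0_in_M] inner_diff_right nn)
  moreover have "n t \<bullet> (x2 t - (n t \<bullet> x2 t) *\<^sub>R n t) = 0" by (simp add: inner_diff_right nn)
  ultimately have "(x2 t - (n t \<bullet> x2 t) *\<^sub>R n t) \<bullet> (x2 t - (n t \<bullet> x2 t) *\<^sub>R n t) = 0"
    by (simp add: inner_diff_left)
  then show ?thesis by simp
qed

section \<open>The normal displacement and smoothness of the normal field along the loop\<close>

abbreviation b where "b t \<equiv> strength (x0 t)"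

lemma b_pos: "b t > 0" by (rule DG_on_M(2)[OF x0_in_M])
lemma b_nz: "b t \<noteq> 0" using b_pos[of t] by simp
lemma Ck_b: "Ck_on k UNIV b"
  using Ck_on_compose[OF open_UNIV open_UNIV _ Ck_strength] Ck_x0_x1 by blast

text \<open>The normal eigenvalue of the Hessian at \<open>x0 t\<close> is \<open>- b t\<close>, so
  that \<open>DG (x0 t) (v t) = - x2 t\<close>.\<close>

definition v where "v t = inverse (b t) *\<^sub>R x2 t"

lemma Ck_v: "Ck_on k UNIV v"
  unfolding v_def[abs_def] by (intro Ck_on_scaleR Ck_on_inverse Ck_b Ck_x2) (use b_nz in auto)

lemma v_periodic: "v (t + 1) = v t" by (simp add: v_def x0_periodic x2_periodic)
lemma x2_eq_v: "x2 t = b t *\<^sub>R v t" using b_pos[of t] by (simp add: v_def)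
lemma v_normal: "v t = (n t \<bullet> v t) *\<^sub>R n t"
  using arg_cong[OF x2_normal[of t], of "\<lambda>x. inverse (b t) *\<^sub>R x"] by (simp add: v_def nn)

text \<open>Obtained by differentiating \<open>Q n = n\<close>, where
  \<open>Q e = e - proj (x0 t) e\<close> projects onto the normal line. The term \<open>Q n'\<close>
  drops out because \<open>n'\<close> is orthogonal to \<open>n\<close>.\<close>

definition n1 where "n1 t = - (\<Sum>i\<in>Basis. (n t \<bullet> i) *\<^sub>R D1 (\<lambda>x. proj x i) (x0 t) (x1 t))"

text \<open>The projection \<open>Q\<close> onto the normal line is smooth along the loop although
  \<open>n\<close> is only known to be continuous. Near \<open>t\<close> the field is
  \<open>Q n0\<close> divided by its length, with \<open>n0 = n t\<close>, the sign being fixed by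
  continuity; hence it is differentiable. The formula \<open>n1\<close> for the derivative contains
  \<open>n\<close> undifferentiated, which \<open>Ck_n\<close> iterates.\<close>

lemma n1: "(n has_vector_derivative n1 t) (at t)" "n t \<bullet> n1 t = 0"
proof -
  have r: "x0 t \<in> reg" for t using x0_in_M M_reg by blast
  have dP: "((\<lambda>t. proj (x0 t) e) has_vector_derivative D1 (\<lambda>x. proj x e) (x0 t) (x1 t)) (at t)" for e t
    using has_derivative_compose[OF x1(1)[unfolded has_vector_derivative_def] Ck_on_has_derivative[OF Ck_proj r]]
    unfolding has_vector_derivative_def by (simp add: linear_scale[OF Ck_on_linear_frechet[OF Ck_proj r]])
  define n0 where "n0 = n t"
  let ?Q = "\<lambda>s e. e - proj (x0 s) e"
  have Q: "?Q s e = (n s \<bullet> e) *\<^sub>R n s" for s e by (simp add: proj_on_M[OF x0_in_M])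
  have dQ: "((\<lambda>s. ?Q s e) has_vector_derivative (- D1 (\<lambda>x. proj x e) (x0 t) (x1 t))) (at t)" for e
    using has_vector_derivative_diff[OF has_vector_derivative_const dP] by simp
  have c0: "continuous_on UNIV x0" using Ck_x0_x1[of 0] by simp
  have cn: "continuous_on UNIV n" using continuous_on_compose2[OF normal_field(1) c0] x0_in_M by auto
  have ev: "\<forall>\<^sub>F s in at t. n s \<bullet> n0 > 0"
  proof -
    have "isCont (\<lambda>s. n s \<bullet> n0) t" using cn by (simp add: continuous_on_eq_continuous_at)
    then have "((\<lambda>s. n s \<bullet> n0) \<longlongrightarrow> 1) (at t)" unfolding isCont_def by (simp add: n0_def nn)
    then show ?thesis by (rule order_tendstoD) simp
  qed
  let ?s = "\<lambda>s. n0 \<bullet> ?Q s n0"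
  have s: "?s s = (n s \<bullet> n0)\<^sup>2" for s unfolding Q by (simp add: power2_eq_square inner_commute)
  have ds: "(?s has_real_derivative (n0 \<bullet> (- D1 (\<lambda>x. proj x n0) (x0 t) (x1 t)))) (at t)"
    unfolding has_real_derivative_iff_has_vector_derivative
    by (rule bounded_linear.has_vector_derivative[OF bounded_linear_inner_right dQ])
  have "?s t = 1" unfolding s by (simp add: n0_def nn)
  then have dinv: "((\<lambda>s. inverse (sqrt (?s s))) has_real_derivative
      (- (inverse (sqrt 1) * (inverse (sqrt 1) / 2 * (n0 \<bullet> (- D1 (\<lambda>x. proj x n0) (x0 t) (x1 t)))) * inverse (sqrt 1)))) (at t)"
    using DERIV_inverse'[OF DERIV_chain2[OF DERIV_real_sqrt ds]] by simp
  obtain d where d: "((\<lambda>s. inverse (sqrt (?s s)) *\<^sub>R ?Q s n0) has_vector_derivative d) (at t)"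
    using has_vector_derivative_scaleR[OF dinv dQ] by blast
  have nd: "(n has_vector_derivative d) (at t)"
    unfolding has_vector_derivative_def
  proof (rule has_derivative_transform_eventually[OF d[unfolded has_vector_derivative_def]])
    have eq: "inverse (sqrt (?s s)) *\<^sub>R ?Q s n0 = n s" if "n s \<bullet> n0 > 0" for s
      unfolding s unfolding Q using that by simp
    show "\<forall>\<^sub>F s in at t. inverse (sqrt (?s s)) *\<^sub>R ?Q s n0 = n s" using ev by (rule eventually_mono) (rule eq)
    show "inverse (sqrt (?s t)) *\<^sub>R ?Q t n0 = n t" by (rule eq) (simp add: n0_def nn)
  qed simp
  have nd0: "n t \<bullet> d = 0"
  proof -
    have "((\<lambda>t. n t \<bullet> n t) has_derivative (\<lambda>h. n t \<bullet> (h *\<^sub>R d) + (h *\<^sub>R d) \<bullet> n t)) (at t)"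
      using nd unfolding has_vector_derivative_def by (intro has_derivative_inner)
    then have "((\<lambda>t::real. 1::real) has_derivative (\<lambda>h. n t \<bullet> (h *\<^sub>R d) + (h *\<^sub>R d) \<bullet> n t)) (at t)" by (simp add: nn)
    from has_derivative_unique[OF this has_derivative_const] have "n t \<bullet> (1 *\<^sub>R d) + (1 *\<^sub>R d) \<bullet> n t = 0" by meson
    then show ?thesis by (simp add: inner_commute)
  qed
  have "((\<lambda>s. \<Sum>i\<in>Basis. (n s \<bullet> i) *\<^sub>R ?Q s i) has_vector_derivative
      (\<Sum>i\<in>Basis. (n t \<bullet> i) *\<^sub>R (- D1 (\<lambda>x. proj x i) (x0 t) (x1 t)) + (d \<bullet> i) *\<^sub>R ?Q t i)) (at t)"
    by (intro has_vector_derivative_sum has_vector_derivative_scaleR dQ has_real_derivative_inner_const nd)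
  moreover have lq: "(\<Sum>i\<in>Basis. (w \<bullet> i) *\<^sub>R ?Q s i) = (n s \<bullet> w) *\<^sub>R n s" for s w
  proof -
    have "linear (?Q s)" unfolding Q by (intro linearI) (simp_all add: inner_add_right scaleR_add_left)
    from linear_expand[OF this, of w] show ?thesis unfolding Q by simp
  qed
  then have "(\<Sum>i\<in>Basis. (n s \<bullet> i) *\<^sub>R ?Q s i) = n s" for s by (simp add: nn)
  ultimately have "(n has_vector_derivative
      (\<Sum>i\<in>Basis. (n t \<bullet> i) *\<^sub>R (- D1 (\<lambda>x. proj x i) (x0 t) (x1 t)) + (d \<bullet> i) *\<^sub>R ?Q t i)) (at t)" by simp
  also have "(\<Sum>i\<in>Basis. (n t \<bullet> i) *\<^sub>R (- D1 (\<lambda>x. proj x i) (x0 t) (x1 t)) + (d \<bullet> i) *\<^sub>R ?Q t i) = n1 t + (n t \<bullet> d) *\<^sub>R n t"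
    using lq[of d t] by (simp add: n1_def sum.distrib sum_negf sum_subtractf)
  finally have "(n has_vector_derivative n1 t) (at t)" using nd0 by simp
  moreover have "n1 t = d" using vector_derivative_unique_at[OF nd calculation] by simp
  ultimately show "(n has_vector_derivative n1 t) (at t)" "n t \<bullet> n1 t = 0" using nd0 by simp_all
qed

lemma Ck_n: "Ck_on k UNIV n"
proof (induction k)
  case 0
  show ?case using n1(1) by (auto intro!: continuous_at_imp_continuous_on has_vector_derivative_continuous)
next
  case (Suc k)
  have "Ck_on k UNIV n1"
    unfolding n1_def[abs_def]
    by (intro Ck_on_minus Ck_on_sum Ck_on_scaleR Ck_on_inner Ck_on_frechet_apply[OF open_UNIV open_reg Ck_proj] x0_image)
      (use Suc Ck_x0_x1 in auto)
  then show ?case using n1(1) by (intro Ck_on_real_SucI)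
qed

end

section \<open>Nondegeneracy and the Jacobi equation\<close>

lemma periodic_vector_derivative:
  assumes u: "\<And>t. (u has_vector_derivative u' t) (at t)" and per: "\<And>t. u (t + 1) = u t"
  shows "u' (t + 1) = u' (t :: real)"
proof -
  have "((\<lambda>t. t + 1) has_vector_derivative 1) (at t)"
    unfolding has_real_derivative_iff_has_vector_derivative[symmetric] by (auto intro!: derivative_eq_intros)
  from vector_diff_chain_at[OF this u] have "(u has_vector_derivative u' (t + 1)) (at t)"
    by (simp add: o_def per)
  from vector_derivative_unique_at[OF this u] show ?thesis .
qed

lemma continuous_on_of_vector_derivative:
  "(\<And>t. (u has_vector_derivative u' t) (at t)) \<Longrightarrow> continuous_on S u"
  by (intro continuous_at_imp_continuous_on ballI) (auto intro: has_vector_derivative_continuous)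

lemma line_has_vector_derivative: "((\<lambda>s. p + s *\<^sub>R q) has_vector_derivative q) (at t)"
  by (auto intro!: derivative_eq_intros)

context repulsive_hypersurface
begin

text \<open>The symmetry of the Hessian, differentiated along \<open>a\<close>. With
  \<open>D2G_commute\<close> the third derivative of \<open>V\<close> is fully symmetric.\<close>

lemma D2G_symmetric: "D2 G x a b \<bullet> c = D2 G x a c \<bullet> b"
proof -
  have d: "((\<lambda>s. D1 G (x + s *\<^sub>R a) b) has_vector_derivative D2 G x a b) (at 0)" for b
    using D1_curve[OF open_UNIV Ck_G line_has_vector_derivative[of x a 0] has_vector_derivative_const[of b] UNIV_I UNIV_I]
      linear_0[OF linear_DG] by simp
  have "((\<lambda>s. D1 G (x + s *\<^sub>R a) b \<bullet> c) has_vector_derivative D2 G x a b \<bullet> c) (at 0)"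
    by (rule bounded_linear.has_vector_derivative[OF bounded_linear_inner_left d])
  moreover have "((\<lambda>s. D1 G (x + s *\<^sub>R a) b \<bullet> c) has_vector_derivative D2 G x a c \<bullet> b) (at 0)"
    unfolding DG_symmetric[of _ b c] by (rule bounded_linear.has_vector_derivative[OF bounded_linear_inner_left d])
  ultimately show ?thesis by (rule vector_derivative_unique_at)
qed

lemma D2G_commute: "D2 G x a b = D2 G x b a" by (rule D2_commute[OF open_UNIV Ck_G UNIV_I])

text \<open>Differentiating \<open>G \<circ> \<pi> = 0\<close> twice relates the normal part of \<open>D\<^sup>2\<pi>\<close> to the third derivatives of \<open>V\<close>.\<close>

lemma D2G_tangent:
  assumes p: "p \<in> M" and a: "a \<bullet> normal_field p = 0" and u: "u \<bullet> normal_field p = 0"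
  shows "D2 G p a u = (strength p * (normal_field p \<bullet> D2 \<pi> p a u)) *\<^sub>R normal_field p"
proof -
  have pt: "p \<in> tube" using p tube(2) by blast
  have \<pi>p: "\<pi> p = p" by (rule closest_point_self[OF p])
  have Mne: "closed M" "M \<noteq> {}" using compact_M p compact_imp_closed by auto
  have zero: "DG (\<pi> y) (D1 \<pi> y u) = 0" if y: "y \<in> tube" for y
  proof -
    have "((\<lambda>y. G (\<pi> y)) has_derivative (\<lambda>w. DG (\<pi> y) (D1 \<pi> y w))) (at y)"
      by (rule has_derivative_compose[OF Ck_on_has_derivative[OF tube(3) y] G_has_derivative])
    moreover have "(\<lambda>y. G (\<pi> y)) = (\<lambda>y. 0)"
      using critical_M closest_point_in_set[OF Mne] by (simp add: fun_eq_iff)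
    ultimately have "((\<lambda>y. 0 :: real^'n) has_derivative (\<lambda>w. DG (\<pi> y) (D1 \<pi> y w))) (at y)" by simp
    from has_derivative_unique[OF this has_derivative_const] show ?thesis by meson
  qed
  have c: "((\<lambda>s. \<pi> (p + s *\<^sub>R a)) has_vector_derivative D1 \<pi> p a) (at 0)"
  proof -
    have "(\<pi> has_derivative D1 \<pi> p) (at (p + 0 *\<^sub>R a))" using Ck_on_has_derivative[OF tube(3) pt] by simp
    from has_derivative_compose[OF line_has_vector_derivative[unfolded has_vector_derivative_def] this]
    show ?thesis unfolding has_vector_derivative_def by (simp add: linear_scale[OF Ck_on_linear_frechet[OF tube(3) pt]])
  qed
  have z: "((\<lambda>s. D1 \<pi> (p + s *\<^sub>R a) u) has_vector_derivative D2 \<pi> p a u) (at 0)"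
    using D1_curve[OF tube(1,3) line_has_vector_derivative[of p a 0] has_vector_derivative_const[of u] _ UNIV_I] pt
      linear_0[OF linear_D1[OF tube(1,3) pt]] by simp
  have "((\<lambda>s. D1 G (\<pi> (p + s *\<^sub>R a)) (D1 \<pi> (p + s *\<^sub>R a) u)) has_vector_derivative
      (D2 G (\<pi> (p + 0 *\<^sub>R a)) (D1 \<pi> p a) (D1 \<pi> (p + 0 *\<^sub>R a) u) + D1 G (\<pi> (p + 0 *\<^sub>R a)) (D2 \<pi> p a u))) (at 0)"
    by (rule D1_curve[OF open_UNIV Ck_G c z]) auto
  then have 1: "((\<lambda>s. D1 G (\<pi> (p + s *\<^sub>R a)) (D1 \<pi> (p + s *\<^sub>R a) u)) has_vector_derivative
      (D2 G p a u + DG p (D2 \<pi> p a u))) (at 0)"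
    by (simp add: \<pi>p D1_closest_point_tangent[OF p a] D1_closest_point_tangent[OF p u])
  have "((\<lambda>s::real. 0 :: real^'n) has_vector_derivative (D2 G p a u + DG p (D2 \<pi> p a u))) (at 0)"
    unfolding has_vector_derivative_def
  proof (rule has_derivative_transform_eventually[OF 1[unfolded has_vector_derivative_def]])
    have "isCont (\<lambda>s. p + s *\<^sub>R a) 0" by (intro continuous_intros)
    then have "\<forall>\<^sub>F s in at 0. p + s *\<^sub>R a \<in> tube"
      unfolding isCont_def using topological_tendstoD[OF _ tube(1)] pt by auto
    then show "\<forall>\<^sub>F s in at 0. D1 G (\<pi> (p + s *\<^sub>R a)) (D1 \<pi> (p + s *\<^sub>R a) u) = 0"
      by (rule eventually_mono) (rule zero)
    show "D1 G (\<pi> (p + 0 *\<^sub>R a)) (D1 \<pi> (p + 0 *\<^sub>R a) u) = 0" using zero[OF pt] by simp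
  qed simp
  from vector_derivative_unique_at[OF this has_vector_derivative_const]
  have "D2 G p a u + DG p (D2 \<pi> p a u) = 0" .
  then show ?thesis unfolding DG_on_M(1)[OF p] by simp
qed

end

context repulsive_geodesic
begin

lemma continuous_x0: "continuous_on S x0" and continuous_x1: "continuous_on S x1" and continuous_x2: "continuous_on S x2"
  using Ck_on_imp_continuous_on[of 0] Ck_x0_x1 Ck_x2 continuous_on_subset subset_UNIV by metis+

lemma x0_tube: "x0 t \<in> tube" using x0_in_M tube(2) by blast

lemma D1_pi_along:
  assumes \<xi>: "\<And>t. (\<xi> has_vector_derivative \<xi>1 t) (at t)" "\<And>t. \<xi> t \<bullet> n t = 0"
  shows "D2 \<pi> (x0 t) (x1 t) (\<xi> t) + D1 \<pi> (x0 t) (\<xi>1 t) = \<xi>1 t"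
proof -
  have "((\<lambda>t. D1 \<pi> (x0 t) (\<xi> t)) has_vector_derivative (D2 \<pi> (x0 t) (x1 t) (\<xi> t) + D1 \<pi> (x0 t) (\<xi>1 t))) (at t)"
    by (rule D1_curve[OF tube(1,3) x1(1) \<xi>(1) x0_tube UNIV_I])
  then have "(\<xi> has_vector_derivative (D2 \<pi> (x0 t) (x1 t) (\<xi> t) + D1 \<pi> (x0 t) (\<xi>1 t))) (at t)"
    by (simp add: D1_closest_point_tangent[OF x0_in_M \<xi>(2)])
  from vector_derivative_unique_at[OF this \<xi>(1)] show ?thesis .
qed

text \<open>\<open>D1_pi_along\<close> differentiated along the loop. The left side is also the
  derivative in \<open>s\<close>, at 0, of the acceleration of the projected loop
  \<open>\<pi> (x0 t + s *\<^sub>R \<xi> t)\<close>; that is how it is used in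
  \<open>jacobi_in_kernel\<close>.\<close>

lemma D1_pi_along_second:
  assumes \<xi>: "\<And>t. (\<xi> has_vector_derivative \<xi>1 t) (at t)" "\<And>t. \<xi> t \<bullet> n t = 0"
    and \<xi>1: "\<And>t. (\<xi>1 has_vector_derivative \<xi>2 t) (at t)"
  shows "D3 \<pi> (x0 t) (\<xi> t) (x1 t) (x1 t) + D2 \<pi> (x0 t) (\<xi>1 t) (x1 t) + D2 \<pi> (x0 t) (x1 t) (\<xi>1 t)
      + D2 \<pi> (x0 t) (\<xi> t) (x2 t) + D1 \<pi> (x0 t) (\<xi>2 t) = \<xi>2 t"
proof -
  have "((\<lambda>t. D2 \<pi> (x0 t) (x1 t) (\<xi> t) + D1 \<pi> (x0 t) (\<xi>1 t)) has_vector_derivative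
     ((D3 \<pi> (x0 t) (x1 t) (x1 t) (\<xi> t) + D2 \<pi> (x0 t) (x2 t) (\<xi> t) + D2 \<pi> (x0 t) (x1 t) (\<xi>1 t))
      + (D2 \<pi> (x0 t) (x1 t) (\<xi>1 t) + D1 \<pi> (x0 t) (\<xi>2 t)))) (at t)"
    by (intro has_vector_derivative_add D2_curve[OF tube(1,3) x1(1) x2 \<xi>(1) x0_tube]
        D1_curve[OF tube(1,3) x1(1) \<xi>1 x0_tube UNIV_I])
  moreover have "(\<lambda>t. D2 \<pi> (x0 t) (x1 t) (\<xi> t) + D1 \<pi> (x0 t) (\<xi>1 t)) = \<xi>1"
    using D1_pi_along[OF \<xi>] by blast
  ultimately have "(\<xi>1 has_vector_derivative ((D3 \<pi> (x0 t) (x1 t) (x1 t) (\<xi> t) + D2 \<pi> (x0 t) (x2 t) (\<xi> t) + D2 \<pi> (x0 t) (x1 t) (\<xi>1 t))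
      + (D2 \<pi> (x0 t) (x1 t) (\<xi>1 t) + D1 \<pi> (x0 t) (\<xi>2 t)))) (at t)" by simp
  from vector_derivative_unique_at[OF this \<xi>1[of t]]
  have "D3 \<pi> (x0 t) (x1 t) (x1 t) (\<xi> t) + D2 \<pi> (x0 t) (x2 t) (\<xi> t) + D2 \<pi> (x0 t) (x1 t) (\<xi>1 t)
      + (D2 \<pi> (x0 t) (x1 t) (\<xi>1 t) + D1 \<pi> (x0 t) (\<xi>2 t)) = \<xi>2 t" .
  moreover have "D3 \<pi> (x0 t) (x1 t) (x1 t) (\<xi> t) = D3 \<pi> (x0 t) (\<xi> t) (x1 t) (x1 t)"
    by (rule trans[OF D3_commute_right[OF tube(1,3) x0_tube] D3_commute_left[OF tube(1,3) x0_tube]])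
  moreover have "D2 \<pi> (x0 t) (x2 t) (\<xi> t) = D2 \<pi> (x0 t) (\<xi> t) (x2 t)" "D2 \<pi> (x0 t) (x1 t) (\<xi>1 t) = D2 \<pi> (x0 t) (\<xi>1 t) (x1 t)"
    by (rule D2_commute[OF tube(1,3) x0_tube])+
  ultimately show ?thesis by (simp add: algebra_simps)
qed

text \<open>The first variation at \<open>Y = \<pi> (x0 + s \<xi>)\<close> is, after an integration
  by parts, minus the integral of \<open>Y'' \<bullet> D1 \<pi> (x0 + s \<xi>) \<eta>\<close>. This
  form contains no derivative of \<open>\<eta>\<close>. At \<open>s = 0\<close> its integrand
  differentiates to \<open>\<xi>2 \<bullet> \<eta> + x2 \<bullet> D2 \<pi> x0 \<xi> \<eta>\<close>,
  and \<open>D2G_tangent\<close> turns the last term into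
  \<open>D2 G x0 v \<xi> \<bullet> \<eta>\<close>, so the Jacobi equation makes it vanish.\<close>

lemma jacobi_in_kernel:
  assumes \<xi>: "\<And>t. (\<xi> has_vector_derivative \<xi>1 t) (at t)" and \<xi>1: "\<And>t. (\<xi>1 has_vector_derivative \<xi>2 t) (at t)"
    and c\<xi>2: "continuous_on UNIV \<xi>2" and per: "\<And>t. \<xi> (t + 1) = \<xi> t" and tan: "\<And>t. \<xi> t \<bullet> n t = 0"
    and eq: "\<And>t w. w \<bullet> n t = 0 \<Longrightarrow> (\<xi>2 t + D2 G (x0 t) (v t) (\<xi> t)) \<bullet> w = 0"
  shows "\<xi> \<in> ker_D2L0 M x0"
proof -
  have c\<xi>: "continuous_on S \<xi>" and c\<xi>1: "continuous_on S \<xi>1" for S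
    using continuous_on_of_vector_derivative \<xi> \<xi>1 by blast+
  have per1: "\<xi>1 (t + 1) = \<xi>1 t" for t by (rule periodic_vector_derivative[OF \<xi> per])
  have w\<xi>: "is_weak_deriv \<xi> \<xi>1" by (rule weak_deriv_of_C1[OF \<xi> c\<xi>1])
  have "D2L0 M x0 \<xi> \<eta> = 0" if \<eta>: "\<eta> \<in> H1_tangent M x0" for \<eta>
  proof -
    obtain \<eta>' where w\<eta>: "is_weak_deriv \<eta> \<eta>'" and per\<eta>: "\<And>t. \<eta> (t + 1) = \<eta> t"
      using \<eta> unfolding H1_tangent_def H1_circle_def by blast
    have tan\<eta>: "\<eta> t \<bullet> n t = 0" for t using \<eta> tangent_iff[OF x0_in_M] by (auto simp: H1_tangent_def)
    have ac\<eta>: "ac_deriv \<eta> \<eta>'" using w\<eta> by (simp add: is_weak_deriv_iff)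
    have c\<eta>: "continuous_on {0..1} \<eta>" by (rule ac_deriv_continuous[OF ac\<eta>])
    let ?y = "\<lambda>s t. x0 t + s *\<^sub>R \<xi> t" and ?y1 = "\<lambda>s t. x1 t + s *\<^sub>R \<xi>1 t" and ?y2 = "\<lambda>s t. x2 t + s *\<^sub>R \<xi>2 t"
    have y: "(?y s has_vector_derivative ?y1 s t) (at t)" and y1: "(?y1 s has_vector_derivative ?y2 s t) (at t)" for s t
      by (intro has_vector_derivative_add x1(1) x2 bounded_linear.has_vector_derivative[OF bounded_linear_scaleR_right] \<xi> \<xi>1)+
    have cy: "continuous_on S (?y s)" "continuous_on S (?y1 s)" "continuous_on S (?y2 s)" for S s
      by (intro continuous_intros continuous_x0 continuous_x1 continuous_x2 c\<xi> c\<xi>1 continuous_on_subset[OF c\<xi>2]; simp)+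
    have "compact (x0 ` {0..1})" using continuous_x0 by (rule compact_continuous_image) simp
    from compact_subset_open_imp_ball_epsilon_subset[OF this tube(1) x0_image(1)]
    obtain d where d: "d > 0" "(\<Union>x\<in>x0 ` {0..1}. ball x d) \<subseteq> tube" .
    have "bounded (\<xi> ` {0..1})" using c\<xi> compact_continuous_image compact_imp_bounded by blast
    then obtain B where B: "B > 0" "\<And>t. t \<in> {0..1} \<Longrightarrow> norm (\<xi> t) \<le> B" by (auto simp: bounded_pos)
    define s0 where "s0 = d / (2 * B)"
    have s0: "s0 > 0" using d B by (simp add: s0_def)
    have yt: "?y s t \<in> tube" if "\<bar>s\<bar> < s0" for s t
    proof -
      \<comment> \<open>The bounds \<open>d\<close> and \<open>B\<close> hold over one period, so
        the time is first moved there.\<close>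
      have f: "frac t \<in> {0..1}" by (simp add: less_imp_le[OF frac_lt_1])
      have "norm (s *\<^sub>R \<xi> (frac t)) \<le> s0 * B" using that B(2)[OF f] by (simp add: mult_mono)
      also have "\<dots> < d" using d B by (simp add: s0_def)
      finally have "?y s (frac t) \<in> ball (x0 (frac t)) d" by (simp add: dist_norm)
      then have "?y s (frac t) \<in> tube" using d(2) f by blast
      then show ?thesis using periodic_frac[of \<xi>, OF per] periodic_frac[of x0, OF x0_periodic] by simp
    qed
    let ?Y1 = "\<lambda>s t. D1 \<pi> (?y s t) (?y1 s t)"
    let ?Y2 = "\<lambda>s t. D2 \<pi> (?y s t) (?y1 s t) (?y1 s t) + D1 \<pi> (?y s t) (?y2 s t)"
    let ?\<Phi> = "\<lambda>s. LINT t:{0..1}|lborel. ?Y1 s t \<bullet> (D2 \<pi> (?y s t) (\<eta> t) (?y1 s t) + D1 \<pi> (?y s t) (\<eta>' t))"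
    have inner_deriv: "deriv (\<lambda>r. L0 (loop_chart M x0 (\<lambda>t. s *\<^sub>R \<xi> t + r *\<^sub>R \<eta> t))) 0 = ?\<Phi> s" if s: "\<bar>s\<bar> < s0" for s
    proof -
      have "((\<lambda>r. L0 (\<lambda>t. \<pi> (?y s t + r *\<^sub>R \<eta> t))) has_real_derivative ?\<Phi> s) (at 0)"
        by (rule L0_first_variation[OF tube(1,3) weak_deriv_of_C1[OF y cy(2)] w\<eta>]) (use yt[OF s] in auto)
      then have "deriv (\<lambda>r. L0 (\<lambda>t. \<pi> (?y s t + r *\<^sub>R \<eta> t))) 0 = ?\<Phi> s" by (rule DERIV_imp_deriv)
      then show ?thesis by (simp add: loop_chart_def add.assoc)
    qed
    \<comment> \<open>The integrand as a function of position, velocity, acceleration and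
      \<open>\<eta>\<close>: varying \<open>s\<close> means moving along a line in a product space,
      as \<open>leibniz_C1\<close> expects.\<close>
    define \<kappa> where "\<kappa> q = (D2 \<pi> (fst q) (fst (snd q)) (fst (snd q)) + D1 \<pi> (fst q) (fst (snd (snd q)))) \<bullet> D1 \<pi> (fst q) (snd (snd (snd q)))"
      for q :: "(real^'n) \<times> (real^'n) \<times> (real^'n) \<times> (real^'n)"
    define O4 where "O4 = tube \<times> (UNIV :: ((real^'n) \<times> (real^'n) \<times> (real^'n)) set)"
    have O4: "open O4" unfolding O4_def by (intro open_Times tube(1) open_UNIV)
    have p1: "Ck_on (Suc 0) O4 fst" by (rule Ck_on_linear[OF bounded_linear_fst O4])
    have p2: "Ck_on (Suc 0) O4 (\<lambda>q. fst (snd q))"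
      by (rule Ck_on_bounded_linear[OF bounded_linear_fst O4 Ck_on_linear[OF bounded_linear_snd O4]])
    have p34: "Ck_on (Suc 0) O4 (\<lambda>q. snd (snd q))"
      by (rule Ck_on_bounded_linear[OF bounded_linear_snd O4 Ck_on_linear[OF bounded_linear_snd O4]])
    have C\<kappa>: "Ck_on (Suc 0) O4 \<kappa>"
      unfolding \<kappa>_def[abs_def]
      by (intro Ck_on_inner Ck_on_add O4 Ck_on_D2_apply[OF tube(1,3) O4 p1] Ck_on_D1_apply[OF tube(1,3) O4 p1] p2
          Ck_on_bounded_linear[OF bounded_linear_fst O4 p34] Ck_on_bounded_linear[OF bounded_linear_snd O4 p34])
        (auto simp: O4_def)
    have \<Phi>\<kappa>: "?\<Phi> s = - (LINT t:{0..1}|lborel. \<kappa> ((x0 t, x1 t, x2 t, \<eta> t) + s *\<^sub>R (\<xi> t, \<xi>1 t, \<xi>2 t, 0)))" if s: "\<bar>s\<bar> < s0" for s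
    proof -
      have ys: "?y s ` S \<subseteq> tube" for S using yt[OF s] by auto
      have Y: "(?Y1 s has_vector_derivative ?Y2 s t) (at t)" for t
        by (rule D1_curve[OF tube(1,3) y y1 yt[OF s] UNIV_I])
      have cY2: "continuous_on S (?Y2 s)" for S
        by (intro continuous_on_add continuous_on_D2_apply[OF tube(1,3)] continuous_on_D1_apply[OF tube(1,3)] cy ys)
      have acY: "ac_deriv (?Y1 s) (?Y2 s)" using weak_deriv_of_C1[OF Y cY2] by (simp add: is_weak_deriv_iff)
      have acy: "ac_deriv (?y s) (?y1 s)" using weak_deriv_of_C1[OF y cy(2)] by (simp add: is_weak_deriv_iff)
      \<comment> \<open>The boundary function \<open>Y' \<bullet> D1 \<pi> y \<eta>\<close> of the
        integration by parts; it is periodic, so its derivative integrates to zero.\<close>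
      define m where "m q = fst q \<bullet> D1 \<pi> (fst (snd q)) (snd (snd q))" for q :: "(real^'n) \<times> (real^'n) \<times> (real^'n)"
      define O3 where "O3 = (UNIV :: (real^'n) set) \<times> tube \<times> (UNIV :: (real^'n) set)"
      have O3: "open O3" unfolding O3_def by (intro open_Times tube(1) open_UNIV)
      have Cm: "Ck_on (Suc 0) O3 m" unfolding m_def[abs_def]
        by (intro Ck_on_inner O3 Ck_on_linear[OF bounded_linear_fst O3] Ck_on_D1_apply[OF tube(1,3) O3]
            Ck_on_bounded_linear[OF bounded_linear_fst O3 Ck_on_linear[OF bounded_linear_snd O3]]
            Ck_on_bounded_linear[OF bounded_linear_snd O3 Ck_on_linear[OF bounded_linear_snd O3]]) (auto simp: O3_def)
      have Dm: "D1 m (p, x, z) (a, b, c) = a \<bullet> D1 \<pi> x z + p \<bullet> (D2 \<pi> x b z + D1 \<pi> x c)" if x: "x \<in> tube" for p x z a b c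
      proof (rule D1_eq_curve[OF Cm])
        show "(p, x, z) \<in> O3" using x by (simp add: O3_def)
        have dD: "((\<lambda>s. D1 \<pi> (x + s *\<^sub>R b) (z + s *\<^sub>R c)) has_vector_derivative (D2 \<pi> (x + 0 *\<^sub>R b) b (z + 0 *\<^sub>R c) + D1 \<pi> (x + 0 *\<^sub>R b) c)) (at 0)"
          by (rule D1_curve[OF tube(1,3) line_has_vector_derivative line_has_vector_derivative]) (use x in auto)
        have "((\<lambda>s. (p + s *\<^sub>R a) \<bullet> D1 \<pi> (x + s *\<^sub>R b) (z + s *\<^sub>R c)) has_derivative
            (\<lambda>h. (p + 0 *\<^sub>R a) \<bullet> (h *\<^sub>R (D2 \<pi> (x + 0 *\<^sub>R b) b (z + 0 *\<^sub>R c) + D1 \<pi> (x + 0 *\<^sub>R b) c)) + (h *\<^sub>R a) \<bullet> D1 \<pi> (x + 0 *\<^sub>R b) (z + 0 *\<^sub>R c))) (at 0)"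
          by (rule has_derivative_inner[OF line_has_vector_derivative[unfolded has_vector_derivative_def] dD[unfolded has_vector_derivative_def]])
        then show "((\<lambda>s. m ((p, x, z) + s *\<^sub>R (a, b, c))) has_vector_derivative a \<bullet> D1 \<pi> x z + p \<bullet> (D2 \<pi> x b z + D1 \<pi> x c)) (at 0)"
          unfolding has_vector_derivative_def m_def by (simp add: algebra_simps)
      qed
      let ?c = "\<lambda>t. (?Y1 s t, ?y s t, \<eta> t)" and ?c' = "\<lambda>t. (?Y2 s t, ?y1 s t, \<eta>' t)"
      let ?g = "\<lambda>t. ?Y2 s t \<bullet> D1 \<pi> (?y s t) (\<eta> t) + ?Y1 s t \<bullet> (D2 \<pi> (?y s t) (?y1 s t) (\<eta> t) + D1 \<pi> (?y s t) (\<eta>' t))"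
      have ac: "ac_deriv (\<lambda>t. m (?c t)) (\<lambda>t. indicator {0..1} t *\<^sub>R D1 m (?c t) (?c' t))"
        by (rule ac_deriv_compose[OF ac_deriv_Pair[OF acY ac_deriv_Pair[OF acy ac\<eta>]] O3 Cm]) (use yt[OF s] in \<open>auto simp: O3_def\<close>)
      have Dmc: "D1 m (?c t) (?c' t) = ?g t" for t by (rule Dm[OF yt[OF s]])
      have "(LINT t:{0..1}|lborel. indicator {0..1} t *\<^sub>R ?g t) = 0"
      proof (rule ac_deriv_closed_integral[OF ac[unfolded Dmc]])
        show "m (?c 1) = m (?c 0)"
          using x0_periodic[of 0] x1_periodic[of 0] per[of 0] per1[of 0] per\<eta>[of 0] by simp
      qed
      then have g0: "(LINT t:{0..1}|lborel. ?g t) = 0"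
        unfolding set_lebesgue_integral_def by (simp add: mult.assoc[symmetric] flip: indicator_inter_arith)
      have "set_integrable lborel {0..1} (\<lambda>t. indicator {0..1} t *\<^sub>R ?g t)"
        using ac unfolding Dmc ac_deriv_def by blast
      then have gi: "set_integrable lborel {0..1} ?g"
        unfolding set_integrable_def by (simp add: mult.assoc[symmetric] flip: indicator_inter_arith)
      have ki: "set_integrable lborel {0..1} (\<lambda>t. ?Y2 s t \<bullet> D1 \<pi> (?y s t) (\<eta> t))"
        by (intro borel_integrable_atLeastAtMost' continuous_on_inner cY2 continuous_on_D1_apply[OF tube(1,3)] cy ys c\<eta>)
      have "?\<Phi> s = (LINT t:{0..1}|lborel. ?g t - ?Y2 s t \<bullet> D1 \<pi> (?y s t) (\<eta> t))"
        by (rule set_lebesgue_integral_cong) (auto simp: D2_commute[OF tube(1,3) yt[OF s]])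
      also have "\<dots> = - (LINT t:{0..1}|lborel. ?Y2 s t \<bullet> D1 \<pi> (?y s t) (\<eta> t))"
        using set_integral_diff(2)[OF gi ki] g0 by simp
      finally show ?thesis by (simp add: \<kappa>_def)
    qed
    have D\<kappa>: "D1 \<kappa> (x0 t, x1 t, x2 t, \<eta> t) (\<xi> t, \<xi>1 t, \<xi>2 t, 0) = 0" for t
    proof (rule D1_eq_curve[OF C\<kappa>])
      show "(x0 t, x1 t, x2 t, \<eta> t) \<in> O4" using x0_tube by (simp add: O4_def)
      have t0: "x0 t + 0 *\<^sub>R \<xi> t \<in> tube" using x0_tube by simp
      note L = line_has_vector_derivative
      let ?A = "D3 \<pi> (x0 t) (\<xi> t) (x1 t) (x1 t) + D2 \<pi> (x0 t) (\<xi>1 t) (x1 t) + D2 \<pi> (x0 t) (x1 t) (\<xi>1 t)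
          + (D2 \<pi> (x0 t) (\<xi> t) (x2 t) + D1 \<pi> (x0 t) (\<xi>2 t))"
      have dY2: "((\<lambda>s. ?Y2 s t) has_vector_derivative ?A) (at 0)"
        using has_vector_derivative_add[OF D2_curve[OF tube(1,3) L L[of "x1 t" "\<xi>1 t"] L[of "x1 t" "\<xi>1 t"] t0]
            D1_curve[OF tube(1,3) L L[of "x2 t" "\<xi>2 t"] t0 UNIV_I]] by simp
      have dZ: "((\<lambda>s. D1 \<pi> (?y s t) (\<eta> t)) has_vector_derivative D2 \<pi> (x0 t) (\<xi> t) (\<eta> t)) (at 0)"
        using D1_curve[OF tube(1,3) L has_vector_derivative_const[of "\<eta> t"] t0 UNIV_I]
          linear_0[OF linear_D1[OF tube(1,3) x0_tube]] by simp
      have A: "?A = \<xi>2 t" using D1_pi_along_second[OF \<xi> tan \<xi>1, of t] by (simp add: add.assoc)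
      have Y20: "?Y2 0 t = x2 t"
        using D1_pi_along[OF x2, of t] n_x1 by (simp add: inner_commute)
      have Z0: "D1 \<pi> (x0 t) (\<eta> t) = \<eta> t" by (rule D1_closest_point_tangent[OF x0_in_M tan\<eta>])
      have "((\<lambda>s. ?Y2 s t \<bullet> D1 \<pi> (?y s t) (\<eta> t)) has_derivative
          (\<lambda>h. ?Y2 0 t \<bullet> (h *\<^sub>R D2 \<pi> (x0 t) (\<xi> t) (\<eta> t)) + (h *\<^sub>R ?A) \<bullet> D1 \<pi> (?y 0 t) (\<eta> t))) (at 0)"
        by (rule has_derivative_inner[OF dY2[unfolded has_vector_derivative_def] dZ[unfolded has_vector_derivative_def]])
      then have "((\<lambda>s. ?Y2 s t \<bullet> D1 \<pi> (?y s t) (\<eta> t)) has_derivative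
          (\<lambda>h. x2 t \<bullet> (h *\<^sub>R D2 \<pi> (x0 t) (\<xi> t) (\<eta> t)) + (h *\<^sub>R \<xi>2 t) \<bullet> \<eta> t)) (at 0)"
        unfolding A Y20 using Z0 by simp
      then have 1: "((\<lambda>s. ?Y2 s t \<bullet> D1 \<pi> (?y s t) (\<eta> t)) has_vector_derivative
          (x2 t \<bullet> D2 \<pi> (x0 t) (\<xi> t) (\<eta> t) + \<xi>2 t \<bullet> \<eta> t)) (at 0)"
        unfolding has_vector_derivative_def by (simp add: algebra_simps)
      \<comment> \<open>Since \<open>x2\<close> is normal, only the normal part of
        \<open>D2 \<pi>\<close> enters, which is the part controlled by
        \<open>D2G_tangent\<close>.\<close>
      have "x2 t \<bullet> D2 \<pi> (x0 t) (\<xi> t) (\<eta> t) = (b t * (n t \<bullet> v t)) * (n t \<bullet> D2 \<pi> (x0 t) (\<xi> t) (\<eta> t))"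
        by (subst x2_eq_v, subst v_normal) simp
      also have "\<dots> = D2 G (x0 t) (\<xi> t) (\<eta> t) \<bullet> v t"
        unfolding D2G_tangent[OF x0_in_M tan tan\<eta>] by simp
      also have "\<dots> = D2 G (x0 t) (v t) (\<xi> t) \<bullet> \<eta> t" using D2G_symmetric D2G_commute by metis
      finally have "x2 t \<bullet> D2 \<pi> (x0 t) (\<xi> t) (\<eta> t) + \<xi>2 t \<bullet> \<eta> t = 0"
        using eq[OF tan\<eta>, of t] by (simp add: inner_add_left add.commute)
      with 1 show "((\<lambda>s. \<kappa> ((x0 t, x1 t, x2 t, \<eta> t) + s *\<^sub>R (\<xi> t, \<xi>1 t, \<xi>2 t, 0))) has_vector_derivative 0) (at 0)"
        by (simp add: \<kappa>_def)
    qed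
    have "((\<lambda>s. LINT t:{0..1}|lborel. \<kappa> ((x0 t, x1 t, x2 t, \<eta> t) + s *\<^sub>R (\<xi> t, \<xi>1 t, \<xi>2 t, 0))) has_real_derivative
        (LINT t:{0..1}|lborel. D1 \<kappa> (x0 t, x1 t, x2 t, \<eta> t) (\<xi> t, \<xi>1 t, \<xi>2 t, 0))) (at 0)"
      by (rule leibniz_C1[OF O4 C\<kappa>])
        (use x0_tube in \<open>auto simp: O4_def intro!: continuous_on_Pair continuous_x0 continuous_x1 continuous_x2 c\<eta> c\<xi> c\<xi>1 continuous_on_subset[OF c\<xi>2]\<close>)
    then have "((\<lambda>s. - (LINT t:{0..1}|lborel. \<kappa> ((x0 t, x1 t, x2 t, \<eta> t) + s *\<^sub>R (\<xi> t, \<xi>1 t, \<xi>2 t, 0)))) has_real_derivative - 0) (at 0)"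
      unfolding D\<kappa> by (intro DERIV_minus) simp
    then have "((\<lambda>s. deriv (\<lambda>r. L0 (loop_chart M x0 (\<lambda>t. s *\<^sub>R \<xi> t + r *\<^sub>R \<eta> t))) 0) has_real_derivative - 0) (at 0)"
      by (rule has_field_derivative_transform_within_open[of _ _ _ "{-s0<..<s0}"])
        (use s0 in \<open>auto simp: inner_deriv \<Phi>\<kappa>\<close>)
    then show ?thesis unfolding D2L0_def by (simp add: DERIV_imp_deriv)
  qed
  moreover have "\<xi> \<in> H1_tangent M x0" by (rule H1_tangentI[OF per w\<xi> tan])
  ultimately show ?thesis unfolding ker_D2L0_def by blast
qed

text \<open>The force balance \<open>DG (x0 t) (v t) = - x2 t\<close>, differentiated along the
  loop. The term in which \<open>v\<close> is differentiated is normal and disappears against a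
  tangential \<open>w\<close>.\<close>

lemma x1_jacobi:
  assumes "w \<bullet> n t = 0"
  shows "(D1 x2 t 1 + D2 G (x0 t) (v t) (x1 t)) \<bullet> w = 0"
proof -
  have "DG (x0 t) (v t) = - x2 t" for t
    using v_normal[of t] by (simp add: DG_on_M(1)[OF x0_in_M] x2_eq_v flip: scaleR_scaleR)
  moreover have "((\<lambda>t. DG (x0 t) (v t)) has_vector_derivative (D2 G (x0 t) (x1 t) (v t) + DG (x0 t) (D1 v t 1))) (at t)"
    by (rule D1_curve[OF open_UNIV Ck_G x1(1) Ck_on_real_derivative(1)[OF Ck_v] UNIV_I UNIV_I])
  ultimately have 1: "((\<lambda>t. - x2 t) has_vector_derivative (D2 G (x0 t) (x1 t) (v t) + DG (x0 t) (D1 v t 1))) (at t)" by simp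
  have 2: "((\<lambda>t. - x2 t) has_vector_derivative - D1 x2 t 1) (at t)"
    by (rule has_vector_derivative_minus[OF Ck_on_real_derivative(1)[OF Ck_x2]])
  have "D2 G (x0 t) (x1 t) (v t) + DG (x0 t) (D1 v t 1) = - D1 x2 t 1"
    by (rule vector_derivative_unique_at[OF 1 2])
  then have "D1 x2 t 1 = - (D2 G (x0 t) (x1 t) (v t) + DG (x0 t) (D1 v t 1))" by (metis minus_equation_iff)
  then have "D1 x2 t 1 + D2 G (x0 t) (v t) (x1 t) = - DG (x0 t) (D1 v t 1)"
    unfolding D2G_commute[of "x0 t" "v t" "x1 t"] by simp
  also have "\<dots> \<bullet> w = 0" unfolding DG_on_M(1)[OF x0_in_M] using assms by (simp add: inner_commute)
  finally show ?thesis .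
qed

text \<open>The kernel is a line and contains both \<open>\<xi>\<close> and, by
  \<open>x1_jacobi\<close>, the nonzero field \<open>x1\<close>.\<close>

lemma nondegenerate:
  assumes \<xi>: "\<And>t. (\<xi> has_vector_derivative \<xi>1 t) (at t)" and \<xi>1: "\<And>t. (\<xi>1 has_vector_derivative \<xi>2 t) (at t)"
    and c\<xi>2: "continuous_on UNIV \<xi>2" and per: "\<And>t. \<xi> (t + 1) = \<xi> t" and tan: "\<And>t. \<xi> t \<bullet> n t = 0"
    and eq: "\<And>t w. w \<bullet> n t = 0 \<Longrightarrow> (\<xi>2 t + D2 G (x0 t) (v t) (\<xi> t)) \<bullet> w = 0"
    and nonconst: "x1 t0 \<noteq> 0"
  shows "\<exists>c. \<forall>t. \<xi> t = c *\<^sub>R x1 t"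
proof -
  obtain \<zeta> where ker: "ker_D2L0 M x0 = {(\<lambda>t. c *\<^sub>R \<zeta> t) | c. True}"
    using nondeg unfolding nondegenerate_closed_geodesic_def by blast
  have "\<xi> \<in> ker_D2L0 M x0" by (rule jacobi_in_kernel[OF assms(1-6)])
  then obtain c where c: "\<xi> = (\<lambda>t. c *\<^sub>R \<zeta> t)" unfolding ker by blast
  have "x1 \<in> ker_D2L0 M x0"
  proof (rule jacobi_in_kernel[OF x2 Ck_on_real_derivative(1)[OF Ck_x2]])
    show "continuous_on UNIV (\<lambda>t. D1 x2 t 1)" using Ck_on_real_derivative(2)[of 0 x2] Ck_x2 by simp
    show "x1 t \<bullet> n t = 0" for t using n_x1[of t] by (simp add: inner_commute)
  qed (use x1_periodic x1_jacobi in auto)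
  then obtain d where d: "x1 = (\<lambda>t. d *\<^sub>R \<zeta> t)" unfolding ker by blast
  with nonconst have "d \<noteq> 0" by auto
  then have "\<xi> t = (c / d) *\<^sub>R x1 t" for t unfolding c d by simp
  then show ?thesis by blast
qed

end

section \<open>Inverting the linearized equations\<close>

lemma periodic_attains_max:
  fixes a :: "real \<Rightarrow> real"
  assumes "continuous_on UNIV a" "\<And>t. a (t + 1) = a t"
  obtains m where "\<And>t. a t \<le> a m"
proof -
  obtain m where m: "m \<in> {0..1}" "\<And>t. t \<in> {0..1} \<Longrightarrow> a t \<le> a m"
    using continuous_attains_sup[of "{0..1}" a] continuous_on_subset[OF assms(1)] by auto
  have "a t \<le> a m" for t
    using m(2)[of "frac t"] periodic_frac[of a, OF assms(2)] frac_lt_1[of t] frac_ge_0[of t] by auto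
  then show ?thesis using that by blast
qed

lemma second_derivative_nonpos_at_max:
  fixes a :: "real \<Rightarrow> real"
  assumes a: "\<And>t. (a has_real_derivative a1 t) (at t)" "(a1 has_real_derivative d) (at m)" and max: "\<And>t. a t \<le> a m"
  shows "a1 m = 0" "d \<le> 0"
proof -
  show a0: "a1 m = 0" by (rule DERIV_local_max[OF a(1), of 1]) (use max in auto)
  show "d \<le> 0"
  proof (rule ccontr)
    assume "\<not> d \<le> 0"
    then obtain e where e: "e > 0" "\<And>h. 0 < h \<Longrightarrow> h < e \<Longrightarrow> a1 m < a1 (m + h)"
      using DERIV_pos_inc_right[OF a(2)] by auto
    obtain z where "m < z" "z < m + e / 2" "a (m + e / 2) - a m = (m + e / 2 - m) * a1 z"
      using MVT2[of m "m + e / 2" a a1] a(1) e(1) by auto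
    moreover have "a1 z > 0" using e(2)[of "z - m"] calculation(1,2) a0 by auto
    then have "0 < e / 2 * a1 z" using e(1) by simp
    ultimately show False using max[of "m + e / 2"] by simp
  qed
qed

text \<open>At a maximum point of \<open>a\<close> the second derivative
  \<open>\<beta> * a + g\<close> is nonpositive; the same for \<open>- a\<close>. The bound improves
  as \<open>\<beta>0\<close> grows, which is the gain in the normal direction.\<close>

lemma maximum_principle:
  fixes a :: "real \<Rightarrow> real"
  assumes a: "\<And>t. (a has_real_derivative a1 t) (at t)" "\<And>t. (a1 has_real_derivative \<beta> t * a t + g t) (at t)"
    and per: "\<And>t. a (t + 1) = a t" and \<beta>: "\<beta>0 > 0" "\<And>t. \<beta> t \<ge> \<beta>0" and g: "\<And>t. \<bar>g t\<bar> \<le> G"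
  shows "\<bar>a t\<bar> \<le> G / \<beta>0"
proof -
  have G0: "G \<ge> 0" using g[of 0] by simp
  have upper: "a t \<le> G / \<beta>0"
    if a: "\<And>t. (a has_real_derivative a1 t) (at t)" "\<And>t. (a1 has_real_derivative \<beta> t * a t + g t) (at t)"
      and per: "\<And>t. a (t + 1) = a t" and g: "\<And>t. \<bar>g t\<bar> \<le> G" for a a1 g t
  proof -
    have ca: "continuous_on UNIV a" using a(1)
      by (auto intro!: continuous_at_imp_continuous_on intro: DERIV_isCont)
    obtain m where m: "\<And>t. a t \<le> a m" using periodic_attains_max[OF ca per] by blast
    have "\<beta> m * a m + g m \<le> 0" by (rule second_derivative_nonpos_at_max(2)[OF a(1) a(2) m])
    then have "\<beta> m * a m \<le> G" using g[of m] by simp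
    have "a m \<le> G / \<beta>0"
    proof (cases "a m \<le> 0")
      case True
      then show ?thesis using G0 \<beta>(1) by (meson divide_nonneg_pos order_trans)
    next
      case False
      then have "\<beta>0 * a m \<le> \<beta> m * a m" using \<beta>(2)[of m] by (intro mult_right_mono) auto
      then have "\<beta>0 * a m \<le> G" using \<open>\<beta> m * a m \<le> G\<close> by simp
      then show ?thesis using \<beta>(1) by (simp add: pos_le_divide_eq mult.commute)
    qed
    then show ?thesis using m[of t] by simp
  qed
  have "a t \<le> G / \<beta>0" by (rule upper[OF a per g])
  moreover have "- a t \<le> G / \<beta>0"
  proof (rule upper[of "\<lambda>t. - a t" "\<lambda>t. - a1 t" "\<lambda>t. - g t"])
    show "((\<lambda>t. - a1 t) has_real_derivative \<beta> t * (- a t) + (- g t)) (at t)" for t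
      using DERIV_minus[OF a(2)[of t]] by simp
  qed (use a(1) per g in \<open>auto intro: DERIV_minus\<close>)
  ultimately show ?thesis by simp
qed

text \<open>An elementary Landau inequality with a free step \<open>e\<close>, later taken as
  \<open>\<delta>^4\<close>, the length scale of the normal equation.\<close>

lemma derivative_interpolation:
  fixes a :: "real \<Rightarrow> real"
  assumes a: "\<And>t. (a has_real_derivative a1 t) (at t)" "\<And>t. (a1 has_real_derivative a2 t) (at t)"
    and A: "\<And>t. \<bar>a t\<bar> \<le> A" "\<And>t. \<bar>a2 t\<bar> \<le> A2" and e: "e > 0"
  shows "\<bar>a1 t\<bar> \<le> 2 * A / e + e * A2"
proof -
  obtain z where z: "t < z" "z < t + e" "a (t + e) - a t = (t + e - t) * a1 z"
    using MVT2[of t "t + e" a a1] a(1) e by auto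
  obtain y where y: "t < y" "y < z" "a1 z - a1 t = (z - t) * a2 y"
    using MVT2[of t z a1 a2] a(2) z by auto
  have "e * a1 z = a (t + e) - a t" using z(3) by simp
  then have "\<bar>e * a1 z\<bar> \<le> 2 * A" using A(1)[of "t + e"] A(1)[of t] by linarith
  then have "e * \<bar>a1 z\<bar> \<le> 2 * A" using e by (simp add: abs_mult)
  then have 1: "\<bar>a1 z\<bar> \<le> 2 * A / e" using e by (simp add: pos_le_divide_eq mult.commute)
  have "\<bar>a1 z - a1 t\<bar> = (z - t) * \<bar>a2 y\<bar>" using y z by (simp add: abs_mult)
  also have "\<dots> \<le> e * A2" using z A(2)[of y] e by (intro mult_mono) auto
  finally show ?thesis using 1 by linarith
qed

lemma periodic_bounded:
  fixes f :: "real \<Rightarrow> 'a::real_normed_vector"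
  assumes "continuous_on UNIV f" "\<And>t. f (t + 1) = f t"
  obtains C where "C > 0" "\<And>t. norm (f t) \<le> C"
proof -
  have "bounded (f ` {0..1})"
    using continuous_on_subset[OF assms(1)] compact_continuous_image compact_imp_bounded by blast
  then obtain C where C: "C > 0" "\<And>t. t \<in> {0..1} \<Longrightarrow> norm (f t) \<le> C" by (auto simp: bounded_pos)
  have "norm (f t) \<le> C" for t
    using C(2)[of "frac t"] periodic_frac[of f, OF assms(2)] frac_lt_1[of t] frac_ge_0[of t] by auto
  then show ?thesis using that C(1) by blast
qed

lemma has_vector_derivative_fst': "(y has_vector_derivative d) (at t) \<Longrightarrow> ((\<lambda>t. fst (y t)) has_vector_derivative fst d) (at t)"
  by (rule bounded_linear.has_vector_derivative[OF bounded_linear_fst])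

lemma has_vector_derivative_snd': "(y has_vector_derivative d) (at t) \<Longrightarrow> ((\<lambda>t. snd (y t)) has_vector_derivative snd d) (at t)"
  by (rule bounded_linear.has_vector_derivative[OF bounded_linear_snd])

lemma has_vector_derivative_shift:
  "(\<And>t. (y has_vector_derivative d t) (at t)) \<Longrightarrow> ((\<lambda>t. y (t + 1)) has_vector_derivative d (t + 1)) (at (t::real))"
proof -
  assume y: "\<And>t. (y has_vector_derivative d t) (at t)"
  have "((\<lambda>t. t + 1) has_vector_derivative 1) (at t)"
    unfolding has_real_derivative_iff_has_vector_derivative[symmetric] by (auto intro!: derivative_eq_intros)
  from vector_diff_chain_at[OF this y] show ?thesis by (simp add: o_def)
qed

lemma has_real_derivative_inner:
  assumes "(f has_vector_derivative f') (at t)" "(g has_vector_derivative g') (at t)"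
  shows "((\<lambda>t. f t \<bullet> g t) has_real_derivative f' \<bullet> g t + f t \<bullet> g') (at t)"
  unfolding has_field_derivative_def
  by (rule has_derivative_eq_rhs[OF has_derivative_inner[OF assms[unfolded has_vector_derivative_def]]])
    (auto simp: fun_eq_iff algebra_simps)

definition Nsol :: "(real \<Rightarrow> real) \<Rightarrow> (real \<Rightarrow> real) \<Rightarrow> (real \<Rightarrow> real) \<Rightarrow> (real \<Rightarrow> real) \<Rightarrow> bool" where
  "Nsol \<beta> g a a1 \<longleftrightarrow> (\<forall>t. (a has_vector_derivative a1 t) (at t)) \<and> (\<forall>t. (a1 has_vector_derivative \<beta> t * a t + g t) (at t)) \<and>
    (\<forall>t. a (t + 1) = a t)"

lemma Nsol_bounds:
  assumes s: "Nsol \<beta> g a a1" and \<beta>: "\<beta>0 > 0" "\<And>t. \<beta> t \<ge> \<beta>0" "\<And>t. \<beta> t \<le> \<beta>1" and g: "\<And>t. \<bar>g t\<bar> \<le> G" and e: "e > 0"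
  shows "\<bar>a t\<bar> \<le> G / \<beta>0" "\<bar>a1 t\<bar> \<le> 2 * (G / \<beta>0) / e + e * (\<beta>1 * (G / \<beta>0) + G)"
proof -
  have d: "(a has_real_derivative a1 t) (at t)" "(a1 has_real_derivative \<beta> t * a t + g t) (at t)" "a (t + 1) = a t" for t
    using s by (simp_all add: Nsol_def has_real_derivative_iff_has_vector_derivative)
  show 1: "\<bar>a t\<bar> \<le> G / \<beta>0" for t by (rule maximum_principle[OF d \<beta>(1,2) g])
  have "\<bar>\<beta> t * a t + g t\<bar> \<le> \<beta>1 * (G / \<beta>0) + G" for t
  proof -
    have "\<bar>\<beta> t * a t\<bar> \<le> \<beta>1 * (G / \<beta>0)"
      unfolding abs_mult using 1[of t] \<beta>(1) \<beta>(2,3)[of t] by (intro mult_mono) auto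
    then show ?thesis using g[of t] by linarith
  qed
  then show "\<bar>a1 t\<bar> \<le> 2 * (G / \<beta>0) / e + e * (\<beta>1 * (G / \<beta>0) + G)"
    by (rule derivative_interpolation[OF d(1,2) 1 _ e])
qed

text \<open>An instance of \<open>boundary_value_problem\<close> for the first order system in
  \<open>(a, a1)\<close>; the maximum principle with zero forcing supplies uniqueness.\<close>

lemma Nsol_exists:
  assumes \<beta>: "continuous_on UNIV \<beta>" "\<beta>0 > 0" "\<And>t. \<beta> t \<ge> \<beta>0" "\<And>t. \<beta> (t + 1) = \<beta> t"
    and g: "continuous_on UNIV g" "\<And>t. g (t + 1) = g t"
  shows "\<exists>a a1. Nsol \<beta> g a a1"
proof -
  obtain \<beta>1 where \<beta>1: "\<beta>1 > 0" "\<And>t. norm (\<beta> t) \<le> \<beta>1" using periodic_bounded[OF \<beta>(1,4)] by blast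
  define A where "A t y = (snd y, \<beta> t * fst y)" for t and y :: "real \<times> real"
  interpret linear_ode A "1 + \<beta>1"
  proof (rule linear_ode.intro)
    show "linear (A t)" for t unfolding A_def by (intro linearI) (simp_all add: algebra_simps)
    show "1 + \<beta>1 > 0" using \<beta>1(1) by simp
    show "norm (A t y) \<le> (1 + \<beta>1) * norm y" for t y
    proof -
      have "norm (A t y) \<le> \<bar>snd y\<bar> + \<bar>\<beta> t\<bar> * \<bar>fst y\<bar>"
        unfolding A_def norm_Pair by (rule order_trans[OF sqrt_sum_squares_le_sum_abs]) (simp add: abs_mult)
      also have "\<dots> \<le> norm y + \<beta>1 * norm y"
        using \<beta>1(2)[of t] norm_snd_le[of "snd y" "fst y"] norm_fst_le[of "fst y" "snd y"] \<beta>1(1) by (intro add_mono mult_mono) auto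
      finally show ?thesis by (simp add: algebra_simps)
    qed
    show "continuous_on UNIV (\<lambda>t. A t (y t))" if "continuous_on UNIV y" for y
      unfolding A_def by (intro continuous_intros that \<beta>(1))
  qed
  \<comment> \<open>Equal values at 0 and 1 imply periodicity: the shifted function solves the same
    initial value problem.\<close>
  have per_shift: "y (t + 1) = y t"
    if y: "\<And>t. (y has_vector_derivative (A t (y t) + (0, h t))) (at t)" "y 1 = y 0" and h: "\<And>t. h (t + 1) = h t" for y h t
  proof -
    have "(\<lambda>t. y (t + 1)) = y"
    proof (rule unique[OF _ y(1)])
      show "((\<lambda>t. y (t + 1)) has_vector_derivative A t (y (t + 1)) + (0, h t)) (at t)" for t
        using has_vector_derivative_shift[OF y(1), of t] by (simp add: A_def \<beta>(4) h)
    qed (use y(2) in simp)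
    then show ?thesis by metis
  qed
  have "\<exists>C>0. \<forall>f F. continuous_on UNIV f \<longrightarrow> (\<forall>t. norm (f t) \<le> F) \<longrightarrow>
    (\<exists>y. (\<forall>t. (y has_vector_derivative (A t (y t) + f t)) (at t)) \<and> y 1 - y 0 = 0 \<and> (\<forall>t\<in>{0..1}. norm (y t) \<le> C * F))"
  proof (rule boundary_value_problem)
    show "linear (\<lambda>z :: (real \<times> real) \<times> (real \<times> real). snd z - fst z)" by (intro linearI) (simp_all add: algebra_simps)
    fix y assume y: "\<And>t. (y has_vector_derivative A t (y t)) (at t)" and y10: "y 1 - y 0 = 0"
    have yp: "y (t + 1) = y t" for t by (rule per_shift[of y "\<lambda>t. 0"]) (use y y10 in \<open>simp_all add: zero_prod_def[symmetric]\<close>)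
    let ?a = "\<lambda>t. fst (y t)" and ?a1 = "\<lambda>t. snd (y t)"
    have d: "(?a has_vector_derivative ?a1 t) (at t)" "(?a1 has_vector_derivative \<beta> t * ?a t + 0) (at t)" for t
      using has_vector_derivative_fst'[OF y[of t]] has_vector_derivative_snd'[OF y[of t]] by (simp_all add: A_def)
    have "\<bar>?a t\<bar> \<le> 0 / \<beta>0" for t
      by (rule maximum_principle[of ?a ?a1 \<beta> "\<lambda>t. 0"])
        (use d \<beta> yp in \<open>simp_all add: has_real_derivative_iff_has_vector_derivative\<close>)
    then have a0: "?a = (\<lambda>t. 0)" by auto
    have "((\<lambda>t::real. 0::real) has_vector_derivative ?a1 0) (at 0)" using d(1)[of 0] unfolding a0 .
    then have "?a1 0 = 0" using vector_derivative_unique_at has_vector_derivative_const by blast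
    then show "y 0 = 0" using fun_cong[OF a0, of 0] by (simp add: prod_eq_iff)
  qed
  then obtain C where C: "\<And>f F. continuous_on UNIV f \<Longrightarrow> (\<forall>t. norm (f t) \<le> F) \<Longrightarrow>
    (\<exists>y. (\<forall>t. (y has_vector_derivative (A t (y t) + f t)) (at t)) \<and> y 1 - y 0 = 0 \<and> (\<forall>t\<in>{0..1}. norm (y t) \<le> C * F))" by blast
  obtain G where G: "\<And>t. norm (g t) \<le> G" using periodic_bounded[OF g] by blast
  have "continuous_on UNIV (\<lambda>t. (0::real, g t))" by (intro continuous_intros g(1))
  from C[OF this, of G] G obtain y where y: "\<And>t. (y has_vector_derivative (A t (y t) + (0, g t))) (at t)" "y 1 = y 0"
    by (auto simp: norm_Pair)
  have "Nsol \<beta> g (\<lambda>t. fst (y t)) (\<lambda>t. snd (y t))"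
    unfolding Nsol_def
    using has_vector_derivative_fst'[OF y(1)] has_vector_derivative_snd'[OF y(1)] per_shift[OF y g(2)] by (simp add: A_def)
  then show ?thesis by blast
qed

section \<open>The tangential linearized equation\<close>

context repulsive_geodesic
begin

abbreviation n' where "n' t \<equiv> D1 n t 1"
abbreviation n'' where "n'' t \<equiv> D1 (\<lambda>t. D1 n t 1) t 1"

lemma n': "(n has_vector_derivative n' t) (at t)" "(n' has_vector_derivative n'' t) (at t)"
  "continuous_on UNIV n'" "continuous_on UNIV n''" "n' (t + 1) = n' t" "n'' (t + 1) = n'' t" "n t \<bullet> n' t = 0"
proof -
  show 1: "(n has_vector_derivative n' t) (at t)" for t by (rule Ck_on_real_derivative(1)[OF Ck_n])
  have C1: "Ck_on k UNIV n'" for k by (rule Ck_on_real_derivative(2)[OF Ck_n])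
  show 2: "(n' has_vector_derivative n'' t) (at t)" for t by (rule Ck_on_real_derivative(1)[OF C1])
  show "continuous_on UNIV n'" using C1[of 0] by simp
  show "continuous_on UNIV n''" using Ck_on_real_derivative(2)[OF C1, of 0] by simp
  show 3: "n' (t + 1) = n' t" for t by (rule periodic_vector_derivative[OF 1 n_periodic])
  show "n'' (t + 1) = n'' t" by (rule periodic_vector_derivative[OF 2 3])
  show "n t \<bullet> n' t = 0" using n1 vector_derivative_unique_at[OF 1 n1(1)] by simp
qed

definition P where "P t w = w - (n t \<bullet> w) *\<^sub>R n t"

lemma P_tangent: "n t \<bullet> P t w = 0" by (simp add: P_def inner_diff_right nn)
lemma P_id: "w \<bullet> n t = 0 \<Longrightarrow> P t w = w" by (simp add: P_def inner_commute)
lemma linear_P: "linear (P t)" unfolding P_def by (intro linearI) (simp_all add: algebra_simps inner_add_right)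
lemma norm_P: "norm (P t w) \<le> norm w"
proof -
  have "P t w \<bullet> P t w = w \<bullet> w - (n t \<bullet> w)\<^sup>2"
    by (simp add: P_def inner_diff_left inner_diff_right nn power2_eq_square inner_commute)
  then have "P t w \<bullet> P t w \<le> w \<bullet> w" by simp
  then show ?thesis unfolding norm_eq_sqrt_inner by (rule real_sqrt_le_mono)
qed

abbreviation Bv where "Bv t w \<equiv> D2 G (x0 t) (v t) w"

text \<open>The \<open>n\<close>-component of the right-hand side is what \<open>\<xi> \<bullet> n = 0\<close> enforces.  The unknown multiplier \<open>l\<close> and
  the phase condition \<open>\<xi> 0 \<bullet> x1 0 = 0\<close> compensate the kernel spanned by \<open>x1\<close>.\<close>

definition Tsol where
  "Tsol f \<xi> \<xi>1 l \<longleftrightarrow> (\<forall>t. (\<xi> has_vector_derivative \<xi>1 t) (at t)) \<and>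
     (\<forall>t. (\<xi>1 has_vector_derivative (- P t (Bv t (\<xi> t)) - (2 * (n' t \<bullet> \<xi>1 t) + n'' t \<bullet> \<xi> t) *\<^sub>R n t + f t - l *\<^sub>R x1 t)) (at t)) \<and>
     (\<forall>t. \<xi> (t + 1) = \<xi> t) \<and> (\<forall>t. \<xi> t \<bullet> n t = 0) \<and> \<xi> 0 \<bullet> x1 0 = 0"

lemma x1_norm_constant: "x1 t \<bullet> x1 t = x1 0 \<bullet> x1 0"
proof -
  have "((\<lambda>t. x1 t \<bullet> x1 t) has_vector_derivative 0) (at t)" for t
  proof -
    have "x2 t \<bullet> x1 t = 0" using n_x1[of t] by (subst x2_normal) simp
    then show ?thesis
      using has_real_derivative_inner[OF x2 x2, of t] by (simp add: has_real_derivative_iff_has_vector_derivative inner_commute)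
  qed
  from vector_derivative_zero_imp_const[OF this] show ?thesis .
qed

lemma Bv_symmetric: "Bv t a \<bullet> c = Bv t c \<bullet> a" by (rule D2G_symmetric)

lemma linear_Bv: "linear (Bv t)" by (rule linear_D2_right[OF open_UNIV Ck_G UNIV_I])

lemma continuous_Bv: "continuous_on S y \<Longrightarrow> continuous_on S (\<lambda>t. Bv t (y t))"
  by (rule continuous_on_D2_apply[OF open_UNIV Ck_G continuous_x0])
    (use Ck_on_imp_continuous_on[OF Ck_v[of 0]] continuous_on_subset in auto)

text \<open>The multiplier vanishes by self-adjointness: \<open>\<xi>' \<bullet> x0' - \<xi> \<bullet> x0''\<close> is periodic with derivative
  \<open>- l |x0'|\<^sup>2\<close>.\<close>

lemma Tsol_zero:
  assumes s: "Tsol (\<lambda>t. 0) \<xi> \<xi>1 l" and nc: "x1 0 \<noteq> 0"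
  shows "\<xi> t = 0" "l = 0"
proof -
  let ?\<xi>2 = "\<lambda>t. - P t (Bv t (\<xi> t)) - (2 * (n' t \<bullet> \<xi>1 t) + n'' t \<bullet> \<xi> t) *\<^sub>R n t - l *\<^sub>R x1 t"
  have \<xi>: "(\<xi> has_vector_derivative \<xi>1 t) (at t)" "(\<xi>1 has_vector_derivative ?\<xi>2 t) (at t)"
    and per: "\<xi> (t + 1) = \<xi> t" and tan: "\<xi> t \<bullet> n t = 0" and ph: "\<xi> 0 \<bullet> x1 0 = 0" for t
    using s by (simp_all add: Tsol_def)
  have per1: "\<xi>1 (t + 1) = \<xi>1 t" for t by (rule periodic_vector_derivative[OF \<xi>(1) per])
  let ?m = "\<lambda>t. \<xi>1 t \<bullet> x1 t - \<xi> t \<bullet> x2 t"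
  have x3: "(x2 has_vector_derivative D1 x2 t 1) (at t)" for t by (rule Ck_on_real_derivative(1)[OF Ck_x2])
  have PB: "P t w \<bullet> u = w \<bullet> u" if "u \<bullet> n t = 0" for t w u using that by (simp add: P_def inner_diff_left inner_commute[of "n t" u])
  have x1n: "x1 t \<bullet> n t = 0" for t using n_x1[of t] by (simp add: inner_commute)
  have dm: "(?m has_real_derivative - l * (x1 0 \<bullet> x1 0)) (at t)" for t
  proof -
    have A: "(?m has_real_derivative (?\<xi>2 t \<bullet> x1 t + \<xi>1 t \<bullet> x2 t) - (\<xi>1 t \<bullet> x2 t + \<xi> t \<bullet> D1 x2 t 1)) (at t)"
      by (intro DERIV_diff has_real_derivative_inner \<xi> x2 x3)
    have B: "?\<xi>2 t \<bullet> x1 t = - (Bv t (\<xi> t) \<bullet> x1 t) - l * (x1 0 \<bullet> x1 0)"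
      using n_x1[of t] x1_norm_constant[of t] by (simp add: inner_diff_left inner_minus_left PB[OF x1n])
    have C: "\<xi> t \<bullet> D1 x2 t 1 = - (Bv t (x1 t) \<bullet> \<xi> t)"
    proof -
      have "D1 x2 t 1 \<bullet> \<xi> t + Bv t (x1 t) \<bullet> \<xi> t = 0"
        using x1_jacobi[OF tan, of t] by (simp only: inner_add_left)
      then show ?thesis by (simp add: inner_commute[of "\<xi> t" "D1 x2 t 1"] eq_neg_iff_add_eq_0)
    qed
    show ?thesis
      by (rule DERIV_cong[OF A]) (use B C Bv_symmetric[of t "\<xi> t" "x1 t"] in linarith)
  qed
  obtain z where "?m 1 - ?m 0 = (1 - 0) * (- l * (x1 0 \<bullet> x1 0))"
    using MVT2[of 0 1 ?m "\<lambda>t. - l * (x1 0 \<bullet> x1 0)"] dm by auto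
  then show l0: "l = 0" using per[of 0] per1[of 0] x1_periodic[of 0] x2_periodic[of 0] nc by simp
  have "\<exists>c. \<forall>t. \<xi> t = c *\<^sub>R x1 t"
  proof (rule nondegenerate[OF \<xi>])
    show "continuous_on UNIV ?\<xi>2"
      unfolding P_def
      by (intro continuous_intros continuous_Bv continuous_on_of_vector_derivative[OF \<xi>(1)]
          continuous_on_of_vector_derivative[OF \<xi>(2)] n'(3,4) continuous_x1 continuous_on_of_vector_derivative[OF n'(1)])
    show "(?\<xi>2 t + Bv t (\<xi> t)) \<bullet> w = 0" if w: "w \<bullet> n t = 0" for t w
    proof -
      have "n t \<bullet> w = 0" using w by (simp add: inner_commute)
      then show ?thesis using l0 by (simp add: inner_diff_left inner_add_left PB[OF w])
    qed
  qed (use per tan nc in auto)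
  then obtain c where c: "\<And>t. \<xi> t = c *\<^sub>R x1 t" by blast
  then have "c = 0" using ph nc by simp
  then show "\<xi> t = 0" using c by simp
qed

lemma Tsol_diff:
  assumes "Tsol f \<xi> \<xi>1 l" "Tsol g \<zeta> \<zeta>1 m"
  shows "Tsol (\<lambda>t. f t - g t) (\<lambda>t. \<xi> t - \<zeta> t) (\<lambda>t. \<xi>1 t - \<zeta>1 t) (l - m)"
proof -
  let ?r = "\<lambda>\<xi> \<xi>1 f l t. - P t (Bv t (\<xi> t)) - (2 * (n' t \<bullet> \<xi>1 t) + n'' t \<bullet> \<xi> t) *\<^sub>R n t + f t - l *\<^sub>R x1 t"
  have "((\<lambda>t. \<xi>1 t - \<zeta>1 t) has_vector_derivative (?r \<xi> \<xi>1 f l t - ?r \<zeta> \<zeta>1 g m t)) (at t)" for t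
    using assms unfolding Tsol_def by (intro has_vector_derivative_diff) blast+
  moreover have "?r \<xi> \<xi>1 f l t - ?r \<zeta> \<zeta>1 g m t = ?r (\<lambda>t. \<xi> t - \<zeta> t) (\<lambda>t. \<xi>1 t - \<zeta>1 t) (\<lambda>t. f t - g t) (l - m) t" for t
    by (simp add: linear_diff[OF linear_Bv] linear_diff[OF linear_P] algebra_simps inner_diff_right)
  ultimately have "((\<lambda>t. \<xi>1 t - \<zeta>1 t) has_vector_derivative ?r (\<lambda>t. \<xi> t - \<zeta> t) (\<lambda>t. \<xi>1 t - \<zeta>1 t) (\<lambda>t. f t - g t) (l - m) t) (at t)" for t
    by simp
  moreover have "((\<lambda>t. \<xi> t - \<zeta> t) has_vector_derivative (\<xi>1 t - \<zeta>1 t)) (at t)" for t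
    using assms unfolding Tsol_def by (intro has_vector_derivative_diff) blast+
  ultimately show ?thesis using assms unfolding Tsol_def by (simp add: inner_diff_left)
qed

lemma Nsol_diff:
  assumes "Nsol \<beta> f a a1" "Nsol \<beta> g c c1"
  shows "Nsol \<beta> (\<lambda>t. f t - g t) (\<lambda>t. a t - c t) (\<lambda>t. a1 t - c1 t)"
proof -
  have "((\<lambda>t. a1 t - c1 t) has_vector_derivative ((\<beta> t * a t + f t) - (\<beta> t * c t + g t))) (at t)" for t
    using assms unfolding Nsol_def by (intro has_vector_derivative_diff) blast+
  then have "((\<lambda>t. a1 t - c1 t) has_vector_derivative (\<beta> t * (a t - c t) + (f t - g t))) (at t)" for t
    by (simp add: algebra_simps)
  moreover have "((\<lambda>t. a t - c t) has_vector_derivative (a1 t - c1 t)) (at t)" for t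
    using assms unfolding Nsol_def by (intro has_vector_derivative_diff) blast+
  ultimately show ?thesis using assms unfolding Nsol_def by simp
qed

text \<open>The constraint \<open>\<xi> \<bullet> n = 0\<close> and the unknown constant
  \<open>l\<close> are absorbed into an unconstrained first order system for
  \<open>(\<xi>, \<xi>1, l)\<close> with \<open>l' = 0\<close>, to which
  \<open>boundary_value_problem\<close> applies; \<open>Tsol_zero\<close> supplies uniqueness.
  Uniqueness also transfers the bound from the solution constructed to every solution.\<close>

lemma Tsol_solver:
  assumes nc: "x1 0 \<noteq> 0"
  obtains C where "C > 0"
    "\<And>f. continuous_on UNIV f \<Longrightarrow> (\<And>t. f (t + 1) = f t) \<Longrightarrow> (\<And>t. n t \<bullet> f t = 0) \<Longrightarrow> \<exists>\<xi> \<xi>1 l. Tsol f \<xi> \<xi>1 l"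
    "\<And>f \<xi> \<xi>1 l F t. continuous_on UNIV f \<Longrightarrow> (\<And>t. f (t + 1) = f t) \<Longrightarrow> (\<And>t. n t \<bullet> f t = 0) \<Longrightarrow>
       Tsol f \<xi> \<xi>1 l \<Longrightarrow> (\<And>t. norm (f t) \<le> F) \<Longrightarrow> norm (\<xi> t) \<le> C * F \<and> norm (\<xi>1 t) \<le> C * F"
proof -
  \<comment> \<open>The normal component is chosen so that \<open>c = n \<bullet> \<xi>\<close>
    satisfies \<open>c'' = c\<close>. A periodic \<open>c\<close> is then 0 by the maximum
    principle, and on tangential \<open>\<xi>\<close> the system is that of
    \<open>Tsol\<close>.\<close>
  define Q where "Q t \<xi> \<eta> l = - P t (Bv t (P t \<xi>)) + (n t \<bullet> \<xi> - 2 * (n' t \<bullet> \<eta>) - n'' t \<bullet> \<xi>) *\<^sub>R n t - l *\<^sub>R x1 t"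
    for t \<xi> \<eta> and l :: real
  define A where "A t y = (fst (snd y), Q t (fst y) (fst (snd y)) (snd (snd y)), 0 :: real)"
    for t and y :: "(real^'n) \<times> (real^'n) \<times> real"
  have cn: "continuous_on UNIV n" by (rule continuous_on_of_vector_derivative[OF n'(1)])
  have cv: "continuous_on UNIV v" using Ck_on_imp_continuous_on[OF Ck_v[of 0]] .
  obtain N1 where N1: "N1 > 0" "\<And>t. norm (n' t) \<le> N1" using periodic_bounded[OF n'(3,5)] by blast
  obtain N2 where N2: "N2 > 0" "\<And>t. norm (n'' t) \<le> N2" using periodic_bounded[OF n'(4,6)] by blast
  obtain X1 where X1: "X1 > 0" "\<And>t. norm (x1 t) \<le> X1" using periodic_bounded[OF x1(2) x1_periodic] by blast
  obtain Vb where Vb: "Vb > 0" "\<And>t. norm (v t) \<le> Vb" using periodic_bounded[OF cv v_periodic] by blast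
  obtain CB where CB: "CB \<ge> 0" "\<And>x a c. x \<in> M \<Longrightarrow> norm (D2 G x a c) \<le> CB * (norm a * norm c)"
    using D2_bounded_on_compact[OF open_UNIV Ck_G compact_M] by auto
  have norm_n: "norm (n t) = 1" for t using nn[of t] by (simp add: norm_eq_1)
  have BvB: "norm (Bv t w) \<le> CB * Vb * norm w" for t w
  proof -
    have "norm (Bv t w) \<le> CB * (norm (v t) * norm w)" by (rule CB(2)[OF x0_in_M])
    also have "\<dots> \<le> CB * (Vb * norm w)" using CB(1) Vb by (intro mult_left_mono mult_right_mono) auto
    finally show ?thesis by (simp add: mult_ac)
  qed
  define K where "K = 1 + CB * Vb + 1 + 2 * N1 + N2 + X1"
  interpret linear_ode A K
  proof (rule linear_ode.intro)
    show "linear (A t)" for t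
      unfolding A_def Q_def
      by (intro linearI)
        (simp_all add: linear_add[OF linear_P] linear_add[OF linear_Bv] linear_scale[OF linear_P] linear_scale[OF linear_Bv]
          algebra_simps inner_add_right)
    show K0: "K > 0" unfolding K_def using CB Vb N1 N2 X1 by (intro add_pos_pos add_pos_nonneg) auto
    show "norm (A t y) \<le> K * norm y" for t y
    proof -
      let ?\<xi> = "fst y" and ?\<eta> = "fst (snd y)" and ?l = "snd (snd y)"
      have le: "norm ?\<xi> \<le> norm y" "norm ?\<eta> \<le> norm y" "\<bar>?l\<bar> \<le> norm y"
        using norm_fst_le[of "fst y" "snd y"] norm_snd_le[of "snd y" "fst y"]
          norm_fst_le[of "fst (snd y)" "snd (snd y)"] norm_snd_le[of "snd (snd y)" "fst (snd y)"] by auto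
      have i: "\<bar>u \<bullet> w\<bar> \<le> c * norm y" if "norm u \<le> c" "norm w \<le> norm y" for u w :: "real^'n" and c
        using Cauchy_Schwarz_ineq2[of u w] mult_mono[OF that] that(1) by (meson norm_ge_zero order_trans)
      have "norm (P t (Bv t (P t ?\<xi>))) \<le> CB * Vb * norm y"
      proof -
        have "norm (P t (Bv t (P t ?\<xi>))) \<le> CB * Vb * norm (P t ?\<xi>)" using norm_P BvB order_trans by blast
        also have "\<dots> \<le> CB * Vb * norm y" using CB(1) Vb(1) norm_P[of t ?\<xi>] le(1) by (intro mult_left_mono) auto
        finally show ?thesis .
      qed
      moreover have "norm ((n t \<bullet> ?\<xi> - 2 * (n' t \<bullet> ?\<eta>) - n'' t \<bullet> ?\<xi>) *\<^sub>R n t) \<le> 1 * norm y + 2 * (N1 * norm y) + N2 * norm y"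
        using i[of "n t" 1 ?\<xi>] i[of "n' t" N1 ?\<eta>] i[of "n'' t" N2 ?\<xi>] N1(2)[of t] N2(2)[of t] le by (simp add: norm_n)
      moreover have "norm (?l *\<^sub>R x1 t) \<le> X1 * norm y"
        using mult_mono[OF le(3) X1(2)[of t]] by (simp add: mult.commute)
      ultimately have "norm (Q t ?\<xi> ?\<eta> ?l) \<le> (CB * Vb + 1 + 2 * N1 + N2 + X1) * norm y"
        unfolding Q_def using norm_triangle_ineq4[of "- P t (Bv t (P t ?\<xi>)) + (n t \<bullet> ?\<xi> - 2 * (n' t \<bullet> ?\<eta>) - n'' t \<bullet> ?\<xi>) *\<^sub>R n t" "?l *\<^sub>R x1 t"]
          norm_triangle_ineq[of "- P t (Bv t (P t ?\<xi>))" "(n t \<bullet> ?\<xi> - 2 * (n' t \<bullet> ?\<eta>) - n'' t \<bullet> ?\<xi>) *\<^sub>R n t"]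
        by (simp add: algebra_simps)
      moreover have "norm (A t y) \<le> norm ?\<eta> + norm (Q t ?\<xi> ?\<eta> ?l)"
        unfolding A_def norm_Pair using sqrt_sum_squares_le_sum_abs[of "norm ?\<eta>" "norm (Q t ?\<xi> ?\<eta> ?l)"] by simp
      ultimately show ?thesis using le(2) by (simp add: K_def algebra_simps)
    qed
    show "continuous_on UNIV (\<lambda>t. A t (y t))" if "continuous_on UNIV y" for y
      unfolding A_def Q_def P_def
      by (intro continuous_intros continuous_Bv that cn n'(3,4) x1(2))
  qed
  have Aper: "A (t + 1) y = A t y" for t y
    unfolding A_def Q_def P_def by (simp add: x0_periodic v_periodic n'(5,6) x1_periodic)
  have to_Tsol: "Tsol f (\<lambda>t. fst (y t)) (\<lambda>t. fst (snd (y t))) (snd (snd (y 0)))"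
    if y: "\<And>t. (y has_vector_derivative (A t (y t) + (0, f t, 0))) (at t)"
      and bc: "fst (y 1) = fst (y 0)" "fst (snd (y 1)) = fst (snd (y 0))" "fst (y 0) \<bullet> x1 0 = 0"
      and f: "\<And>t. f (t + 1) = f t" "\<And>t. n t \<bullet> f t = 0" for y f
  proof -
    let ?\<xi> = "\<lambda>t. fst (y t)" and ?\<eta> = "\<lambda>t. fst (snd (y t))" and ?l = "\<lambda>t. snd (snd (y t))"
    have d: "(?\<xi> has_vector_derivative ?\<eta> t) (at t)" "(?\<eta> has_vector_derivative Q t (?\<xi> t) (?\<eta> t) (?l t) + f t) (at t)"
      "(?l has_vector_derivative 0) (at t)" for t
      using has_vector_derivative_fst'[OF y[of t]] has_vector_derivative_fst'[OF has_vector_derivative_snd'[OF y[of t]]]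
        has_vector_derivative_snd'[OF has_vector_derivative_snd'[OF y[of t]]] by (simp_all add: A_def)
    have l: "?l t = ?l 0" for t by (rule vector_derivative_zero_imp_const[OF d(3)])
    have "(\<lambda>t. y (t + 1)) = y"
    proof (rule unique[OF _ y])
      show "((\<lambda>t. y (t + 1)) has_vector_derivative A t (y (t + 1)) + (0, f t, 0)) (at t)" for t
        using has_vector_derivative_shift[OF y, of t] by (simp add: Aper f(1))
      show "y (0 + 1) = y 0" using bc l[of 1] by (simp add: prod_eq_iff)
    qed
    then have yp: "y (t + 1) = y t" for t by metis
    let ?c = "\<lambda>t. n t \<bullet> ?\<xi> t" and ?c1 = "\<lambda>t. n' t \<bullet> ?\<xi> t + n t \<bullet> ?\<eta> t"
    have c: "(?c has_real_derivative ?c1 t) (at t)" for t by (rule has_real_derivative_inner[OF n'(1) d(1)])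
    have c1: "(?c1 has_real_derivative 1 * ?c t + 0) (at t)" for t
    proof -
      have "(?c1 has_real_derivative (n'' t \<bullet> ?\<xi> t + n' t \<bullet> ?\<eta> t) + (n' t \<bullet> ?\<eta> t + n t \<bullet> (Q t (?\<xi> t) (?\<eta> t) (?l t) + f t))) (at t)"
        by (intro DERIV_add has_real_derivative_inner n'(1,2) d)
      moreover have "n t \<bullet> Q t (?\<xi> t) (?\<eta> t) (?l t) = n t \<bullet> ?\<xi> t - 2 * (n' t \<bullet> ?\<eta> t) - n'' t \<bullet> ?\<xi> t"
        by (simp add: Q_def inner_diff_right inner_add_right P_tangent nn n_x1)
      ultimately show ?thesis by (simp add: inner_add_right f(2))
    qed
    have "\<bar>?c t\<bar> \<le> 0 / 1" for t
      by (rule maximum_principle[OF c c1]) (use yp n_periodic in auto)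
    then have tan: "?\<xi> t \<bullet> n t = 0" for t by (simp add: inner_commute)
    have QE: "Q t (?\<xi> t) (?\<eta> t) (?l t) + f t = - P t (Bv t (?\<xi> t)) - (2 * (n' t \<bullet> ?\<eta> t) + n'' t \<bullet> ?\<xi> t) *\<^sub>R n t + f t - ?l 0 *\<^sub>R x1 t" for t
      using tan[of t] l[of t] by (simp add: Q_def P_id[OF tan] inner_commute algebra_simps)
    have "(?\<eta> has_vector_derivative (- P t (Bv t (?\<xi> t)) - (2 * (n' t \<bullet> ?\<eta> t) + n'' t \<bullet> ?\<xi> t) *\<^sub>R n t + f t - ?l 0 *\<^sub>R x1 t)) (at t)" for t
      using d(2)[of t] unfolding QE .
    then show ?thesis unfolding Tsol_def using d(1) yp tan bc(3) by (intro conjI allI) simp_all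
  qed
  \<comment> \<open>Periodicity of \<open>\<xi>\<close> and \<open>\<xi>1\<close> and the phase
    condition: as many conditions as initial values, \<open>l\<close> included.\<close>
  define Bd where "Bd p q = (fst q - fst p, fst (snd q) - fst (snd p), fst p \<bullet> x1 0)"
    for p q :: "(real^'n) \<times> (real^'n) \<times> real"
  have "\<exists>C>0. \<forall>f F. continuous_on UNIV f \<longrightarrow> (\<forall>t. norm (f t) \<le> F) \<longrightarrow>
    (\<exists>y. (\<forall>t. (y has_vector_derivative (A t (y t) + f t)) (at t)) \<and> Bd (y 0) (y 1) = 0 \<and> (\<forall>t\<in>{0..1}. norm (y t) \<le> C * F))"
  proof (rule boundary_value_problem)
    show "linear (\<lambda>z. Bd (fst z) (snd z))" unfolding Bd_def
      by (intro linearI) (simp_all add: algebra_simps inner_add_left)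
    fix y assume y: "\<And>t. (y has_vector_derivative A t (y t)) (at t)" and bd: "Bd (y 0) (y 1) = 0"
    have "fst (y 1) = fst (y 0)" "fst (snd (y 1)) = fst (snd (y 0))" "fst (y 0) \<bullet> x1 0 = 0"
      using bd by (simp_all add: Bd_def prod_eq_iff)
    note bd' = this
    have T: "Tsol (\<lambda>t. 0) (\<lambda>t. fst (y t)) (\<lambda>t. fst (snd (y t))) (snd (snd (y 0)))"
      by (rule to_Tsol) (use y bd' in \<open>simp_all add: zero_prod_def[symmetric]\<close>)
    have 1: "fst (y t) = 0" for t by (rule Tsol_zero(1)[OF T nc])
    have 2: "snd (snd (y 0)) = 0" by (rule Tsol_zero(2)[OF T nc])
    have "((\<lambda>t. fst (y t)) has_vector_derivative fst (snd (y 0))) (at 0)" using T unfolding Tsol_def by blast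
    then have "((\<lambda>t::real. 0) has_vector_derivative fst (snd (y 0))) (at 0)" by (simp add: 1)
    from vector_derivative_unique_at[OF this has_vector_derivative_const] have "fst (snd (y 0)) = 0" .
    then show "y 0 = 0" using 1[of 0] 2 by (simp add: prod_eq_iff)
  qed
  then obtain C where C0: "C > 0" and C: "\<And>f F. continuous_on UNIV f \<Longrightarrow> (\<forall>t. norm (f t) \<le> F) \<Longrightarrow>
    (\<exists>y. (\<forall>t. (y has_vector_derivative (A t (y t) + f t)) (at t)) \<and> Bd (y 0) (y 1) = 0 \<and> (\<forall>t\<in>{0..1}. norm (y t) \<le> C * F))" by blast
  have solve: "\<exists>\<xi> \<xi>1 l. Tsol f \<xi> \<xi>1 l \<and> (\<forall>t. norm (\<xi> t) \<le> C * F \<and> norm (\<xi>1 t) \<le> C * F)"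
    if f: "continuous_on UNIV f" "\<And>t. f (t + 1) = f t" "\<And>t. n t \<bullet> f t = 0" "\<And>t. norm (f t) \<le> F" for f F
  proof -
    have "continuous_on UNIV (\<lambda>t. (0 :: real^'n, f t, 0 :: real))" by (intro continuous_intros f(1))
    moreover have "\<forall>t. norm (0 :: real^'n, f t, 0 :: real) \<le> F" using f(4) by (simp add: norm_Pair)
    ultimately obtain y where y: "\<And>t. (y has_vector_derivative (A t (y t) + (0, f t, 0))) (at t)"
      "Bd (y 0) (y 1) = 0" "\<And>t. t \<in> {0..1} \<Longrightarrow> norm (y t) \<le> C * F" using C by blast
    have T: "Tsol f (\<lambda>t. fst (y t)) (\<lambda>t. fst (snd (y t))) (snd (snd (y 0)))"
      by (rule to_Tsol[OF y(1)]) (use y(2) f in \<open>simp_all add: Bd_def zero_prod_def\<close>)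
    have per: "fst (y (t + 1)) = fst (y t)" for t using T by (simp add: Tsol_def)
    have "((\<lambda>t. fst (y t)) has_vector_derivative fst (snd (y t))) (at t)" for t using T unfolding Tsol_def by blast
    from periodic_vector_derivative[OF this per] have per1: "fst (snd (y (t + 1))) = fst (snd (y t))" for t .
    have "norm (fst (y t)) \<le> C * F \<and> norm (fst (snd (y t))) \<le> C * F" for t
    proof -
      have fr: "frac t \<in> {0..1}" using frac_lt_1[of t] frac_ge_0[of t] by simp
      have "norm (fst (y (frac t))) \<le> C * F" "norm (fst (snd (y (frac t)))) \<le> C * F"
        using y(3)[OF fr] norm_fst_le[of "fst (y (frac t))" "snd (y (frac t))"] norm_snd_le[of "snd (y (frac t))" "fst (y (frac t))"]
          norm_fst_le[of "fst (snd (y (frac t)))" "snd (snd (y (frac t)))"] by auto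
      then show ?thesis
        using periodic_frac[of "\<lambda>t. fst (y t)", OF per] periodic_frac[of "\<lambda>t. fst (snd (y t))", OF per1] by simp
    qed
    with T show ?thesis by blast
  qed
  show ?thesis
  proof (rule that[OF C0])
    fix f :: "real \<Rightarrow> real^'n" assume f: "continuous_on UNIV f" "\<And>t. f (t + 1) = f t" "\<And>t. n t \<bullet> f t = 0"
    obtain F where "\<And>t. norm (f t) \<le> F" using periodic_bounded[OF f(1,2)] by blast
    with solve[OF f] show "\<exists>\<xi> \<xi>1 l. Tsol f \<xi> \<xi>1 l" by blast
  next
    fix f :: "real \<Rightarrow> real^'n" and \<xi> \<xi>1 l F and t :: real
    assume f: "continuous_on UNIV f" "\<And>t. f (t + 1) = f t" "\<And>t. n t \<bullet> f t = 0"
      and T: "Tsol f \<xi> \<xi>1 l" and F: "\<And>t. norm (f t) \<le> F"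
    obtain \<zeta> \<zeta>1 m where Z: "Tsol f \<zeta> \<zeta>1 m" "\<And>t. norm (\<zeta> t) \<le> C * F \<and> norm (\<zeta>1 t) \<le> C * F"
      using solve[OF f F] by blast
    have D: "Tsol (\<lambda>t. 0) (\<lambda>t. \<xi> t - \<zeta> t) (\<lambda>t. \<xi>1 t - \<zeta>1 t) (l - m)" using Tsol_diff[OF T Z(1)] by simp
    have e: "\<xi> = \<zeta>" using Tsol_zero(1)[OF D nc] by auto
    have "(\<xi> has_vector_derivative \<xi>1 t) (at t)" "(\<zeta> has_vector_derivative \<zeta>1 t) (at t)"
      using T Z(1) unfolding Tsol_def by blast+
    then have "\<xi>1 t = \<zeta>1 t" unfolding e by (rule vector_derivative_unique_at)
    then show "norm (\<xi> t) \<le> C * F \<and> norm (\<xi>1 t) \<le> C * F" using Z(2)[of t] e by simp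
  qed
qed

section \<open>The contraction\<close>

abbreviation v' where "v' t \<equiv> D1 v t 1"
abbreviation v'' where "v'' t \<equiv> D1 (\<lambda>t. D1 v t 1) t 1"

lemma v': "(v has_vector_derivative v' t) (at t)" "(v' has_vector_derivative v'' t) (at t)"
  "continuous_on UNIV v'" "continuous_on UNIV v''" "v' (t + 1) = v' t" "v'' (t + 1) = v'' t"
proof -
  show 1: "(v has_vector_derivative v' t) (at t)" for t by (rule Ck_on_real_derivative(1)[OF Ck_v])
  have C1: "Ck_on k UNIV v'" for k by (rule Ck_on_real_derivative(2)[OF Ck_v])
  show 2: "(v' has_vector_derivative v'' t) (at t)" for t by (rule Ck_on_real_derivative(1)[OF C1])
  show "continuous_on UNIV v'" using C1[of 0] by simp
  show "continuous_on UNIV v''" using Ck_on_real_derivative(2)[OF C1, of 0] by simp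
  show 3: "v' (t + 1) = v' t" for t by (rule periodic_vector_derivative[OF 1 v_periodic])
  show "v'' (t + 1) = v'' t" by (rule periodic_vector_derivative[OF 2 3])
qed

text \<open>\<open>G\<close> vanishes on \<open>M\<close>, so this is \<open>G\<close> near the loop
  minus its linear part.\<close>

definition remainder where "remainder t z = G (x0 t + z) - DG (x0 t) z"

lemma DG_taylor:
  obtains c where "c \<ge> 0"
    "\<And>t z w. norm z \<le> 1 \<Longrightarrow> norm (DG (x0 t + z) w - DG (x0 t) w - D2 G (x0 t) z w) \<le> c * (norm z)\<^sup>2 * norm w"
proof -
  obtain r where r: "M \<subseteq> cball 0 r"
    using compact_imp_bounded[OF compact_M] unfolding bounded_iff by (auto simp: subset_iff)
  have "\<exists>C\<ge>0. \<forall>x\<in>cball 0 r. \<forall>z. norm z \<le> 1 \<longrightarrow> norm (DG (x + z) i - DG x i - D2 G x z i) \<le> C * (norm z)\<^sup>2" for i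
    unfolding D2_def by (rule Ck_taylor1) (rule Ck_DG)
  then obtain k where k: "\<And>i. k i \<ge> 0"
    "\<And>i x z. x \<in> cball 0 r \<Longrightarrow> norm z \<le> 1 \<Longrightarrow> norm (DG (x + z) i - DG x i - D2 G x z i) \<le> k i * (norm z)\<^sup>2"
    by metis
  define m where "m = (\<Sum>i\<in>Basis. k i)"
  have m: "m \<ge> 0" unfolding m_def by (intro sum_nonneg k)
  show ?thesis
  proof (rule that[of "real DIM(real^'n) * m"])
    show "0 \<le> real DIM(real^'n) * m" using m by simp
    fix t and z w :: "real^'n" assume z: "norm z \<le> 1"
    have x: "x0 t \<in> cball 0 r" using x0_in_M r by blast
    have "norm (DG (x0 t + z) w - DG (x0 t) w - D2 G (x0 t) z w) \<le> (real DIM(real^'n) * (m * (norm z)\<^sup>2)) * norm w"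
    proof (rule norm_linear_le_basis)
      show "linear (\<lambda>w. DG (x0 t + z) w - DG (x0 t) w - D2 G (x0 t) z w)"
        by (intro linear_compose_sub linear_DG linear_D2_right[OF open_UNIV Ck_G UNIV_I])
      fix i :: "real^'n" assume i: "i \<in> Basis"
      have "k i \<le> m" unfolding m_def using i k(1) by (intro member_le_sum) auto
      then have "k i * (norm z)\<^sup>2 \<le> m * (norm z)\<^sup>2" by (intro mult_right_mono) auto
      then show "norm (DG (x0 t + z) i - DG (x0 t) i - D2 G (x0 t) z i) \<le> m * (norm z)\<^sup>2"
        using k(2)[OF x z, of i] by linarith
    qed
    then show "norm (DG (x0 t + z) w - DG (x0 t) w - D2 G (x0 t) z w) \<le> real DIM(real^'n) * m * (norm z)\<^sup>2 * norm w"
      by (simp add: mult.assoc)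
  qed
qed

lemma linear_D2G: "linear (\<lambda>z. D2 G x z w)" "linear (D2 G x w)"
  by (rule linear_D2_left[OF open_UNIV Ck_G UNIV_I], rule linear_D2_right[OF open_UNIV Ck_G UNIV_I])

text \<open>The quadratic part is kept explicit because its tangential component has a structure
  that a norm bound would lose, see \<open>P_D2G_tangent\<close>. The rest has a derivative of size
  \<open>r\<^sup>2\<close> by \<open>DG_taylor\<close>, and the difference of the quadratic parts is
  a single value of \<open>D2 G\<close> by symmetry.\<close>

lemma remainder_quadratic:
  obtains c where "c \<ge> 0"
    "\<And>t z w r. norm z \<le> r \<Longrightarrow> norm w \<le> r \<Longrightarrow> r \<le> 1 \<Longrightarrow>
       norm (remainder t z - remainder t w - (1/2) *\<^sub>R D2 G (x0 t) (z + w) (z - w)) \<le> c * r\<^sup>2 * norm (z - w)"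
proof -
  obtain c where c: "c \<ge> 0"
    "\<And>t z w. norm z \<le> 1 \<Longrightarrow> norm (DG (x0 t + z) w - DG (x0 t) w - D2 G (x0 t) z w) \<le> c * (norm z)\<^sup>2 * norm w"
    using DG_taylor by blast
  show ?thesis
  proof (rule that[OF c(1)])
    fix t and z w :: "real^'n" and r :: real assume zw: "norm z \<le> r" "norm w \<le> r" and r: "r \<le> 1"
    have r0: "r \<ge> 0" using zw(1) norm_ge_zero[of z] by linarith
    define E where "E = (\<lambda>z. remainder t z - (1/2) *\<^sub>R D2 G (x0 t) z z)"
    let ?E' = "\<lambda>z u. DG (x0 t + z) u - DG (x0 t) u - D2 G (x0 t) z u"
    have "(E has_derivative ?E' y) (at y within cball 0 r)" for y
    proof -
      have bl: "bounded_linear (DG (x0 t))" by (simp add: linear_DG linear_conv_bounded_linear[symmetric])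
      have 1: "((\<lambda>z. G (x0 t + z)) has_derivative (\<lambda>u. DG (x0 t + y) u)) (at y)"
        by (rule has_derivative_compose[OF _ G_has_derivative]) (auto intro!: derivative_eq_intros)
      have bb: "bounded_bilinear (D2 G (x0 t))"
        unfolding bilinear_conv_bounded_bilinear[symmetric] bilinear_def using linear_D2G by blast
      have 2: "((\<lambda>z. D2 G (x0 t) z z) has_derivative (\<lambda>u. D2 G (x0 t) y u + D2 G (x0 t) u y)) (at y)"
        using bounded_bilinear.FDERIV[OF bb has_derivative_ident has_derivative_ident] .
      have "(E has_derivative (\<lambda>u. DG (x0 t + y) u - DG (x0 t) u - (1/2) *\<^sub>R (D2 G (x0 t) y u + D2 G (x0 t) u y))) (at y)"
        unfolding E_def remainder_def
        by (intro has_derivative_diff has_derivative_scaleR_right 1 2 bounded_linear_imp_has_derivative[OF bl])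
      moreover have "(1/2) *\<^sub>R (D2 G (x0 t) y u + D2 G (x0 t) u y) = D2 G (x0 t) y u" for u
        by (subst D2G_commute[of _ u y]) (simp add: scaleR_2[symmetric])
      ultimately show ?thesis using has_derivative_at_withinI by auto
    qed
    moreover have "onorm (?E' y) \<le> c * r\<^sup>2" if y: "y \<in> cball 0 r" for y
    proof (rule onorm_le)
      fix u
      have yr: "norm y \<le> r" using y by simp
      then have "norm (?E' y u) \<le> c * (norm y)\<^sup>2 * norm u" using r by (intro c(2)) simp
      also have "\<dots> \<le> c * r\<^sup>2 * norm u" using yr c(1) by (intro mult_right_mono mult_left_mono power_mono) auto
      finally show "norm (?E' y u) \<le> c * r\<^sup>2 * norm u" .
    qed
    ultimately have le: "norm (E z - E w) \<le> c * r\<^sup>2 * norm (z - w)"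
      by (rule differentiable_bound[OF convex_cball]) (use zw in auto)
    have "D2 G (x0 t) (z + w) (z - w) = D2 G (x0 t) z z - D2 G (x0 t) w w"
      using D2G_commute[of "x0 t" z w] by (simp add: linear_add[OF linear_D2G(1)] linear_diff[OF linear_D2G(2)])
    then have "E z - E w = remainder t z - remainder t w - (1/2) *\<^sub>R D2 G (x0 t) (z + w) (z - w)"
      by (simp add: E_def scaleR_diff_right)
    then show "norm (remainder t z - remainder t w - (1/2) *\<^sub>R D2 G (x0 t) (z + w) (z - w)) \<le> c * r\<^sup>2 * norm (z - w)"
      using le by simp
  qed
qed

section \<open>Lipschitz estimates for the forcing\<close>

definition shift where "shift \<delta> t \<xi> a = \<delta>^8 *\<^sub>R v t + \<xi> + a *\<^sub>R n t" for \<delta> a :: real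

text \<open>What remains of the equation once the force of \<open>\<delta>^8 *\<^sub>R v t\<close>
  has cancelled \<open>x2\<close> and the term \<open>b t / \<delta>^8 * a\<close> has gone to
  \<open>Nsol\<close>. The last two summands compensate the terms that occur in \<open>Tsol\<close>
  with the opposite sign.\<close>

definition forcing where
  "forcing \<delta> t \<xi> \<xi>1 a a1 = - ((2 * a1) *\<^sub>R n' t + a *\<^sub>R n'' t + \<delta>^8 *\<^sub>R v'' t + (1/\<delta>^8) *\<^sub>R remainder t (shift \<delta> t \<xi> a))
     + P t (Bv t \<xi>) + (2 * (n' t \<bullet> \<xi>1) + n'' t \<bullet> \<xi>) *\<^sub>R n t" for \<delta> a a1 :: real

text \<open>In the Lipschitz constant of the forcing, the remainder contributes \<open>1 / \<delta>\<^sup>2\<close> in the normal direction but only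
  \<open>\<delta>\<^sup>3\<close> in the tangential ones; the weight makes both small.\<close>

definition weighted where "weighted \<delta> t F = P t F + (\<delta>^3 * (n t \<bullet> F)) *\<^sub>R n t" for \<delta> :: real

lemma norm_n: "norm (n t) = 1" using nn[of t] by (simp add: norm_eq_1)

lemma P_n: "P t (n t) = 0" by (simp add: P_def nn)

lemma P_P: "P t (P t w) = P t w" by (rule P_id) (simp add: inner_commute P_tangent)

text \<open>By \<open>D2G_tangent\<close> the second derivative of \<open>G\<close> at two tangent
  vectors is normal. Otherwise the part quadratic in \<open>\<xi>\<close> would contribute a
  tangential Lipschitz constant of order \<delta>^(-2).\<close>

lemma P_D2G_tangent: "u \<bullet> n t = 0 \<Longrightarrow> w \<bullet> n t = 0 \<Longrightarrow> P t (D2 G (x0 t) u w) = 0"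
  by (subst D2G_tangent[OF x0_in_M]) (simp_all add: linear_scale[OF linear_P] P_n)

lemma linear_weighted: "linear (weighted \<delta> t)"
  unfolding weighted_def by (intro linearI) (simp_all add: linear_add[OF linear_P] linear_scale[OF linear_P] inner_add_right algebra_simps)

text \<open>\<open>D\<close> stands for the distance of two forcings, and the bounds on differences
  are the gains of \<open>decoupled_solver\<close>. In the tangential estimate the pairing of
  \<open>\<delta>^8 *\<^sub>R v t\<close> with \<open>\<xi> - \<zeta>\<close> is subtracted and two
  tangent vectors give nothing; each remaining term involves a normal amplitude or is cubic, and so
  is of order \<delta>^11 or better.\<close>

lemma remainder_lipschitz:
  assumes c: "c \<ge> 1" "\<And>t. norm (v t) \<le> c"
    and CB: "\<And>t u w. norm (D2 G (x0 t) u w) \<le> c * (norm u * norm w)"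
    and R: "\<And>t z w r. norm z \<le> r \<Longrightarrow> norm w \<le> r \<Longrightarrow> r \<le> 1 \<Longrightarrow>
       norm (remainder t z - remainder t w - (1/2) *\<^sub>R D2 G (x0 t) (z + w) (z - w)) \<le> c * r\<^sup>2 * norm (z - w)"
    and \<delta>: "0 < \<delta>" "3 * c * \<delta>^6 \<le> 1" and D: "D \<ge> 0"
    and \<xi>: "norm \<xi> \<le> c * \<delta>^6" "norm \<zeta> \<le> c * \<delta>^6" "\<xi> \<bullet> n t = 0" "\<zeta> \<bullet> n t = 0" "norm (\<xi> - \<zeta>) \<le> c * D"
    and a: "\<bar>a\<bar> \<le> c * \<delta>^11" "\<bar>d\<bar> \<le> c * \<delta>^11" "\<bar>a - d\<bar> \<le> c * \<delta>^5 * D"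
  shows "norm (remainder t (shift \<delta> t \<xi> a) - remainder t (shift \<delta> t \<zeta> d)) \<le> 12 * c^3 * \<delta>^6 * D"
    "norm (P t (remainder t (shift \<delta> t \<xi> a) - remainder t (shift \<delta> t \<zeta> d)) - \<delta>^8 *\<^sub>R P t (Bv t (\<xi> - \<zeta>))) \<le> 22 * c^4 * \<delta>^11 * D"
proof -
  let ?z = "shift \<delta> t \<xi> a" and ?w = "shift \<delta> t \<zeta> d" and ?B = "D2 G (x0 t)"
  have c0: "0 \<le> c" using c by simp
  have \<delta>6: "\<delta>^6 \<le> 1"
  proof -
    have "1 * \<delta>^6 \<le> 3 * c * \<delta>^6" using c \<delta>(1) by (intro mult_right_mono) auto
    then show ?thesis using \<delta>(2) by simp
  qed
  have \<delta>1: "\<delta> \<le> 1" using power_le_one_iff[of \<delta> 6] \<delta>6 \<delta>(1) by simp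
  have pw: "\<delta>^j \<le> \<delta>^i" if "i \<le> j" for i j by (rule power_decreasing[OF that]) (use \<delta> \<delta>1 in auto)
  have r: "norm ?z \<le> 3 * c * \<delta>^6" "norm ?w \<le> 3 * c * \<delta>^6"
  proof -
    have g: "norm (shift \<delta> t x s) \<le> 3 * c * \<delta>^6" if "norm x \<le> c * \<delta>^6" "\<bar>s\<bar> \<le> c * \<delta>^11" for x and s :: real
    proof -
      have "norm (shift \<delta> t x s) \<le> norm (\<delta>^8 *\<^sub>R v t) + norm x + norm (s *\<^sub>R n t)"
        unfolding shift_def by (meson norm_triangle_ineq add_right_mono order_trans)
      moreover have "norm (\<delta>^8 *\<^sub>R v t) \<le> \<delta>^6 * c"
        using mult_mono[OF pw[of 6 8] c(2)[of t]] \<delta>(1) by simp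
      moreover have "c * \<delta>^11 \<le> c * \<delta>^6" using pw[of 6 11] c0 by (intro mult_left_mono) auto
      ultimately show ?thesis using that by (simp add: norm_n mult.commute)
    qed
    show "norm ?z \<le> 3 * c * \<delta>^6" "norm ?w \<le> 3 * c * \<delta>^6" using g \<xi> a by blast+
  qed
  \<comment> \<open>The cubic error, of order \<delta>^12.\<close>
  define e where "e = remainder t ?z - remainder t ?w - (1/2) *\<^sub>R ?B (?z + ?w) (?z - ?w)"
  have zw: "?z - ?w = (\<xi> - \<zeta>) + (a - d) *\<^sub>R n t" by (simp add: shift_def algebra_simps)
  have c5: "c * \<delta>^5 * D \<le> c * D" using c0 D pw[of 0 5] mult_right_mono[of "c * \<delta>^5" c D] mult_left_mono[of "\<delta>^5" 1 c] by simp
  have nzw: "norm (?z - ?w) \<le> 2 * c * D"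
    unfolding zw using norm_triangle_ineq[of "\<xi> - \<zeta>" "(a - d) *\<^sub>R n t"] \<xi>(5) a(3) c5 by (simp add: norm_n)
  have szw: "norm (?z + ?w) \<le> 6 * c * \<delta>^6" using norm_triangle_ineq[of ?z ?w] r by linarith
  have e: "norm e \<le> 18 * c^4 * \<delta>^12 * D"
  proof -
    have "norm e \<le> c * (3 * c * \<delta>^6)\<^sup>2 * norm (?z - ?w)" unfolding e_def by (rule R[OF r \<delta>(2)])
    also have "\<dots> \<le> c * (3 * c * \<delta>^6)\<^sup>2 * (2 * c * D)" using c0 nzw by (intro mult_left_mono) auto
    also have "\<dots> = 18 * c^4 * \<delta>^12 * D" by (simp add: power_mult_distrib power2_eq_square power_numeral_reduce algebra_simps)
    finally show ?thesis .
  qed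
  have Bh: "norm ((1/2) *\<^sub>R ?B x y) \<le> c * (p * q) / 2" if "norm x \<le> p" "norm y \<le> q" for x y p q
  proof -
    have p0: "0 \<le> p" using that(1) norm_ge_zero[of x] by linarith
    have "norm x * norm y \<le> p * q" using that p0 by (intro mult_mono) auto
    then have "c * (norm x * norm y) \<le> c * (p * q)" using c0 by (rule mult_left_mono)
    then show ?thesis using CB[of t x y] by simp
  qed
  have "norm (remainder t ?z - remainder t ?w) \<le> norm ((1/2) *\<^sub>R ?B (?z + ?w) (?z - ?w)) + norm e"
    using norm_triangle_ineq[of "(1/2) *\<^sub>R ?B (?z + ?w) (?z - ?w)" e] by (simp add: e_def)
  also have "\<dots> \<le> c * ((6 * c * \<delta>^6) * (2 * c * D)) / 2 + 18 * c^4 * \<delta>^12 * D" by (intro add_mono Bh szw nzw e)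
  also have "\<dots> = 6 * c^3 * \<delta>^6 * D + (6 * c^3 * \<delta>^6 * D) * (3 * c * \<delta>^6)"
    by (simp add: power_numeral_reduce algebra_simps)
  also have "\<dots> \<le> 6 * c^3 * \<delta>^6 * D + (6 * c^3 * \<delta>^6 * D) * 1"
    using c0 \<delta> D by (intro add_left_mono mult_left_mono) auto
  finally show "norm (remainder t ?z - remainder t ?w) \<le> 12 * c^3 * \<delta>^6 * D" by (simp add: mult_ac)
  have "?B (?z + ?w) (\<xi> - \<zeta>) = 2 *\<^sub>R (\<delta>^8 *\<^sub>R Bv t (\<xi> - \<zeta>)) + ?B (\<xi> + \<zeta>) (\<xi> - \<zeta>) + ?B ((a + d) *\<^sub>R n t) (\<xi> - \<zeta>)"
  proof -
    have "?z + ?w = 2 *\<^sub>R (\<delta>^8 *\<^sub>R v t) + (\<xi> + \<zeta>) + (a + d) *\<^sub>R n t" by (simp only: shift_def scaleR_2 scaleR_add_left add_ac)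
    then show ?thesis by (simp only: linear_add[OF linear_D2G(1)] linear_scale[OF linear_D2G(1)])
  qed
  moreover have "?B (?z + ?w) (?z - ?w) = ?B (?z + ?w) (\<xi> - \<zeta>) + ?B (?z + ?w) ((a - d) *\<^sub>R n t)"
    unfolding zw by (rule linear_add[OF linear_D2G(2)])
  ultimately have "remainder t ?z - remainder t ?w = \<delta>^8 *\<^sub>R Bv t (\<xi> - \<zeta>) + (1/2) *\<^sub>R ?B (\<xi> + \<zeta>) (\<xi> - \<zeta>)
      + ((1/2) *\<^sub>R ?B ((a + d) *\<^sub>R n t) (\<xi> - \<zeta>) + (1/2) *\<^sub>R ?B (?z + ?w) ((a - d) *\<^sub>R n t) + e)"
    by (simp add: e_def algebra_simps)
  moreover have "P t (?B (\<xi> + \<zeta>) (\<xi> - \<zeta>)) = 0"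
    by (rule P_D2G_tangent) (simp_all add: \<xi> inner_add_left inner_diff_left)
  ultimately have "P t (remainder t ?z - remainder t ?w) - \<delta>^8 *\<^sub>R P t (Bv t (\<xi> - \<zeta>)) =
      P t ((1/2) *\<^sub>R ?B ((a + d) *\<^sub>R n t) (\<xi> - \<zeta>) + (1/2) *\<^sub>R ?B (?z + ?w) ((a - d) *\<^sub>R n t) + e)"
    by (simp only: linear_add[OF linear_P] linear_scale[OF linear_P]) simp
  also have "norm \<dots> \<le> norm ((1/2) *\<^sub>R ?B ((a + d) *\<^sub>R n t) (\<xi> - \<zeta>)) + norm ((1/2) *\<^sub>R ?B (?z + ?w) ((a - d) *\<^sub>R n t)) + norm e"
    by (rule order_trans[OF norm_P]) (meson norm_triangle_ineq add_right_mono order_trans)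
  also have "\<dots> \<le> c * ((2 * c * \<delta>^11) * (c * D)) / 2 + c * ((6 * c * \<delta>^6) * (c * \<delta>^5 * D)) / 2 + 18 * c^4 * \<delta>^12 * D"
    using a \<xi>(5) szw e by (intro add_mono Bh) (auto simp: norm_n)
  also have "\<dots> = 4 * (c^3 * (\<delta>^11 * D)) + 18 * (c^4 * (\<delta>^12 * D))"
    by (simp add: power_numeral_reduce algebra_simps)
  also have "\<dots> \<le> 4 * (c^4 * (\<delta>^11 * D)) + 18 * (c^4 * (\<delta>^11 * D))"
    using pw[of 11 12] power_increasing[of 3 4 c] c c0 D \<delta>(1)
    by (intro add_mono mult_left_mono mult_right_mono) auto
  finally show "norm (P t (remainder t ?z - remainder t ?w) - \<delta>^8 *\<^sub>R P t (Bv t (\<xi> - \<zeta>))) \<le> 22 * c^4 * \<delta>^11 * D"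
    by (simp add: mult_ac)
qed

text \<open>The remainder enters tangentially with \<delta>^11/\<delta>^8 = \<delta>^3 and, after
  weighting, normally with \<delta>^3 \<delta>^6/\<delta>^8 = \<delta>. The summand
  \<open>P t (Bv t \<xi>)\<close> of the forcing cancels the tangential part of the remainder that
  is of order one.\<close>

lemma weighted_forcing_lipschitz:
  assumes c: "c \<ge> 1" "\<And>t. norm (v t) \<le> c" "\<And>t. norm (n' t) \<le> c" "\<And>t. norm (n'' t) \<le> c"
    and CB: "\<And>t u w. norm (D2 G (x0 t) u w) \<le> c * (norm u * norm w)"
    and R: "\<And>t z w r. norm z \<le> r \<Longrightarrow> norm w \<le> r \<Longrightarrow> r \<le> 1 \<Longrightarrow>
       norm (remainder t z - remainder t w - (1/2) *\<^sub>R D2 G (x0 t) (z + w) (z - w)) \<le> c * r\<^sup>2 * norm (z - w)"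
    and \<delta>: "0 < \<delta>" "\<delta> \<le> 1" "3 * c * \<delta>^6 \<le> 1" and D: "D \<ge> 0"
    and \<xi>: "norm \<xi> \<le> c * \<delta>^6" "norm \<zeta> \<le> c * \<delta>^6" "\<xi> \<bullet> n t = 0" "\<zeta> \<bullet> n t = 0" "norm (\<xi> - \<zeta>) \<le> c * D"
    and \<xi>1: "norm (\<xi>1 - \<zeta>1) \<le> c * D"
    and a: "\<bar>a\<bar> \<le> c * \<delta>^11" "\<bar>d\<bar> \<le> c * \<delta>^11" "\<bar>a - d\<bar> \<le> c * \<delta>^5 * D"
    and a1: "\<bar>a1 - d1\<bar> \<le> c * \<delta> * D"
  shows "norm (weighted \<delta> t (forcing \<delta> t \<xi> \<xi>1 a a1) - weighted \<delta> t (forcing \<delta> t \<zeta> \<zeta>1 d d1)) \<le> 44 * (c^4 * \<delta> * D)"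
proof -
  have c0: "0 \<le> c" using c by simp
  define S where "S = remainder t (shift \<delta> t \<xi> a) - remainder t (shift \<delta> t \<zeta> d)"
  note S = remainder_lipschitz[OF c(1,2) CB R \<delta>(1,3) D \<xi> a, folded S_def]
  define Q where "Q = P t (Bv t (\<xi> - \<zeta>))"
  define A where "A = (2 * (a1 - d1)) *\<^sub>R n' t + (a - d) *\<^sub>R n'' t"
  define s where "s = 2 * (n' t \<bullet> (\<xi>1 - \<zeta>1)) + n'' t \<bullet> (\<xi> - \<zeta>)"
  define F where "F = - A - (1/\<delta>^8) *\<^sub>R S + Q + s *\<^sub>R n t"
  \<comment> \<open>Every term is dominated by the one expression \<open>c^4 * \<delta> * D\<close>;
    the numerals 25 and 19 below count terms with their coefficients.\<close>
  have mono: "c^i * \<delta>^j * D \<le> c^4 * \<delta> * D" if "i \<le> 4" "1 \<le> j" for i j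
    using power_increasing[OF that(1) c(1)] power_decreasing[OF that(2), of \<delta>] c0 \<delta> D
    by (intro mult_right_mono mult_mono) auto
  have "forcing \<delta> t \<xi> \<xi>1 a a1 - forcing \<delta> t \<zeta> \<zeta>1 d d1 = F"
    unfolding forcing_def F_def A_def S_def Q_def s_def
    by (simp add: linear_diff[OF linear_Bv] linear_diff[OF linear_P] algebra_simps inner_diff_right)
  then have eq: "weighted \<delta> t (forcing \<delta> t \<xi> \<xi>1 a a1) - weighted \<delta> t (forcing \<delta> t \<zeta> \<zeta>1 d d1) = weighted \<delta> t F"
    by (simp add: linear_diff[OF linear_weighted, symmetric])
  have nA: "norm A \<le> 2 * (c * \<delta> * D * c) + c * \<delta>^5 * D * c"
  proof -
    have "norm A \<le> 2 * (\<bar>a1 - d1\<bar> * norm (n' t)) + \<bar>a - d\<bar> * norm (n'' t)"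
      unfolding A_def by (rule order_trans[OF norm_triangle_ineq]) (simp add: abs_mult del: right_diff_distrib_numeral)
    also have "\<dots> \<le> 2 * (c * \<delta> * D * c) + c * \<delta>^5 * D * c"
      using c0 \<delta> D by (intro add_mono mult_left_mono mult_mono a1 a(3) c(3,4)) auto
    finally show ?thesis .
  qed
  have nQ: "norm Q \<le> c * (c * (c * D))"
  proof -
    have "norm Q \<le> norm (Bv t (\<xi> - \<zeta>))" unfolding Q_def by (rule norm_P)
    also have "\<dots> \<le> c * (norm (v t) * norm (\<xi> - \<zeta>))" by (rule CB)
    also have "\<dots> \<le> c * (c * (c * D))" using c0 D by (intro mult_left_mono mult_mono c(2) \<xi>(5)) auto
    finally show ?thesis .
  qed
  have ns: "\<bar>s\<bar> \<le> 3 * (c * (c * D))"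
  proof -
    have "\<bar>s\<bar> \<le> 2 * (norm (n' t) * norm (\<xi>1 - \<zeta>1)) + norm (n'' t) * norm (\<xi> - \<zeta>)"
      unfolding s_def using Cauchy_Schwarz_ineq2[of "n' t" "\<xi>1 - \<zeta>1"] Cauchy_Schwarz_ineq2[of "n'' t" "\<xi> - \<zeta>"] by linarith
    also have "\<dots> \<le> 2 * (c * (c * D)) + c * (c * D)"
      using c0 D by (intro add_mono mult_left_mono mult_mono \<xi>1 \<xi>(5) c(3,4)) auto
    finally show ?thesis by (simp add: mult_ac)
  qed
  \<comment> \<open>The order-one term \<open>Q\<close> is joined to the remainder, where the
    sharper estimate \<open>S(2)\<close> applies.\<close>
  have "P t F = - P t A - (1/\<delta>^8) *\<^sub>R (P t S - \<delta>^8 *\<^sub>R Q)"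
    unfolding F_def using \<delta>(1) P_P[of t "Bv t (\<xi> - \<zeta>)"]
    by (simp add: linear_add[OF linear_P] linear_diff[OF linear_P] linear_scale[OF linear_P] linear_neg[OF linear_P] P_n
        scaleR_diff_right Q_def)
  then have "norm (P t F) \<le> norm A + (1/\<delta>^8) * norm (P t S - \<delta>^8 *\<^sub>R Q)"
    using norm_triangle_ineq4[of "- P t A" "(1/\<delta>^8) *\<^sub>R (P t S - \<delta>^8 *\<^sub>R Q)"] norm_P[of t A] \<delta>(1) by simp
  also have "\<dots> \<le> norm A + (1/\<delta>^8) * (22 * c^4 * \<delta>^11 * D)"
    using S(2) \<delta>(1) unfolding Q_def by (intro add_left_mono mult_left_mono) auto
  also have "\<dots> \<le> 2 * (c^2 * \<delta>^1 * D) + c^2 * \<delta>^5 * D + 22 * (c^4 * \<delta>^3 * D)"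
    using nA \<delta>(1) by (simp add: power_numeral_reduce field_simps)
  also have "\<dots> \<le> 25 * (c^4 * \<delta> * D)"
    using mono[of 2 1] mono[of 2 5] mono[of 4 3] by simp
  finally have 1: "norm (P t F) \<le> 25 * (c^4 * \<delta> * D)" .
  have "norm F \<le> norm A + (1/\<delta>^8) * norm S + norm Q + \<bar>s\<bar>"
  proof -
    have "norm F \<le> norm (- A) + norm ((1/\<delta>^8) *\<^sub>R S) + norm Q + norm (s *\<^sub>R n t)"
      unfolding F_def by (meson norm_triangle_ineq norm_triangle_ineq4 add_right_mono order_trans)
    then show ?thesis using \<delta>(1) by (simp add: norm_n)
  qed
  also have "\<dots> \<le> (2 * (c * \<delta> * D * c) + c * \<delta>^5 * D * c) + (1/\<delta>^8) * (12 * c^3 * \<delta>^6 * D) + c * (c * (c * D)) + 3 * (c * (c * D))"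
    using \<delta>(1) by (intro add_mono mult_left_mono nA S(1) nQ ns) auto
  finally have nF: "norm F \<le> (2 * (c * \<delta> * D * c) + c * \<delta>^5 * D * c) + (1/\<delta>^8) * (12 * c^3 * \<delta>^6 * D) + c * (c * (c * D)) + 3 * (c * (c * D))" .
  have "norm ((\<delta>^3 * (n t \<bullet> F)) *\<^sub>R n t) \<le> \<delta>^3 * norm F"
    using Cauchy_Schwarz_ineq2[of "n t" F] \<delta>(1) by (simp add: norm_n abs_mult)
  also have "\<dots> \<le> \<delta>^3 * ((2 * (c * \<delta> * D * c) + c * \<delta>^5 * D * c) + (1/\<delta>^8) * (12 * c^3 * \<delta>^6 * D) + c * (c * (c * D)) + 3 * (c * (c * D)))"
    using \<delta>(1) nF by (intro mult_left_mono) auto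
  also have "\<dots> = 2 * (c^2 * \<delta>^4 * D) + c^2 * \<delta>^8 * D + 12 * (c^3 * \<delta>^1 * D) + c^3 * \<delta>^3 * D + 3 * (c^2 * \<delta>^3 * D)"
    using \<delta>(1) by (simp add: power_numeral_reduce field_simps)
  also have "\<dots> \<le> 19 * (c^4 * \<delta> * D)"
    using mono[of 2 4] mono[of 2 8] mono[of 3 1] mono[of 3 3] mono[of 2 3] by simp
  finally have 2: "norm ((\<delta>^3 * (n t \<bullet> F)) *\<^sub>R n t) \<le> 19 * (c^4 * \<delta> * D)" .
  show ?thesis
    unfolding eq unfolding weighted_def
    using norm_triangle_ineq[of "P t F" "(\<delta>^3 * (n t \<bullet> F)) *\<^sub>R n t"] 1 2 by linarith
qed

text \<open>The value at the centre of the iteration. The remainder at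
  \<open>\<delta>^8 *\<^sub>R v t\<close> is of order \<delta>^16, so division by \<delta>^8 leaves
  \<delta>^8, well inside the ball of radius \<delta>^6 used later.\<close>

lemma weighted_forcing_zero:
  assumes c: "c \<ge> 1" "\<And>t. norm (v t) \<le> c" "\<And>t. norm (v'' t) \<le> c"
    and CB: "\<And>t u w. norm (D2 G (x0 t) u w) \<le> c * (norm u * norm w)"
    and R: "\<And>t z w r. norm z \<le> r \<Longrightarrow> norm w \<le> r \<Longrightarrow> r \<le> 1 \<Longrightarrow>
       norm (remainder t z - remainder t w - (1/2) *\<^sub>R D2 G (x0 t) (z + w) (z - w)) \<le> c * r\<^sup>2 * norm (z - w)"
    and \<delta>: "0 < \<delta>" "\<delta> \<le> 1" "c * \<delta>^8 \<le> 1"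
  shows "norm (weighted \<delta> t (forcing \<delta> t 0 0 0 0)) \<le> 6 * (c^3 * \<delta>^8)"
proof -
  have c0: "0 \<le> c" using c by simp
  let ?z = "\<delta>^8 *\<^sub>R v t" and ?B = "D2 G (x0 t)"
  have z: "norm ?z \<le> c * \<delta>^8" using c(2)[of t] \<delta>(1) by (simp add: mult.commute)
  have "remainder t 0 = 0" using critical_M x0_in_M by (simp add: remainder_def linear_0[OF linear_DG])
  then have 1: "norm (remainder t ?z - (1/2) *\<^sub>R ?B ?z ?z) \<le> c * (c * \<delta>^8)\<^sup>2 * norm ?z"
    using R[where t = t, OF z _ \<delta>(3), of 0] c0 \<delta>(1) by simp
  also have "\<dots> \<le> c * (c * \<delta>^8)\<^sup>2 * 1" using z \<delta>(3) c0 by (intro mult_left_mono) auto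
  finally have 1: "norm (remainder t ?z - (1/2) *\<^sub>R ?B ?z ?z) \<le> c * (c * \<delta>^8)\<^sup>2" by simp
  have "norm ((1/2) *\<^sub>R ?B ?z ?z) \<le> c * (norm ?z * norm ?z)" using CB[of t ?z ?z] norm_ge_zero[of "?B ?z ?z"] by (simp del: norm_ge_zero)
  also have "\<dots> \<le> c * (c * \<delta>^8)\<^sup>2" unfolding power2_eq_square using c0 z by (intro mult_left_mono mult_mono) auto
  finally have "norm (remainder t ?z) \<le> 2 * (c * (c * \<delta>^8)\<^sup>2)"
    using 1 norm_triangle_ineq[of "remainder t ?z - (1/2) *\<^sub>R ?B ?z ?z" "(1/2) *\<^sub>R ?B ?z ?z"] by simp
  then have "(1/\<delta>^8) * norm (remainder t ?z) \<le> (1/\<delta>^8) * (2 * (c * (c * \<delta>^8)\<^sup>2))"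
    using \<delta>(1) by (intro mult_left_mono) auto
  also have "\<dots> = 2 * (c^3 * \<delta>^8)" using \<delta>(1) by (simp add: power_numeral_reduce field_simps)
  finally have 2: "(1/\<delta>^8) * norm (remainder t ?z) \<le> 2 * (c^3 * \<delta>^8)" .
  have 3: "\<delta>^8 * norm (v'' t) \<le> c^3 * \<delta>^8"
  proof -
    have "c \<le> c^3" using power_increasing[of 1 3 c] c(1) by simp
    then have "norm (v'' t) \<le> c^3" using c(3)[of t] by linarith
    then show ?thesis using \<delta>(1) by (simp add: mult.commute)
  qed
  define F where "F = forcing \<delta> t 0 0 0 0"
  have "F = - (\<delta>^8 *\<^sub>R v'' t + (1/\<delta>^8) *\<^sub>R remainder t ?z)"
    by (simp add: F_def forcing_def shift_def linear_0[OF linear_Bv] linear_0[OF linear_P])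
  then have "norm F = norm (\<delta>^8 *\<^sub>R v'' t + (1/\<delta>^8) *\<^sub>R remainder t ?z)" by (simp only: norm_minus_cancel)
  then have "norm F \<le> \<delta>^8 * norm (v'' t) + (1/\<delta>^8) * norm (remainder t ?z)"
    using norm_triangle_ineq[of "\<delta>^8 *\<^sub>R v'' t" "(1/\<delta>^8) *\<^sub>R remainder t ?z"] \<delta>(1) by simp
  then have nF: "norm F \<le> 3 * (c^3 * \<delta>^8)" using 2 3 by linarith
  have "\<delta>^3 * \<bar>n t \<bullet> F\<bar> \<le> 1 * norm F"
    using Cauchy_Schwarz_ineq2[of "n t" F] \<delta> power_le_one[of \<delta> 3] by (intro mult_mono) (auto simp: norm_n)
  then have "norm ((\<delta>^3 * (n t \<bullet> F)) *\<^sub>R n t) \<le> norm F" using \<delta>(1) by (simp add: norm_n abs_mult)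
  then show ?thesis
    unfolding F_def[symmetric] weighted_def
    using norm_triangle_ineq[of "P t F" "(\<delta>^3 * (n t \<bullet> F)) *\<^sub>R n t"] norm_P[of t F] nF by linarith
qed

section \<open>The fixed point problem for the forcing\<close>

lemma forcing_continuous:
  assumes y: "continuous_on UNIV \<xi>" "continuous_on UNIV \<xi>1" "continuous_on UNIV a" "continuous_on UNIV a1"
  shows "continuous_on UNIV (\<lambda>t. weighted \<delta> t (forcing \<delta> t (\<xi> t) (\<xi>1 t) (a t) (a1 t)))"
proof -
  have n: "continuous_on UNIV n" by (rule continuous_on_of_vector_derivative[OF n'(1)])
  have P: "continuous_on UNIV f \<Longrightarrow> continuous_on UNIV (\<lambda>t. P t (f t))" for f
    unfolding P_def by (intro continuous_intros n)
  have s: "continuous_on UNIV (\<lambda>t. shift \<delta> t (\<xi> t) (a t))"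
    unfolding shift_def by (intro continuous_intros y n continuous_on_of_vector_derivative[OF v'(1)])
  have r: "continuous_on UNIV (\<lambda>t. remainder t (shift \<delta> t (\<xi> t) (a t)))"
    unfolding remainder_def
    by (intro continuous_on_diff continuous_on_compose2[OF Ck_on_imp_continuous_on[OF Ck_G]] continuous_on_add continuous_x0 s
        continuous_on_D1_apply[OF open_UNIV Ck_G] subset_UNIV)
  have "continuous_on UNIV (\<lambda>t. forcing \<delta> t (\<xi> t) (\<xi>1 t) (a t) (a1 t))"
    unfolding forcing_def by (intro continuous_intros P r y n n'(3,4) v'(4) continuous_Bv)
  then show ?thesis unfolding weighted_def by (intro continuous_intros P n)
qed

lemma forcing_periodic:
  assumes "\<And>t. \<xi> (t + 1) = \<xi> t" "\<And>t. \<xi>1 (t + 1) = \<xi>1 t" "\<And>t. a (t + 1) = a t" "\<And>t. a1 (t + 1) = a1 t"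
  shows "weighted \<delta> (t + 1) (forcing \<delta> (t + 1) (\<xi> (t + 1)) (\<xi>1 (t + 1)) (a (t + 1)) (a1 (t + 1))) =
    weighted \<delta> t (forcing \<delta> t (\<xi> t) (\<xi>1 t) (a t) (a1 t))"
  unfolding weighted_def forcing_def shift_def remainder_def P_def
  by (simp add: assms x0_periodic v_periodic n'(5,6) v'(6))

text \<open>\<open>H\<close> is the weighted forcing; the division by \<open>\<delta>^3\<close>
  undoes the weight.\<close>

definition decoupled where
  "decoupled \<delta> H \<xi> \<xi>1 l a a1 \<longleftrightarrow> Tsol (\<lambda>t. P t (H t)) \<xi> \<xi>1 l \<and> Nsol (\<lambda>t. b t / \<delta>^8) (\<lambda>t. (n t \<bullet> H t) / \<delta>^3) a a1"
  for \<delta> l :: real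

lemma decoupled_diff:
  assumes "decoupled \<delta> H \<xi> \<xi>1 l a a1" "decoupled \<delta> K \<zeta> \<zeta>1 m d d1"
  shows "decoupled \<delta> (\<lambda>t. H t - K t) (\<lambda>t. \<xi> t - \<zeta> t) (\<lambda>t. \<xi>1 t - \<zeta>1 t) (l - m) (\<lambda>t. a t - d t) (\<lambda>t. a1 t - d1 t)"
proof -
  have "Tsol (\<lambda>t. P t (H t) - P t (K t)) (\<lambda>t. \<xi> t - \<zeta> t) (\<lambda>t. \<xi>1 t - \<zeta>1 t) (l - m)"
    using Tsol_diff assms unfolding decoupled_def by blast
  moreover have "Nsol (\<lambda>t. b t / \<delta>^8) (\<lambda>t. (n t \<bullet> H t) / \<delta>^3 - (n t \<bullet> K t) / \<delta>^3) (\<lambda>t. a t - d t) (\<lambda>t. a1 t - d1 t)"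
    using Nsol_diff assms unfolding decoupled_def by blast
  ultimately show ?thesis unfolding decoupled_def by (simp add: linear_diff[OF linear_P] inner_diff_right diff_divide_distrib)
qed

lemma decoupled_regular:
  assumes "decoupled \<delta> H \<xi> \<xi>1 l a a1"
  shows "continuous_on UNIV \<xi>" "continuous_on UNIV \<xi>1" "continuous_on UNIV a" "continuous_on UNIV a1"
    "\<xi> (t + 1) = \<xi> t" "\<xi>1 (t + 1) = \<xi>1 t" "a (t + 1) = a t" "a1 (t + 1) = a1 t" "\<xi> t \<bullet> n t = 0"
proof -
  have T: "(\<xi> has_vector_derivative \<xi>1 t) (at t)" "\<exists>d. (\<xi>1 has_vector_derivative d) (at t)" "\<xi> (t + 1) = \<xi> t" "\<xi> t \<bullet> n t = 0"
    "(a has_vector_derivative a1 t) (at t)" "\<exists>d. (a1 has_vector_derivative d) (at t)" "a (t + 1) = a t" for t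
    using assms unfolding decoupled_def Tsol_def Nsol_def by blast+
  show "continuous_on UNIV \<xi>" by (rule continuous_on_of_vector_derivative[OF T(1)])
  show "continuous_on UNIV a" by (rule continuous_on_of_vector_derivative[OF T(5)])
  obtain d where d: "\<And>t. (\<xi>1 has_vector_derivative d t) (at t)" using T(2) by metis
  obtain e where e: "\<And>t. (a1 has_vector_derivative e t) (at t)" using T(6) by metis
  show "continuous_on UNIV \<xi>1" by (rule continuous_on_of_vector_derivative[OF d])
  show "continuous_on UNIV a1" by (rule continuous_on_of_vector_derivative[OF e])
  show "\<xi> (t + 1) = \<xi> t" "a (t + 1) = a t" "\<xi> t \<bullet> n t = 0" by (rule T)+
  show "\<xi>1 (t + 1) = \<xi>1 t" by (rule periodic_vector_derivative[OF T(1,3)])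
  show "a1 (t + 1) = a1 t" by (rule periodic_vector_derivative[OF T(5,7)])
qed

text \<open>A normal forcing of size \<open>h / \<delta>^3\<close> against a coefficient of order
  \<delta>^(-8) gives \<open>a\<close> of order \<open>\<delta>^5 * h\<close>, and interpolation
  costs \<delta>^4 for the derivative. In tangential directions nothing is gained.\<close>

lemma decoupled_solver:
  assumes nc: "x1 0 \<noteq> 0"
  obtains C where "C > 0"
    "\<And>\<delta> H. 0 < \<delta> \<Longrightarrow> continuous_on UNIV H \<Longrightarrow> (\<And>t. H (t + 1) = H t) \<Longrightarrow> \<exists>\<xi> \<xi>1 l a a1. decoupled \<delta> H \<xi> \<xi>1 l a a1"
    "\<And>\<delta> H \<xi> \<xi>1 l a a1 h t. 0 < \<delta> \<Longrightarrow> decoupled \<delta> H \<xi> \<xi>1 l a a1 \<Longrightarrow> continuous_on UNIV H \<Longrightarrow> (\<And>t. H (t + 1) = H t) \<Longrightarrow>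
       (\<And>t. norm (H t) \<le> h) \<Longrightarrow>
       norm (\<xi> t) \<le> C * h \<and> norm (\<xi>1 t) \<le> C * h \<and> \<bar>a t\<bar> \<le> C * \<delta>^5 * h \<and> \<bar>a1 t\<bar> \<le> C * \<delta> * h"
proof -
  obtain C where C: "C > 0"
    "\<And>f. continuous_on UNIV f \<Longrightarrow> (\<And>t. f (t + 1) = f t) \<Longrightarrow> (\<And>t. n t \<bullet> f t = 0) \<Longrightarrow> \<exists>\<xi> \<xi>1 l. Tsol f \<xi> \<xi>1 l"
    "\<And>f \<xi> \<xi>1 l F t. continuous_on UNIV f \<Longrightarrow> (\<And>t. f (t + 1) = f t) \<Longrightarrow> (\<And>t. n t \<bullet> f t = 0) \<Longrightarrow>
       Tsol f \<xi> \<xi>1 l \<Longrightarrow> (\<And>t. norm (f t) \<le> F) \<Longrightarrow> norm (\<xi> t) \<le> C * F \<and> norm (\<xi>1 t) \<le> C * F"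
    by (rule Tsol_solver[OF nc]) blast
  have n: "continuous_on UNIV n" by (rule continuous_on_of_vector_derivative[OF n'(1)])
  have cb: "continuous_on UNIV b" using Ck_b[of 0] by simp
  obtain b1 where b1: "b1 > 0" "\<And>t. norm (b t) \<le> b1"
    using periodic_bounded[OF cb] by (auto simp: x0_periodic)
  have "continuous_on UNIV (\<lambda>t. inverse (b t))" by (intro continuous_intros cb) (simp add: b_nz)
  then obtain q where q: "q > 0" "\<And>t. norm (inverse (b t)) \<le> q"
    using periodic_bounded[of "\<lambda>t. inverse (b t)"] by (auto simp: x0_periodic)
  have b: "1 / q \<le> b t" "b t \<le> b1" for t
    using q(1) q(2)[of t] b1(2)[of t] b_pos[of t] by (simp_all add: field_simps)
  define K where "K = C + q + (2 * q + b1 * q + 1)"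
  have K: "C \<le> K" "q \<le> K" "2 * q + b1 * q + 1 \<le> K" using C(1) q(1) b1(1) by (simp_all add: K_def)
  have reg: "continuous_on UNIV (\<lambda>t. P t (H t))" "P (t + 1) (H (t + 1)) = P t (H t)" "n t \<bullet> P t (H t) = 0"
    "continuous_on UNIV (\<lambda>t. (n t \<bullet> H t) / \<delta>^3)" "(n (t + 1) \<bullet> H (t + 1)) / \<delta>^3 = (n t \<bullet> H t) / \<delta>^3"
    if "0 < \<delta>" "continuous_on UNIV H" "\<And>t. H (t + 1) = H t" for H t and \<delta> :: real
    using that(1) unfolding P_tangent unfolding P_def
    by (intro continuous_intros n that(2) | simp add: that(3) x0_periodic)+
  show ?thesis
  proof (rule that[of K])
    show "K > 0" using K(1) C(1) by simp
    fix \<delta> :: real and H :: "real \<Rightarrow> real^'n" assume \<delta>: "0 < \<delta>" and H: "continuous_on UNIV H" "\<And>t. H (t + 1) = H t"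
    obtain \<xi> \<xi>1 l where 1: "Tsol (\<lambda>t. P t (H t)) \<xi> \<xi>1 l" using C(2)[OF reg(1,2,3)[OF \<delta> H]] by blast
    have "\<exists>a a1. Nsol (\<lambda>t. b t / \<delta>^8) (\<lambda>t. (n t \<bullet> H t) / \<delta>^3) a a1"
    proof (rule Nsol_exists)
      show "continuous_on UNIV (\<lambda>t. b t / \<delta>^8)" using \<delta> by (intro continuous_intros cb) auto
      show "(1 / q) / \<delta>^8 > 0" using \<delta> q(1) by simp
      show "(1 / q) / \<delta>^8 \<le> b t / \<delta>^8" for t using b(1)[of t] \<delta> by (intro divide_right_mono) auto
      show "b (t + 1) / \<delta>^8 = b t / \<delta>^8" for t by (simp add: x0_periodic)
    qed (rule reg(4,5)[OF \<delta> H])+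
    then show "\<exists>\<xi> \<xi>1 l a a1. decoupled \<delta> H \<xi> \<xi>1 l a a1" using 1 unfolding decoupled_def by blast
  next
    fix \<delta> l h t :: real and H \<xi> \<xi>1 a a1
    assume \<delta>: "0 < \<delta>" and s: "decoupled \<delta> H \<xi> \<xi>1 l a a1" and H: "continuous_on UNIV H" "\<And>t. H (t + 1) = H t" and h: "\<And>t. norm (H t) \<le> h"
    have h0: "h \<ge> 0" using order_trans[OF norm_ge_zero h[of 0]] .
    have "norm (P t (H t)) \<le> h" for t using norm_P h order_trans by blast
    then have 1: "norm (\<xi> t) \<le> C * h \<and> norm (\<xi>1 t) \<le> C * h"
      using C(3)[OF reg(1,2,3)[OF \<delta> H]] s unfolding decoupled_def by blast
    have N: "Nsol (\<lambda>t. b t / \<delta>^8) (\<lambda>t. (n t \<bullet> H t) / \<delta>^3) a a1" using s unfolding decoupled_def by blast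
    have B: "(1 / q) / \<delta>^8 > 0" "(1 / q) / \<delta>^8 \<le> b t / \<delta>^8" "b t / \<delta>^8 \<le> b1 / \<delta>^8" for t
      using \<delta> q(1) divide_right_mono[OF b(1), of "\<delta>^8" t] divide_right_mono[OF b(2), of "\<delta>^8" t] by simp_all
    have g: "\<bar>(n t \<bullet> H t) / \<delta>^3\<bar> \<le> h / \<delta>^3" for t
      using Cauchy_Schwarz_ineq2[of "n t" "H t"] h[of t] \<delta> by (simp add: norm_n abs_divide divide_right_mono)
    \<comment> \<open>With the interpolation step \<open>\<delta>^4\<close> both terms of the bound
      for \<open>a1\<close> are of order \<open>\<delta> * h\<close>.\<close>
    have a: "\<bar>a t\<bar> \<le> (h / \<delta>^3) / ((1 / q) / \<delta>^8)" "\<bar>a1 t\<bar> \<le> 2 * ((h / \<delta>^3) / ((1 / q) / \<delta>^8)) / \<delta>^4 + \<delta>^4 * (b1 / \<delta>^8 * ((h / \<delta>^3) / ((1 / q) / \<delta>^8)) + h / \<delta>^3)"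
      using Nsol_bounds[OF N B g, of "\<delta>^4" t] \<delta> by auto
    have e: "(h / \<delta>^3) / ((1 / q) / \<delta>^8) = q * (\<delta>^5 * h)" using \<delta> q(1) by (simp add: power_numeral_reduce field_simps)
    have e2: "2 * (q * (\<delta>^5 * h)) / \<delta>^4 + \<delta>^4 * (b1 / \<delta>^8 * (q * (\<delta>^5 * h)) + h / \<delta>^3) = (2 * q + b1 * q + 1) * (\<delta> * h)"
      using \<delta> by (simp add: power_numeral_reduce field_simps)
    have m: "k * s \<le> K * s" if "k \<le> K" "0 \<le> s" for k s using that by (rule mult_right_mono)
    have "\<bar>a t\<bar> \<le> K * (\<delta>^5 * h)" by (rule order_trans[OF a(1)[unfolded e] m[OF K(2)]]) (use h0 \<delta> in simp)
    moreover have "\<bar>a1 t\<bar> \<le> K * (\<delta> * h)" by (rule order_trans[OF a(2)[unfolded e e2] m[OF K(3)]]) (use h0 \<delta> in simp)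
    moreover have "C * h \<le> K * h" using m[OF K(1) h0] .
    ultimately show "norm (\<xi> t) \<le> K * h \<and> norm (\<xi>1 t) \<le> K * h \<and> \<bar>a t\<bar> \<le> K * \<delta>^5 * h \<and> \<bar>a1 t\<bar> \<le> K * \<delta> * h"
      using 1 unfolding mult.assoc by linarith
  qed
qed

lemma weighted_decompose: "P t (weighted \<delta> t F) = P t F" "n t \<bullet> weighted \<delta> t F = \<delta>^3 * (n t \<bullet> F)"
  unfolding weighted_def
  by (simp_all add: linear_add[OF linear_P] linear_scale[OF linear_P] P_n P_P inner_add_right P_tangent nn)

lemma closed_periodic_bcontfun:
  fixes r :: real
  shows "closed {H :: real \<Rightarrow>\<^sub>C (real^'n). (\<forall>t. apply_bcontfun H (t + 1) = apply_bcontfun H t) \<and> (\<forall>t. norm (apply_bcontfun H t) \<le> r)}"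
proof -
  have ev: "continuous_on UNIV (\<lambda>H :: real \<Rightarrow>\<^sub>C (real^'n). apply_bcontfun H t)" for t
    unfolding continuous_on_iff using dist_fun_lt_imp_dist_val_lt by blast
  show ?thesis
    by (intro closed_Collect_conj closed_Collect_all closed_Collect_eq closed_Collect_le continuous_on_norm ev continuous_on_const)
qed

text \<open>The unknown of the contraction is the weighted forcing \<open>H\<close>. The linear
  solver controls the derivatives \<open>\<xi>1\<close> and \<open>a1\<close> by the sup norm of
  \<open>H\<close>, so the space of bounded continuous functions suffices.\<close>

lemma forced_solution:
  assumes nc: "x1 0 \<noteq> 0"
  obtains C \<delta>0 where "C > 0" "\<delta>0 > 0" "\<delta>0 \<le> 1"
    "\<And>\<delta>. 0 < \<delta> \<Longrightarrow> \<delta> \<le> \<delta>0 \<Longrightarrow> \<exists>H \<xi> \<xi>1 l a a1. decoupled \<delta> H \<xi> \<xi>1 l a a1 \<and>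
       (\<forall>t. H t = weighted \<delta> t (forcing \<delta> t (\<xi> t) (\<xi>1 t) (a t) (a1 t))) \<and>
       (\<forall>t. norm (\<xi> t) \<le> C * \<delta>^6 \<and> norm (\<xi>1 t) \<le> C * \<delta>^6 \<and> \<bar>a t\<bar> \<le> C * \<delta>^6 \<and> \<bar>a1 t\<bar> \<le> C * \<delta>^6)"
proof -
  obtain K where K: "K > 0"
    "\<And>\<delta> H. 0 < \<delta> \<Longrightarrow> continuous_on UNIV H \<Longrightarrow> (\<And>t. H (t + 1) = H t) \<Longrightarrow> \<exists>\<xi> \<xi>1 l a a1. decoupled \<delta> H \<xi> \<xi>1 l a a1"
    "\<And>\<delta> H \<xi> \<xi>1 l a a1 h t. 0 < \<delta> \<Longrightarrow> decoupled \<delta> H \<xi> \<xi>1 l a a1 \<Longrightarrow> continuous_on UNIV H \<Longrightarrow> (\<And>t. H (t + 1) = H t) \<Longrightarrow>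
       (\<And>t. norm (H t) \<le> h) \<Longrightarrow>
       norm (\<xi> t) \<le> K * h \<and> norm (\<xi>1 t) \<le> K * h \<and> \<bar>a t\<bar> \<le> K * \<delta>^5 * h \<and> \<bar>a1 t\<bar> \<le> K * \<delta> * h"
    by (rule decoupled_solver[OF nc]) blast
  have cv: "continuous_on UNIV v" by (rule continuous_on_of_vector_derivative[OF v'(1)])
  obtain N1 where N1: "N1 > 0" "\<And>t. norm (n' t) \<le> N1" using periodic_bounded[OF n'(3,5)] by blast
  obtain N2 where N2: "N2 > 0" "\<And>t. norm (n'' t) \<le> N2" using periodic_bounded[OF n'(4,6)] by blast
  obtain V0 where V0: "V0 > 0" "\<And>t. norm (v t) \<le> V0" using periodic_bounded[OF cv v_periodic] by blast
  obtain V2 where V2: "V2 > 0" "\<And>t. norm (v'' t) \<le> V2" using periodic_bounded[OF v'(4,6)] by blast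
  obtain CB where CB: "CB \<ge> 0" "\<And>x a c. x \<in> M \<Longrightarrow> norm (D2 G x a c) \<le> CB * (norm a * norm c)"
    using D2_bounded_on_compact[OF open_UNIV Ck_G compact_M] by auto
  obtain CR where CR: "CR \<ge> 0" "\<And>t z w r. norm z \<le> r \<Longrightarrow> norm w \<le> r \<Longrightarrow> r \<le> 1 \<Longrightarrow>
       norm (remainder t z - remainder t w - (1/2) *\<^sub>R D2 G (x0 t) (z + w) (z - w)) \<le> CR * r\<^sup>2 * norm (z - w)"
    using remainder_quadratic by blast
  \<comment> \<open>One constant for all bounds, at least 1 so that its powers are ordered.\<close>
  define c where "c = 1 + K + N1 + N2 + V0 + V2 + CB + CR"
  have le: "1 \<le> c" "K \<le> c" "N1 \<le> c" "N2 \<le> c" "V0 \<le> c" "V2 \<le> c" "CB \<le> c" "CR \<le> c"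
    using K(1) N1(1) N2(1) V0(1) V2(1) CB(1) CR(1) by (simp_all add: c_def)
  have cB: "norm (D2 G (x0 t) u w) \<le> c * (norm u * norm w)" for t u w
    using CB(2)[OF x0_in_M, of t u w] mult_right_mono[OF le(7), of "norm u * norm w"] by simp
  have cR: "norm (remainder t z - remainder t w - (1/2) *\<^sub>R D2 G (x0 t) (z + w) (z - w)) \<le> c * r\<^sup>2 * norm (z - w)"
    if "norm z \<le> r" "norm w \<le> r" "r \<le> 1" for t z w r
    using CR(2)[OF that, of t] mult_right_mono[OF le(8), of "r\<^sup>2 * norm (z - w)"] by (simp add: mult.assoc)
  note cN = order_trans[OF V0(2) le(5)] order_trans[OF N1(2) le(3)] order_trans[OF N2(2) le(4)] and cV2 = order_trans[OF V2(2) le(6)]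
  have c1: "1 \<le> c^4" "c \<le> c^4" "c^3 \<le> c^4" using power_increasing[of 0 4 c] power_increasing[of 1 4 c] power_increasing[of 3 4 c] le(1) by auto
  show ?thesis
  \<comment> \<open>Gives \<open>44 * c^4 * \<delta> \<le> 1/2\<close>, the contraction
    constant.\<close>
  proof (rule that[of c "1 / (88 * c^4)"])
    show "c > 0" "1 / (88 * c^4) > 0" using le(1) by simp_all
    show "1 / (88 * c^4) \<le> 1" using c1(1) by (subst divide_le_eq_1_pos) auto
    fix \<delta> :: real assume \<delta>0: "0 < \<delta>" and "\<delta> \<le> 1 / (88 * c^4)"
    then have \<delta>c: "88 * (c^4 * \<delta>) \<le> 1" using c1(1) by (subst (asm) pos_le_divide_eq) (auto simp: mult_ac)
    have \<delta>1: "\<delta> \<le> 1" using \<delta>c mult_right_mono[OF c1(1) less_imp_le[OF \<delta>0]] \<delta>0 by linarith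
    have pw: "\<delta>^j \<le> \<delta>^i" if "i \<le> j" for i j by (rule power_decreasing[OF that]) (use \<delta>0 \<delta>1 in auto)
    have c\<delta>: "c * \<delta>^j \<le> c^4 * \<delta>" if "1 \<le> j" for j
      using mult_mono[OF c1(2) pw[OF that]] le(1) \<delta>0 by simp
    have small: "3 * c * \<delta>^6 \<le> 1" "c * \<delta>^8 \<le> 1" using c\<delta>[of 6] c\<delta>[of 8] \<delta>c \<delta>0 c1(1) by (simp_all add: mult.assoc)
    \<comment> \<open>The radius \<open>\<delta>^6\<close> is large against the value at the centre,
      of order \<delta>^8, and by one factor \<delta> smaller than \<delta>^5, the radius at which
      the weighted normal Lipschitz constant would be of order one.\<close>
    define S where "S = {H :: real \<Rightarrow>\<^sub>C (real^'n). (\<forall>t. apply_bcontfun H (t + 1) = apply_bcontfun H t) \<and> (\<forall>t. norm (apply_bcontfun H t) \<le> \<delta>^6)}"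
    have "\<forall>H\<in>S. \<exists>\<xi> \<xi>1 l a a1. decoupled \<delta> (apply_bcontfun H) \<xi> \<xi>1 l a a1"
    proof
      fix H assume H: "H \<in> S"
      show "\<exists>\<xi> \<xi>1 l a a1. decoupled \<delta> (apply_bcontfun H) \<xi> \<xi>1 l a a1"
        by (rule K(2)[OF \<delta>0 continuous_on_apply_bcontfun]) (use H in \<open>simp add: S_def\<close>)
    qed
    \<comment> \<open>Any choice of solutions serves: the bounds of \<open>decoupled_solver\<close>
      hold for every solution, and by \<open>decoupled_diff\<close> also for differences.\<close>
    then obtain X X1 L A A1 where sol: "\<And>H. H \<in> S \<Longrightarrow> decoupled \<delta> (apply_bcontfun H) (X H) (X1 H) (L H) (A H) (A1 H)"
      by metis
    define \<Phi> where "\<Phi> H t = weighted \<delta> t (forcing \<delta> t (X H t) (X1 H t) (A H t) (A1 H t))" for H t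
    have bnd: "norm (X H t) \<le> c * \<delta>^6 \<and> norm (X1 H t) \<le> c * \<delta>^6 \<and> \<bar>A H t\<bar> \<le> c * \<delta>^11 \<and> \<bar>A1 H t\<bar> \<le> c * \<delta> * \<delta>^6" if H: "H \<in> S" for H t
    proof -
      have 1: "norm (X H t) \<le> K * \<delta>^6 \<and> norm (X1 H t) \<le> K * \<delta>^6 \<and> \<bar>A H t\<bar> \<le> K * \<delta>^5 * \<delta>^6 \<and> \<bar>A1 H t\<bar> \<le> K * \<delta> * \<delta>^6"
        by (rule K(3)[OF \<delta>0 sol[OF H] continuous_on_apply_bcontfun]) (use H in \<open>simp_all add: S_def\<close>)
      have m: "K * s \<le> c * s" if "0 \<le> s" for s using le(2) that by (rule mult_right_mono)
      have "K * \<delta>^6 \<le> c * \<delta>^6" "K * \<delta>^11 \<le> c * \<delta>^11" "K * (\<delta> * \<delta>^6) \<le> c * (\<delta> * \<delta>^6)"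
        by (rule m, use \<delta>0 in simp)+
      moreover have "\<delta>^5 * \<delta>^6 = \<delta>^11" by (simp add: power_add[symmetric])
      ultimately show ?thesis using 1 unfolding mult.assoc by (metis order_trans)
    qed
    have tan: "X H t \<bullet> n t = 0" if "H \<in> S" for H t by (rule decoupled_regular(9)[OF sol[OF that]])
    have \<Phi>_lip: "norm (\<Phi> H t - \<Phi> J t) \<le> (1/2) * dist H J" if H: "H \<in> S" and J: "J \<in> S" for H J t
    proof -
      let ?D = "dist H J"
      have d: "norm (X H t - X J t) \<le> K * ?D \<and> norm (X1 H t - X1 J t) \<le> K * ?D \<and> \<bar>A H t - A J t\<bar> \<le> K * \<delta>^5 * ?D \<and> \<bar>A1 H t - A1 J t\<bar> \<le> K * \<delta> * ?D"
        by (rule K(3)[OF \<delta>0 decoupled_diff[OF sol[OF H] sol[OF J]]])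
          (use H J dist_bounded[of H _ J] in \<open>auto simp: S_def dist_norm intro!: continuous_on_diff\<close>)
      have m: "K * s \<le> c * s" if "0 \<le> s" for s using le(2) that by (rule mult_right_mono)
      have d': "norm (X H t - X J t) \<le> c * ?D" "norm (X1 H t - X1 J t) \<le> c * ?D" "\<bar>A H t - A J t\<bar> \<le> c * \<delta>^5 * ?D" "\<bar>A1 H t - A1 J t\<bar> \<le> c * \<delta> * ?D"
      proof -
        have "K * ?D \<le> c * ?D" "K * (\<delta>^5 * ?D) \<le> c * (\<delta>^5 * ?D)" "K * (\<delta> * ?D) \<le> c * (\<delta> * ?D)"
          by (rule m, use \<delta>0 in simp)+
        then show "norm (X H t - X J t) \<le> c * ?D" "norm (X1 H t - X1 J t) \<le> c * ?D" "\<bar>A H t - A J t\<bar> \<le> c * \<delta>^5 * ?D" "\<bar>A1 H t - A1 J t\<bar> \<le> c * \<delta> * ?D"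
          using d unfolding mult.assoc by linarith+
      qed
      have "norm (\<Phi> H t - \<Phi> J t) \<le> 44 * (c^4 * \<delta> * ?D)"
        unfolding \<Phi>_def
        by (rule weighted_forcing_lipschitz[OF le(1) cN cB cR \<delta>0 \<delta>1 small(1) zero_le_dist])
          (use bnd[OF H, of t] bnd[OF J, of t] tan[OF H] tan[OF J] d' in auto)
      also have "\<dots> \<le> (1/2) * ?D" using mult_right_mono[OF \<delta>c, of ?D] by simp
      finally show ?thesis .
    qed
    have \<Phi>_bound: "norm (\<Phi> H t) \<le> \<delta>^6" if H: "H \<in> S" for H t
    proof -
      \<comment> \<open>Comparison with zero data, which obey the same bounds; the radius
        \<open>\<delta>^6\<close> plays the part of \<open>D\<close>.\<close>
      have "norm (\<Phi> H t - weighted \<delta> t (forcing \<delta> t 0 0 0 0)) \<le> 44 * (c^4 * \<delta> * \<delta>^6)"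
        unfolding \<Phi>_def
        by (rule weighted_forcing_lipschitz[OF le(1) cN cB cR \<delta>0 \<delta>1 small(1)])
          (use bnd[OF H, of t] tan[OF H] \<delta>0 le(1) in \<open>auto simp: mult.assoc power_add[symmetric]\<close>)
      moreover have "norm (weighted \<delta> t (forcing \<delta> t 0 0 0 0)) \<le> 6 * (c^3 * \<delta>^8)"
        by (rule weighted_forcing_zero[OF le(1) cN(1) cV2 cB cR \<delta>0 \<delta>1 small(2)])
      moreover have "c^3 * \<delta>^8 \<le> c^4 * (\<delta> * \<delta>^6)" using mult_mono[OF c1(3) pw[of 7 8]] le(1) \<delta>0 by (simp add: power_numeral_reduce)
      moreover have "88 * (c^4 * \<delta>) * \<delta>^6 \<le> 1 * \<delta>^6" using \<delta>c \<delta>0 by (intro mult_right_mono) auto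
      moreover have "0 \<le> c^4 * (\<delta> * \<delta>^6)" using \<delta>0 by simp
      ultimately show ?thesis
        using norm_triangle_ineq[of "\<Phi> H t - weighted \<delta> t (forcing \<delta> t 0 0 0 0)" "weighted \<delta> t (forcing \<delta> t 0 0 0 0)"]
        by (simp add: mult.assoc)
    qed
    define \<Psi> where "\<Psi> H = Bcontfun (\<Phi> H)" for H
    have \<Psi>: "apply_bcontfun (\<Psi> H) = \<Phi> H" if H: "H \<in> S" for H
    proof -
      have "continuous_on UNIV (\<Phi> H)" unfolding \<Phi>_def by (rule forcing_continuous) (rule decoupled_regular(1-4)[OF sol[OF H]])+
      then have "\<Phi> H \<in> bcontfun" using \<Phi>_bound[OF H] by (rule bcontfun_normI)
      then show ?thesis unfolding \<Psi>_def by (rule Bcontfun_inverse)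
    qed
    have "\<exists>!H\<in>S. \<Psi> H = H"
    proof (rule Banach_fix)
      show "complete S" unfolding S_def complete_eq_closed by (rule closed_periodic_bcontfun)
      have "0 \<in> S" using \<delta>0 by (simp add: S_def)
      then show "S \<noteq> {}" by blast
      show "0 \<le> (1/2 :: real)" "(1/2 :: real) < 1" by simp_all
      show "\<Psi> ` S \<subseteq> S"
      proof
        fix J assume "J \<in> \<Psi> ` S"
        then obtain H where H: "H \<in> S" "J = \<Psi> H" by blast
        have "\<Phi> H (t + 1) = \<Phi> H t" for t
          unfolding \<Phi>_def by (rule forcing_periodic) (rule decoupled_regular(5-8)[OF sol[OF H(1)]])+
        then show "J \<in> S" using \<Phi>_bound[OF H(1)] unfolding H(2) S_def by (simp add: \<Psi>[OF H(1)])
      qed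
      show "dist (\<Psi> H) (\<Psi> J) \<le> 1/2 * dist H J" if "H \<in> S" "J \<in> S" for H J
      proof (rule dist_bound)
        show "dist (apply_bcontfun (\<Psi> H) t) (apply_bcontfun (\<Psi> J) t) \<le> 1/2 * dist H J" for t
          unfolding \<Psi>[OF that(1)] \<Psi>[OF that(2)] using \<Phi>_lip[OF that, of t] by (simp only: dist_norm[of "\<Phi> H t"])
      qed
    qed
    then obtain H where H: "H \<in> S" "\<Psi> H = H" by blast
    have "apply_bcontfun H t = \<Phi> H t" for t using \<Psi>[OF H(1)] H(2) by simp
    moreover have "norm (X H t) \<le> c * \<delta>^6 \<and> norm (X1 H t) \<le> c * \<delta>^6 \<and> \<bar>A H t\<bar> \<le> c * \<delta>^6 \<and> \<bar>A1 H t\<bar> \<le> c * \<delta>^6" for t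
    proof -
      have "c * \<delta>^11 \<le> c * \<delta>^6" "c * \<delta> * \<delta>^6 \<le> c * \<delta>^6"
        using mult_left_mono[OF pw[of 6 11], of c] mult_left_mono[OF pw[of 6 7], of c] le(1) by (simp_all add: power_numeral_reduce mult.assoc)
      then show ?thesis using bnd[OF H(1), of t] by linarith
    qed
    ultimately show "\<exists>H \<xi> \<xi>1 l a a1. decoupled \<delta> H \<xi> \<xi>1 l a a1 \<and>
       (\<forall>t. H t = weighted \<delta> t (forcing \<delta> t (\<xi> t) (\<xi>1 t) (a t) (a1 t))) \<and>
       (\<forall>t. norm (\<xi> t) \<le> c * \<delta>^6 \<and> norm (\<xi>1 t) \<le> c * \<delta>^6 \<and> \<bar>a t\<bar> \<le> c * \<delta>^6 \<and> \<bar>a1 t\<bar> \<le> c * \<delta>^6)"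
      using sol[OF H(1)] unfolding \<Phi>_def by blast
  qed
qed

section \<open>From the fixed point to periodic orbits\<close>

lemma newton_orbit:
  assumes nc: "x1 0 \<noteq> 0"
  obtains C \<delta>0 where "C > 0" "\<delta>0 > 0" "\<delta>0 \<le> 1"
    "\<And>\<delta>. 0 < \<delta> \<Longrightarrow> \<delta> \<le> \<delta>0 \<Longrightarrow> \<exists>w w1. (\<forall>t. (w has_vector_derivative w1 t) (at t)) \<and>
       (\<forall>t. (w1 has_vector_derivative - ((1/\<delta>^8) *\<^sub>R G (w t))) (at t)) \<and> (\<forall>t. w (t + 1) = w t) \<and>
       (\<forall>t. norm (w t - x0 t) \<le> C * \<delta>^6 \<and> norm (w1 t - x1 t) \<le> C * \<delta>^6)"
proof -
  obtain K \<delta>1 where K: "K > 0" "\<delta>1 > 0" "\<delta>1 \<le> 1"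
    "\<And>\<delta>. 0 < \<delta> \<Longrightarrow> \<delta> \<le> \<delta>1 \<Longrightarrow> \<exists>H \<xi> \<xi>1 l a a1. decoupled \<delta> H \<xi> \<xi>1 l a a1 \<and>
       (\<forall>t. H t = weighted \<delta> t (forcing \<delta> t (\<xi> t) (\<xi>1 t) (a t) (a1 t))) \<and>
       (\<forall>t. norm (\<xi> t) \<le> K * \<delta>^6 \<and> norm (\<xi>1 t) \<le> K * \<delta>^6 \<and> \<bar>a t\<bar> \<le> K * \<delta>^6 \<and> \<bar>a1 t\<bar> \<le> K * \<delta>^6)"
    by (rule forced_solution[OF nc]) blast
  have cv: "continuous_on UNIV v" by (rule continuous_on_of_vector_derivative[OF v'(1)])
  obtain N1 where N1: "N1 > 0" "\<And>t. norm (n' t) \<le> N1" using periodic_bounded[OF n'(3,5)] by blast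
  obtain V0 where V0: "V0 > 0" "\<And>t. norm (v t) \<le> V0" using periodic_bounded[OF cv v_periodic] by blast
  obtain V1 where V1: "V1 > 0" "\<And>t. norm (v' t) \<le> V1" using periodic_bounded[OF v'(3,5)] by blast
  define C where "C = V0 + V1 + 2 * K + K * N1"
  have C0: "C > 0" using K(1) N1(1) V0(1) V1(1) by (simp add: C_def add_pos_pos)
  have C: "V0 + 2 * K \<le> C" "V1 + 2 * K + K * N1 \<le> C" using K(1) N1(1) V0(1) V1(1) by (simp_all add: C_def)
  define X where "X = norm (x1 0)"
  have X: "X > 0" using nc by (simp add: X_def)
  show ?thesis
  \<comment> \<open>The second entry keeps \<open>w1\<close> within \<open>X / 2\<close> of
    \<open>x1\<close>, so that \<open>x1 t \<bullet> w1 t\<close> stays positive.\<close>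
  proof (rule that[OF C0, of "min \<delta>1 (X / (2 * C))"])
    show "min \<delta>1 (X / (2 * C)) > 0" "min \<delta>1 (X / (2 * C)) \<le> 1" using K(2,3) X C0 by auto
    fix \<delta> :: real assume \<delta>0: "0 < \<delta>" and "\<delta> \<le> min \<delta>1 (X / (2 * C))"
    then have \<delta>: "\<delta> \<le> \<delta>1" "\<delta> * (2 * C) \<le> X" "\<delta> \<le> 1" using C0 K(3) by (simp_all add: field_simps)
    have pw: "\<delta>^j \<le> \<delta>^i" if "i \<le> j" for i j by (rule power_decreasing[OF that]) (use \<delta>0 \<delta> in auto)
    obtain H \<xi> \<xi>1 l a a1 where s: "decoupled \<delta> H \<xi> \<xi>1 l a a1"
      and H: "\<And>t. H t = weighted \<delta> t (forcing \<delta> t (\<xi> t) (\<xi>1 t) (a t) (a1 t))"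
      and bd: "\<And>t. norm (\<xi> t) \<le> K * \<delta>^6" "\<And>t. norm (\<xi>1 t) \<le> K * \<delta>^6" "\<And>t. \<bar>a t\<bar> \<le> K * \<delta>^6" "\<And>t. \<bar>a1 t\<bar> \<le> K * \<delta>^6"
      using K(4)[OF \<delta>0 \<delta>(1)] by blast
    define F where "F t = forcing \<delta> t (\<xi> t) (\<xi>1 t) (a t) (a1 t)" for t
    \<comment> \<open>Removing the weight recovers the true forcing \<open>F\<close> in both
      components.\<close>
    have HF: "P t (H t) = P t (F t)" "n t \<bullet> H t = \<delta>^3 * (n t \<bullet> F t)" for t
      unfolding H F_def by (rule weighted_decompose)+
    define \<xi>2 where "\<xi>2 t = - P t (Bv t (\<xi> t)) - (2 * (n' t \<bullet> \<xi>1 t) + n'' t \<bullet> \<xi> t) *\<^sub>R n t + P t (H t) - l *\<^sub>R x1 t" for t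
    define a2 where "a2 t = b t / \<delta>^8 * a t + (n t \<bullet> H t) / \<delta>^3" for t
    have d\<xi>: "(\<xi> has_vector_derivative \<xi>1 t) (at t)" "(\<xi>1 has_vector_derivative \<xi>2 t) (at t)" for t
      using s unfolding decoupled_def Tsol_def \<xi>2_def by blast+
    have da: "(a has_real_derivative a1 t) (at t)" "(a1 has_real_derivative a2 t) (at t)" for t
      using s unfolding decoupled_def Nsol_def a2_def has_real_derivative_iff_has_vector_derivative by blast+
    define w where "w t = x0 t + shift \<delta> t (\<xi> t) (a t)" for t
    define w1 where "w1 t = x1 t + (\<delta>^8 *\<^sub>R v' t + \<xi>1 t + (a t *\<^sub>R n' t + a1 t *\<^sub>R n t))" for t
    define w2 where "w2 t = x2 t + (\<delta>^8 *\<^sub>R v'' t + \<xi>2 t + ((a t *\<^sub>R n'' t + a1 t *\<^sub>R n' t) + (a1 t *\<^sub>R n' t + a2 t *\<^sub>R n t)))" for t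
    have dw: "(w has_vector_derivative w1 t) (at t)" for t
      unfolding w_def w1_def shift_def
      by (intro has_vector_derivative_add has_vector_derivative_scaleR x1(1) d\<xi> da n' bounded_linear.has_vector_derivative[OF bounded_linear_scaleR_right] v')
    have dw1: "(w1 has_vector_derivative w2 t) (at t)" for t
      unfolding w2_def w1_def
      by (intro has_vector_derivative_add has_vector_derivative_scaleR x2 d\<xi> da n' bounded_linear.has_vector_derivative[OF bounded_linear_scaleR_right] v')
    \<comment> \<open>The linear part of the force yields \<open>x2\<close> through \<open>v\<close>
      and the coefficient of \<open>Nsol\<close>, while the compensating summands of
      \<open>forcing\<close> cancel against \<open>Tsol\<close>. Only
      \<open>l *\<^sub>R x1 t\<close> is left over.\<close>
    have w2: "w2 t = - ((1/\<delta>^8) *\<^sub>R G (w t)) - l *\<^sub>R x1 t" for t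
    proof -
      define s where "s = 2 * (n' t \<bullet> \<xi>1 t) + n'' t \<bullet> \<xi> t"
      define R where "R = remainder t (shift \<delta> t (\<xi> t) (a t))"
      have "n t \<bullet> shift \<delta> t (\<xi> t) (a t) = \<delta>^8 * (n t \<bullet> v t) + a t"
        using decoupled_regular(9)[OF s, of t] by (simp add: shift_def inner_add_right nn inner_commute[of "n t" "\<xi> t"])
      then have "G (w t) = R - (b t * (\<delta>^8 * (n t \<bullet> v t) + a t)) *\<^sub>R n t"
        unfolding w_def R_def remainder_def by (simp add: DG_on_M(1)[OF x0_in_M])
      then have G: "(1/\<delta>^8) *\<^sub>R G (w t) = (1/\<delta>^8) *\<^sub>R R - (b t * (n t \<bullet> v t)) *\<^sub>R n t - (b t / \<delta>^8 * a t) *\<^sub>R n t"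
      proof -
        have "(1/\<delta>^8) * (b t * (\<delta>^8 * (n t \<bullet> v t) + a t)) = b t * (n t \<bullet> v t) + b t / \<delta>^8 * a t"
          using \<delta>0 by (simp add: field_simps)
        then show ?thesis using \<open>G (w t) = _\<close> by (simp only: scaleR_diff_right scaleR_scaleR scaleR_add_left diff_diff_eq)
      qed
      have x: "x2 t = (b t * (n t \<bullet> v t)) *\<^sub>R n t" by (subst x2_eq_v, subst v_normal) simp
      have F: "F t = - ((2 * a1 t) *\<^sub>R n' t + a t *\<^sub>R n'' t + \<delta>^8 *\<^sub>R v'' t + (1/\<delta>^8) *\<^sub>R R) + P t (Bv t (\<xi> t)) + s *\<^sub>R n t"
        by (simp add: F_def forcing_def s_def R_def)
      have PF: "P t (H t) = F t - (n t \<bullet> F t) *\<^sub>R n t" unfolding HF(1) by (simp add: P_def)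
      have a2: "a2 t = b t / \<delta>^8 * a t + n t \<bullet> F t" unfolding a2_def HF(2) using \<delta>0 by simp
      have "w2 t = x2 t + \<delta>^8 *\<^sub>R v'' t - P t (Bv t (\<xi> t)) - s *\<^sub>R n t + F t - l *\<^sub>R x1 t + a t *\<^sub>R n'' t + (2 * a1 t) *\<^sub>R n' t + (b t / \<delta>^8 * a t) *\<^sub>R n t"
        unfolding w2_def \<xi>2_def PF a2 s_def[symmetric] by (simp add: scaleR_add_left scaleR_2 scaleR_scaleR[symmetric] del: scaleR_scaleR)
      then show ?thesis unfolding F G x by (simp add: algebra_simps)
    qed
    have per: "w (t + 1) = w t" for t
      by (simp add: w_def shift_def x0_periodic v_periodic decoupled_regular(5,7)[OF s])
    have per1: "w1 (t + 1) = w1 t" for t by (rule periodic_vector_derivative[OF dw per])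
    have near: "norm (w t - x0 t) \<le> C * \<delta>^6" "norm (w1 t - x1 t) \<le> C * \<delta>^6" for t
    proof -
      have "norm (w t - x0 t) \<le> norm (\<delta>^8 *\<^sub>R v t) + norm (\<xi> t) + norm (a t *\<^sub>R n t)"
        unfolding w_def shift_def add_diff_cancel_left' by (meson norm_triangle_ineq add_right_mono order_trans)
      moreover have "norm (\<delta>^8 *\<^sub>R v t) \<le> \<delta>^6 * V0" "norm (\<delta>^8 *\<^sub>R v' t) \<le> \<delta>^6 * V1"
        using mult_mono[OF pw[of 6 8] V0(2)[of t]] mult_mono[OF pw[of 6 8] V1(2)[of t]] \<delta>0 by simp_all
      moreover have "norm (w1 t - x1 t) \<le> norm (\<delta>^8 *\<^sub>R v' t) + norm (\<xi>1 t) + (norm (a t *\<^sub>R n' t) + norm (a1 t *\<^sub>R n t))"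
        unfolding w1_def add_diff_cancel_left' by (meson norm_triangle_ineq add_mono order_refl order_trans)
      moreover have "norm (a t *\<^sub>R n' t) \<le> (K * \<delta>^6) * N1" using mult_mono[OF bd(3)[of t] N1(2)[of t]] K(1) \<delta>0 by simp
      moreover have "norm (a1 t *\<^sub>R n t) \<le> K * \<delta>^6" "norm (a t *\<^sub>R n t) \<le> K * \<delta>^6" using bd(3,4)[of t] by (simp_all add: norm_n)
      moreover have "(V0 + 2 * K) * \<delta>^6 \<le> C * \<delta>^6" "(V1 + 2 * K + K * N1) * \<delta>^6 \<le> C * \<delta>^6"
        using C \<delta>0 by (auto intro!: mult_right_mono)
      ultimately show "norm (w t - x0 t) \<le> C * \<delta>^6" "norm (w1 t - x1 t) \<le> C * \<delta>^6"
        using bd(1,2)[of t] by (simp_all add: algebra_simps)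
    qed
    have pos: "0 < x1 t \<bullet> w1 t" for t
    proof -
      have nx: "norm (x1 t) = X" using x1_norm_constant[of t] by (simp add: X_def norm_eq_sqrt_inner)
      have "C * \<delta>^6 \<le> C * \<delta>" using pw[of 1 6] C0 by simp
      moreover have "2 * (C * \<delta>) \<le> X" using \<delta>(2) by (simp add: mult_ac)
      ultimately have "norm (w1 t - x1 t) \<le> X / 2" using near(2)[of t] by linarith
      then have "X * norm (w1 t - x1 t) \<le> X * (X / 2)" using X by (intro mult_left_mono) auto
      moreover have "\<bar>x1 t \<bullet> (w1 t - x1 t)\<bar> \<le> X * norm (w1 t - x1 t)" using Cauchy_Schwarz_ineq2[of "x1 t" "w1 t - x1 t"] nx by simp
      moreover have "x1 t \<bullet> w1 t = X * X + x1 t \<bullet> (w1 t - x1 t)"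
        using nx by (simp add: inner_diff_right dot_square_norm power2_eq_square)
      moreover have "X * (X / 2) < X * X" using X by simp
      ultimately show ?thesis by linarith
    qed
    define E where "E t = (1/2) * (w1 t \<bullet> w1 t) + (1/\<delta>^8) * V (w t)" for t
    have dE: "(E has_real_derivative - l * (x1 t \<bullet> w1 t)) (at t)" for t
    proof -
      have "((\<lambda>t. V (w t)) has_derivative (\<lambda>s. D1 V (w t) (s *\<^sub>R w1 t))) (at t)"
        by (rule has_derivative_compose[OF dw[unfolded has_vector_derivative_def] Ck_on_has_derivative[OF Ck_V UNIV_I]])
      then have "((\<lambda>t. V (w t)) has_real_derivative (G (w t) \<bullet> w1 t)) (at t)"
        unfolding has_field_derivative_def grad_inner[OF Ck_V] inner_scaleR_right mult.commute[of _ "G (w t) \<bullet> w1 t"] .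
      then have "(E has_real_derivative (1/2) * (w2 t \<bullet> w1 t + w1 t \<bullet> w2 t) + (1/\<delta>^8) * (G (w t) \<bullet> w1 t)) (at t)"
        unfolding E_def by (intro DERIV_add DERIV_cmult has_real_derivative_inner dw1)
      moreover have "(1/2) * (w2 t \<bullet> w1 t + w1 t \<bullet> w2 t) + (1/\<delta>^8) * (G (w t) \<bullet> w1 t) = - l * (x1 t \<bullet> w1 t)"
        unfolding inner_commute[of "w1 t" "w2 t"] unfolding w2 using \<delta>0 by (simp add: inner_diff_left field_simps)
      ultimately show ?thesis by simp
    qed
    have "\<exists>z>0. z < 1 \<and> E 1 - E 0 = (1 - 0) * (- l * (x1 z \<bullet> w1 z))"
      by (rule MVT2) (use dE in auto)
    then obtain z where z: "E 1 - E 0 = (1 - 0) * (- l * (x1 z \<bullet> w1 z))" by blast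
    moreover have "E 1 = E 0" using per[of 0] per1[of 0] by (simp add: E_def)
    ultimately have "l = 0" using pos[of z] by simp
    then have "(w1 has_vector_derivative - ((1/\<delta>^8) *\<^sub>R G (w t))) (at t)" for t using dw1[of t] w2[of t] by simp
    then show "\<exists>w w1. (\<forall>t. (w has_vector_derivative w1 t) (at t)) \<and>
       (\<forall>t. (w1 has_vector_derivative - ((1/\<delta>^8) *\<^sub>R G (w t))) (at t)) \<and> (\<forall>t. w (t + 1) = w t) \<and>
       (\<forall>t. norm (w t - x0 t) \<le> C * \<delta>^6 \<and> norm (w1 t - x1 t) \<le> C * \<delta>^6)"
      using dw per near by blast
  qed
qed

text \<open>A constant loop sits at an equilibrium of \<open>V\<close> and is its own solution for
  every \<open>T\<close>. Otherwise \<delta>^4 = 1/T, and the error \<delta>^6 is relaxed to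
  \<delta>^4.\<close>

lemma rescaled_orbits:
  obtains C T0 where "C > 0" "T0 > 0"
    "\<And>T. T0 \<le> T \<Longrightarrow> \<exists>w w1. (\<forall>t. (w has_vector_derivative w1 t) (at t)) \<and>
       (\<forall>t. (w1 has_vector_derivative - (T\<^sup>2 *\<^sub>R G (w t))) (at t)) \<and> (\<forall>t. w (t + 1) = w t) \<and>
       (\<forall>t. norm (w t - x0 t) \<le> C / T \<and> norm (w1 t - x1 t) \<le> C / T)"
proof (cases "x1 0 = 0")
  case True
  \<comment> \<open>The speed is constant, so it vanishes everywhere once it vanishes at time
    0.\<close>
  then have x1_0: "x1 t = 0" for t using x1_norm_constant[of t] by simp
  then have "x1 = (\<lambda>t. 0)" by blast
  moreover have "G (x0 t) = 0" for t using critical_M x0_in_M by blast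
  ultimately have "(x1 has_vector_derivative - (T\<^sup>2 *\<^sub>R G (x0 t))) (at t)" for T t
    by (simp only: scaleR_zero_right minus_zero has_vector_derivative_const)
  then show ?thesis
    using x1(1) x0_periodic by (intro that[of 1 1]) (simp_all, intro exI[of _ x0] exI[of _ x1], simp)
next
  case False
  obtain C \<delta>0 where C: "C > 0" "\<delta>0 > 0" "\<delta>0 \<le> 1"
    "\<And>\<delta>. 0 < \<delta> \<Longrightarrow> \<delta> \<le> \<delta>0 \<Longrightarrow> \<exists>w w1. (\<forall>t. (w has_vector_derivative w1 t) (at t)) \<and>
       (\<forall>t. (w1 has_vector_derivative - ((1/\<delta>^8) *\<^sub>R G (w t))) (at t)) \<and> (\<forall>t. w (t + 1) = w t) \<and>
       (\<forall>t. norm (w t - x0 t) \<le> C * \<delta>^6 \<and> norm (w1 t - x1 t) \<le> C * \<delta>^6)"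
    by (rule newton_orbit[OF False]) blast
  show ?thesis
  proof (rule that[OF C(1), of "1 / \<delta>0^4"])
    show "0 < 1 / \<delta>0^4" using C(2) by simp
    fix T assume "1 / \<delta>0^4 \<le> T"
    moreover from this have T: "T > 0" using C(2) by (meson less_le_trans zero_less_divide_1_iff zero_less_power)
    ultimately have T4: "1 / T \<le> \<delta>0^4" using C(2) by (simp add: field_simps)
    define \<delta> where "\<delta> = root 4 (1 / T)"
    have \<delta>4: "\<delta>^4 = 1 / T" unfolding \<delta>_def using T by (intro real_root_pow_pos2) auto
    have \<delta>: "0 < \<delta>" using T by (simp add: \<delta>_def)
    have \<delta>\<delta>0: "\<delta> \<le> \<delta>0" by (rule power_le_imp_le_base[of _ 3]) (use T4 C(2) in \<open>simp_all add: \<delta>4\<close>)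
    have "\<delta>^8 = (\<delta>^4)\<^sup>2" by (simp add: power_mult[symmetric])
    then have \<delta>8: "1 / \<delta>^8 = T\<^sup>2" unfolding \<delta>4 by (simp add: power_divide)
    have "\<delta>^6 \<le> \<delta>^4" using \<delta> \<delta>\<delta>0 C(3) by (intro power_decreasing) auto
    then have le: "C * \<delta>^6 \<le> C / T" using mult_left_mono[of "\<delta>^6" "1/T" C] C(1) unfolding \<delta>4 by simp
    show "\<exists>w w1. (\<forall>t. (w has_vector_derivative w1 t) (at t)) \<and>
       (\<forall>t. (w1 has_vector_derivative - (T\<^sup>2 *\<^sub>R G (w t))) (at t)) \<and> (\<forall>t. w (t + 1) = w t) \<and>
       (\<forall>t. norm (w t - x0 t) \<le> C / T \<and> norm (w1 t - x1 t) \<le> C / T)"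
      using C(4)[OF \<delta> \<delta>\<delta>0] order_trans[OF _ le] unfolding \<delta>8 by meson
  qed
qed

end

section \<open>Periodic solutions near the geodesic\<close>

lemma uniform_limit_inverse_bound:
  fixes f :: "real \<Rightarrow> 'a \<Rightarrow> 'b::real_normed_vector"
  assumes "\<And>T t. T0 \<le> T \<Longrightarrow> norm (f T t - g t) \<le> C / T"
  shows "uniform_limit UNIV f g at_top"
proof (rule uniform_limitI)
  fix e :: real assume e: "e > 0"
  have "((\<lambda>T. C / T) \<longlongrightarrow> 0) at_top" by (rule tendsto_divide_0[OF tendsto_const filterlim_at_top_imp_at_infinity[OF filterlim_ident]])
  then have "\<forall>\<^sub>F T in at_top. C / T < e" using e by (rule order_tendstoD)
  then show "\<forall>\<^sub>F T in at_top. \<forall>t\<in>UNIV. dist (f T t) (g t) < e"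
    using eventually_ge_at_top[of T0]
  proof eventually_elim
    case (elim T)
    then show ?case using assms[of T] by (auto simp: dist_norm intro: le_less_trans)
  qed
qed

theorem theorem1p1:
  fixes V :: "real^'n \<Rightarrow> real" and M :: "(real^'n) set" and x0 :: "real \<Rightarrow> real^'n"
  assumes "smooth_map_on UNIV V"
    and "compact M" and "orientable_hypersurface M"
    and "\<forall>x\<in>M. grad V x = 0"
    and "nondegenerate_closed_geodesic M x0"
    and "\<forall>x\<in>M. \<forall>\<nu>. unit_normal M x \<nu> \<longrightarrow> hess V x \<nu> \<nu> < 0"
  shows "\<exists>T0>0. \<exists>u :: real \<Rightarrow> real \<Rightarrow> real^'n.
           (\<forall>T\<ge>T0. (\<forall>t. u T (t + T) = u T t) \<and> solves_newton V (u T)) \<and>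
           tendsto_C1_circle (\<lambda>T t. u T (T * t)) x0 at_top"
proof -
  interpret repulsive_geodesic V M x0 by unfold_locales (use assms in auto)
  obtain C T0 where C: "C > 0" and T0: "T0 > 0" and ex: "\<And>T. T0 \<le> T \<Longrightarrow> \<exists>w w1. (\<forall>t. (w has_vector_derivative w1 t) (at t)) \<and>
       (\<forall>t. (w1 has_vector_derivative - (T\<^sup>2 *\<^sub>R G (w t))) (at t)) \<and> (\<forall>t. w (t + 1) = w t) \<and>
       (\<forall>t. norm (w t - x0 t) \<le> C / T \<and> norm (w1 t - x1 t) \<le> C / T)"
    by (rule rescaled_orbits) blast
  obtain W W1 where W: "\<And>T t. T0 \<le> T \<Longrightarrow> (W T has_vector_derivative W1 T t) (at t)"
    "\<And>T t. T0 \<le> T \<Longrightarrow> (W1 T has_vector_derivative - (T\<^sup>2 *\<^sub>R G (W T t))) (at t)"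
    "\<And>T t. T0 \<le> T \<Longrightarrow> W T (t + 1) = W T t"
    "\<And>T t. T0 \<le> T \<Longrightarrow> norm (W T t - x0 t) \<le> C / T" "\<And>T t. T0 \<le> T \<Longrightarrow> norm (W1 T t - x1 t) \<le> C / T"
    using ex by metis
  \<comment> \<open>On the unit circle the equation carries the factor \<open>T\<^sup>2\<close>,
    which slowing time by \<open>T\<close> removes.\<close>
  define u where "u T t = W T (t / T)" for T t
  have scale: "((\<lambda>t. f (t / T)) has_vector_derivative (1 / T) *\<^sub>R d) (at t)"
    if "(f has_vector_derivative d) (at (t / T))" for f :: "real \<Rightarrow> real^'n" and d t T
  proof -
    have "((\<lambda>t. t / T) has_vector_derivative 1 / T) (at t)"
      unfolding has_real_derivative_iff_has_vector_derivative[symmetric] by (rule DERIV_cdivide[OF DERIV_ident])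
    from vector_diff_chain_at[OF this, of f d] that show ?thesis by (simp add: o_def)
  qed
  have u: "(\<forall>t. u T (t + T) = u T t) \<and> solves_newton V (u T)" if T: "T0 \<le> T" for T
  proof
    have T_pos: "T > 0" using T T0 by simp
    show "\<forall>t. u T (t + T) = u T t" using W(3)[OF T] T_pos by (simp add: u_def add_divide_distrib)
    show "solves_newton V (u T)"
      unfolding solves_newton_def
    proof (intro exI allI conjI)
      fix t
      show "(u T has_vector_derivative (1 / T) *\<^sub>R W1 T (t / T)) (at t)"
        unfolding u_def by (rule scale[OF W(1)[OF T]])
      show "((\<lambda>t. (1 / T) *\<^sub>R W1 T (t / T)) has_vector_derivative (1 / T) *\<^sub>R (1 / T) *\<^sub>R - (T\<^sup>2 *\<^sub>R G (W T (t / T)))) (at t)"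
        by (rule bounded_linear.has_vector_derivative[OF bounded_linear_scaleR_right scale[OF W(2)[OF T]]])
      show "(1 / T) *\<^sub>R (1 / T) *\<^sub>R - (T\<^sup>2 *\<^sub>R G (W T (t / T))) + grad V (u T t) = 0"
        using T_pos by (simp add: u_def power2_eq_square)
    qed
  qed
  have uW: "(\<lambda>t. u T (T * t)) = W T" if "T0 \<le> T" for T using that T0 by (simp add: u_def fun_eq_iff)
  have circle: "f \<in> C1_circle" if "\<And>t. (f has_vector_derivative d t) (at t)" "\<And>t. (d has_vector_derivative e t) (at t)" "\<And>t. f (t + 1) = f t"
    for f d e :: "real \<Rightarrow> real^'n"
    using that(1,3) continuous_on_of_vector_derivative[OF that(2), of UNIV] unfolding C1_circle_def C1_differentiable_on_def by blast
  have "tendsto_C1_circle (\<lambda>T t. u T (T * t)) x0 at_top"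
    unfolding tendsto_C1_circle_def
  proof (intro conjI)
    show "x0 \<in> C1_circle" by (rule circle[OF x1(1) x2 x0_periodic])
    show "\<forall>\<^sub>F T in at_top. (\<lambda>t. u T (T * t)) \<in> C1_circle"
      using eventually_ge_at_top[of T0] by eventually_elim (simp add: uW circle[OF W(1,2,3)])
    show "uniform_limit UNIV (\<lambda>T t. u T (T * t)) x0 at_top"
      by (rule uniform_limit_inverse_bound[of T0 _ _ C]) (use uW W(4) in \<open>simp add: fun_eq_iff\<close>)
    show "uniform_limit UNIV (\<lambda>T t. vector_derivative (\<lambda>t. u T (T * t)) (at t)) (\<lambda>t. vector_derivative x0 (at t)) at_top"
      by (rule uniform_limit_inverse_bound[of T0 _ _ C])
        (simp add: uW vector_derivative_at[OF W(1)] vector_derivative_at[OF x1(1)] W(5))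
  qed
  then show ?thesis using T0 u by blast
qed

end
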